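(* Let $(M,\omega)$ be a symplectic manifold endowed with a Hamiltonian action of a Lie group $G$ with momentum map $J:M\to\mathfrak g^*$. Let $\mu\in\mathfrak g^*$ and let $K_\mu$ be its kernel group. Assume that: (1) $K_\mu$ acts properly on $J^{-1}(\mathbb R^+\mu)$; (2) $J$ is transverse to $\mathbb R^+\mu$; (3) $\mathfrak g=\ker\mu+\mathfrak g_\mu$. Then the ray quotient at $\mu$, $M_{\mathbb R^+\mu}:=J^{-1}(\mathbb R^+\mu)/K_\mu$, is naturally a symplectic orbifold: it carries a symplectic form $\omega_{\mathbb R^+\mu}$ given by $$\pi_{\mathbb R^+\mu}^*\,\omega_{\mathbb R^+\mu}=i_{\mathbb R^+\mu}^*\,\omega ,$$ where $\pi_{\mathbb R^+\mu}:J^{-1}(\mathbb R^+\mu)\to M_{\mathbb R^+\mu}$ is the canonical projection and $i_{\mathbb R^+\mu}:J^{-1}(\mathbb R^+\mu)\hookrightarrow M$ is the canonical immersion.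
   Context: $\mathbb R^+=(0,\infty)$ and $\mathbb R^+\mu=\{r\mu: r>0\}$. A Hamiltonian action of $G$ on $(M,\omega)$ is a smooth action by symplectomorphisms admitting a momentum map $J:M\to\mathfrak g^*$, i.e. $d\langle J,\xi\rangle=\omega(\xi_M,\cdot)$ for all $\xi\in\mathfrak g$, where $\xi_M$ is the infinitesimal generator of $\xi$ on $M$; $J$ is $G$-equivariant for the coadjoint action on $\mathfrak g^*$. $G_\mu$ is the isotropy group of $\mu$ under the coadjoint action and $\mathfrak g_\mu$ its Lie algebra. The kernel group $K_\mu$ of $\mu$ is the unique connected normal Lie subgroup of $G_\mu$ with Lie algebra $\mathfrak k_\mu=\ker(\mu|_{\mathfrak g_\mu})$. *)

theory Defs
  imports "HOL-Analysis.Analysis" "HOL-Algebra.Group_Action"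
begin

section \<open>Smooth functions on subsets of Euclidean spaces\<close>

primrec Ck_on :: "nat \<Rightarrow> 'a::euclidean_space set \<Rightarrow> ('a \<Rightarrow> 'b::real_normed_vector) \<Rightarrow> bool" where
  "Ck_on 0 S f \<longleftrightarrow> continuous_on S f"
| "Ck_on (Suc k) S f \<longleftrightarrow>
     (\<forall>x\<in>S. f differentiable (at x)) \<and>
     (\<forall>v. Ck_on k S (\<lambda>x. frechet_derivative f (at x) v))"

text \<open>For a set that need not be open, smooth means: locally the restriction of a smooth
  function on an open set.  We use this for relatively open subsets of linear subspaces.\<close>

definition smooth_on :: "'a::euclidean_space set \<Rightarrow> ('a \<Rightarrow> 'b::real_normed_vector) \<Rightarrow> bool" where
  "smooth_on S f \<longleftrightarrow>
     (\<forall>x\<in>S. \<exists>U g. open U \<and> x \<in> U \<and> (\<forall>k. Ck_on k U g) \<and> (\<forall>y\<in>U \<inter> S. f y = g y))"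

section \<open>Manifolds\<close>

text \<open>A manifold is modelled on a linear subspace of a Euclidean space; this allows every
  dimension (including 0) below that of the ambient type, as needed for Lie subgroups,
  submanifolds and orbifolds whose dimension is not known in advance.  A chart is a pair of its
  domain and its coordinate map, whose values outside the domain are irrelevant.\<close>

type_synonym ('a, 'e) chart = "'a set \<times> ('a \<Rightarrow> 'e)"

record ('a, 'e) mfd =
  mtop :: "'a topology"
  model :: "'e set"
  atlas :: "('a, 'e) chart set"

abbreviation points :: "('a, 'e) mfd \<Rightarrow> 'a set" where
  "points M \<equiv> topspace (mtop M)"

definition smooth_manifold :: "('a, 'e::euclidean_space) mfd \<Rightarrow> bool" where
  "smooth_manifold M \<longleftrightarrow>
     Hausdorff_space (mtop M) \<and> second_countable (mtop M) \<and> subspace (model M) \<and>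
     (\<forall>(U, \<phi>)\<in>atlas M. openin (mtop M) U \<and> openin (top_of_set (model M)) (\<phi> ` U) \<and>
        homeomorphic_map (subtopology (mtop M) U) (top_of_set (\<phi> ` U)) \<phi>) \<and>
     (\<Union>(U, \<phi>)\<in>atlas M. U) = points M \<and>
     (\<forall>(U, \<phi>)\<in>atlas M. \<forall>(U', \<psi>)\<in>atlas M. smooth_on (\<phi> ` (U \<inter> U')) (\<psi> \<circ> inv_into U \<phi>))"

definition euclid_mfd :: "'e::euclidean_space set \<Rightarrow> 'e set \<Rightarrow> ('e, 'e) mfd" where
  "euclid_mfd V U = \<lparr>mtop = top_of_set U, model = V, atlas = {(U, \<lambda>x. x)}\<rparr>"

abbreviation real_line :: "(real, real) mfd" where
  "real_line \<equiv> euclid_mfd UNIV UNIV"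

definition prod_mfd :: "('a, 'e) mfd \<Rightarrow> ('b, 'f) mfd \<Rightarrow> ('a \<times> 'b, 'e \<times> 'f) mfd" where
  "prod_mfd M N = \<lparr>mtop = prod_topology (mtop M) (mtop N), model = model M \<times> model N,
     atlas = {(U \<times> U', map_prod \<phi> \<psi>) | U \<phi> U' \<psi>. (U, \<phi>) \<in> atlas M \<and> (U', \<psi>) \<in> atlas N}\<rparr>"

text \<open>Smoothness of a map defined on an open subset \<open>W\<close> of \<open>M\<close>.\<close>

definition smooth_map_on ::
  "('a, 'e::euclidean_space) mfd \<Rightarrow> 'a set \<Rightarrow> ('b, 'f::euclidean_space) mfd \<Rightarrow> ('a \<Rightarrow> 'b) \<Rightarrow> bool"
  where "smooth_map_on M W N F \<longleftrightarrow>
     continuous_map (subtopology (mtop M) W) (mtop N) F \<and>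
     (\<forall>(U, \<phi>)\<in>atlas M. \<forall>(U', \<psi>)\<in>atlas N.
        smooth_on (\<phi> ` {p \<in> U \<inter> W. F p \<in> U'}) (\<psi> \<circ> F \<circ> inv_into U \<phi>))"

abbreviation smooth_map ::
  "('a, 'e::euclidean_space) mfd \<Rightarrow> ('b, 'f::euclidean_space) mfd \<Rightarrow> ('a \<Rightarrow> 'b) \<Rightarrow> bool" where
  "smooth_map M \<equiv> smooth_map_on M (points M)"

text \<open>The tangent space at \<open>p\<close> consists of vectors of the model space attached to charts around
  \<open>p\<close>, identified along the derivatives of chart transitions.  We represent each such class by
  its representative in a chosen chart \<open>chart_at M p\<close>, so that the tangent space at every point
  is \<open>model M\<close> as a vector space.  The tangent map uses the chosen charts at both ends;
  another choice of charts changes all notions below only by the canonical identification.\<close>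

definition chart_at :: "('a, 'e) mfd \<Rightarrow> 'a \<Rightarrow> ('a, 'e) chart" where
  "chart_at M p = (SOME c. c \<in> atlas M \<and> p \<in> fst c)"

definition tangent_map :: "('a, 'e::euclidean_space) mfd \<Rightarrow> ('b, 'f::euclidean_space) mfd \<Rightarrow>
    ('a \<Rightarrow> 'b) \<Rightarrow> 'a \<Rightarrow> 'e \<Rightarrow> 'f" where
  "tangent_map M N F p =
     (let (U, \<phi>) = chart_at M p; (U', \<psi>) = chart_at N (F p)
      in frechet_derivative (\<psi> \<circ> F \<circ> inv_into U \<phi>) (at (\<phi> p) within model M))"

definition embedded_submanifold ::
  "('a, 'e::euclidean_space) mfd \<Rightarrow> 'a set \<Rightarrow> ('a, 'f::euclidean_space) mfd \<Rightarrow> bool" where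
  "embedded_submanifold N S M \<longleftrightarrow>
     smooth_manifold N \<and> S \<subseteq> points M \<and> mtop N = subtopology (mtop M) S \<and>
     smooth_map N M (\<lambda>x. x) \<and> (\<forall>x\<in>S. inj_on (tangent_map N M (\<lambda>x. x) x) (model N))"

section \<open>Symplectic forms\<close>

type_synonym ('a, 'e) form2 = "'a \<Rightarrow> 'e \<Rightarrow> 'e \<Rightarrow> real"

definition pullback_form :: "('a, 'e::euclidean_space) mfd \<Rightarrow> ('b, 'f::euclidean_space) mfd \<Rightarrow>
    ('a \<Rightarrow> 'b) \<Rightarrow> ('b, 'f) form2 \<Rightarrow> ('a, 'e) form2" where
  "pullback_form M N F \<omega> p u v = \<omega> (F p) (tangent_map M N F p u) (tangent_map M N F p v)"

definition form_in_chart :: "('a, 'e::euclidean_space) mfd \<Rightarrow> ('a, 'e) chart \<Rightarrow>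
    ('a, 'e) form2 \<Rightarrow> ('e, 'e) form2" where
  "form_in_chart M c \<omega> =
     (case c of (U, \<phi>) \<Rightarrow> pullback_form (euclid_mfd (model M) (\<phi> ` U)) M (inv_into U \<phi>) \<omega>)"

definition two_form :: "('a, 'e::euclidean_space) mfd \<Rightarrow> ('a, 'e) form2 \<Rightarrow> bool" where
  "two_form M \<omega> \<longleftrightarrow>
     (\<forall>p\<in>points M. \<forall>u\<in>model M. \<forall>v\<in>model M. \<omega> p u v = - \<omega> p v u) \<and>
     (\<forall>p\<in>points M. \<forall>u\<in>model M. \<forall>v\<in>model M. \<forall>w\<in>model M. \<forall>a b.
        \<omega> p (a *\<^sub>R u + b *\<^sub>R v) w = a * \<omega> p u w + b * \<omega> p v w) \<and>
     (\<forall>(U, \<phi>)\<in>atlas M. \<forall>u\<in>model M. \<forall>v\<in>model M.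
        smooth_on (\<phi> ` U) (\<lambda>x. form_in_chart M (U, \<phi>) \<omega> x u v))"

text \<open>The expression below is the exterior derivative in coordinates, evaluated on the constant
  vector fields \<open>u\<close>, \<open>v\<close>, \<open>w\<close>.\<close>

definition closed_form :: "('a, 'e::euclidean_space) mfd \<Rightarrow> ('a, 'e) form2 \<Rightarrow> bool" where
  "closed_form M \<omega> \<longleftrightarrow>
     (\<forall>(U, \<phi>)\<in>atlas M. \<forall>x\<in>\<phi> ` U. \<forall>u\<in>model M. \<forall>v\<in>model M. \<forall>w\<in>model M.
        let \<eta> = form_in_chart M (U, \<phi>) \<omega> in
          frechet_derivative (\<lambda>y. \<eta> y v w) (at x within model M) u
        + frechet_derivative (\<lambda>y. \<eta> y w u) (at x within model M) v
        + frechet_derivative (\<lambda>y. \<eta> y u v) (at x within model M) w = 0)"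

definition symplectic_form :: "('a, 'e::euclidean_space) mfd \<Rightarrow> ('a, 'e) form2 \<Rightarrow> bool" where
  "symplectic_form M \<omega> \<longleftrightarrow>
     two_form M \<omega> \<and> closed_form M \<omega> \<and>
     (\<forall>p\<in>points M. \<forall>u\<in>model M. (\<forall>v\<in>model M. \<omega> p u v = 0) \<longrightarrow> u = 0)"

section \<open>Lie groups and Hamiltonian actions\<close>

text \<open>A Lie group is given by its group structure \<open>G\<close> and its manifold structure \<open>GM\<close>.  By the
  convention above, its Lie algebra, the tangent space at the identity, is \<open>model GM\<close>.\<close>

definition lie_group :: "'g monoid \<Rightarrow> ('g, 'e::euclidean_space) mfd \<Rightarrow> bool" where
  "lie_group G GM \<longleftrightarrow>
     group G \<and> smooth_manifold GM \<and> points GM = carrier G \<and>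
     smooth_map (prod_mfd GM GM) GM (\<lambda>(g, h). g \<otimes>\<^bsub>G\<^esub> h) \<and>
     smooth_map GM GM (\<lambda>g. inv\<^bsub>G\<^esub> g)"

definition lie_subgroup ::
  "('g, 'k::euclidean_space) mfd \<Rightarrow> 'g monoid \<Rightarrow> ('g, 'e::euclidean_space) mfd \<Rightarrow> bool" where
  "lie_subgroup H G GM \<longleftrightarrow>
     subgroup (points H) G \<and> lie_group (G\<lparr>carrier := points H\<rparr>) H \<and>
     smooth_map H GM (\<lambda>x. x) \<and> (\<forall>x\<in>points H. inj_on (tangent_map H GM (\<lambda>x. x) x) (model H))"

definition lie_subalgebra_of ::
  "('g, 'k::euclidean_space) mfd \<Rightarrow> 'g monoid \<Rightarrow> ('g, 'e::euclidean_space) mfd \<Rightarrow> 'e set" where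
  "lie_subalgebra_of H G GM = tangent_map H GM (\<lambda>x. x) \<one>\<^bsub>G\<^esub> ` model H"

definition Ad :: "'g monoid \<Rightarrow> ('g, 'e::euclidean_space) mfd \<Rightarrow> 'g \<Rightarrow> 'e \<Rightarrow> 'e" where
  "Ad G GM g = tangent_map GM GM (\<lambda>h. g \<otimes>\<^bsub>G\<^esub> h \<otimes>\<^bsub>G\<^esub> inv\<^bsub>G\<^esub> g) \<one>\<^bsub>G\<^esub>"

definition dual :: "'e::real_vector set \<Rightarrow> ('e \<Rightarrow> real) set" where
  "dual V = {\<nu> \<in> extensional V.
     \<forall>u\<in>V. \<forall>v\<in>V. \<forall>a b. \<nu> (a *\<^sub>R u + b *\<^sub>R v) = a * \<nu> u + b * \<nu> v}"

definition coad :: "'g monoid \<Rightarrow> ('g, 'e::euclidean_space) mfd \<Rightarrow> 'g \<Rightarrow> ('e \<Rightarrow> real) \<Rightarrow> ('e \<Rightarrow> real)"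
  where "coad G GM g \<nu> = (\<lambda>\<xi>\<in>model GM. \<nu> (Ad G GM (inv\<^bsub>G\<^esub> g) \<xi>))"

definition isotropy_group ::
  "'g monoid \<Rightarrow> ('g, 'e::euclidean_space) mfd \<Rightarrow> ('e \<Rightarrow> real) \<Rightarrow> 'g set" where
  "isotropy_group G GM \<mu> = {g \<in> carrier G. coad G GM g \<mu> = \<mu>}"

text \<open>\<open>isotropy_group G GM \<mu>\<close> is closed, hence an embedded Lie subgroup, and its tangent space at
  the identity consists of the velocities of the smooth curves of the group that stay in it.\<close>

definition isotropy_algebra ::
  "'g monoid \<Rightarrow> ('g, 'e::euclidean_space) mfd \<Rightarrow> ('e \<Rightarrow> real) \<Rightarrow> 'e set" where
  "isotropy_algebra G GM \<mu> = {tangent_map real_line GM \<gamma> 0 1 | \<gamma>.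
     smooth_map real_line GM \<gamma> \<and> \<gamma> 0 = \<one>\<^bsub>G\<^esub> \<and> range \<gamma> \<subseteq> isotropy_group G GM \<mu>}"

text \<open>By the chain rule this is the velocity at \<open>t = 0\<close> of \<open>\<Phi> (exp (t \<xi>)) x\<close>.\<close>

definition infinitesimal_generator :: "'g monoid \<Rightarrow> ('g, 'e::euclidean_space) mfd \<Rightarrow>
    ('m, 'f::euclidean_space) mfd \<Rightarrow> ('g \<Rightarrow> 'm \<Rightarrow> 'm) \<Rightarrow> 'e \<Rightarrow> 'm \<Rightarrow> 'f" where
  "infinitesimal_generator G GM M \<Phi> \<xi> x = tangent_map GM M (\<lambda>g. \<Phi> g x) \<one>\<^bsub>G\<^esub> \<xi>"

definition hamiltonian_action :: "'g monoid \<Rightarrow> ('g, 'e::euclidean_space) mfd \<Rightarrow>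
    ('m, 'f::euclidean_space) mfd \<Rightarrow> ('m, 'f) form2 \<Rightarrow> ('g \<Rightarrow> 'm \<Rightarrow> 'm) \<Rightarrow>
    ('m \<Rightarrow> 'e \<Rightarrow> real) \<Rightarrow> bool" where
  "hamiltonian_action G GM M \<omega> \<Phi> J \<longleftrightarrow>
     group_action G (points M) \<Phi> \<and>
     smooth_map (prod_mfd GM M) M (\<lambda>(g, x). \<Phi> g x) \<and>
     (\<forall>g\<in>carrier G. \<forall>x\<in>points M. \<forall>u\<in>model M. \<forall>v\<in>model M.
        pullback_form M M (\<Phi> g) \<omega> x u v = \<omega> x u v) \<and>
     (\<forall>x\<in>points M. J x \<in> dual (model GM)) \<and>
     (\<forall>\<xi>\<in>model GM. smooth_map M real_line (\<lambda>x. J x \<xi>)) \<and>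
     (\<forall>\<xi>\<in>model GM. \<forall>x\<in>points M. \<forall>v\<in>model M.
        tangent_map M real_line (\<lambda>y. J y \<xi>) x v
          = \<omega> x (infinitesimal_generator G GM M \<Phi> \<xi> x) v) \<and>
     (\<forall>g\<in>carrier G. \<forall>x\<in>points M. J (\<Phi> g x) = coad G GM g (J x))"

text \<open>The manifold structure of \<open>K\<close> may be finer than the one induced by \<open>GM\<close>: the kernel group
  need not be closed.  Since the isotropy group is embedded, a Lie subgroup of it is the same as
  a Lie subgroup of the whole group contained in it.\<close>

definition kernel_group :: "('g, 'k::euclidean_space) mfd \<Rightarrow> 'g monoid \<Rightarrow>
    ('g, 'e::euclidean_space) mfd \<Rightarrow> ('e \<Rightarrow> real) \<Rightarrow> bool" where
  "kernel_group K G GM \<mu> \<longleftrightarrow>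
     lie_subgroup K G GM \<and> connected_space (mtop K) \<and>
     points K \<lhd> G\<lparr>carrier := isotropy_group G GM \<mu>\<rparr> \<and>
     lie_subalgebra_of K G GM = {\<xi> \<in> isotropy_algebra G GM \<mu>. \<mu> \<xi> = 0}"

definition ray :: "('g, 'e::euclidean_space) mfd \<Rightarrow> ('e \<Rightarrow> real) \<Rightarrow> ('e \<Rightarrow> real) set" where
  "ray GM \<mu> = {(\<lambda>\<xi>\<in>model GM. r * \<mu> \<xi>) | r. r > 0}"

definition ray_preimage :: "('g, 'e::euclidean_space) mfd \<Rightarrow> ('m, 'f) mfd \<Rightarrow>
    ('m \<Rightarrow> 'e \<Rightarrow> real) \<Rightarrow> ('e \<Rightarrow> real) \<Rightarrow> 'm set" where
  "ray_preimage GM M J \<mu> = {x \<in> points M. J x \<in> ray GM \<mu>}"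

text \<open>The tangent space of the ray at each of its points is the span of \<open>\<mu>\<close> (also if \<open>\<mu> = 0\<close>,
  when the ray is a point).\<close>

definition transverse_to_ray :: "('g, 'e::euclidean_space) mfd \<Rightarrow> ('m, 'f::euclidean_space) mfd \<Rightarrow>
    ('m \<Rightarrow> 'e \<Rightarrow> real) \<Rightarrow> ('e \<Rightarrow> real) \<Rightarrow> bool" where
  "transverse_to_ray GM M J \<mu> \<longleftrightarrow>
     (\<forall>x\<in>ray_preimage GM M J \<mu>. \<forall>\<nu>\<in>dual (model GM). \<exists>v\<in>model M. \<exists>c. \<forall>\<xi>\<in>model GM.
        \<nu> \<xi> = tangent_map M real_line (\<lambda>y. J y \<xi>) x v + c * \<mu> \<xi>)"

definition acts_properly ::
  "('g, 'k) mfd \<Rightarrow> 'm topology \<Rightarrow> ('g \<Rightarrow> 'm \<Rightarrow> 'm) \<Rightarrow> bool" where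
  "acts_properly K X \<Phi> \<longleftrightarrow>
     proper_map (prod_topology (mtop K) X) (prod_topology X X) (\<lambda>(k, x). (\<Phi> k x, x))"

section \<open>Orbit spaces\<close>

definition quotient_topology :: "'a topology \<Rightarrow> ('a \<Rightarrow> 'b) \<Rightarrow> 'b topology" where
  "quotient_topology X q =
     topology (\<lambda>U. U \<subseteq> q ` topspace X \<and> openin X {x \<in> topspace X. q x \<in> U})"

lemma openin_quotient_topology:
  "openin (quotient_topology X q) U \<longleftrightarrow>
     U \<subseteq> q ` topspace X \<and> openin X {x \<in> topspace X. q x \<in> U}"
proof -
  have "istopology (\<lambda>U. U \<subseteq> q ` topspace X \<and> openin X {x \<in> topspace X. q x \<in> U})"
    unfolding istopology_def
  proof (intro conjI allI impI)
    fix S T assume "S \<subseteq> q ` topspace X \<and> openin X {x \<in> topspace X. q x \<in> S}"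
      and "T \<subseteq> q ` topspace X \<and> openin X {x \<in> topspace X. q x \<in> T}"
    moreover have "{x \<in> topspace X. q x \<in> S \<inter> T} =
        {x \<in> topspace X. q x \<in> S} \<inter> {x \<in> topspace X. q x \<in> T}" by auto
    ultimately show "S \<inter> T \<subseteq> q ` topspace X" "openin X {x \<in> topspace X. q x \<in> S \<inter> T}"
      by auto
  next
    fix \<K> assume *: "\<forall>U\<in>\<K>. U \<subseteq> q ` topspace X \<and> openin X {x \<in> topspace X. q x \<in> U}"
    then show "\<Union>\<K> \<subseteq> q ` topspace X" by auto
    have "{x \<in> topspace X. q x \<in> \<Union>\<K>} = (\<Union>U\<in>\<K>. {x \<in> topspace X. q x \<in> U})" by auto
    with * show "openin X {x \<in> topspace X. q x \<in> \<Union>\<K>}" by auto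
  qed
  then show ?thesis
    unfolding quotient_topology_def by (simp add: topology_inverse')
qed

lemma topspace_quotient_topology: "topspace (quotient_topology X q) = q ` topspace X"
proof
  show "topspace (quotient_topology X q) \<subseteq> q ` topspace X"
    using openin_topspace[of "quotient_topology X q"] unfolding openin_quotient_topology
    by (rule conjunct1)
  have "{x \<in> topspace X. q x \<in> q ` topspace X} = topspace X" by auto
  then have "openin (quotient_topology X q) (q ` topspace X)"
    by (simp add: openin_quotient_topology)
  then show "q ` topspace X \<subseteq> topspace (quotient_topology X q)"
    by (rule openin_subset)
qed

lemma quotient_map_quotient_topology: "quotient_map X (quotient_topology X q) q"
  by (auto simp: quotient_map_def topspace_quotient_topology openin_quotient_topology)

section \<open>Orbifolds\<close>

text \<open>An orbifold chart on \<open>Q\<close> modelled on \<open>V\<close> is \<open>(U, \<Gamma>, \<phi>)\<close> with \<open>U\<close> a connected open subset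
  of \<open>V\<close>, \<open>\<Gamma>\<close> a finite group of diffeomorphisms of \<open>U\<close>, and \<open>\<phi>\<close> inducing a homeomorphism from
  the orbit space of \<open>\<Gamma>\<close> onto an open subset of \<open>Q\<close>.  Diffeomorphisms of \<open>U\<close> are represented by
  extensional functions.\<close>

type_synonym ('q, 'e) orbichart = "'e set \<times> ('e \<Rightarrow> 'e) set \<times> ('e \<Rightarrow> 'q)"

definition orbichart :: "'q topology \<Rightarrow> 'e::euclidean_space set \<Rightarrow> ('q, 'e) orbichart \<Rightarrow> bool" where
  "orbichart Q V = (\<lambda>(U, \<Gamma>, \<phi>).
     openin (top_of_set V) U \<and> connected U \<and>
     finite \<Gamma> \<and> subgroup \<Gamma> (BijGroup U) \<and> (\<forall>\<gamma>\<in>\<Gamma>. smooth_on U \<gamma>) \<and>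
     continuous_map (top_of_set U) Q \<phi> \<and> open_map (top_of_set U) Q \<phi> \<and>
     (\<forall>x\<in>U. \<forall>y\<in>U. \<phi> x = \<phi> y \<longleftrightarrow> (\<exists>\<gamma>\<in>\<Gamma>. y = \<gamma> x)))"

definition orbichart_embedding ::
  "'e::euclidean_space set \<Rightarrow> ('q, 'e) orbichart \<Rightarrow> ('q, 'e) orbichart \<Rightarrow> ('e \<Rightarrow> 'e) \<Rightarrow> bool" where
  "orbichart_embedding V = (\<lambda>(W, H, \<psi>) (U, \<Gamma>, \<phi>) j.
     j ` W \<subseteq> U \<and> openin (top_of_set V) (j ` W) \<and> inj_on j W \<and>
     smooth_on W j \<and> smooth_on (j ` W) (inv_into W j) \<and> (\<forall>x\<in>W. \<phi> (j x) = \<psi> x))"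

definition orbicharts_compatible :: "'q topology \<Rightarrow> 'e::euclidean_space set \<Rightarrow>
    ('q, 'e) orbichart \<Rightarrow> ('q, 'e) orbichart \<Rightarrow> bool" where
  "orbicharts_compatible Q V = (\<lambda>(U\<^sub>1, \<Gamma>\<^sub>1, \<phi>\<^sub>1) (U\<^sub>2, \<Gamma>\<^sub>2, \<phi>\<^sub>2).
     \<forall>q \<in> \<phi>\<^sub>1 ` U\<^sub>1 \<inter> \<phi>\<^sub>2 ` U\<^sub>2. \<exists>W H \<psi> j\<^sub>1 j\<^sub>2.
       orbichart Q V (W, H, \<psi>) \<and> q \<in> \<psi> ` W \<and>
       orbichart_embedding V (W, H, \<psi>) (U\<^sub>1, \<Gamma>\<^sub>1, \<phi>\<^sub>1) j\<^sub>1 \<and>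
       orbichart_embedding V (W, H, \<psi>) (U\<^sub>2, \<Gamma>\<^sub>2, \<phi>\<^sub>2) j\<^sub>2)"

definition orbifold ::
  "'q topology \<Rightarrow> 'e::euclidean_space set \<Rightarrow> ('q, 'e) orbichart set \<Rightarrow> bool" where
  "orbifold Q V A \<longleftrightarrow>
     Hausdorff_space Q \<and> second_countable Q \<and> subspace V \<and>
     (\<forall>c\<in>A. orbichart Q V c) \<and> (\<Union>(U, \<Gamma>, \<phi>)\<in>A. \<phi> ` U) = topspace Q \<and>
     (\<forall>c\<in>A. \<forall>d\<in>A. orbicharts_compatible Q V c d)"

text \<open>A symplectic form on an orbifold is a family of symplectic forms on the chart domains that
  agree along all embeddings from a common chart.  Taking for the two embeddings the identity and
  an element of the group of a chart shows that each member is invariant under its group.\<close>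

definition orbifold_symplectic_form :: "'q topology \<Rightarrow> 'e::euclidean_space set \<Rightarrow>
    ('q, 'e) orbichart set \<Rightarrow> (('q, 'e) orbichart \<Rightarrow> ('e, 'e) form2) \<Rightarrow> bool" where
  "orbifold_symplectic_form Q V A \<Omega> \<longleftrightarrow>
     (\<forall>(U, \<Gamma>, \<phi>)\<in>A. symplectic_form (euclid_mfd V U) (\<Omega> (U, \<Gamma>, \<phi>))) \<and>
     (\<forall>c\<in>A. \<forall>d\<in>A. \<forall>w j\<^sub>1 j\<^sub>2.
        orbichart Q V w \<and> orbichart_embedding V w c j\<^sub>1 \<and> orbichart_embedding V w d j\<^sub>2 \<longrightarrow>
        (\<forall>x\<in>fst w. \<forall>u\<in>V. \<forall>v\<in>V.
           pullback_form (euclid_mfd V (fst w)) (euclid_mfd V (fst c)) j\<^sub>1 (\<Omega> c) x u v =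
           pullback_form (euclid_mfd V (fst w)) (euclid_mfd V (fst d)) j\<^sub>2 (\<Omega> d) x u v))"

text \<open>Maps from a manifold \<open>N\<close> into an orbifold: \<open>s\<close> is a smooth lift of \<open>p\<close> to a chart over the
  open set \<open>W\<close>; \<open>p\<close> is a smooth submersion if it has submersive local lifts through every point of
  a chart above the image; and forms are pulled back through local lifts.\<close>

definition local_lift :: "('a, 'n::euclidean_space) mfd \<Rightarrow> 'e::euclidean_space set \<Rightarrow>
    ('q, 'e) orbichart \<Rightarrow> ('a \<Rightarrow> 'q) \<Rightarrow> 'a set \<Rightarrow> ('a \<Rightarrow> 'e) \<Rightarrow> bool" where
  "local_lift N V = (\<lambda>(U, \<Gamma>, \<phi>) p W s.
     openin (mtop N) W \<and> smooth_map_on N W (euclid_mfd V U) s \<and> (\<forall>x\<in>W. \<phi> (s x) = p x))"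

definition orbifold_submersion :: "('a, 'n::euclidean_space) mfd \<Rightarrow> 'e::euclidean_space set \<Rightarrow>
    ('q, 'e) orbichart set \<Rightarrow> ('a \<Rightarrow> 'q) \<Rightarrow> bool" where
  "orbifold_submersion N V A p \<longleftrightarrow>
     (\<forall>(U, \<Gamma>, \<phi>)\<in>A. \<forall>x\<in>points N. \<forall>y\<in>U. \<phi> y = p x \<longrightarrow>
        (\<exists>W s. local_lift N V (U, \<Gamma>, \<phi>) p W s \<and> x \<in> W \<and> s x = y \<and>
           (\<forall>z\<in>W. tangent_map N (euclid_mfd V U) s z ` model N = V)))"

definition orbifold_pullback_eq :: "('a, 'n::euclidean_space) mfd \<Rightarrow> 'e::euclidean_space set \<Rightarrow>
    ('q, 'e) orbichart set \<Rightarrow> ('a \<Rightarrow> 'q) \<Rightarrow> (('q, 'e) orbichart \<Rightarrow> ('e, 'e) form2) \<Rightarrow>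
    ('a, 'n) form2 \<Rightarrow> bool" where
  "orbifold_pullback_eq N V A p \<Omega> \<sigma> \<longleftrightarrow>
     (\<forall>c\<in>A. \<forall>W s. local_lift N V c p W s \<longrightarrow>
        (\<forall>x\<in>W. \<forall>u\<in>model N. \<forall>v\<in>model N.
           pullback_form N (euclid_mfd V (fst c)) s (\<Omega> c) x u v = \<sigma> x u v))"

end

theory Submission
  imports Defs
begin

text \<open>By (2) the ray preimage \<open>S\<close> is a regular level set of the components of \<open>J\<close> along \<open>ker \<mu>\<close>,
  and \<open>K\<close> acts on it properly, with discrete stabilizers since transversality makes \<open>\<xi> \<mapsto> \<xi>\<^sub>M\<close>
  injective on \<open>ker \<mu>\<close>.  A transversal to the orbits on which the (finite) stabilizer of its centre
  acts is an orbifold chart of the orbit space; no linearization of the stabilizer is needed, as the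
  projection of a flow box along the orbits turns each of its elements into a diffeomorphism of the
  transversal.  The reduced form is the restriction of \<open>\<omega>\<close> to these transversals, so everything rests
  on the fact that the kernel of \<open>\<omega>\<close> restricted to \<open>S\<close> consists of the orbit directions.  A vector of
  that kernel is \<open>\<xi>\<^sub>M\<close> with \<open>\<xi> \<in> ker \<mu>\<close>, because \<open>TS\<close> is cut out by the equations
  \<open>\<omega> (\<xi>\<^sub>M, -) = 0\<close>.  Being tangent to \<open>S\<close>, it annihilates all \<open>\<eta>\<^sub>M\<close> with \<open>\<eta> \<in> ker \<mu>\<close>; it annihilates
  \<open>\<zeta>\<^sub>M\<close> for \<open>\<zeta>\<close> in the isotropy algebra because \<open>J\<close> is constant along the orbits of the isotropy
  group; so by (3) \<open>J\<close> is infinitesimally constant along \<open>\<xi>\<close>, that is, \<open>\<xi>\<close> lies in the isotropy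
  algebra.\<close>

section \<open>Calculus of smooth maps\<close>

text \<open>Stabilizers in \<open>K\<close> are finite because they are discrete and, by properness,
  compact. Two points of the overview hide most of the work. Its last step needs a curve in the
  isotropy group with a prescribed velocity, since \<open>isotropy_algebra\<close> consists of
  velocities of curves; infinitesimal constancy of \<open>J\<close> along one vector yields such a
  curve only because the momentum map along an orbit has constant rank. And the equation for the
  reduced form is demanded for every smooth local lift, whereas two lifts may differ by a group
  element that changes from point to point; so the lifts built from slices have to be compared with
  arbitrary ones. All manifolds are modelled on subspaces, hence derivatives, the inverse function
  theorem and the exterior derivative are developed relative to a subspace. The topology of
  \<open>K\<close> may be finer than that induced by \<open>G\<close>; for this reason orbits are
  studied with \<open>K\<close> as an abstract Lie group acting smoothly on \<open>S\<close>, and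
  \<open>G\<close> returns only to identify the kernel of the form.\<close>

lemma Ck_on_subset: "Ck_on k U f \<Longrightarrow> V \<subseteq> U \<Longrightarrow> Ck_on k V f"
  by (induction k arbitrary: f) (auto intro: continuous_on_subset)

text \<open>\<open>frechet_derivative\<close> is a choice among all derivatives, so the two sets of
  derivatives at \<open>x\<close> must coincide; in this form the equality also covers points where
  \<open>f\<close> is not differentiable.\<close>

lemma frechet_derivative_cong_open:
  assumes "open U" "x \<in> U" "\<And>y. y \<in> U \<Longrightarrow> f y = g y"
  shows "frechet_derivative f (at x) = frechet_derivative g (at x)"
proof -
  have "(f has_derivative D) (at x) \<longleftrightarrow> (g has_derivative D) (at x)" for D
    using has_derivative_transform_within_open[OF _ assms(1,2), of f D UNIV g]
      has_derivative_transform_within_open[OF _ assms(1,2), of g D UNIV f] assms(3) by auto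
  then show ?thesis by (simp add: frechet_derivative_def)
qed

lemma Ck_on_cong:
  assumes "open U" "\<And>x. x \<in> U \<Longrightarrow> f x = g x" "Ck_on k U f"
  shows "Ck_on k U g"
  using assms(2,3)
proof (induction k arbitrary: f g)
  case 0 then show ?case using continuous_on_cong by force
next
  case (Suc k)
  have d: "g differentiable (at x)" if "x \<in> U" for x
    using Suc.prems that has_derivative_transform_within_open[OF _ assms(1) that, of f _ UNIV g]
    by (simp add: differentiable_def) metis
  have "Ck_on k U (\<lambda>x. frechet_derivative g (at x) v)" for v
  proof (rule Suc.IH[of "\<lambda>x. frechet_derivative f (at x) v"])
    show "frechet_derivative f (at x) v = frechet_derivative g (at x) v" if "x \<in> U" for x
      using frechet_derivative_cong_open[OF assms(1) that Suc.prems(1)] by simp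
  qed (use Suc.prems(2) in simp)
  with d show ?case by simp
qed

lemma Ck_on_imp_continuous: "Ck_on k U f \<Longrightarrow> continuous_on U f"
  by (cases k) (auto intro!: continuous_at_imp_continuous_on differentiable_imp_continuous_within)

text \<open>That \<open>Ck_on (Suc k)\<close> contains the lower orders is not built into the
  recursion; the base case is that differentiable maps are continuous.\<close>

lemma Ck_on_Suc_D: "Ck_on (Suc k) U f \<Longrightarrow> Ck_on k U f"
proof (induction k arbitrary: f)
  case 0 then show ?case using Ck_on_imp_continuous[of "Suc 0"] by simp
next
  case (Suc k) 
  show ?case unfolding Ck_on.simps(2)[of k]
    using Suc.prems Suc.IH by (subst (asm) Ck_on.simps(2)) blast
qed

text \<open>Replaces the chosen \<open>frechet_derivative\<close> by any explicit derivative; most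
  closure properties below are inductions through this rule.\<close>

lemma Ck_on_SucI:
  assumes "open U" "\<And>x. x \<in> U \<Longrightarrow> (f has_derivative f' x) (at x)" "\<And>v. Ck_on k U (\<lambda>x. f' x v)"
  shows "Ck_on (Suc k) U f"
proof -
  have "frechet_derivative f (at x) = f' x" if "x \<in> U" for x
    using frechet_derivative_at[OF assms(2)[OF that]] by (rule sym)
  then have "Ck_on k U (\<lambda>x. frechet_derivative f (at x) v)" for v
    by (intro Ck_on_cong[OF assms(1) _ assms(3)[of v]]) simp
  then show ?thesis using assms(2) by (auto simp: differentiable_def)
qed

lemma Ck_on_SucD:
  assumes "Ck_on (Suc k) U f"
  shows "x \<in> U \<Longrightarrow> (f has_derivative frechet_derivative f (at x)) (at x)"
    and "Ck_on k U (\<lambda>x. frechet_derivative f (at x) v)"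
proof -
  show "x \<in> U \<Longrightarrow> (f has_derivative frechet_derivative f (at x)) (at x)"
    using assms frechet_derivative_works by (metis Ck_on.simps(2))
  show "Ck_on k U (\<lambda>x. frechet_derivative f (at x) v)" using assms by simp
qed

lemma Ck_on_const: "Ck_on k U (\<lambda>x. c)"
  by (induction k arbitrary: c) auto

lemma Ck_on_linear:
  assumes "bounded_linear L" shows "Ck_on k U L"
proof (cases k)
  case 0 then show ?thesis using assms by (simp add: linear_continuous_on)
next
  case (Suc j)
  have "frechet_derivative L (at x) = L" for x
    using frechet_derivative_at[OF bounded_linear_imp_has_derivative[OF assms]] by metis
  then show ?thesis using Suc assms by (simp add: bounded_linear_imp_differentiable Ck_on_const)
qed

lemma Ck_on_linear_compose:
  assumes "open U" "bounded_linear L" "Ck_on k U f"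
  shows "Ck_on k U (\<lambda>x. L (f x))"
  using assms(3)
proof (induction k arbitrary: f)
  case 0 then show ?case using assms(2)
    by (simp add: bounded_linear.continuous_on)
next
  case (Suc k)
  show ?case
    by (rule Ck_on_SucI[OF assms(1) bounded_linear.has_derivative[OF assms(2) Ck_on_SucD(1)[OF Suc.prems]]])
      (use Suc.IH Ck_on_SucD(2)[OF Suc.prems] in auto)
qed

lemma Ck_on_add:
  assumes "open U" "Ck_on k U f" "Ck_on k U g"
  shows "Ck_on k U (\<lambda>x. f x + g x)"
  using assms(2,3)
proof (induction k arbitrary: f g)
  case 0 then show ?case by (simp add: continuous_on_add)
next
  case (Suc k)
  show ?case
    by (rule Ck_on_SucI[OF assms(1) has_derivative_add[OF Ck_on_SucD(1)[OF Suc.prems(1)] Ck_on_SucD(1)[OF Suc.prems(2)]]])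
      (use Suc.IH Ck_on_SucD(2)[OF Suc.prems(1)] Ck_on_SucD(2)[OF Suc.prems(2)] in auto)
qed

lemma Ck_on_bilinear:
  fixes f :: "'a::euclidean_space \<Rightarrow> 'b::real_normed_vector" and g :: "'a \<Rightarrow> 'c::real_normed_vector"
  assumes "open U" "bounded_bilinear h" "Ck_on k U f" "Ck_on k U g"
  shows "Ck_on k U (\<lambda>x. h (f x) (g x))"
  using assms(3,4)
proof (induction k arbitrary: f g)
  case 0 then show ?case using assms(2) by (simp add: bounded_bilinear.continuous_on)
next
  case (Suc k)
  show ?case
    by (rule Ck_on_SucI[OF assms(1) bounded_bilinear.FDERIV[OF assms(2) Ck_on_SucD(1)[OF Suc.prems(1)] Ck_on_SucD(1)[OF Suc.prems(2)]]],
        assumption, assumption)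
      (intro Ck_on_add[OF assms(1)] Suc.IH Ck_on_SucD(2)[OF Suc.prems(1)] Ck_on_SucD(2)[OF Suc.prems(2)]
        Ck_on_Suc_D[OF Suc.prems(1)] Ck_on_Suc_D[OF Suc.prems(2)])
qed

lemma Ck_on_sum:
  assumes "open U" "finite I" "\<And>i. i \<in> I \<Longrightarrow> Ck_on k U (f i)"
  shows "Ck_on k U (\<lambda>x. \<Sum>i\<in>I. f i x)"
  using assms(2,3) by (induction I rule: finite_induct) (auto simp: Ck_on_const intro!: Ck_on_add assms(1))

lemma Ck_on_compose:
  fixes f :: "'a::euclidean_space \<Rightarrow> 'b::euclidean_space" and g :: "'b \<Rightarrow> 'c::real_normed_vector"
  assumes "open U" "open T" "f ` U \<subseteq> T" "Ck_on k U f" "Ck_on k T g"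
  shows "Ck_on k U (\<lambda>x. g (f x))"
  using assms(4,5)
proof (induction k arbitrary: g)
  case 0 then show ?case using assms(3) continuous_on_compose2 by (metis Ck_on.simps(1))
next
  case (Suc k)
  let ?g = "\<lambda>b y. frechet_derivative g (at y) b"
  show ?case
  proof (rule Ck_on_SucI[OF assms(1)])
    fix x assume x: "x \<in> U"
    have g: "(g has_derivative frechet_derivative g (at (f x))) (at (f x))"
      using Ck_on_SucD(1)[OF Suc.prems(2)] x assms(3) by blast
    have f: "(f has_derivative frechet_derivative f (at x)) (at x)"
      using Ck_on_SucD(1)[OF Suc.prems(1)] x by blast
    interpret bounded_linear "frechet_derivative g (at (f x))" using g by (rule has_derivative_bounded_linear)
    \<comment> \<open>\<open>Ck_on\<close> controls derivatives only in fixed directions, while here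
      the direction moves with \<open>x\<close>; expanding it in the basis leaves fixed directions
      with smooth coefficients.\<close>
    have eq: "frechet_derivative g (at (f x)) w = (\<Sum>b\<in>Basis. (w \<bullet> b) *\<^sub>R ?g b (f x))" for w
      by (subst euclidean_representation[of w, symmetric]) (simp only: sum scaleR)
    show "((\<lambda>x. g (f x)) has_derivative (\<lambda>v. \<Sum>b\<in>Basis. (frechet_derivative f (at x) v \<bullet> b) *\<^sub>R ?g b (f x))) (at x)"
      by (rule has_derivative_eq_rhs[OF has_derivative_compose[OF f g]]) (rule ext, rule eq)
  next
    fix v
    have "Ck_on k U (\<lambda>x. ?g b (f x))" for b
      using Suc.IH[OF Ck_on_Suc_D[OF Suc.prems(1)] Ck_on_SucD(2)[OF Suc.prems(2)]] .
    moreover have "Ck_on k U (\<lambda>x. frechet_derivative f (at x) v \<bullet> b)" for b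
      by (rule Ck_on_linear_compose[OF assms(1) bounded_linear_inner_left Ck_on_SucD(2)[OF Suc.prems(1)]])
    ultimately show "Ck_on k U (\<lambda>x. \<Sum>b\<in>Basis. (frechet_derivative f (at x) v \<bullet> b) *\<^sub>R ?g b (f x))"
      by (intro Ck_on_sum Ck_on_bilinear[OF assms(1) bounded_bilinear_scaleR] assms(1)) auto
  qed
qed

lemma Ck_on_local:
  assumes "\<And>x. x \<in> U \<Longrightarrow> \<exists>W. open W \<and> x \<in> W \<and> Ck_on k W f"
  shows "Ck_on k U f"
  using assms
proof (induction k arbitrary: f)
  case 0
  then show ?case by (simp) (meson continuous_at_imp_continuous_on continuous_on_eq_continuous_at)
next
  case (Suc k)
  show ?case unfolding Ck_on.simps
    by (intro conjI ballI allI Suc.IH) (use Suc.prems in \<open>auto; meson\<close>)+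
qed

section \<open>Smooth maps on arbitrary subsets\<close>

lemma smooth_onE:
  assumes "smooth_on S f" "x \<in> S"
  obtains U g where "open U" "x \<in> U" "\<And>k. Ck_on k U g" "\<And>y. y \<in> U \<Longrightarrow> y \<in> S \<Longrightarrow> f y = g y"
  using assms(1)[unfolded smooth_on_def, rule_format, OF assms(2)] that by blast

lemma smooth_onI:
  assumes "\<And>x. x \<in> S \<Longrightarrow> \<exists>U g. open U \<and> x \<in> U \<and> (\<forall>k. Ck_on k U g) \<and> (\<forall>y\<in>U \<inter> S. f y = g y)"
  shows "smooth_on S f"
  using assms by (simp add: smooth_on_def)

lemma smooth_on_open: "open U \<Longrightarrow> smooth_on U f \<longleftrightarrow> (\<forall>k. Ck_on k U f)"
proof
  assume U: "open U" and sm: "smooth_on U f"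
  have "\<exists>W. open W \<and> x \<in> W \<and> Ck_on k W f" if x: "x \<in> U" for x k
  proof -
    obtain W g where W: "open W" "x \<in> W" "\<And>k. Ck_on k W g" "\<And>y. y \<in> W \<Longrightarrow> y \<in> U \<Longrightarrow> f y = g y"
      using smooth_onE[OF sm x] by metis
    have "open (W \<inter> U)" using W U by auto
    moreover have "Ck_on k (W \<inter> U) f"
      using W(4) by (intro Ck_on_cong[OF calculation _ Ck_on_subset[OF W(3) inf_le1]]) auto
    ultimately show ?thesis using W(2) x by blast
  qed
  then show "\<forall>k. Ck_on k U f" using Ck_on_local by metis
next
  assume "open U" "\<forall>k. Ck_on k U f"
  then show "smooth_on U f" by (intro smooth_onI exI[of _ U] exI[of _ f]) simp
qed

lemma smooth_on_cong:
  assumes "smooth_on S f" "T \<subseteq> S" "\<And>x. x \<in> T \<Longrightarrow> f x = g x"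
  shows "smooth_on T g"
proof (rule smooth_onI)
  fix x assume "x \<in> T"
  then have "x \<in> S" using assms(2) by blast
  obtain U h where U: "open U" "x \<in> U" "\<And>k. Ck_on k U h" "\<And>y. y \<in> U \<Longrightarrow> y \<in> S \<Longrightarrow> f y = h y"
    using smooth_onE[OF assms(1) \<open>x \<in> S\<close>] by metis
  have "\<forall>y\<in>U \<inter> T. g y = h y" using U(4) assms(2,3) by force
  with U(1-3) show "\<exists>U h. open U \<and> x \<in> U \<and> (\<forall>k. Ck_on k U h) \<and> (\<forall>y\<in>U \<inter> T. g y = h y)" by auto
qed

lemma smooth_on_subset: "smooth_on S f \<Longrightarrow> T \<subseteq> S \<Longrightarrow> smooth_on T f"
  using smooth_on_cong[of S f T f] by simp

lemma smooth_on_local: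
  assumes "\<And>x. x \<in> S \<Longrightarrow> \<exists>T. openin (top_of_set S) T \<and> x \<in> T \<and> smooth_on T f"
  shows "smooth_on S f"
proof (rule smooth_onI)
  fix x assume "x \<in> S"
  then obtain T where T: "openin (top_of_set S) T" "x \<in> T" "smooth_on T f" using assms by blast
  obtain U g where U: "open U" "x \<in> U" "\<And>k. Ck_on k U g" "\<And>y. y \<in> U \<Longrightarrow> y \<in> T \<Longrightarrow> f y = g y"
    using smooth_onE[OF T(3,2)] by metis
  obtain O' where O': "open O'" "T = S \<inter> O'" using T(1) openin_open by metis
  have "Ck_on k (U \<inter> O') g" for k by (rule Ck_on_subset[OF U(3) inf_le1])
  then show "\<exists>U g. open U \<and> x \<in> U \<and> (\<forall>k. Ck_on k U g) \<and> (\<forall>y\<in>U \<inter> S. f y = g y)"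
    using U(1,2,4) T(2) O' by (intro exI[of _ "U \<inter> O'"] exI[of _ g]) (simp add: open_Int)
qed

lemma smooth_on_imp_continuous_on:
  assumes a: "smooth_on S f" shows "continuous_on S f"
proof -
  have "continuous (at x within S) f" if x: "x \<in> S" for x
  proof -
    obtain U g where U: "open U" "x \<in> U" "\<And>k. Ck_on k U g" "\<And>y. y \<in> U \<Longrightarrow> y \<in> S \<Longrightarrow> f y = g y"
      using smooth_onE[OF a x] by metis
    have "continuous_on (S \<inter> U) g"
      using Ck_on_imp_continuous[OF U(3)] continuous_on_subset by (metis inf_le2)
    then have "continuous_on (S \<inter> U) f"
      by (rule continuous_on_eq) (simp add: U(4))
    then have "continuous (at x within S \<inter> U) f"
      using x U(2) continuous_on_eq_continuous_within by blast
    moreover have "at x within S \<inter> U = at x within S"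
      using U(1,2) by (intro at_within_nhd[of _ U]) auto
    ultimately show ?thesis by simp
  qed
  then show ?thesis by (simp add: continuous_on_eq_continuous_within)
qed

lemma smooth_on_const: "smooth_on S (\<lambda>x. c)"
  using Ck_on_const by (intro smooth_onI exI[of _ UNIV] exI[of _ "\<lambda>x. c"]) auto

lemma smooth_on_linear: "bounded_linear L \<Longrightarrow> smooth_on S L"
  using Ck_on_linear by (intro smooth_onI exI[of _ UNIV] exI[of _ L]) auto

lemma smooth_on_id: "smooth_on S (\<lambda>x. x)"
  by (rule smooth_on_linear) (rule bounded_linear_ident)

lemma smooth_on_compose:
  assumes "smooth_on S f" "smooth_on T g" "\<And>x. x \<in> S \<Longrightarrow> f x \<in> T"
  shows "smooth_on S (\<lambda>x. g (f x))"
proof (rule smooth_onI)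
  fix x assume x: "x \<in> S"
  obtain U f' where U: "open U" "x \<in> U" "\<And>k. Ck_on k U f'" "\<And>y. y \<in> U \<Longrightarrow> y \<in> S \<Longrightarrow> f y = f' y"
    using smooth_onE[OF assms(1) x] by metis
  obtain U' g' where U': "open U'" "f x \<in> U'" "\<And>k. Ck_on k U' g'" "\<And>y. y \<in> U' \<Longrightarrow> y \<in> T \<Longrightarrow> g y = g' y"
    using smooth_onE[OF assms(2) assms(3)[OF x]] by metis
  let ?W = "U \<inter> f' -` U'"
  have W: "open ?W"
    using Ck_on_imp_continuous[OF U(3)] U U'(1) by (simp add: continuous_open_preimage)
  have "Ck_on k ?W (\<lambda>x. g' (f' x))" for k
    by (rule Ck_on_compose[OF W U'(1) _ Ck_on_subset[OF U(3) inf_le1] U'(3)]) auto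
  moreover have "x \<in> ?W" using U(2,4) U'(2) x by auto
  moreover have "\<forall>y\<in>?W \<inter> S. g (f y) = g' (f' y)" using U(4) U'(4) assms(3) by (metis IntE vimageD)
  ultimately show "\<exists>U ga. open U \<and> x \<in> U \<and> (\<forall>k. Ck_on k U ga) \<and> (\<forall>y\<in>U \<inter> S. g (f y) = ga y)"
    using W by (intro exI[of _ ?W] exI[of _ "\<lambda>x. g' (f' x)"] conjI allI)
qed

lemma smooth_on_linear_compose:
  assumes "bounded_linear L" "smooth_on S f" shows "smooth_on S (\<lambda>x. L (f x))"
proof (rule smooth_onI)
  fix x assume x: "x \<in> S"
  obtain U f' where U: "open U" "x \<in> U" "\<And>k. Ck_on k U f'" "\<And>y. y \<in> U \<Longrightarrow> y \<in> S \<Longrightarrow> f y = f' y"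
    using smooth_onE[OF assms(2) x] by metis
  from Ck_on_linear_compose[OF U(1) assms(1) U(3)] U
  show "\<exists>U g. open U \<and> x \<in> U \<and> (\<forall>k. Ck_on k U g) \<and> (\<forall>y\<in>U \<inter> S. L (f y) = g y)"
    by (intro exI[of _ U] exI[of _ "\<lambda>x. L (f' x)"]) simp
qed

lemma smooth_on_bilinear:
  assumes "bounded_bilinear h" "smooth_on S f" "smooth_on S g"
  shows "smooth_on S (\<lambda>x. h (f x) (g x))"
proof (rule smooth_onI)
  fix x assume x: "x \<in> S"
  obtain U f' where U: "open U" "x \<in> U" "\<And>k. Ck_on k U f'" "\<And>y. y \<in> U \<Longrightarrow> y \<in> S \<Longrightarrow> f y = f' y"
    using smooth_onE[OF assms(2) x] by metis
  obtain U' g' where U': "open U'" "x \<in> U'" "\<And>k. Ck_on k U' g'" "\<And>y. y \<in> U' \<Longrightarrow> y \<in> S \<Longrightarrow> g y = g' y"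
    using smooth_onE[OF assms(3) x] by metis
  from Ck_on_bilinear[OF open_Int[OF U(1) U'(1)] assms(1) Ck_on_subset[OF U(3) inf_le1] Ck_on_subset[OF U'(3) inf_le2]] U U'
  show "\<exists>U ga. open U \<and> x \<in> U \<and> (\<forall>k. Ck_on k U ga) \<and> (\<forall>y\<in>U \<inter> S. h (f y) (g y) = ga y)"
    by (intro exI[of _ "U \<inter> U'"] exI[of _ "\<lambda>x. h (f' x) (g' x)"]) (simp add: open_Int)
qed

lemma smooth_on_add:
  assumes "smooth_on S f" "smooth_on S g"
  shows "smooth_on S (\<lambda>x. f x + g x)"
proof (rule smooth_onI)
  fix x assume x: "x \<in> S"
  obtain U f' where U: "open U" "x \<in> U" "\<And>k. Ck_on k U f'" "\<And>y. y \<in> U \<Longrightarrow> y \<in> S \<Longrightarrow> f y = f' y"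
    using smooth_onE[OF assms(1) x] by metis
  obtain U' g' where U': "open U'" "x \<in> U'" "\<And>k. Ck_on k U' g'" "\<And>y. y \<in> U' \<Longrightarrow> y \<in> S \<Longrightarrow> g y = g' y"
    using smooth_onE[OF assms(2) x] by metis
  from Ck_on_add[OF open_Int[OF U(1) U'(1)] Ck_on_subset[OF U(3) inf_le1] Ck_on_subset[OF U'(3) inf_le2]] U U'
  show "\<exists>U ga. open U \<and> x \<in> U \<and> (\<forall>k. Ck_on k U ga) \<and> (\<forall>y\<in>U \<inter> S. f y + g y = ga y)"
    by (intro exI[of _ "U \<inter> U'"] exI[of _ "\<lambda>x. f' x + g' x"]) (simp add: open_Int)
qed

lemmas smooth_on_scaleR = smooth_on_bilinear[OF bounded_bilinear_scaleR]
lemmas smooth_on_mult = smooth_on_bilinear[OF bounded_bilinear_mult]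

lemma smooth_on_uminus: "smooth_on S f \<Longrightarrow> smooth_on S (\<lambda>x. - f x)"
  by (rule smooth_on_linear_compose[of uminus]) (auto intro: bounded_linear_minus bounded_linear_ident)

lemma smooth_on_diff: "smooth_on S f \<Longrightarrow> smooth_on S g \<Longrightarrow> smooth_on S (\<lambda>x. f x - g x)"
  using smooth_on_add[OF _ smooth_on_uminus, of S f g] by simp

lemma smooth_on_sum:
  assumes "finite I" "\<And>i. i \<in> I \<Longrightarrow> smooth_on S (f i)"
  shows "smooth_on S (\<lambda>x. \<Sum>i\<in>I. f i x)"
  using assms by (induction I rule: finite_induct) (auto intro: smooth_on_const smooth_on_add)

lemma smooth_on_Pair:
  assumes "smooth_on S f" "smooth_on S g"
  shows "smooth_on S (\<lambda>x. (f x, g x))"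
proof -
  have "bounded_linear (\<lambda>a. (a, 0))" "bounded_linear (\<lambda>b. (0, b))"
    by (auto intro!: bounded_linear_Pair bounded_linear_ident bounded_linear_zero)
  from smooth_on_add[OF smooth_on_linear_compose[OF this(1) assms(1)] smooth_on_linear_compose[OF this(2) assms(2)]]
  show ?thesis by simp
qed

lemma smooth_on_fst: "smooth_on S f \<Longrightarrow> smooth_on S (\<lambda>x. fst (f x))"
  and smooth_on_snd: "smooth_on S f \<Longrightarrow> smooth_on S (\<lambda>x. snd (f x))"
  by (auto intro: smooth_on_linear_compose bounded_linear_fst bounded_linear_snd)

text \<open>Meant for a reparametrization that squeezes the whole line into a short interval;
  \<open>sin\<close> and \<open>cos\<close> are treated together because each is, up to sign, the
  derivative of the other.\<close>

lemma smooth_on_sin: "smooth_on S (sin :: real \<Rightarrow> real)"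
proof -
  have s: "(sin has_derivative (\<lambda>v. v * cos x)) (at x)" and c: "(cos has_derivative (\<lambda>v. v * (- sin x))) (at x)" for x :: real
    by (auto intro!: derivative_eq_intros)
  have "Ck_on k UNIV (sin :: real \<Rightarrow> real) \<and> Ck_on k UNIV (cos :: real \<Rightarrow> real)" for k
  proof (induction k)
    case 0 show ?case by (simp add: continuous_on_sin continuous_on_cos continuous_on_id)
  next
    case (Suc k)
    have L: "bounded_linear (\<lambda>z. v * z)" "bounded_linear (\<lambda>z. v * (- z))" for v :: real
      by (auto intro!: bounded_linear_mult_right bounded_linear_minus)
    have "Ck_on k UNIV (\<lambda>x. v * cos x)" "Ck_on k UNIV (\<lambda>x. v * (- sin x))" for v :: real
      using Ck_on_linear_compose[OF open_UNIV L(1), of k cos v] Ck_on_linear_compose[OF open_UNIV L(2), of k sin v] Suc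
      by auto
    then show ?case using Ck_on_SucI[OF open_UNIV s] Ck_on_SucI[OF open_UNIV c] by blast
  qed
  then show ?thesis by (intro smooth_onI exI[of _ UNIV] exI[of _ sin]) auto
qed

section \<open>Derivatives along a subspace\<close>

abbreviation der :: "'a::euclidean_space set \<Rightarrow> ('a \<Rightarrow> 'b::real_normed_vector) \<Rightarrow> 'a \<Rightarrow> 'a \<Rightarrow> 'b" where
  "der V f x \<equiv> frechet_derivative f (at x within V)"

text \<open>One orthonormal basis is fixed per subspace: forms and functionals are expanded in it,
  and it makes \<open>proj\<close> the orthogonal projection, a linear and hence smooth retraction
  of the ambient space onto \<open>V\<close>.\<close>

definition onb :: "'a::euclidean_space set \<Rightarrow> 'a set" where
  "onb V = (SOME B. B \<subseteq> V \<and> pairwise orthogonal B \<and> (\<forall>b\<in>B. norm b = 1) \<and>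
     independent B \<and> card B = dim V \<and> span B = V)"

definition proj :: "'a::euclidean_space set \<Rightarrow> 'a \<Rightarrow> 'a" where
  "proj V x = (\<Sum>b\<in>onb V. (x \<bullet> b) *\<^sub>R b)"

lemma onb:
  assumes "subspace V"
  shows "onb V \<subseteq> V" "pairwise orthogonal (onb V)" "\<And>b. b \<in> onb V \<Longrightarrow> norm b = 1"
    "independent (onb V)" "card (onb V) = dim V" "span (onb V) = V" "finite (onb V)"
proof -
  have "\<exists>B. B \<subseteq> V \<and> pairwise orthogonal B \<and> (\<forall>b\<in>B. norm b = 1) \<and> independent B \<and> card B = dim V \<and> span B = V"
    by (rule orthonormal_basis_subspace[OF assms]) blast
  from someI_ex[OF this, folded onb_def]
  show *: "onb V \<subseteq> V" "pairwise orthogonal (onb V)" "\<And>b. b \<in> onb V \<Longrightarrow> norm b = 1"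
    "independent (onb V)" "card (onb V) = dim V" "span (onb V) = V" by blast+
  show "finite (onb V)" using *(4) by (rule independent_imp_finite)
qed

lemma linear_proj: "linear (proj V)"
  unfolding proj_def
  by (rule linearI) (simp_all add: inner_add_left scaleR_add_left sum.distrib scaleR_sum_right)

lemma bounded_linear_proj: "bounded_linear (proj V)"
  using linear_proj by (simp add: linear_conv_bounded_linear)

lemma proj_in: "subspace V \<Longrightarrow> proj V x \<in> V"
  unfolding proj_def using onb(1) by (intro subspace_sum) (auto intro: subspace_scale)

lemma proj_onb:
  assumes "subspace V" "b \<in> onb V" shows "proj V b = b"
proof -
  have "proj V b = (\<Sum>c\<in>onb V. if c = b then b else 0)"
    unfolding proj_def
  proof (rule sum.cong[OF refl])
    fix c assume c: "c \<in> onb V"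
    show "(b \<bullet> c) *\<^sub>R c = (if c = b then b else 0)"
      using onb(3)[OF assms(1) c] pairwiseD[OF onb(2)[OF assms(1)] assms(2) c]
      by (auto simp: orthogonal_def norm_eq_1)
  qed
  then show ?thesis using onb(7)[OF assms(1)] assms(2) by simp
qed

lemma proj_id:
  assumes "subspace V" "x \<in> V" shows "proj V x = x"
proof -
  have "x \<in> span (onb V)" using assms onb(6)[OF assms(1)] by simp
  then show ?thesis
    using linear_eq_on_span[OF linear_proj[of V] linear_id, of "onb V" x] proj_onb[OF assms(1)]
    by simp
qed

lemma expand_onb:
  assumes "subspace V" "v \<in> V" "linear h"
  shows "h v = (\<Sum>b\<in>onb V. (v \<bullet> b) *\<^sub>R h b)"
proof -
  have "h v = h (proj V v)" using assms proj_id by metis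
  also have "\<dots> = (\<Sum>b\<in>onb V. (v \<bullet> b) *\<^sub>R h b)"
    unfolding proj_def by (simp add: linear_sum[OF assms(3)] linear_scale[OF assms(3)])
  finally show ?thesis .
qed

text \<open>Relative to a subspace a derivative is determined only on vectors of \<open>V\<close>:
  such a vector is the velocity of a line that stays in \<open>V\<close>. So
  \<open>der V f x u\<close> carries information only for \<open>u\<close> in
  \<open>V\<close>.\<close>

lemma has_derivative_within_subspace_unique:
  assumes "subspace V" "x \<in> V" "u \<in> V" "(f has_derivative f1) (at x within V)" "(f has_derivative f2) (at x within V)"
  shows "f1 u = f2 u"
proof -
  let ?c = "\<lambda>t::real. x + t *\<^sub>R u"
  have c: "(?c has_derivative (\<lambda>t. t *\<^sub>R u)) (at 0)"
    by (auto intro!: derivative_eq_intros)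
  have sub: "range ?c \<subseteq> V" using assms by (auto intro: subspace_add subspace_scale)
  have "(f \<circ> ?c has_derivative f' \<circ> (\<lambda>t. t *\<^sub>R u)) (at 0)" if "(f has_derivative f') (at x within V)" for f'
    using has_derivative_subset[OF that sub] by (intro diff_chain_within[OF c]) simp
  from has_derivative_unique[OF this[OF assms(4)] this[OF assms(5)]] show ?thesis
    by (metis comp_apply scaleR_one)
qed

lemma der_eqI:
  assumes "subspace V" "x \<in> V" "u \<in> V" "(f has_derivative f') (at x within V)"
  shows "der V f x u = f' u"
proof -
  have "f differentiable (at x within V)" using assms(4) by (auto simp: differentiable_def)
  then have "(f has_derivative der V f x) (at x within V)" by (simp only: frechet_derivative_works)
  from has_derivative_within_subspace_unique[OF assms(1-3) this assms(4)] show ?thesis .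
qed

text \<open>Since the filter does not change, one and the same \<open>der V\<close> serves for
  functions of interest only on an open part of \<open>V\<close>.\<close>

lemma at_within_openin:
  assumes "openin (top_of_set V) S" "x \<in> S" shows "at x within S = at x within V"
proof -
  obtain T where "open T" "S = V \<inter> T" using assms(1) openin_open by metis
  then show ?thesis using assms(2) by (intro at_within_nhd[of _ T]) auto
qed

lemma has_derivative_cong_openin:
  assumes "openin (top_of_set V) S" "x \<in> S" "\<And>y. y \<in> S \<Longrightarrow> f y = g y"
  shows "(f has_derivative D) (at x within V) \<longleftrightarrow> (g has_derivative D) (at x within V)"
proof -
  have "(f has_derivative D) (at x within S) \<longleftrightarrow> (g has_derivative D) (at x within S)"
    using has_derivative_transform[of x S f g D] has_derivative_transform[of x S g f D] assms(2,3) by metis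
  then show ?thesis by (simp add: at_within_openin[OF assms(1,2)])
qed

lemma der_cong:
  assumes "openin (top_of_set V) S" "x \<in> S" "\<And>y. y \<in> S \<Longrightarrow> f y = g y"
  shows "der V f x = der V g x"
  unfolding frechet_derivative_def using has_derivative_cong_openin[OF assms] by presburger

text \<open>Makes \<open>der\<close> independent of the local extension that smoothness provides:
  along \<open>V\<close> each extension has the derivative of \<open>f\<close> itself.\<close>

lemma smooth_on_extension_derivative:
  assumes "subspace V" "openin (top_of_set V) S" "open U" "\<And>k. Ck_on k U g" "\<And>y. y \<in> U \<Longrightarrow> y \<in> S \<Longrightarrow> f y = g y" 
    and y: "y \<in> U" "y \<in> S"
  shows "(f has_derivative frechet_derivative g (at y)) (at y within V)"
proof -
  have o: "openin (top_of_set V) (U \<inter> S)" using assms(2,3) by (simp add: openin_Int_open Int_commute)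
  have "(g has_derivative frechet_derivative g (at y)) (at y)"
    using Ck_on_SucD(1)[OF assms(4)] y(1) by blast
  then have "(g has_derivative frechet_derivative g (at y)) (at y within V)"
    by (rule has_derivative_at_withinI)
  then show ?thesis by (subst has_derivative_cong_openin[OF o]) (use assms(5) y in auto)
qed

lemma smooth_on_has_derivative:
  assumes "subspace V" "openin (top_of_set V) S" "smooth_on S f" "x \<in> S"
  shows "(f has_derivative der V f x) (at x within V)"
proof -
  obtain U g where U: "open U" "x \<in> U" "\<And>k. Ck_on k U g" "\<And>y. y \<in> U \<Longrightarrow> y \<in> S \<Longrightarrow> f y = g y"
    using smooth_onE[OF assms(3,4)] by metis
  have "f differentiable (at x within V)"
    using smooth_on_extension_derivative[OF assms(1,2) U(1,3,4) U(2) assms(4)] by (auto simp: differentiable_def)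
  then show ?thesis by (simp only: frechet_derivative_works)
qed

lemma openin_subspace_subset: "openin (top_of_set V) S \<Longrightarrow> S \<subseteq> V"
  by (metis openin_imp_subset)

lemma smooth_on_der:
  assumes "subspace V" "openin (top_of_set V) S" "smooth_on S f" "u \<in> V"
  shows "smooth_on S (\<lambda>x. der V f x u)"
proof (rule smooth_onI)
  fix x assume x: "x \<in> S"
  obtain U g where U: "open U" "x \<in> U" "\<And>k. Ck_on k U g" "\<And>y. y \<in> U \<Longrightarrow> y \<in> S \<Longrightarrow> f y = g y"
    using smooth_onE[OF assms(3) x] by metis
  have "\<forall>y\<in>U \<inter> S. der V f y u = frechet_derivative g (at y) u"
    using smooth_on_extension_derivative[OF assms(1,2) U(1,3,4)] openin_subspace_subset[OF assms(2)]
    by (auto intro!: der_eqI assms)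
  moreover have "Ck_on k U (\<lambda>y. frechet_derivative g (at y) u)" for k
    using Ck_on_SucD(2)[OF U(3)] .
  ultimately show "\<exists>U g. open U \<and> x \<in> U \<and> (\<forall>k. Ck_on k U g) \<and> (\<forall>y\<in>U \<inter> S. der V f y u = g y)"
    using U(1,2) by blast
qed

lemma der_linear:
  assumes "subspace V" "openin (top_of_set V) S" "smooth_on S f" "x \<in> S"
  shows "linear (der V f x)"
  using smooth_on_has_derivative[OF assms] has_derivative_linear by blast

text \<open>Near \<open>x\<close> the map coincides with its composition with \<open>proj W\<close>,
  so its derivative along \<open>V\<close> is fixed by \<open>proj W\<close>.\<close>

lemma der_in:
  fixes f :: "'a::euclidean_space \<Rightarrow> 'b::euclidean_space"
  assumes "subspace V" "openin (top_of_set V) S" "smooth_on S f" "x \<in> S" "u \<in> V" "subspace W" "f ` S \<subseteq> W"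
  shows "der V f x u \<in> W"
proof -
  note d = smooth_on_has_derivative[OF assms(1-4)]
  have "((\<lambda>x. proj W (f x)) has_derivative (\<lambda>v. proj W (der V f x v))) (at x within V)"
    by (rule bounded_linear.has_derivative[OF bounded_linear_proj d])
  then have "(f has_derivative (\<lambda>v. proj W (der V f x v))) (at x within V)"
    using has_derivative_cong_openin[OF assms(2,4), of f "\<lambda>x. proj W (f x)"] assms(6,7) proj_id
    by (metis (no_types, lifting) image_subset_iff)
  then show ?thesis
    using der_eqI[OF assms(1) _ assms(5)] proj_in[OF assms(6)] openin_subspace_subset[OF assms(2)] assms(4) by (metis subsetD)
qed

lemma der_compose:
  assumes V: "subspace V" "openin (top_of_set V) S" "smooth_on S f"
    and W: "subspace W" "openin (top_of_set W) T" "smooth_on T g"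
    and x: "x \<in> S" "u \<in> V" and sub: "f ` S \<subseteq> T"
  shows "der V (\<lambda>x. g (f x)) x u = der W g (f x) (der V f x u)"
proof -
  have "(f has_derivative der V f x) (at x within S)"
    using smooth_on_has_derivative[OF V x(1)] at_within_openin[OF V(2) x(1)] by simp
  moreover have "(g has_derivative der W g (f x)) (at (f x) within f ` S)"
    using smooth_on_has_derivative[OF W] sub x(1) openin_subspace_subset[OF W(2)]
    by (meson has_derivative_subset image_subset_iff order_trans)
  ultimately have "(g \<circ> f has_derivative der W g (f x) \<circ> der V f x) (at x within S)"
    by (rule diff_chain_within)
  then show ?thesis
    using der_eqI[OF V(1) _ x(2), of x "\<lambda>x. g (f x)"] at_within_openin[OF V(2) x(1)] openin_subspace_subset[OF V(2)] x(1)
    by (auto simp: o_def)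
qed

lemma der_bounded_linear:
  assumes "subspace V" "x \<in> V" "u \<in> V" "bounded_linear L"
  shows "der V L x u = L u"
  by (rule der_eqI[OF assms(1-3)]) (rule bounded_linear_imp_has_derivative[OF assms(4)])

lemma der_linear_compose:
  assumes "subspace V" "openin (top_of_set V) S" "smooth_on S f" "x \<in> S" "u \<in> V" "bounded_linear L"
  shows "der V (\<lambda>x. L (f x)) x u = L (der V f x u)"
  by (rule der_eqI[OF assms(1) _ assms(5) bounded_linear.has_derivative[OF assms(6) smooth_on_has_derivative[OF assms(1-4)]]])
    (use assms openin_subspace_subset in blast)

lemma der_id: "subspace V \<Longrightarrow> x \<in> V \<Longrightarrow> u \<in> V \<Longrightarrow> der V (\<lambda>x. x) x u = u"
  by (rule der_bounded_linear) (auto simp: bounded_linear_ident)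

lemma der_const: "subspace V \<Longrightarrow> x \<in> V \<Longrightarrow> u \<in> V \<Longrightarrow> der V (\<lambda>x. c) x u = 0"
  by (rule der_eqI) auto

lemma der_Pair:
  assumes "subspace V" "openin (top_of_set V) S" "smooth_on S f" "smooth_on S g" "x \<in> S" "u \<in> V"
  shows "der V (\<lambda>x. (f x, g x)) x u = (der V f x u, der V g x u)"
  by (rule der_eqI[OF assms(1) _ assms(6) has_derivative_Pair[OF smooth_on_has_derivative[OF assms(1-3,5)] smooth_on_has_derivative[OF assms(1,2,4,5)]]])
    (use assms openin_subspace_subset in blast)

lemma der_bilinear:
  assumes "bounded_bilinear h" "subspace V" "openin (top_of_set V) S" "smooth_on S f" "smooth_on S g" "x \<in> S" "u \<in> V"
  shows "der V (\<lambda>x. h (f x) (g x)) x u = h (f x) (der V g x u) + h (der V f x u) (g x)"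
  by (rule der_eqI[OF assms(2) _ assms(7) bounded_bilinear.FDERIV[OF assms(1) smooth_on_has_derivative[OF assms(2,3,4,6)] smooth_on_has_derivative[OF assms(2,3,5,6)]]])
    (use assms openin_subspace_subset in blast)

lemma der_sum:
  assumes "subspace V" "openin (top_of_set V) S" "\<And>i. i \<in> I \<Longrightarrow> smooth_on S (f i)" "x \<in> S" "u \<in> V"
  shows "der V (\<lambda>x. \<Sum>i\<in>I. f i x) x u = (\<Sum>i\<in>I. der V (f i) x u)"
  by (rule der_eqI[OF assms(1) _ assms(5) has_derivative_sum])
    (use assms openin_subspace_subset smooth_on_has_derivative in blast)+

section \<open>Symmetry of second derivatives\<close>

lemma der_line:
  assumes "subspace V" "openin (top_of_set V) S" "smooth_on S f" "y + s *\<^sub>R u \<in> S" "u \<in> V" "y \<in> V"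
  shows "((\<lambda>s. f (y + s *\<^sub>R u)) has_vector_derivative der V f (y + s *\<^sub>R u) u) (at s)"
proof -
  let ?c = "\<lambda>t::real. y + t *\<^sub>R u"
  have c: "(?c has_derivative (\<lambda>t. t *\<^sub>R u)) (at s)"
    by (auto intro!: derivative_eq_intros)
  have sub: "range ?c \<subseteq> V" using assms by (auto intro: subspace_add subspace_scale)
  have "(f \<circ> ?c has_derivative der V f (?c s) \<circ> (\<lambda>t. t *\<^sub>R u)) (at s)"
    using has_derivative_subset[OF smooth_on_has_derivative[OF assms(1-4)] sub] by (intro diff_chain_within[OF c]) simp
  then show ?thesis
    using linear_scale[OF der_linear[OF assms(1-4)]] by (simp add: has_vector_derivative_def o_def)
qed

text \<open>The mean value theorem, applied twice to the difference over a square of side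
  \<open>h\<close>. The left side is symmetric in \<open>u\<close> and \<open>v\<close>, while the
  right side takes the two derivatives in a definite order.\<close>

lemma mixed_difference_mvt:
  fixes f :: "'a::euclidean_space \<Rightarrow> real"
  assumes V: "subspace V" "openin (top_of_set V) S" "smooth_on S f" and uv: "x \<in> V" "u \<in> V" "v \<in> V" and h: "h > 0"
    and sub: "\<And>s t. 0 \<le> s \<Longrightarrow> s \<le> h \<Longrightarrow> 0 \<le> t \<Longrightarrow> t \<le> h \<Longrightarrow> x + s *\<^sub>R u + t *\<^sub>R v \<in> S"
  shows "\<exists>s t. 0 < s \<and> s < h \<and> 0 < t \<and> t < h \<and>
     f (x + h *\<^sub>R u + h *\<^sub>R v) - f (x + h *\<^sub>R u) - f (x + h *\<^sub>R v) + f x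
       = h * h * der V (\<lambda>y. der V f y u) (x + s *\<^sub>R u + t *\<^sub>R v) v"
proof -
  have 1: "((\<lambda>s. f (x + s *\<^sub>R u + h *\<^sub>R v) - f (x + s *\<^sub>R u)) has_real_derivative
     der V f (x + s *\<^sub>R u + h *\<^sub>R v) u - der V f (x + s *\<^sub>R u) u) (at s)" if "0 \<le> s" "s \<le> h" for s
  proof (rule DERIV_diff)
    have "((\<lambda>s. f ((x + h *\<^sub>R v) + s *\<^sub>R u)) has_vector_derivative der V f ((x + h *\<^sub>R v) + s *\<^sub>R u) u) (at s)"
      by (rule der_line[OF V]) (use uv V(1) sub[OF that, of h] h in \<open>auto intro: subspace_add subspace_scale simp: algebra_simps\<close>)
    then show "((\<lambda>s. f (x + s *\<^sub>R u + h *\<^sub>R v)) has_real_derivative der V f (x + s *\<^sub>R u + h *\<^sub>R v) u) (at s)"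
      by (simp add: has_real_derivative_iff_has_vector_derivative algebra_simps)
    show "((\<lambda>s. f (x + s *\<^sub>R u)) has_real_derivative der V f (x + s *\<^sub>R u) u) (at s)"
      using der_line[OF V _ uv(2,1), of s] sub[OF that, of 0] h by (simp add: has_real_derivative_iff_has_vector_derivative)
  qed
  obtain s where s: "0 < s" "s < h" and e1: "(f (x + h *\<^sub>R u + h *\<^sub>R v) - f (x + h *\<^sub>R u)) - (f (x + 0 *\<^sub>R u + h *\<^sub>R v) - f (x + 0 *\<^sub>R u))
     = (h - 0) * (der V f (x + s *\<^sub>R u + h *\<^sub>R v) u - der V f (x + s *\<^sub>R u) u)"
    using MVT2[OF h 1] by auto
  have "((\<lambda>t. der V f ((x + s *\<^sub>R u) + t *\<^sub>R v) u) has_vector_derivative der V (\<lambda>y. der V f y u) ((x + s *\<^sub>R u) + t *\<^sub>R v) v) (at t)"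
    if "0 \<le> t" "t \<le> h" for t
    by (rule der_line[OF V(1,2) smooth_on_der[OF V uv(2)]])
      (use uv V(1) s sub[of s t] that in \<open>auto intro: subspace_add subspace_scale\<close>)
  then have 2: "((\<lambda>t. der V f ((x + s *\<^sub>R u) + t *\<^sub>R v) u) has_real_derivative der V (\<lambda>y. der V f y u) ((x + s *\<^sub>R u) + t *\<^sub>R v) v) (at t)"
    if "0 \<le> t" "t \<le> h" for t using that by (simp add: has_real_derivative_iff_has_vector_derivative)
  obtain t where t: "0 < t" "t < h" and e2: "der V f ((x + s *\<^sub>R u) + h *\<^sub>R v) u - der V f ((x + s *\<^sub>R u) + 0 *\<^sub>R v) u
     = (h - 0) * der V (\<lambda>y. der V f y u) ((x + s *\<^sub>R u) + t *\<^sub>R v) v"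
    using MVT2[OF h 2] by auto
  show ?thesis using s t e1 e2 by (intro exI[of _ s] exI[of _ t]) (simp add: algebra_simps)
qed

lemma der_symmetric_real:
  fixes f :: "'a::euclidean_space \<Rightarrow> real"
  assumes V: "subspace V" "openin (top_of_set V) S" "smooth_on S f" and uv: "x \<in> S" "u \<in> V" "v \<in> V"
  shows "der V (\<lambda>y. der V f y u) x v = der V (\<lambda>y. der V f y v) x u"
proof -
  have xV: "x \<in> V" using uv(1) openin_subspace_subset[OF V(2)] by blast
  define A where "A = (\<lambda>y. der V (\<lambda>y. der V f y u) y v)"
  define B where "B = (\<lambda>y. der V (\<lambda>y. der V f y v) y u)"
  have "continuous_on S A" "continuous_on S B" unfolding A_def B_def
    by (intro smooth_on_imp_continuous_on smooth_on_der V uv)+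
  moreover obtain T where T: "open T" "S = V \<inter> T" using V(2) openin_open by metis
  obtain d where d: "d > 0" "ball x d \<subseteq> T" using T uv(1) open_contains_ball by blast
  \<comment> \<open>With \<open>c\<close> above \<open>norm u + norm v\<close>, every
    \<open>s *\<^sub>R u + t *\<^sub>R v\<close> with \<open>s\<close> and \<open>t\<close> between
    0 and \<open>h\<close> is shorter than \<open>h * c\<close>; the summand 1 keeps
    \<open>c\<close> positive.\<close>
  define c where "c = 1 + norm u + norm v"
  have c: "c > 0" unfolding c_def by (smt (verit) norm_ge_zero)
  have near: "norm (s *\<^sub>R u + t *\<^sub>R v) < e"
    if "0 \<le> s" "s \<le> h" "0 \<le> t" "t \<le> h" "h * c < e" "h > 0" for s t h e
  proof -
    have "norm (s *\<^sub>R u + t *\<^sub>R v) \<le> s * norm u + t * norm v"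
      using norm_triangle_ineq[of "s *\<^sub>R u" "t *\<^sub>R v"] that by simp
    also have "\<dots> \<le> h * norm u + h * norm v"
      using that by (intro add_mono mult_right_mono) auto
    also have "\<dots> < e" using that unfolding c_def by (simp add: algebra_simps)
    finally show ?thesis .
  qed
  have inS: "x + s *\<^sub>R u + t *\<^sub>R v \<in> S" if "norm (s *\<^sub>R u + t *\<^sub>R v) < d" for s t
  proof -
    have "x + s *\<^sub>R u + t *\<^sub>R v \<in> ball x d" using that by (simp add: dist_norm norm_minus_commute add.assoc flip: norm_minus_cancel[of "s *\<^sub>R u + t *\<^sub>R v"])
    moreover have "x + s *\<^sub>R u + t *\<^sub>R v \<in> V" using xV uv V(1) by (auto intro!: subspace_add subspace_scale)
    ultimately show ?thesis using d T by blast
  qed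
  have close: "\<bar>A x - B x\<bar> \<le> 2 * e" if e: "e > 0" for e
  proof -
    have "\<exists>r>0. \<forall>y\<in>S. dist y x < r \<longrightarrow> \<bar>F y - F x\<bar> < e" if "continuous_on S F" for F :: "'a \<Rightarrow> real"
      using that uv(1) e unfolding continuous_on_iff by (auto simp: dist_real_def)
    then obtain ra rb where r: "ra > 0" "\<And>y. y \<in> S \<Longrightarrow> dist y x < ra \<Longrightarrow> \<bar>A y - A x\<bar> < e"
       "rb > 0" "\<And>y. y \<in> S \<Longrightarrow> dist y x < rb \<Longrightarrow> \<bar>B y - B x\<bar> < e"
      using \<open>continuous_on S A\<close> \<open>continuous_on S B\<close> by meson
    define m where "m = min d (min ra rb)"
    \<comment> \<open>Then \<open>h * c\<close> is half of \<open>m\<close>, so the whole square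
      stays within distance \<open>m\<close> of \<open>x\<close>: inside \<open>S\<close>, and where
      \<open>A\<close> and \<open>B\<close> differ by less than \<open>e\<close> from their values
      at \<open>x\<close>.\<close>
    define h where "h = m / (2 * c)"
    have m: "m > 0" using d r unfolding m_def by auto
    then have h: "h > 0" "h * c < m" using c unfolding h_def by (auto simp: field_simps)
    have n: "norm (s *\<^sub>R u + t *\<^sub>R v) < m" if "0 \<le> s" "s \<le> h" "0 \<le> t" "t \<le> h" for s t
      using near[OF that h(2,1)] .
    have S1: "x + s *\<^sub>R u + t *\<^sub>R v \<in> S" if "0 \<le> s" "s \<le> h" "0 \<le> t" "t \<le> h" for s t
      using n[OF that] by (intro inS) (simp add: m_def)
    have S2: "x + s *\<^sub>R v + t *\<^sub>R u \<in> S" if "0 \<le> s" "s \<le> h" "0 \<le> t" "t \<le> h" for s t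
      using S1[of t s] that by (simp add: algebra_simps)
    obtain s t where st: "0 < s" "s < h" "0 < t" "t < h" and
      e1: "f (x + h *\<^sub>R u + h *\<^sub>R v) - f (x + h *\<^sub>R u) - f (x + h *\<^sub>R v) + f x = h * h * A (x + s *\<^sub>R u + t *\<^sub>R v)"
      using mixed_difference_mvt[OF V xV uv(2,3) h(1) S1] unfolding A_def by blast
    obtain s' t' where st': "0 < s'" "s' < h" "0 < t'" "t' < h" and
      e2: "f (x + h *\<^sub>R v + h *\<^sub>R u) - f (x + h *\<^sub>R v) - f (x + h *\<^sub>R u) + f x = h * h * B (x + s' *\<^sub>R v + t' *\<^sub>R u)"
      using mixed_difference_mvt[OF V xV uv(3,2) h(1) S2] unfolding B_def by blast
    have "h * h * A (x + s *\<^sub>R u + t *\<^sub>R v) = h * h * B (x + s' *\<^sub>R v + t' *\<^sub>R u)"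
      using e1 e2 by (simp add: algebra_simps)
    then have AB: "A (x + s *\<^sub>R u + t *\<^sub>R v) = B (x + s' *\<^sub>R v + t' *\<^sub>R u)" using h by simp
    have "\<bar>A (x + s *\<^sub>R u + t *\<^sub>R v) - A x\<bar> < e"
      using n[of s t] S1[of s t] st unfolding m_def by (intro r(2)) (auto simp: dist_norm add.assoc)
    moreover have "\<bar>B (x + s' *\<^sub>R v + t' *\<^sub>R u) - B x\<bar> < e"
      using n[of t' s'] S2[of s' t'] st' unfolding m_def by (intro r(4)) (auto simp: dist_norm add.assoc add.commute)
    ultimately show ?thesis using AB by linarith
  qed
  have "A x = B x"
  proof (rule ccontr)
    assume "A x \<noteq> B x"
    then show False using close[of "\<bar>A x - B x\<bar> / 4"] by simp
  qed
  then show ?thesis by (simp add: A_def B_def)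
qed

lemma der_symmetric:
  fixes f :: "'a::euclidean_space \<Rightarrow> 'b::euclidean_space"
  assumes V: "subspace V" "openin (top_of_set V) S" "smooth_on S f" and uv: "x \<in> S" "u \<in> V" "v \<in> V"
  shows "der V (\<lambda>y. der V f y u) x v = der V (\<lambda>y. der V f y v) x u"
proof (rule euclidean_eqI)
  fix b :: 'b
  have i: "bounded_linear (\<lambda>z. z \<bullet> b)" by (rule bounded_linear_inner_left)
  have "der V (\<lambda>y. der V f y u) x v \<bullet> b = der V (\<lambda>y. der V (\<lambda>z. f z \<bullet> b) y u) x v" if "u \<in> V" "v \<in> V" for u v
  proof -
    have "der V (\<lambda>y. der V f y u) x v \<bullet> b = der V (\<lambda>y. der V f y u \<bullet> b) x v"
      by (rule der_linear_compose[OF V(1,2) smooth_on_der[OF V] uv(1) _ i, symmetric]) (use that in auto)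
    also have "\<dots> = der V (\<lambda>y. der V (\<lambda>z. f z \<bullet> b) y u) x v"
      by (rule fun_cong[OF der_cong[OF V(2) uv(1)]])
        (rule der_linear_compose[OF V _ _ i, symmetric], use that in auto)
    finally show ?thesis .
  qed
  then show "der V (\<lambda>y. der V f y u) x v \<bullet> b = der V (\<lambda>y. der V f y v) x u \<bullet> b"
    using der_symmetric_real[OF V(1,2) smooth_on_linear_compose[OF i V(3)] uv] uv by simp
qed

section \<open>The inverse function theorem\<close>

lemma linear_inverse_on:
  fixes f :: "'a::euclidean_space \<Rightarrow> 'b::euclidean_space"
  assumes "subspace V" "linear f" "inj_on f V"
  obtains g where "linear g" "\<And>x. x \<in> V \<Longrightarrow> g (f x) = x" "range g \<subseteq> V" "\<And>y. y \<in> f ` V \<Longrightarrow> f (g y) = y"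
proof -
  obtain g where "range g \<subseteq> V" "linear g" "\<forall>v\<in>V. g (f v) = v"
    using linear_exists_left_inverse_on[OF assms(2,1,3)] by blast
  then show ?thesis by (intro that[of g]) auto
qed

text \<open>Rank and nullity inside \<open>V\<close>: on the orthogonal complement of its kernel in
  \<open>V\<close> the map is injective, and it has the same image there.\<close>

lemma dim_image_plus_kernel:
  fixes f :: "'a::euclidean_space \<Rightarrow> 'b::euclidean_space"
  assumes V: "subspace V" and f: "linear f"
  shows "dim (f ` V) + dim {x \<in> V. f x = 0} = dim V"
proof -
  let ?K = "{x \<in> V. f x = 0}"
  let ?C = "{y \<in> V. \<forall>x\<in>?K. orthogonal x y}"
  have K: "subspace ?K"
    using V f by (auto simp: subspace_def linear_add linear_scale linear_0)
  have C: "subspace ?C"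
    using V by (auto simp: subspace_def orthogonal_clauses)
  have d: "dim ?C + dim ?K = dim V"
    by (rule dim_subspace_orthogonal_to_vectors[OF K V]) auto
  have "inj_on f ?C"
  proof (rule inj_onI)
    fix x y assume xy: "x \<in> ?C" "y \<in> ?C" "f x = f y"
    have "x - y \<in> ?C" using subspace_diff[OF C xy(1,2)] .
    moreover have "x - y \<in> ?K" using xy V f by (auto simp: linear_diff intro: subspace_diff)
    ultimately have "orthogonal (x - y) (x - y)" by blast
    then show "x = y" by (simp add: orthogonal_self)
  qed
  then have "dim (f ` ?C) = dim ?C" by (intro dim_image_eq[OF f]) (simp only: span_eq_iff[THEN iffD2, OF C])
  moreover have "f ` ?C = f ` V"
  proof
    show "f ` V \<subseteq> f ` ?C"
    proof safe
      fix x assume x: "x \<in> V"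
      obtain y z where yz: "y \<in> span ?K" "\<And>w. w \<in> span ?K \<Longrightarrow> orthogonal z w" "x = y + z"
        using orthogonal_subspace_decomp_exists[of ?K x] by metis
      have y: "y \<in> ?K" using yz(1) span_eq_iff[THEN iffD2, OF K] by simp
      then have "z \<in> V" using subspace_diff[OF V x, of y] yz(3) by simp
      moreover have "orthogonal w z" if "w \<in> ?K" for w
        using yz(2)[OF span_base[OF that]] by (simp add: orthogonal_commute)
      ultimately have "z \<in> ?C" by blast
      moreover have "f x = f z" using y yz(3) f by (simp add: linear_add)
      ultimately show "f x \<in> f ` ?C" by blast
    qed
  qed auto
  ultimately show ?thesis using d by simp
qed

text \<open>Product rule at a zero of \<open>p\<close>: the increment of \<open>q\<close> is
  multiplied by something of the order of \<open>norm (y - x)\<close>, so continuity of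
  \<open>q\<close> is enough. It differentiates a family of inverses that is known only to be
  continuous.\<close>

lemma has_derivative_scaleR_vanishing:
  fixes p :: "'a::real_normed_vector \<Rightarrow> real" and q :: "'a \<Rightarrow> 'b::real_normed_vector"
  assumes p: "(p has_derivative p') (at x)" "p x = 0" and q: "continuous (at x) q"
  shows "((\<lambda>y. p y *\<^sub>R q y) has_derivative (\<lambda>h. p' h *\<^sub>R q x)) (at x)"
proof -
  have 1: "((\<lambda>y. p y *\<^sub>R q x) has_derivative (\<lambda>h. p' h *\<^sub>R q x)) (at x)"
    by (rule has_derivative_scaleR_left[OF p(1)])
  have 2: "((\<lambda>y. p y *\<^sub>R (q y - q x)) has_derivative (\<lambda>h. 0)) (at x)"
    unfolding has_derivative_at2
  proof (intro conjI bounded_linear_zero)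
    obtain K where K: "\<And>h. norm (p' h) \<le> norm h * K" "K > 0"
      using bounded_linear.pos_bounded[OF has_derivative_bounded_linear[OF p(1)]] by blast
    have a: "((\<lambda>y. norm (p y - (p x + p' (y - x))) / norm (y - x)) \<longlongrightarrow> 0) (at x)"
    proof -
      have "((\<lambda>y. (1 / norm (y - x)) *\<^sub>R (p y - (p x + p' (y - x)))) \<longlongrightarrow> 0) (at x)"
        using p(1) unfolding has_derivative_at2 by blast
      from tendsto_norm[OF this] show ?thesis by (simp add: divide_inverse abs_mult mult.commute)
    qed
    have "((\<lambda>y. q y - q x) \<longlongrightarrow> 0) (at x)" using q by (simp add: continuous_within LIM_zero_iff)
    then have b: "((\<lambda>y. norm (q y - q x)) \<longlongrightarrow> 0) (at x)" by (rule tendsto_norm_zero)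
    have "((\<lambda>y. (norm (p y - (p x + p' (y - x))) / norm (y - x) + K) * norm (q y - q x)) \<longlongrightarrow> (0 + K) * 0) (at x)"
      by (intro tendsto_mult tendsto_add a b tendsto_const)
    then have lim: "((\<lambda>y. (norm (p y - (p x + p' (y - x))) / norm (y - x) + K) * norm (q y - q x)) \<longlongrightarrow> 0) (at x)" by simp
    have "norm ((1 / norm (y - x)) *\<^sub>R (p y *\<^sub>R (q y - q x) - (p x *\<^sub>R (q x - q x) + 0)))
      \<le> (norm (p y - (p x + p' (y - x))) / norm (y - x) + K) * norm (q y - q x)" if "y \<noteq> x" for y
    proof -
      have n: "norm (y - x) > 0" using that by simp
      have "norm (p y) \<le> norm (p y - (p x + p' (y - x))) + norm (p' (y - x))"
        using p(2) norm_triangle_ineq[of "p y - (p x + p' (y - x))" "p' (y - x)"] by simp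
      also have "\<dots> \<le> norm (p y - (p x + p' (y - x))) + norm (y - x) * K" using K(1)[of "y - x"] by linarith
      finally have "norm (p y) / norm (y - x) \<le> norm (p y - (p x + p' (y - x))) / norm (y - x) + K"
        using n by (simp add: field_simps)
      from mult_right_mono[OF this, of "norm (q y - q x)"] show ?thesis by simp
    qed
    then show "((\<lambda>y. (1 / norm (y - x)) *\<^sub>R (p y *\<^sub>R (q y - q x) - (p x *\<^sub>R (q x - q x) + 0))) \<longlongrightarrow> 0) (at x)"
      by (intro Lim_null_comparison[OF _ lim]) (simp add: eventually_at_filter)
  qed
  show ?thesis using has_derivative_add[OF 1 2] by (simp add: algebra_simps)
qed

text \<open>Inversion is as smooth as the family inverted. The resolvent identity
  \<open>H y v = H y0 v - H y (A y w - A y0 w)\<close> with \<open>w = H y0 v\<close> gives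
  continuity, then the derivative, and then the induction on \<open>k\<close>, since the derivative
  is built from \<open>H\<close> and derivatives of \<open>A\<close>.\<close>

lemma Ck_on_inverse_family:
  fixes A H :: "'a::euclidean_space \<Rightarrow> 'b::euclidean_space \<Rightarrow> 'b"
  assumes V: "open V" and lin: "\<And>y. y \<in> V \<Longrightarrow> linear (A y)" "\<And>y. y \<in> V \<Longrightarrow> linear (H y)"
    and AH: "\<And>y v. y \<in> V \<Longrightarrow> A y (H y v) = v" and HA: "\<And>y v. y \<in> V \<Longrightarrow> H y (A y v) = v"
    and A: "\<And>z. Ck_on k V (\<lambda>y. A y z)"
  shows "Ck_on k V (\<lambda>y. H y v)"
proof -
  have cH: "continuous (at y0) (\<lambda>y. H y v)" if y0: "y0 \<in> V" for y0 v
  proof -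
    have cA: "continuous (at y0) (\<lambda>y. A y z)" for z
      using Ck_on_imp_continuous[OF A] V y0 continuous_on_eq_continuous_at by blast
    have tA: "((\<lambda>y. A y z) \<longlongrightarrow> A y0 z) (at y0)" for z using cA by (simp add: continuous_within)
    \<comment> \<open>\<open>E y\<close> bounds the operator norm of the difference of
      \<open>A y\<close> and \<open>A y0\<close>.\<close>
    define E where "E = (\<lambda>y. \<Sum>b\<in>Basis. norm (A y b - A y0 b))"
    have tE: "(E \<longlongrightarrow> 0) (at y0)" unfolding E_def
      by (rule tendsto_null_sum) (rule tendsto_norm_zero, simp add: LIM_zero_iff tA)
    have bE: "norm (A y z - A y0 z) \<le> norm z * E y" if "y \<in> V" for y z
    proof -
      have "A y z - A y0 z = (\<Sum>b\<in>Basis. (z \<bullet> b) *\<^sub>R (A y b - A y0 b))"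
      proof -
        have "linear (\<lambda>z. A y z - A y0 z)" using lin(1) that y0 by (intro linear_compose_sub)
        from linear_sum[OF this, of "\<lambda>b. (z \<bullet> b) *\<^sub>R b" Basis] linear_scale[OF this]
        show ?thesis by (simp add: euclidean_representation)
      qed
      also have "norm \<dots> \<le> (\<Sum>b\<in>Basis. norm z * norm (A y b - A y0 b))"
        by (rule sum_norm_le) (simp add: mult_right_mono Basis_le_norm)
      finally show ?thesis unfolding E_def by (simp add: sum_distrib_left)
    qed
    obtain K where K: "\<And>v. norm (H y0 v) \<le> norm v * K" "K > 0"
      using bounded_linear.pos_bounded[of "H y0"] lin(2)[OF y0] by (metis linear_conv_bounded_linear)
    have "\<forall>\<^sub>F y in at y0. E y < 1 / (2 * K)" using tE K(2) by (intro order_tendstoD) auto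
    moreover have "\<forall>\<^sub>F y in at y0. y \<in> V" using eventually_at_in_open'[OF V y0] .
    ultimately have le: "\<forall>\<^sub>F y in at y0. norm (H y v - H y0 v) \<le> 2 * K * norm (A y (H y0 v) - A y0 (H y0 v))"
    proof eventually_elim
      case (elim y)
      define w where "w = H y0 v"
      \<comment> \<open>The error made by \<open>H y0 v\<close> as a value of \<open>H y v\<close>.
        As \<open>E y\<close> is below \<open>1 / (2 * K)\<close>, replacing \<open>A y0\<close> by
        \<open>A y\<close> costs at most half of \<open>norm z\<close>, which is absorbed on the
        left.\<close>
      define z where "z = H y (A y w - A y0 w)"
      have z: "z = w - H y v" unfolding z_def using elim lin(2) HA AH y0 by (simp add: linear_diff w_def)
      have "norm z = norm (H y0 (A y0 z))" using HA[OF y0] by simp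
      also have "\<dots> \<le> norm (A y0 z) * K" by (rule K(1))
      also have "\<dots> \<le> (norm (A y z) + norm z * E y) * K"
        using bE[OF elim(2), of z] norm_triangle_sub[of "A y0 z" "A y z"] K(2)
        by (intro mult_right_mono) (auto simp: norm_minus_commute)
      also have "norm z * E y * K \<le> norm z * (1 / (2 * K)) * K"
        using elim(1) K(2) by (intro mult_right_mono mult_left_mono) auto
      then have "(norm (A y z) + norm z * E y) * K \<le> norm (A y z) * K + norm z / 2"
        using K(2) by (simp add: algebra_simps)
      finally have "norm z \<le> 2 * K * norm (A y z)" by (simp add: algebra_simps)
      moreover have "A y z = A y w - A y0 w" unfolding z_def using AH[OF elim(2)] by simp
      ultimately show ?case unfolding z w_def by (simp add: norm_minus_commute)
    qed
    have "((\<lambda>y. 2 * K * norm (A y (H y0 v) - A y0 (H y0 v))) \<longlongrightarrow> 2 * K * 0) (at y0)"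
      by (intro tendsto_mult tendsto_const tendsto_norm_zero) (simp add: LIM_zero_iff tA)
    then have "((\<lambda>y. H y v - H y0 v) \<longlongrightarrow> 0) (at y0)"
      by (intro Lim_null_comparison[OF le]) (simp only: mult_zero_right)
    then show ?thesis by (simp add: continuous_within LIM_zero_iff)
  qed
  show ?thesis using A
  proof (induction k arbitrary: v)
    case 0
    show ?case using cH by (simp add: continuous_at_imp_continuous_on)
  next
    case (Suc k)
    have IH: "Ck_on k V (\<lambda>y. H y v)" for v by (rule Suc.IH) (rule Ck_on_Suc_D[OF Suc.prems])
    let ?dA = "\<lambda>z y. frechet_derivative (\<lambda>y. A y z) (at y)"
    have dA: "((\<lambda>y. A y z) has_derivative ?dA z y) (at y)" if "y \<in> V" for y z
      by (rule Ck_on_SucD(1)[OF Suc.prems that])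
    have eq: "?dA z y w = (\<Sum>c\<in>Basis. (z \<bullet> c) *\<^sub>R ?dA c y w)" if "y \<in> V" for y z w
    proof -
      have "A y' z = (\<Sum>c\<in>Basis. (z \<bullet> c) *\<^sub>R A y' c)" if "y' \<in> V" for y'
        using linear_sum[OF lin(1)[OF that], of "\<lambda>b. (z \<bullet> b) *\<^sub>R b" Basis] linear_scale[OF lin(1)[OF that]]
        by (simp add: euclidean_representation)
      then have 1: "?dA z y = frechet_derivative (\<lambda>y. \<Sum>c\<in>Basis. (z \<bullet> c) *\<^sub>R A y c) (at y)"
        by (intro frechet_derivative_cong_open[OF V that])
      have 2: "((\<lambda>y. \<Sum>c\<in>Basis. (z \<bullet> c) *\<^sub>R A y c) has_derivative (\<lambda>w. \<Sum>c\<in>Basis. (z \<bullet> c) *\<^sub>R ?dA c y w)) (at y)"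
        by (intro has_derivative_sum has_derivative_scaleR_right dA that)
      show ?thesis by (simp only: 1 frechet_derivative_at[OF 2, symmetric])
    qed
    let ?D = "\<lambda>y w. - (\<Sum>b\<in>Basis. (\<Sum>c\<in>Basis. (H y v \<bullet> c) * (?dA c y w \<bullet> b)) *\<^sub>R H y b)"
    show ?case
    proof (rule Ck_on_SucI[OF V])
      fix y0 assume y0: "y0 \<in> V"
      define w where "w = H y0 v"
      \<comment> \<open>Coordinates of \<open>A y w - A y0 w\<close>. They vanish at
        \<open>y0\<close>, so their products with the merely continuous \<open>H y b\<close> are
        differentiable there.\<close>
      define p where "p = (\<lambda>b y. (A y w - A y0 w) \<bullet> b)"
      have "(p b has_derivative (\<lambda>h. ?dA w y0 h \<bullet> b)) (at y0)" for b
        unfolding p_def using has_derivative_diff[OF dA[OF y0, of w] has_derivative_const[of "A y0 w"]]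
        by (intro has_derivative_inner_left) simp
      then have "((\<lambda>y. \<Sum>b\<in>Basis. p b y *\<^sub>R H y b) has_derivative (\<lambda>h. \<Sum>b\<in>Basis. (?dA w y0 h \<bullet> b) *\<^sub>R H y0 b)) (at y0)"
        by (intro has_derivative_sum has_derivative_scaleR_vanishing cH y0) (simp_all add: p_def)
      from has_derivative_diff[OF has_derivative_const[of "H y0 v"] this]
      have dD: "((\<lambda>y. H y0 v - (\<Sum>b\<in>Basis. p b y *\<^sub>R H y b)) has_derivative ?D y0) (at y0)"
        by (rule has_derivative_eq_rhs)
          (simp add: fun_eq_iff eq[OF y0, of w] inner_sum_left flip: w_def)
      have eqH: "H y0 v - (\<Sum>b\<in>Basis. p b y *\<^sub>R H y b) = H y v" if y: "y \<in> V" for y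
      proof -
        have "(\<Sum>b\<in>Basis. p b y *\<^sub>R H y b) = H y (A y w - A y0 w)"
          unfolding p_def
          using linear_sum[OF lin(2)[OF y], of "\<lambda>b. ((A y w - A y0 w) \<bullet> b) *\<^sub>R b" Basis] linear_scale[OF lin(2)[OF y]]
          by (simp add: euclidean_representation)
        also have "\<dots> = w - H y v" using y lin(2) HA AH y0 by (simp add: linear_diff w_def)
        finally show ?thesis by (simp add: w_def)
      qed
      show "((\<lambda>y. H y v) has_derivative ?D y0) (at y0)"
        by (rule has_derivative_transform_within_open[OF dD V y0 eqH])
    next
      fix w
      have 1: "Ck_on k V (\<lambda>y. H y v \<bullet> c)" for c by (rule Ck_on_linear_compose[OF V bounded_linear_inner_left IH])
      have 2: "Ck_on k V (\<lambda>y. ?dA c y w \<bullet> b)" for b c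
        by (rule Ck_on_linear_compose[OF V bounded_linear_inner_left Ck_on_SucD(2)[OF Suc.prems]])
      show "Ck_on k V (\<lambda>y. ?D y w)"
        by (intro Ck_on_linear_compose[OF V bounded_linear_minus[OF bounded_linear_ident]] Ck_on_sum V finite_Basis
            Ck_on_bilinear[OF V bounded_bilinear_scaleR] Ck_on_bilinear[OF V bounded_bilinear_mult] 1 2 IH)
    qed
  qed
qed

text \<open>The classical theorem yields a differentiable inverse \<open>g\<close> whose derivative
  at \<open>y\<close> inverts that of \<open>f\<close> at \<open>g y\<close>. If \<open>g\<close>
  has order \<open>k\<close>, so has this family of inverses, hence \<open>g\<close> gains one
  order.\<close>

lemma inverse_function_smooth:
  fixes f :: "'a::euclidean_space \<Rightarrow> 'a"
  assumes U: "open U" "\<And>k. Ck_on k U f" "x0 \<in> U" and inj: "inj (frechet_derivative f (at x0))"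
  obtains U' g where "open U'" "U' \<subseteq> U" "x0 \<in> U'" "open (f ` U')" "\<And>x. x \<in> U' \<Longrightarrow> g (f x) = x" "\<And>k. Ck_on k (f ` U') g"
proof -
  let ?d = "\<lambda>x. frechet_derivative f (at x)"
  have d: "(f has_derivative frechet_derivative f (at x)) (at x)" if "x \<in> U" for x by (rule Ck_on_SucD(1)[OF U(2) that])
  have cd: "continuous_on U (\<lambda>x. ?d x v)" for v by (rule Ck_on_imp_continuous[OF Ck_on_SucD(2)[OF U(2)]])
  define f' where "f' = (\<lambda>x. Blinfun (?d x))"
  have f': "blinfun_apply (f' x) = ?d x" if "x \<in> U" for x
    unfolding f'_def by (rule bounded_linear_Blinfun_apply[OF has_derivative_bounded_linear[OF d[OF that]]])
  have "continuous_on U f'"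
  proof (rule continuous_on_blinfun_componentwise)
    fix i :: 'a show "continuous_on U (\<lambda>x. blinfun_apply (f' x) i)"
      by (rule continuous_on_eq[OF cd[of i]]) (simp add: f')
  qed
  moreover have "linear (?d x0)" using d[OF U(3)] has_derivative_linear by blast
  then obtain h where h: "linear h" "h \<circ> ?d x0 = id" using inj linear_injective_left_inverse by blast
  have "Blinfun h o\<^sub>L f' x0 = id_blinfun"
    using h f'[OF U(3)] by (intro blinfun_eqI) (simp add: bounded_linear_Blinfun_apply linear_conv_bounded_linear fun_eq_iff)
  ultimately obtain U' V g g' where *: "open U'" "U' \<subseteq> U" "x0 \<in> U'" "open V" "f x0 \<in> V" "homeomorphism U' V f g"
    and g': "\<And>y. y \<in> V \<Longrightarrow> (g has_derivative (g' y)) (at y)" "\<And>y. y \<in> V \<Longrightarrow> g' y = inv_into UNIV (blinfun_apply (f'(g y)))"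
     "\<And>y. y \<in> V \<Longrightarrow> bij (blinfun_apply (f'(g y)))"
    using inverse_function_theorem[OF U(1), of f f' x0 "Blinfun h"] d f' U(3) by (metis (no_types, lifting))
  have V: "V = f ` U'" and gV: "g ` V = U'" and gf: "\<And>x. x \<in> U' \<Longrightarrow> g (f x) = x"
    using *(6) by (auto simp: homeomorphism_def)
  have gU: "g y \<in> U" if "y \<in> V" for y using gV that *(2) by blast
  have lg: "linear (g' y)" if "y \<in> V" for y using g'(1)[OF that] has_derivative_linear by blast
  have inv: "?d (g y) (g' y v) = v" "g' y (?d (g y) v) = v" if "y \<in> V" for y v
    using g'(2,3)[OF that] f'[OF gU[OF that]] by (auto simp: bij_is_surj surj_f_inv_f bij_is_inj)
  have "Ck_on k V g" for k
  proof (induction k)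
    case 0 show ?case using *(6) by (simp add: homeomorphism_def)
  next
    case (Suc k)
    have "Ck_on k V (\<lambda>y. ?d (g y) v)" for v
      by (rule Ck_on_compose[OF *(4) U(1) _ Suc Ck_on_SucD(2)[OF U(2)]]) (use gU in blast)
    then have c: "Ck_on k V (\<lambda>y. g' y v)" for v
      using lg inv has_derivative_linear[OF d[OF gU]]
      by (intro Ck_on_inverse_family[OF *(4), of "\<lambda>y. ?d (g y)" g'])
    show ?case by (rule Ck_on_SucI[OF *(4) g'(1) c])
  qed
  then show ?thesis using that[of U' g] * gf V by blast
qed

text \<open>\<open>f\<close> is extended to an open set of the ambient space by
  \<open>B (f (proj V x)) + (x - proj V x)\<close>, where \<open>B\<close> inverts the derivative at
  \<open>x0\<close>. The extension has the identity as derivative at \<open>x0\<close> and equals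
  \<open>B (f x)\<close> on \<open>V\<close>, so its inverse, precomposed with \<open>B\<close>,
  inverts \<open>f\<close>.\<close>

theorem inverse_function_on_subspace:
  fixes f :: "'a::euclidean_space \<Rightarrow> 'b::euclidean_space"
  assumes V: "subspace V" "openin (top_of_set V) S" "smooth_on S f" and W: "subspace W" "f ` S \<subseteq> W"
    and x0: "x0 \<in> S" and bij: "inj_on (der V f x0) V" "dim V = dim W"
  obtains S' g where "openin (top_of_set V) S'" "S' \<subseteq> S" "x0 \<in> S'" "openin (top_of_set W) (f ` S')"
    "\<And>x. x \<in> S' \<Longrightarrow> g (f x) = x" "smooth_on (f ` S') g"
proof -
  have x0V: "x0 \<in> V" using x0 openin_subspace_subset[OF V(2)] by blast
  have lin: "linear (der V f x0)" by (rule der_linear[OF V x0])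
  have im: "der V f x0 ` V \<subseteq> W" using der_in[OF V x0 _ W] by blast
  have imW: "der V f x0 ` V = W"
    using dim_image_eq[OF lin, of V] bij span_eq_iff[THEN iffD2, OF V(1)]
    by (intro subspace_dim_equal linear_subspace_image[OF lin] V(1) W(1) im) simp
  obtain B where B: "linear B" "\<And>x. x \<in> V \<Longrightarrow> B (der V f x0 x) = x" "range B \<subseteq> V" "\<And>y. y \<in> W \<Longrightarrow> der V f x0 (B y) = y"
    using linear_inverse_on[OF V(1) lin bij(1)] imW by metis
  have bB: "bounded_linear B" using B(1) by (simp add: linear_conv_bounded_linear)
  define U where "U = proj V -` S"
  obtain T where T: "open T" "S = V \<inter> T" using V(2) openin_open by metis
  have "U = proj V -` T" unfolding U_def using T proj_in[OF V(1)] by auto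
  then have U: "open U"
    using open_vimage[OF T(1) linear_continuous_on[OF bounded_linear_proj]] by simp
  define F where "F = (\<lambda>x. B (f (proj V x)) + (x - proj V x))"
  have "smooth_on U F" unfolding F_def U_def
    by (intro smooth_on_add smooth_on_diff smooth_on_linear_compose[OF bB] smooth_on_compose[OF smooth_on_linear[OF bounded_linear_proj] V(3)]
        smooth_on_id smooth_on_linear[OF bounded_linear_proj]) auto
  then have FC: "Ck_on k U F" for k using U smooth_on_open by blast
  have x0U: "x0 \<in> U" unfolding U_def using proj_id[OF V(1) x0V] x0 by simp
  have p0: "proj V x0 = x0" by (rule proj_id[OF V(1) x0V])
  have pd: "(proj V has_derivative proj V) (at x0)" using bounded_linear_proj by (rule bounded_linear_imp_has_derivative)
  have "(f has_derivative der V f x0) (at (proj V x0) within range (proj V))"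
    unfolding p0 using proj_in[OF V(1)] by (intro has_derivative_subset[OF smooth_on_has_derivative[OF V x0]]) auto
  from diff_chain_within[OF pd this] have "((\<lambda>x. f (proj V x)) has_derivative (\<lambda>v. der V f x0 (proj V v))) (at x0)"
    by (simp add: o_def)
  from has_derivative_add[OF bounded_linear.has_derivative[OF bB this] has_derivative_diff[OF has_derivative_ident pd]]
  have "(F has_derivative (\<lambda>v. B (der V f x0 (proj V v)) + (v - proj V v))) (at x0)"
    unfolding F_def .
  moreover have "B (der V f x0 (proj V v)) + (v - proj V v) = v" for v
    using B(2)[OF proj_in[OF V(1)]] by simp
  ultimately have "(F has_derivative (\<lambda>v. v)) (at x0)" by simp
  then have "frechet_derivative F (at x0) = (\<lambda>v. v)" using frechet_derivative_at by metis
  then have inj: "inj (frechet_derivative F (at x0))" by simp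
  obtain U' g where U': "open U'" "U' \<subseteq> U" "x0 \<in> U'" "open (F ` U')" "\<And>x. x \<in> U' \<Longrightarrow> g (F x) = x" "\<And>k. Ck_on k (F ` U') g"
    using inverse_function_smooth[OF U FC x0U inj] by metis
  have FV: "F x = B (f x)" if "x \<in> V" for x using proj_id[OF V(1) that] by (simp add: F_def)
  have SU: "V \<inter> U \<subseteq> S" unfolding U_def using proj_id[OF V(1)] by auto
  define S' where "S' = V \<inter> U'"
  have S'S: "S' \<subseteq> S" using SU U'(2) unfolding S'_def by blast
  have fS': "f ` S' = W \<inter> B -` (F ` U')"
  proof
    show "f ` S' \<subseteq> W \<inter> B -` (F ` U')"
    proof
      fix y assume "y \<in> f ` S'"
      then obtain x where "x \<in> V" "x \<in> U'" "y = f x" unfolding S'_def by blast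
      then show "y \<in> W \<inter> B -` (F ` U')" using FV[of x] W(2) S'S unfolding S'_def by force
    qed
    show "W \<inter> B -` (F ` U') \<subseteq> f ` S'"
    proof
      fix y assume "y \<in> W \<inter> B -` (F ` U')"
      then obtain x where x: "y \<in> W" "x \<in> U'" "B y = F x" by blast
      have "B y \<in> V" "B (f (proj V x)) \<in> V" using B(3) by auto
      \<comment> \<open>A point that \<open>F\<close> sends into \<open>V\<close> lies in
        \<open>V\<close> itself: the normal component of \<open>x\<close> is a difference of two
        vectors of \<open>V\<close>.\<close>
      then have "x - proj V x \<in> V"
        using x(3) subspace_diff[OF V(1), of "F x" "B (f (proj V x))"] by (simp add: F_def)
      then have xV: "x \<in> V" using subspace_add[OF V(1) _ proj_in[OF V(1)], of "x - proj V x" x] by simp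
      then have "B y = B (f x)" using x(3) FV by simp
      moreover have "f x \<in> W" using xV x(2) S'S W(2) unfolding S'_def by blast
      ultimately have "y = f x" using B(4) x(1) by metis
      then show "y \<in> f ` S'" using xV x(2) unfolding S'_def by blast
    qed
  qed
  show ?thesis
  proof (rule that[of S' "\<lambda>y. g (B y)"])
    show "openin (top_of_set V) S'" unfolding S'_def using U'(1) by (simp add: openin_open_Int)
    show "S' \<subseteq> S" by (rule S'S)
    show "x0 \<in> S'" using U'(3) x0V unfolding S'_def by blast
    have "open (B -` (F ` U'))" using open_vimage[OF U'(4) linear_continuous_on[OF bB]] .
    then show "openin (top_of_set W) (f ` S')" unfolding fS' by (simp add: openin_open_Int)
    show "g (B (f x)) = x" if "x \<in> S'" for x using that U'(5) FV unfolding S'_def by force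
    have "smooth_on (F ` U') g" using U'(4,6) smooth_on_open by blast
    then show "smooth_on (f ` S') (\<lambda>y. g (B y))"
      by (rule smooth_on_compose[OF smooth_on_linear[OF bB]]) (use fS' in auto)
  qed
qed

section \<open>Smooth maps between manifolds\<close>

text \<open>Hausdorffness and second countability play no role for smooth maps and their tangent maps;
  leaving them out makes products available at no cost.\<close>

definition smooth_atlas :: "('a, 'e::euclidean_space) mfd \<Rightarrow> bool" where
  "smooth_atlas M \<longleftrightarrow> subspace (model M) \<and>
     (\<forall>(U, \<phi>)\<in>atlas M. openin (mtop M) U \<and> openin (top_of_set (model M)) (\<phi> ` U) \<and>
        homeomorphic_map (subtopology (mtop M) U) (top_of_set (\<phi> ` U)) \<phi>) \<and>
     (\<Union>(U, \<phi>)\<in>atlas M. U) = points M \<and>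
     (\<forall>(U, \<phi>)\<in>atlas M. \<forall>(U', \<psi>)\<in>atlas M. smooth_on (\<phi> ` (U \<inter> U')) (\<psi> \<circ> inv_into U \<phi>))"

lemma smooth_manifold_imp_atlas: "smooth_manifold M \<Longrightarrow> smooth_atlas M"
  by (simp add: smooth_manifold_def smooth_atlas_def)

lemma smooth_atlasD:
  assumes "smooth_atlas M"
  shows "subspace (model M)"
    and "(U, \<phi>) \<in> atlas M \<Longrightarrow> openin (mtop M) U"
    and "(U, \<phi>) \<in> atlas M \<Longrightarrow> openin (top_of_set (model M)) (\<phi> ` U)"
    and "(U, \<phi>) \<in> atlas M \<Longrightarrow> homeomorphic_map (subtopology (mtop M) U) (top_of_set (\<phi> ` U)) \<phi>"
    and "(U, \<phi>) \<in> atlas M \<Longrightarrow> (U', \<psi>) \<in> atlas M \<Longrightarrow> smooth_on (\<phi> ` (U \<inter> U')) (\<psi> \<circ> inv_into U \<phi>)"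
    and "p \<in> points M \<Longrightarrow> \<exists>U \<phi>. (U, \<phi>) \<in> atlas M \<and> p \<in> U"
proof -
  note A = assms[unfolded smooth_atlas_def]
  note B = bspec[OF A[THEN conjunct2, THEN conjunct1], of "(U, \<phi>)", simplified]
  show "subspace (model M)" using A by (rule conjunct1)
  show "(U, \<phi>) \<in> atlas M \<Longrightarrow> openin (mtop M) U"
    "(U, \<phi>) \<in> atlas M \<Longrightarrow> openin (top_of_set (model M)) (\<phi> ` U)"
    "(U, \<phi>) \<in> atlas M \<Longrightarrow> homeomorphic_map (subtopology (mtop M) U) (top_of_set (\<phi> ` U)) \<phi>"
    using B by simp_all
  have "(\<Union>(U, \<phi>)\<in>atlas M. U) = points M" using A by (elim conjE)
  then show "p \<in> points M \<Longrightarrow> \<exists>U \<phi>. (U, \<phi>) \<in> atlas M \<and> p \<in> U" by fastforce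
  have "\<forall>(U, \<phi>)\<in>atlas M. \<forall>(U', \<psi>)\<in>atlas M. smooth_on (\<phi> ` (U \<inter> U')) (\<psi> \<circ> inv_into U \<phi>)"
    using A by (elim conjE)
  note C = bspec[OF this, of "(U, \<phi>)", unfolded prod.case]
  show "smooth_on (\<phi> ` (U \<inter> U')) (\<psi> \<circ> inv_into U \<phi>)" if "(U, \<phi>) \<in> atlas M" "(U', \<psi>) \<in> atlas M"
    using bspec[OF C[OF that(1)] that(2), unfolded prod.case] .
qed

lemma chart_subset: "smooth_atlas M \<Longrightarrow> (U, \<phi>) \<in> atlas M \<Longrightarrow> U \<subseteq> points M"
  using smooth_atlasD(2) openin_subset by blast

lemma chart_inj: "smooth_atlas M \<Longrightarrow> (U, \<phi>) \<in> atlas M \<Longrightarrow> inj_on \<phi> U"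
  using homeomorphic_imp_injective_map[OF smooth_atlasD(4)] chart_subset
  by (metis inf.absorb_iff2 topspace_subtopology)

lemma chart_inv [simp]: "smooth_atlas M \<Longrightarrow> (U, \<phi>) \<in> atlas M \<Longrightarrow> p \<in> U \<Longrightarrow> inv_into U \<phi> (\<phi> p) = p"
  by (rule inv_into_f_f[OF chart_inj])

lemma chart_continuous:
  "smooth_atlas M \<Longrightarrow> (U, \<phi>) \<in> atlas M \<Longrightarrow> continuous_map (subtopology (mtop M) U) (top_of_set (\<phi> ` U)) \<phi>"
  using smooth_atlasD(4) homeomorphic_imp_continuous_map by blast

lemma chart_inv_continuous:
  assumes "smooth_atlas M" "(U, \<phi>) \<in> atlas M"
  shows "continuous_map (top_of_set (\<phi> ` U)) (subtopology (mtop M) U) (inv_into U \<phi>)"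
proof -
  obtain g where g: "homeomorphic_maps (subtopology (mtop M) U) (top_of_set (\<phi> ` U)) \<phi> g"
    using smooth_atlasD(4)[OF assms] homeomorphic_map_maps by blast
  have t: "topspace (subtopology (mtop M) U) = U" using chart_subset[OF assms] by auto
  have c: "continuous_map (top_of_set (\<phi> ` U)) (subtopology (mtop M) U) g"
    using g by (simp add: homeomorphic_maps_def)
  show ?thesis
  proof (rule continuous_map_eq[OF c])
    fix y assume "y \<in> topspace (top_of_set (\<phi> ` U))"
    then obtain x where x: "x \<in> U" "y = \<phi> x" by auto
    then have "g y = x" using g t by (simp add: homeomorphic_maps_def)
    then show "g y = inv_into U \<phi> y" using x assms by simp
  qed
qed

lemma chart_image_open:
  assumes "smooth_atlas M" "(U, \<phi>) \<in> atlas M" "openin (mtop M) W" "W \<subseteq> U"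
  shows "openin (top_of_set (model M)) (\<phi> ` W)"
proof -
  have "openin (subtopology (mtop M) U) W"
    using assms(3,4) by (simp add: openin_subtopology_alt) (metis inf.absorb_iff2 image_eqI mem_Collect_eq)
  then have "openin (top_of_set (\<phi> ` U)) (\<phi> ` W)"
    using homeomorphic_imp_open_map[OF smooth_atlasD(4)[OF assms(1,2)]] by (simp add: open_map_def)
  then show ?thesis using smooth_atlasD(3)[OF assms(1,2)] openin_trans by blast
qed

lemma chart_preimage_open:
  assumes "smooth_atlas M" "(U, \<phi>) \<in> atlas M" "openin (top_of_set (model M)) Y"
  shows "openin (mtop M) {p \<in> U. \<phi> p \<in> Y}"
proof -
  have "\<phi> ` U \<subseteq> model M" using openin_subspace_subset[OF smooth_atlasD(3)[OF assms(1,2)]] .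
  moreover obtain T where "open T" "Y = model M \<inter> T" using assms(3) openin_open by metis
  ultimately have "\<phi> ` U \<inter> Y = \<phi> ` U \<inter> T" "open T" by auto
  then have "openin (top_of_set (\<phi> ` U)) (\<phi> ` U \<inter> Y)" by (simp add: openin_open_Int)
  from openin_continuous_map_preimage[OF chart_continuous[OF assms(1,2)] this]
  moreover have "{x \<in> topspace (subtopology (mtop M) U). \<phi> x \<in> \<phi> ` U \<inter> Y} = {p \<in> U. \<phi> p \<in> Y}"
    using chart_subset[OF assms(1,2)] by auto
  ultimately have "openin (subtopology (mtop M) U) {p \<in> U. \<phi> p \<in> Y}" by simp
  then show ?thesis using smooth_atlasD(2)[OF assms(1,2)] openin_trans_full by blast
qed

lemma chart_at:
  assumes "smooth_atlas M" "p \<in> points M" "chart_at M p = (U, \<phi>)"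
  shows "(U, \<phi>) \<in> atlas M" "p \<in> U"
proof -
  have "\<exists>c. c \<in> atlas M \<and> p \<in> fst c" using smooth_atlasD(6)[OF assms(1,2)] by force
  from someI_ex[OF this, folded chart_at_def] show "(U, \<phi>) \<in> atlas M" "p \<in> U" using assms(3) by auto
qed

text \<open>Smoothness seen in one pair of charts on one neighbourhood. \<open>smooth_map_on\<close>
  speaks of all pairs of charts and demands continuity; the two notions are matched in
  \<open>smooth_at_iff_smooth_map_on\<close>, and the pointwise one is easier to compose.\<close>

definition smooth_in ::
  "('a, 'e::euclidean_space) mfd \<Rightarrow> ('b, 'f::euclidean_space) mfd \<Rightarrow> ('a \<Rightarrow> 'b) \<Rightarrow>
    ('a, 'e) chart \<Rightarrow> ('b, 'f) chart \<Rightarrow> 'a set \<Rightarrow> bool" where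
  "smooth_in M N F c d W \<longleftrightarrow> c \<in> atlas M \<and> d \<in> atlas N \<and> openin (mtop M) W \<and>
     W \<subseteq> fst c \<and> F ` W \<subseteq> fst d \<and> smooth_on (snd c ` W) (snd d \<circ> F \<circ> inv_into (fst c) (snd c))"

definition smooth_at ::
  "('a, 'e::euclidean_space) mfd \<Rightarrow> ('b, 'f::euclidean_space) mfd \<Rightarrow> ('a \<Rightarrow> 'b) \<Rightarrow> 'a \<Rightarrow> bool" where
  "smooth_at M N F p \<longleftrightarrow> (\<exists>c d W. p \<in> W \<and> smooth_in M N F c d W)"

lemma smooth_inD:
  assumes "smooth_in M N F (U, \<phi>) (U', \<psi>) W"
  shows "(U, \<phi>) \<in> atlas M" "(U', \<psi>) \<in> atlas N" "openin (mtop M) W" "W \<subseteq> U"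
    and "smooth_on (\<phi> ` W) (\<psi> \<circ> F \<circ> inv_into U \<phi>)"
    and "\<And>x. x \<in> W \<Longrightarrow> x \<in> U" "\<And>x. x \<in> W \<Longrightarrow> F x \<in> U'"
  using assms unfolding smooth_in_def by auto

lemma smooth_inI:
  assumes "(U, \<phi>) \<in> atlas M" "(U', \<psi>) \<in> atlas N" "openin (mtop M) W" "W \<subseteq> U"
    and "\<And>x. x \<in> W \<Longrightarrow> F x \<in> U'" and "smooth_on (\<phi> ` W) (\<psi> \<circ> F \<circ> inv_into U \<phi>)"
  shows "smooth_in M N F (U, \<phi>) (U', \<psi>) W"
  using assms unfolding smooth_in_def by auto

text \<open>Continuity comes back by factoring \<open>F\<close> into the source chart, the smooth
  representative and the inverse target chart; that \<open>F\<close> maps \<open>W\<close> into a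
  single chart domain makes this possible.\<close>

lemma smooth_in_continuous:
  assumes M: "smooth_atlas M" and N: "smooth_atlas N" and F: "smooth_in M N F c d W"
  shows "continuous_map (subtopology (mtop M) W) (mtop N) F"
proof -
  obtain U \<phi> U' \<psi> where cd: "c = (U, \<phi>)" "d = (U', \<psi>)" by (cases c; cases d) auto
  note F' = smooth_inD[OF F[unfolded cd]]
  let ?h = "\<psi> \<circ> F \<circ> inv_into U \<phi>"
  have W: "W \<subseteq> points M" using openin_subset[OF F'(3)] .
  have "continuous_map (subtopology (mtop M) W) (top_of_set (\<phi> ` U)) \<phi>"
    by (rule continuous_map_from_subtopology_mono[OF chart_continuous[OF M F'(1)] F'(4)])
  then have "continuous_map (subtopology (mtop M) W) euclidean \<phi>"
    by (simp add: continuous_map_in_subtopology)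
  then have 1: "continuous_map (subtopology (mtop M) W) (top_of_set (\<phi> ` W)) \<phi>"
    by (rule continuous_map_into_subtopology) auto
  have "?h ` \<phi> ` W \<subseteq> \<psi> ` U'"
    using F'(6,7) chart_inv[OF M F'(1)] by auto
  then have 2: "continuous_map (top_of_set (\<phi> ` W)) (top_of_set (\<psi> ` U')) ?h"
    using smooth_on_imp_continuous_on[OF F'(5)]
    by (simp only: continuous_map_in_subtopology continuous_map_iff_continuous topspace_euclidean_subtopology image_subset_iff_funcset)
  have 3: "continuous_map (top_of_set (\<psi> ` U')) (mtop N) (inv_into U' \<psi>)"
    using chart_inv_continuous[OF N F'(2)] by (rule continuous_map_into_fulltopology)
  have "continuous_map (subtopology (mtop M) W) (mtop N) (inv_into U' \<psi> \<circ> (?h \<circ> \<phi>))"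
    by (rule continuous_map_compose[OF continuous_map_compose[OF 1 2] 3])
  then show ?thesis
  proof (rule continuous_map_eq)
    fix x assume "x \<in> topspace (subtopology (mtop M) W)"
    then have "x \<in> W" by simp
    then show "(inv_into U' \<psi> \<circ> (?h \<circ> \<phi>)) x = F x"
      by (simp add: chart_inv[OF M F'(1) F'(6)] chart_inv[OF N F'(2) F'(7)])
  qed
qed

lemma smooth_at_points:
  assumes "smooth_atlas M" "smooth_atlas N" "smooth_at M N F p"
  shows "p \<in> points M" "F p \<in> points N"
proof -
  obtain U \<phi> U' \<psi> W where *: "p \<in> W" "smooth_in M N F (U, \<phi>) (U', \<psi>) W"
    using assms(3) unfolding smooth_at_def by (metis surj_pair)
  note F = smooth_inD[OF *(2)]
  show "p \<in> points M" "F p \<in> points N"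
    using chart_subset[OF assms(1) F(1)] chart_subset[OF assms(2) F(2)] F(6,7)[OF *(1)] by auto
qed

lemma smooth_in_mono: "smooth_in M N F c d W \<Longrightarrow> openin (mtop M) W' \<Longrightarrow> W' \<subseteq> W \<Longrightarrow> smooth_in M N F c d W'"
  unfolding smooth_in_def by (meson image_mono order_trans smooth_on_subset)

lemma openin_preimage_restrict:
  assumes "openin X W" "continuous_map (subtopology X W) Y F" "openin Y O'"
  shows "openin X {x \<in> W. F x \<in> O'}"
proof -
  have "{x \<in> topspace (subtopology X W). F x \<in> O'} = {x \<in> W. F x \<in> O'}" using openin_subset[OF assms(1)] by auto
  then have "openin (subtopology X W) {x \<in> W. F x \<in> O'}" using openin_continuous_map_preimage[OF assms(2,3)] by simp
  then show ?thesis by (rule openin_trans_full) (rule assms(1))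
qed

lemma smooth_in_change_charts:
  assumes M: "smooth_atlas M" and N: "smooth_atlas N" and F: "smooth_in M N F c d W"
    and c: "(U1, \<phi>1) \<in> atlas M" and d: "(U1', \<psi>1) \<in> atlas N"
  shows "smooth_in M N F (U1, \<phi>1) (U1', \<psi>1) {x \<in> W \<inter> U1. F x \<in> U1'}"
proof -
  obtain U \<phi> U' \<psi> where cd: "c = (U, \<phi>)" "d = (U', \<psi>)" by (cases c; cases d) auto
  note F' = smooth_inD[OF F[unfolded cd]]
  define W' where "W' = {x \<in> W \<inter> U1. F x \<in> U1'}"
  have "openin (mtop M) {x \<in> W. F x \<in> U1'}"
    by (rule openin_preimage_restrict[OF F'(3) smooth_in_continuous[OF M N F] smooth_atlasD(2)[OF N d]])
  moreover have "W' = {x \<in> W. F x \<in> U1'} \<inter> U1" unfolding W'_def by auto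
  ultimately have W: "openin (mtop M) W'" using smooth_atlasD(2)[OF M c] by auto
  have mem: "x \<in> U1" "x \<in> W" "F x \<in> U1'" "x \<in> U" "F x \<in> U'" if "x \<in> W'" for x
    using that F'(6,7) by (auto simp: W'_def)
  have inv: "inv_into U1 \<phi>1 (\<phi>1 x) = x" "inv_into U \<phi> (\<phi> x) = x" "inv_into U' \<psi> (\<psi> (F x)) = F x" if "x \<in> W'" for x
    using chart_inv[OF M c mem(1)] chart_inv[OF M F'(1) mem(4)] chart_inv[OF N F'(2) mem(5)] that by auto
  have 1: "smooth_on (\<phi>1 ` W') (\<phi> \<circ> inv_into U1 \<phi>1)"
    by (rule smooth_on_subset[OF smooth_atlasD(5)[OF M c F'(1)]]) (use mem in blast)
  have 2: "smooth_on (\<phi> ` W') (\<psi> \<circ> F \<circ> inv_into U \<phi>)"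
    by (rule smooth_on_subset[OF F'(5)]) (use mem in blast)
  have 4: "smooth_on (\<phi> ` W') (\<lambda>y. (\<psi>1 \<circ> inv_into U' \<psi>) ((\<psi> \<circ> F \<circ> inv_into U \<phi>) y))"
    by (rule smooth_on_compose[OF 2 smooth_atlasD(5)[OF N F'(2) d]]) (use inv mem in auto)
  have 5: "smooth_on (\<phi>1 ` W') (\<lambda>y. (\<psi>1 \<circ> inv_into U' \<psi>) ((\<psi> \<circ> F \<circ> inv_into U \<phi>) ((\<phi> \<circ> inv_into U1 \<phi>1) y)))"
    by (rule smooth_on_compose[OF 1 4]) (use inv in auto)
  have "smooth_on (\<phi>1 ` W') (\<psi>1 \<circ> F \<circ> inv_into U1 \<phi>1)"
    by (rule smooth_on_cong[OF 5 order_refl]) (use inv in auto)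
  then show ?thesis unfolding W'_def[symmetric] using c d W mem by (intro smooth_inI) auto
qed

lemma smooth_atD:
  assumes "smooth_at M N F p"
  obtains U \<phi> U' \<psi> W where "p \<in> W" "smooth_in M N F (U, \<phi>) (U', \<psi>) W"
  using assms unfolding smooth_at_def by (metis surj_pair)

lemma smooth_atI: "p \<in> W \<Longrightarrow> smooth_in M N F c d W \<Longrightarrow> smooth_at M N F p"
  unfolding smooth_at_def by blast

lemma smooth_atE:
  assumes M: "smooth_atlas M" and N: "smooth_atlas N" and F: "smooth_at M N F p"
    and c: "(U, \<phi>) \<in> atlas M" "p \<in> U" and d: "(U', \<psi>) \<in> atlas N" "F p \<in> U'"
  obtains W where "p \<in> W" "smooth_in M N F (U, \<phi>) (U', \<psi>) W"
proof -
  obtain V \<alpha> V' \<beta> W where *: "p \<in> W" "smooth_in M N F (V, \<alpha>) (V', \<beta>) W"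
    by (rule smooth_atD[OF F])
  show ?thesis
    by (rule that[OF _ smooth_in_change_charts[OF M N *(2) c(1) d(1)]]) (use * c d in simp)
qed

lemma smooth_at_cong:
  assumes F: "smooth_at M N F p" and W: "openin (mtop M) W" "p \<in> W" "\<And>x. x \<in> W \<Longrightarrow> F x = G x"
    and M: "smooth_atlas M"
  shows "smooth_at M N G p"
proof -
  obtain U \<phi> U' \<psi> W' where *: "p \<in> W'" "smooth_in M N F (U, \<phi>) (U', \<psi>) W'"
    by (rule smooth_atD[OF F])
  note F' = smooth_inD[OF *(2)]
  have "smooth_on (\<phi> ` (W \<inter> W')) (\<psi> \<circ> G \<circ> inv_into U \<phi>)"
  proof (rule smooth_on_cong[OF F'(5)])
    fix y assume "y \<in> \<phi> ` (W \<inter> W')"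
    then obtain x where "x \<in> W" "x \<in> W'" "y = \<phi> x" by blast
    then show "(\<psi> \<circ> F \<circ> inv_into U \<phi>) y = (\<psi> \<circ> G \<circ> inv_into U \<phi>) y"
      using W(3) chart_inv[OF M F'(1) F'(6)] by simp
  qed blast
  then have "smooth_in M N G (U, \<phi>) (U', \<psi>) (W \<inter> W')"
    using F' W by (intro smooth_inI) force+
  then show ?thesis by (rule smooth_atI[rotated]) (use * W in simp)
qed

lemma smooth_map_on_imp_smooth_at:
  assumes M: "smooth_atlas M" and N: "smooth_atlas N" and F: "smooth_map_on M W N F" and W: "openin (mtop M) W" and p: "p \<in> W"
  shows "smooth_at M N F p"
proof -
  have c: "continuous_map (subtopology (mtop M) W) (mtop N) F" using F by (simp add: smooth_map_on_def)
  have pM: "p \<in> points M" using W p openin_subset by blast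
  then have FN: "F p \<in> points N" using c p by (auto simp: continuous_map_def)
  obtain U \<phi> where U: "(U, \<phi>) \<in> atlas M" "p \<in> U" using smooth_atlasD(6)[OF M pM] by blast
  obtain U' \<psi> where U': "(U', \<psi>) \<in> atlas N" "F p \<in> U'" using smooth_atlasD(6)[OF N FN] by blast
  have "smooth_on (\<phi> ` {p \<in> U \<inter> W. F p \<in> U'}) (\<psi> \<circ> F \<circ> inv_into U \<phi>)"
    by (rule bspec[OF bspec[OF F[unfolded smooth_map_on_def, THEN conjunct2] U(1), unfolded prod.case] U'(1), unfolded prod.case])
  moreover have "openin (mtop M) {p \<in> U \<inter> W. F p \<in> U'}"
  proof -
    have "{p \<in> U \<inter> W. F p \<in> U'} = U \<inter> {p \<in> W. F p \<in> U'}" by auto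
    then show ?thesis using openin_preimage_restrict[OF W c smooth_atlasD(2)[OF N U'(1)]] smooth_atlasD(2)[OF M U(1)] by auto
  qed
  ultimately have "smooth_in M N F (U, \<phi>) (U', \<psi>) {p \<in> U \<inter> W. F p \<in> U'}"
    using U U' by (intro smooth_inI) auto
  then show ?thesis by (rule smooth_atI[rotated]) (use p U U' in simp)
qed

lemma smooth_map_onI:
  assumes M: "smooth_atlas M" and N: "smooth_atlas N" and W: "openin (mtop M) W" and F: "\<And>p. p \<in> W \<Longrightarrow> smooth_at M N F p"
  shows "smooth_map_on M W N F"
  unfolding smooth_map_on_def
proof (intro conjI ballI)
  have WM: "W \<subseteq> points M" using W openin_subset by blast
  have "openin (subtopology (mtop M) W) {x \<in> topspace (subtopology (mtop M) W). F x \<in> O'}" if O': "openin (mtop N) O'" for O'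
  proof (subst openin_subopen, intro ballI)
    fix x assume x: "x \<in> {x \<in> topspace (subtopology (mtop M) W). F x \<in> O'}"
    then have "x \<in> W" by simp
    then obtain c d W' where W': "x \<in> W'" "smooth_in M N F c d W'" using F unfolding smooth_at_def by blast
    then have o: "openin (mtop M) W'" by (simp add: smooth_in_def)
    let ?T = "W \<inter> {x \<in> W'. F x \<in> O'}"
    have "openin (mtop M) {x \<in> W'. F x \<in> O'}"
      by (rule openin_preimage_restrict[OF o smooth_in_continuous[OF M N W'(2)] O'])
    then have "openin (subtopology (mtop M) W) ?T" by (rule openin_subtopology_Int2)
    then show "\<exists>T. openin (subtopology (mtop M) W) T \<and> x \<in> T \<and> T \<subseteq> {x \<in> topspace (subtopology (mtop M) W). F x \<in> O'}"
      using x W' WM by (intro exI[of _ ?T]) auto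
  qed
  moreover have "F x \<in> points N" if "x \<in> W" for x using smooth_at_points(2)[OF M N F[OF that]] .
  ultimately show "continuous_map (subtopology (mtop M) W) (mtop N) F"
    using WM by (auto simp: continuous_map_def)
next
  fix c assume c: "c \<in> atlas M"
  obtain U \<phi> where [simp]: "c = (U, \<phi>)" by (cases c) auto
  have "smooth_on (\<phi> ` {p \<in> U \<inter> W. F p \<in> U'}) (\<psi> \<circ> F \<circ> inv_into U \<phi>)"
    if U: "(U, \<phi>) \<in> atlas M" "(U', \<psi>) \<in> atlas N" for U' \<psi>
  proof (rule smooth_on_local)
    fix y assume "y \<in> \<phi> ` {p \<in> U \<inter> W. F p \<in> U'}"
    then obtain p where p: "p \<in> U" "p \<in> W" "F p \<in> U'" "y = \<phi> p" by blast
    obtain W' where W': "p \<in> W'" "smooth_in M N F (U, \<phi>) (U', \<psi>) W'"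
      by (rule smooth_atE[OF M N F[OF p(2)] U(1) p(1) U(2) p(3)])
    have s: "smooth_in M N F (U, \<phi>) (U', \<psi>) (W' \<inter> W)"
      by (rule smooth_in_mono[OF W'(2)]) (use W' W in \<open>auto simp: smooth_in_def\<close>)
    note s' = s[unfolded smooth_in_def, simplified]
    have "openin (top_of_set (model M)) (\<phi> ` (W' \<inter> W))"
      by (rule chart_image_open[OF M U(1)]) (use s' in auto)
    then have "openin (top_of_set (\<phi> ` {p \<in> U \<inter> W. F p \<in> U'})) (\<phi> ` (W' \<inter> W))"
    proof (rule openin_subset_trans)
      show "\<phi> ` (W' \<inter> W) \<subseteq> \<phi> ` {p \<in> U \<inter> W. F p \<in> U'}" using s' by (intro image_mono) auto
      show "\<phi> ` {p \<in> U \<inter> W. F p \<in> U'} \<subseteq> model M" using openin_subspace_subset[OF smooth_atlasD(3)[OF M U(1)]] by blast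
    qed
    then show "\<exists>T. openin (top_of_set (\<phi> ` {p \<in> U \<inter> W. F p \<in> U'})) T \<and> y \<in> T \<and> smooth_on T (\<psi> \<circ> F \<circ> inv_into U \<phi>)"
      using W' p s' by (intro exI[of _ "\<phi> ` (W' \<inter> W)"]) auto
  qed
  then show "case c of (U, \<phi>) \<Rightarrow> \<forall>(U', \<psi>)\<in>atlas N. smooth_on (\<phi> ` {p \<in> U \<inter> W. F p \<in> U'}) (\<psi> \<circ> F \<circ> inv_into U \<phi>)"
    using c by auto
qed

lemma smooth_at_iff_smooth_map_on:
  assumes M: "smooth_atlas M" and N: "smooth_atlas N" and W: "openin (mtop M) W"
  shows "smooth_map_on M W N F \<longleftrightarrow> (\<forall>p\<in>W. smooth_at M N F p)"
  using smooth_map_onI[OF M N W] smooth_map_on_imp_smooth_at[OF M N _ W] by blast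

lemma smooth_at_compose:
  assumes M: "smooth_atlas M" and N: "smooth_atlas N" and P: "smooth_atlas P"
    and F: "smooth_at M N F p" and G: "smooth_at N P G (F p)"
  shows "smooth_at M P (\<lambda>x. G (F x)) p"
proof -
  obtain U \<phi> U' \<psi> W where 1: "p \<in> W" "smooth_in M N F (U, \<phi>) (U', \<psi>) W"
    by (rule smooth_atD[OF F])
  note F' = smooth_inD[OF 1(2)]
  obtain T \<tau> where T: "(T, \<tau>) \<in> atlas P" "G (F p) \<in> T"
    using smooth_atlasD(6)[OF P smooth_at_points(2)[OF N P G]] by blast
  obtain W' where 2: "F p \<in> W'" "smooth_in N P G (U', \<psi>) (T, \<tau>) W'"
    by (rule smooth_atE[OF N P G F'(2) F'(7)[OF 1(1)] T])
  note G' = smooth_inD[OF 2(2)]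
  let ?W = "{x \<in> W. F x \<in> W'}"
  have W: "openin (mtop M) ?W"
    by (rule openin_preimage_restrict[OF F'(3) smooth_in_continuous[OF M N 1(2)] G'(3)])
  have inv: "inv_into U \<phi> (\<phi> x) = x" "inv_into U' \<psi> (\<psi> (F x)) = F x" if "x \<in> ?W" for x
    using that chart_inv[OF M F'(1) F'(6)] chart_inv[OF N F'(2) F'(7)] by auto
  have "smooth_on (\<phi> ` ?W) (\<lambda>y. (\<tau> \<circ> G \<circ> inv_into U' \<psi>) ((\<psi> \<circ> F \<circ> inv_into U \<phi>) y))"
    by (rule smooth_on_compose[OF smooth_on_subset[OF F'(5)] G'(5)]) (use inv in auto)
  then have "smooth_on (\<phi> ` ?W) (\<tau> \<circ> (\<lambda>x. G (F x)) \<circ> inv_into U \<phi>)"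
    by (rule smooth_on_cong[OF _ order_refl]) (use inv in auto)
  then have "smooth_in M P (\<lambda>x. G (F x)) (U, \<phi>) (T, \<tau>) ?W"
    using F' G' W by (intro smooth_inI) auto
  then show ?thesis by (rule smooth_atI[rotated]) (use 1 2 in simp)
qed

lemma smooth_at_const:
  assumes "smooth_atlas M" "smooth_atlas N" "p \<in> points M" "q \<in> points N"
  shows "smooth_at M N (\<lambda>x. q) p"
proof -
  obtain U \<phi> U' \<psi> where "(U, \<phi>) \<in> atlas M" "p \<in> U" "(U', \<psi>) \<in> atlas N" "q \<in> U'"
    using smooth_atlasD(6)[OF assms(1,3)] smooth_atlasD(6)[OF assms(2,4)] by blast
  moreover then have "smooth_in M N (\<lambda>x. q) (U, \<phi>) (U', \<psi>) U"
    using assms smooth_atlasD(2) by (intro smooth_inI) (auto simp: o_def smooth_on_const)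
  ultimately show ?thesis by (intro smooth_atI)
qed

lemma smooth_at_id:
  assumes "smooth_atlas M" "p \<in> points M"
  shows "smooth_at M M (\<lambda>x. x) p"
proof -
  obtain U \<phi> where U: "(U, \<phi>) \<in> atlas M" "p \<in> U"
    using smooth_atlasD(6)[OF assms] by blast
  have "smooth_on (\<phi> ` U) (\<phi> \<circ> (\<lambda>x. x) \<circ> inv_into U \<phi>)"
    by (rule smooth_on_cong[OF smooth_on_id order_refl]) (use U assms(1) in auto)
  then have "smooth_in M M (\<lambda>x. x) (U, \<phi>) (U, \<phi>) U"
    using smooth_atlasD(2)[OF assms(1) U(1)] U by (intro smooth_inI) auto
  then show ?thesis using U by (intro smooth_atI)
qed

section \<open>Open subsets of linear spaces as manifolds\<close>

lemma euclid_mfd_simps [simp]: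
  "mtop (euclid_mfd V U) = top_of_set U" "model (euclid_mfd V U) = V" "atlas (euclid_mfd V U) = {(U, \<lambda>x. x)}"
  by (simp_all add: euclid_mfd_def)

lemma inv_into_ident [simp]: "x \<in> U \<Longrightarrow> inv_into U (\<lambda>x. x) x = x"
  by (rule inv_into_f_f) auto

lemma smooth_manifold_euclid:
  assumes "subspace V" "openin (top_of_set V) U"
  shows "smooth_manifold (euclid_mfd V U)"
proof -
  have "second_countable (top_of_set U)"
  proof (rule second_countable_subtopology)
    show "second_countable (euclidean :: 'a topology)"
      unfolding second_countable_def
      by (metis ex_countable_basis open_openin topological_basis_def topological_basis_open topological_basisE UNIV_I)
  qed
  moreover have "homeomorphic_map (top_of_set U) (top_of_set U) (\<lambda>x. x)"
    using homeomorphic_map_id[of "top_of_set U"] by (simp add: id_def)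
  moreover have "smooth_on U ((\<lambda>x. x) \<circ> inv_into U (\<lambda>x. x))"
    by (rule smooth_on_cong[OF smooth_on_id order_refl]) simp
  ultimately show ?thesis using assms
    by (simp add: smooth_manifold_def Hausdorff_space_subtopology Hausdorff_space_euclidean subtopology_subtopology)
qed

lemma smooth_atlas_euclid:
  "subspace V \<Longrightarrow> openin (top_of_set V) U \<Longrightarrow> smooth_atlas (euclid_mfd V U)"
  by (intro smooth_manifold_imp_atlas smooth_manifold_euclid)

lemma openin_top_of_open:
  "openin (top_of_set V) U \<Longrightarrow> openin (top_of_set U) W \<longleftrightarrow> openin (top_of_set V) W \<and> W \<subseteq> U"
  by (meson openin_imp_subset openin_subset_trans openin_trans openin_subspace_subset)

lemma smooth_at_euclidI:
  assumes "openin (top_of_set V) U" "openin (top_of_set V) W" "x \<in> W" "W \<subseteq> U" "\<And>y. y \<in> W \<Longrightarrow> f y \<in> T" "smooth_on W f"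
  shows "smooth_at (euclid_mfd V U) (euclid_mfd V' T) f x"
proof (rule smooth_atI[OF assms(3)])
  have "smooth_on ((\<lambda>x. x) ` W) ((\<lambda>x. x) \<circ> f \<circ> inv_into U (\<lambda>x. x))"
    by (rule smooth_on_cong[OF assms(6)]) (use assms(4) in \<open>auto simp: subset_iff\<close>)
  then show "smooth_in (euclid_mfd V U) (euclid_mfd V' T) f (U, \<lambda>x. x) (T, \<lambda>x. x) W"
    using assms openin_top_of_open[OF assms(1)] by (intro smooth_inI) auto
qed

lemma smooth_at_euclidE:
  assumes "openin (top_of_set V) U" "smooth_at (euclid_mfd V U) (euclid_mfd V' T) f x"
  obtains W where "openin (top_of_set V) W" "x \<in> W" "W \<subseteq> U" "f ` W \<subseteq> T" "smooth_on W f"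
proof -
  obtain A \<phi> B \<psi> W where *: "x \<in> W" "smooth_in (euclid_mfd V U) (euclid_mfd V' T) f (A, \<phi>) (B, \<psi>) W"
    by (rule smooth_atD[OF assms(2)])
  note F = smooth_inD[OF *(2)]
  have [simp]: "A = U" "\<phi> = (\<lambda>x. x)" "B = T" "\<psi> = (\<lambda>x. x)" using F(1,2) by auto
  have "smooth_on W f"
    by (rule smooth_on_cong[OF F(5)]) (use F(6) in auto)
  then show ?thesis using F(3) F(7) *(1) openin_top_of_open[OF assms(1)] by (intro that[of W]) auto
qed

lemma smooth_map_euclid_iff:
  assumes V: "subspace V" "openin (top_of_set V) U" and V': "subspace V'" "openin (top_of_set V') T"
  shows "smooth_map (euclid_mfd V U) (euclid_mfd V' T) f \<longleftrightarrow> smooth_on U f \<and> f ` U \<subseteq> T"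
proof -
  have U: "openin (mtop (euclid_mfd V U)) U" by simp
  have p: "points (euclid_mfd V U) = U" by simp
  have "(\<forall>x\<in>U. smooth_at (euclid_mfd V U) (euclid_mfd V' T) f x) \<longleftrightarrow> smooth_on U f \<and> f ` U \<subseteq> T"
  proof
    assume *: "\<forall>x\<in>U. smooth_at (euclid_mfd V U) (euclid_mfd V' T) f x"
    have "smooth_on U f"
    proof (rule smooth_on_local)
      fix x assume "x \<in> U"
      with * have "smooth_at (euclid_mfd V U) (euclid_mfd V' T) f x" by blast
      then obtain W where "openin (top_of_set V) W" "x \<in> W" "W \<subseteq> U" "f ` W \<subseteq> T" "smooth_on W f"
        by (rule smooth_at_euclidE[OF V(2)])
      then show "\<exists>T. openin (top_of_set U) T \<and> x \<in> T \<and> smooth_on T f"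
        using openin_top_of_open[OF V(2)] by blast
    qed
    moreover have "f ` U \<subseteq> T"
      using * smooth_at_points(2)[OF smooth_atlas_euclid[OF V] smooth_atlas_euclid[OF V']] by auto
    ultimately show "smooth_on U f \<and> f ` U \<subseteq> T" ..
  next
    assume "smooth_on U f \<and> f ` U \<subseteq> T"
    then show "\<forall>x\<in>U. smooth_at (euclid_mfd V U) (euclid_mfd V' T) f x"
      using V by (intro ballI smooth_at_euclidI[of V U U]) auto
  qed
  then show ?thesis
    using smooth_at_iff_smooth_map_on[OF smooth_atlas_euclid[OF V] smooth_atlas_euclid[OF V'] U] by (simp only: p)
qed

lemma smooth_at_chart:
  assumes "smooth_atlas M" "(U, \<phi>) \<in> atlas M" "p \<in> U" "openin (top_of_set (model M)) T" "\<phi> p \<in> T"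
  shows "smooth_at M (euclid_mfd (model M) T) \<phi> p"
proof (rule smooth_atI)
  let ?W = "{x \<in> U. \<phi> x \<in> T}"
  have "smooth_on (\<phi> ` ?W) ((\<lambda>x. x) \<circ> \<phi> \<circ> inv_into U \<phi>)"
    by (rule smooth_on_cong[OF smooth_on_id order_refl]) (use assms in auto)
  then show "smooth_in M (euclid_mfd (model M) T) \<phi> (U, \<phi>) (T, \<lambda>x. x) ?W"
    using assms chart_preimage_open[OF assms(1,2,4)] by (intro smooth_inI) auto
qed (use assms in simp)

lemma smooth_at_chart_inv:
  assumes "smooth_atlas M" "(U, \<phi>) \<in> atlas M" "openin (top_of_set (model M)) T" "x \<in> T" "x \<in> \<phi> ` U"
  shows "smooth_at (euclid_mfd (model M) T) M (inv_into U \<phi>) x"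
proof (rule smooth_atI)
  let ?W = "T \<inter> \<phi> ` U"
  have "smooth_on ((\<lambda>x. x) ` ?W) (\<phi> \<circ> inv_into U \<phi> \<circ> inv_into T (\<lambda>x. x))"
    by (rule smooth_on_cong[OF smooth_on_id order_refl]) (use assms in auto)
  then show "smooth_in (euclid_mfd (model M) T) M (inv_into U \<phi>) (T, \<lambda>x. x) (U, \<phi>) ?W"
    using assms smooth_atlasD(3)[OF assms(1,2)] openin_top_of_open[OF assms(3)] by (intro smooth_inI) auto
qed (use assms in simp)

section \<open>Tangent maps\<close>

lemma tangent_map_eq:
  assumes "chart_at M p = (U, \<phi>)" "chart_at N (F p) = (U', \<psi>)"
  shows "tangent_map M N F p = der (model M) (\<psi> \<circ> F \<circ> inv_into U \<phi>) (\<phi> p)"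
  using assms by (simp add: tangent_map_def)

text \<open>\<open>tangent_map\<close> is computed in the chosen charts, so a local representative
  must first be moved there; most proofs about tangent maps start with this.\<close>

lemma smooth_at_chart_at:
  assumes M: "smooth_atlas M" and N: "smooth_atlas N" and F: "smooth_at M N F p"
  obtains U \<phi> U' \<psi> W where "chart_at M p = (U, \<phi>)" "chart_at N (F p) = (U', \<psi>)" "p \<in> W"
    "smooth_in M N F (U, \<phi>) (U', \<psi>) W"
proof -
  obtain U \<phi> U' \<psi> where c: "chart_at M p = (U, \<phi>)" "chart_at N (F p) = (U', \<psi>)" by (metis surj_pair)
  note p = smooth_at_points[OF M N F]
  show ?thesis
    by (rule smooth_atE[OF M N F chart_at[OF M p(1) c(1)] chart_at[OF N p(2) c(2)]]) (use that c in blast)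
qed

lemma smooth_in_local_rep:
  assumes M: "smooth_atlas M" and N: "smooth_atlas N" and F: "smooth_in M N F (U, \<phi>) (U', \<psi>) W"
  shows "openin (top_of_set (model M)) (\<phi> ` W)" "(\<psi> \<circ> F \<circ> inv_into U \<phi>) ` \<phi> ` W \<subseteq> model N"
    "\<And>x. x \<in> W \<Longrightarrow> (\<psi> \<circ> F \<circ> inv_into U \<phi>) (\<phi> x) = \<psi> (F x)"
proof -
  note F' = smooth_inD[OF F]
  show "openin (top_of_set (model M)) (\<phi> ` W)" by (rule chart_image_open[OF M F'(1,3,4)])
  show rep: "(\<psi> \<circ> F \<circ> inv_into U \<phi>) (\<phi> x) = \<psi> (F x)" if "x \<in> W" for x
    using chart_inv[OF M F'(1) F'(6)[OF that]] by simp
  show "(\<psi> \<circ> F \<circ> inv_into U \<phi>) ` \<phi> ` W \<subseteq> model N"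
    using rep F'(7) openin_subspace_subset[OF smooth_atlasD(3)[OF N F'(2)]] by auto
qed

lemma tangent_map_cong:
  assumes M: "smooth_atlas M" and W: "openin (mtop M) W" "p \<in> W" "\<And>x. x \<in> W \<Longrightarrow> F x = G x"
  shows "tangent_map M N F p = tangent_map M N G p"
proof -
  obtain U \<phi> U' \<psi> where c: "chart_at M p = (U, \<phi>)" "chart_at N (F p) = (U', \<psi>)" by (metis surj_pair)
  have pM: "p \<in> points M" using W openin_subset by blast
  note U = chart_at[OF M pM c(1)]
  have c': "chart_at N (G p) = (U', \<psi>)" using c(2) W by simp
  have "openin (mtop M) (U \<inter> W)" using smooth_atlasD(2)[OF M U(1)] W(1) by blast
  then have "openin (top_of_set (model M)) (\<phi> ` (U \<inter> W))" by (rule chart_image_open[OF M U(1)]) blast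
  then have "der (model M) (\<psi> \<circ> F \<circ> inv_into U \<phi>) (\<phi> p) = der (model M) (\<psi> \<circ> G \<circ> inv_into U \<phi>) (\<phi> p)"
    by (rule der_cong) (use U W M in auto)
  then show ?thesis by (simp only: tangent_map_eq[where F=F, OF c] tangent_map_eq[where F=G, OF c(1) c'])
qed

lemma tangent_map_linear:
  assumes M: "smooth_atlas M" and N: "smooth_atlas N" and F: "smooth_at M N F p"
  shows "linear (tangent_map M N F p)"
proof -
  obtain U \<phi> U' \<psi> W where c: "chart_at M p = (U, \<phi>)" "chart_at N (F p) = (U', \<psi>)" "p \<in> W"
    "smooth_in M N F (U, \<phi>) (U', \<psi>) W" by (rule smooth_at_chart_at[OF M N F])
  show ?thesis unfolding tangent_map_eq[where F=F, OF c(1,2)]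
    by (rule der_linear[OF smooth_atlasD(1)[OF M] smooth_in_local_rep(1)[OF M N c(4)] smooth_inD(5)[OF c(4)]]) (use c in blast)
qed

lemma tangent_map_in:
  assumes M: "smooth_atlas M" and N: "smooth_atlas N" and F: "smooth_at M N F p" and u: "u \<in> model M"
  shows "tangent_map M N F p u \<in> model N"
proof -
  obtain U \<phi> U' \<psi> W where c: "chart_at M p = (U, \<phi>)" "chart_at N (F p) = (U', \<psi>)" "p \<in> W"
    "smooth_in M N F (U, \<phi>) (U', \<psi>) W" by (rule smooth_at_chart_at[OF M N F])
  show ?thesis unfolding tangent_map_eq[where F=F, OF c(1,2)]
    by (rule der_in[OF smooth_atlasD(1)[OF M] smooth_in_local_rep(1)[OF M N c(4)] smooth_inD(5)[OF c(4)] _ u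
          smooth_atlasD(1)[OF N] smooth_in_local_rep(2)[OF M N c(4)]]) (use c in blast)
qed

text \<open>The chart chosen at \<open>F p\<close> serves as target chart of the first factor and
  source chart of the second, so the chain rule applies to the representatives with no transition
  map in between.\<close>

lemma tangent_map_compose:
  assumes M: "smooth_atlas M" and N: "smooth_atlas N" and P: "smooth_atlas P"
    and F: "smooth_at M N F p" and G: "smooth_at N P G (F p)" and u: "u \<in> model M"
  shows "tangent_map M P (\<lambda>x. G (F x)) p u = tangent_map N P G (F p) (tangent_map M N F p u)"
proof -
  obtain U \<phi> U' \<psi> W where c: "chart_at M p = (U, \<phi>)" "chart_at N (F p) = (U', \<psi>)" "p \<in> W"
    "smooth_in M N F (U, \<phi>) (U', \<psi>) W" by (rule smooth_at_chart_at[OF M N F])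
  note F' = smooth_inD[OF c(4)]
  obtain A \<alpha> T \<tau> W' where d: "chart_at N (F p) = (A, \<alpha>)" "chart_at P (G (F p)) = (T, \<tau>)" "F p \<in> W'"
    "smooth_in N P G (A, \<alpha>) (T, \<tau>) W'" by (rule smooth_at_chart_at[OF N P G])
  have [simp]: "A = U'" "\<alpha> = \<psi>" using c(2) d(1) by auto
  note d' = d(4)[simplified]
  let ?f = "\<psi> \<circ> F \<circ> inv_into U \<phi>" and ?g = "\<tau> \<circ> G \<circ> inv_into U' \<psi>"
  let ?W = "{x \<in> W. F x \<in> W'}"
  have W: "openin (mtop M) ?W"
    by (rule openin_preimage_restrict[OF F'(3) smooth_in_continuous[OF M N c(4)] smooth_inD(3)[OF d']])
  then have oW: "openin (top_of_set (model M)) (\<phi> ` ?W)"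
    by (rule chart_image_open[OF M F'(1)]) (use F'(4) in blast)
  have p: "p \<in> ?W" using c d by simp
  have rep: "?f (\<phi> x) = \<psi> (F x)" if "x \<in> W" for x by (rule smooth_in_local_rep(3)[OF M N c(4) that])
  have "der (model M) (\<lambda>x. ?g (?f x)) (\<phi> p) u = der (model N) ?g (?f (\<phi> p)) (der (model M) ?f (\<phi> p) u)"
    by (rule der_compose[OF smooth_atlasD(1)[OF M] oW smooth_on_subset[OF F'(5)] smooth_atlasD(1)[OF N]
          smooth_in_local_rep(1)[OF N P d'] smooth_inD(5)[OF d'] _ u]) (use p rep in auto)
  moreover have "der (model M) (\<tau> \<circ> (\<lambda>x. G (F x)) \<circ> inv_into U \<phi>) (\<phi> p) = der (model M) (\<lambda>x. ?g (?f x)) (\<phi> p)"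
    by (rule der_cong[OF oW]) (use p rep F' M chart_inv[OF N F'(2) F'(7)] in auto)
  ultimately show ?thesis
    using tangent_map_eq[where F=F, OF c(1,2)] tangent_map_eq[where F=G, OF c(2) d(2)]
      tangent_map_eq[where F="\<lambda>x. G (F x)", OF c(1) d(2)] rep[OF c(3)] by simp
qed

lemma tangent_map_id:
  assumes M: "smooth_atlas M" "p \<in> points M" "u \<in> model M"
  shows "tangent_map M M (\<lambda>x. x) p u = u"
proof -
  obtain U \<phi> where c: "chart_at M p = (U, \<phi>)" by (metis surj_pair)
  note U = chart_at[OF M(1,2) c]
  have o: "openin (top_of_set (model M)) (\<phi> ` U)" by (rule smooth_atlasD(3)[OF M(1) U(1)])
  have "der (model M) (\<phi> \<circ> (\<lambda>x. x) \<circ> inv_into U \<phi>) (\<phi> p) = der (model M) (\<lambda>x. x) (\<phi> p)"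
    by (rule der_cong[OF o]) (use U M in auto)
  then show ?thesis unfolding tangent_map_eq[where F="\<lambda>x. x", OF c c]
    using der_id[OF smooth_atlasD(1)[OF M(1)] _ M(3)] openin_subspace_subset[OF o] U by auto
qed

lemma tangent_map_const:
  assumes M: "smooth_atlas M" "p \<in> points M" "u \<in> model M"
  shows "tangent_map M N (\<lambda>x. q) p u = 0"
proof -
  obtain U \<phi> U' \<psi> where c: "chart_at M p = (U, \<phi>)" "chart_at N q = (U', \<psi>)" by (metis surj_pair)
  note U = chart_at[OF M(1,2) c(1)]
  have "\<phi> p \<in> model M" using openin_subspace_subset[OF smooth_atlasD(3)[OF M(1) U(1)]] U by auto
  then show ?thesis using tangent_map_eq[of M p U \<phi> N "\<lambda>x. q" U' \<psi>, OF c] der_const[OF smooth_atlasD(1)[OF M(1)] _ M(3)]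
    by (simp add: o_def)
qed

lemma chart_at_euclid: "x \<in> U \<Longrightarrow> chart_at (euclid_mfd V U) x = (U, \<lambda>x. x)"
  unfolding chart_at_def by (rule some_equality) auto

lemma tangent_map_euclid:
  assumes "openin (top_of_set V) U" "x \<in> U" "f x \<in> T"
  shows "tangent_map (euclid_mfd V U) (euclid_mfd V' T) f x = der V f x"
  unfolding tangent_map_eq[where F=f, OF chart_at_euclid[OF assms(2)] chart_at_euclid[OF assms(3)]] euclid_mfd_simps
  by (rule der_cong[OF assms(1,2)]) simp

section \<open>Product manifolds\<close>

lemma prod_mfd_simps [simp]:
  "mtop (prod_mfd M N) = prod_topology (mtop M) (mtop N)" "model (prod_mfd M N) = model M \<times> model N"
  "atlas (prod_mfd M N) = {(U \<times> U', map_prod \<phi> \<psi>) | U \<phi> U' \<psi>. (U, \<phi>) \<in> atlas M \<and> (U', \<psi>) \<in> atlas N}"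
  by (simp_all add: prod_mfd_def)

lemma inv_into_map_prod:
  assumes "inj_on \<phi> U" "inj_on \<psi> U'" "y \<in> \<phi> ` U" "z \<in> \<psi> ` U'"
  shows "inv_into (U \<times> U') (map_prod \<phi> \<psi>) (y, z) = (inv_into U \<phi> y, inv_into U' \<psi> z)"
proof -
  have "inj_on (map_prod \<phi> \<psi>) (U \<times> U')" using assms(1,2) by (auto simp: inj_on_def)
  moreover obtain a b where "a \<in> U" "b \<in> U'" "y = \<phi> a" "z = \<psi> b" using assms(3,4) by blast
  ultimately show ?thesis using inv_into_f_f[of "map_prod \<phi> \<psi>" "U \<times> U'" "(a, b)"] assms(1,2) by simp
qed

lemma smooth_atlas_prod:
  assumes M: "smooth_atlas M" and N: "smooth_atlas N"
  shows "smooth_atlas (prod_mfd M N)"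
proof -
  have op: "openin (prod_topology (mtop M) (mtop N)) (U \<times> U')"
      and op': "openin (top_of_set (model M \<times> model N)) (map_prod \<phi> \<psi> ` (U \<times> U'))"
      and hom: "homeomorphic_map (subtopology (prod_topology (mtop M) (mtop N)) (U \<times> U'))
         (top_of_set (map_prod \<phi> \<psi> ` (U \<times> U'))) (map_prod \<phi> \<psi>)"
    if U: "(U, \<phi>) \<in> atlas M" "(U', \<psi>) \<in> atlas N" for U \<phi> U' \<psi>
  proof -
    have im: "map_prod \<phi> \<psi> ` (U \<times> U') = (\<phi> ` U) \<times> (\<psi> ` U')" by auto
    show "openin (prod_topology (mtop M) (mtop N)) (U \<times> U')"
      using smooth_atlasD(2)[OF M U(1)] smooth_atlasD(2)[OF N U(2)] by (simp add: openin_prod_Times_iff)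
    show "openin (top_of_set (model M \<times> model N)) (map_prod \<phi> \<psi> ` (U \<times> U'))"
      unfolding im using smooth_atlasD(3)[OF M U(1)] smooth_atlasD(3)[OF N U(2)] by (rule openin_Times)
    obtain f g where fg: "homeomorphic_maps (subtopology (mtop M) U) (top_of_set (\<phi> ` U)) \<phi> f"
       "homeomorphic_maps (subtopology (mtop N) U') (top_of_set (\<psi> ` U')) \<psi> g"
      using smooth_atlasD(4)[OF M U(1)] smooth_atlasD(4)[OF N U(2)] unfolding homeomorphic_map_maps by blast
    have "homeomorphic_maps (prod_topology (subtopology (mtop M) U) (subtopology (mtop N) U'))
        (prod_topology (top_of_set (\<phi> ` U)) (top_of_set (\<psi> ` U'))) (\<lambda>(x, y). (\<phi> x, \<psi> y)) (\<lambda>(x, y). (f x, g y))"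
      using fg homeomorphic_maps_prod by blast
    moreover have "(\<lambda>(x, y). (\<phi> x, \<psi> y)) = map_prod \<phi> \<psi>" by (simp add: map_prod_def)
    ultimately show "homeomorphic_map (subtopology (prod_topology (mtop M) (mtop N)) (U \<times> U'))
         (top_of_set (map_prod \<phi> \<psi> ` (U \<times> U'))) (map_prod \<phi> \<psi>)"
      unfolding im subtopology_Times prod_topology_subtopology_eu[symmetric] homeomorphic_map_maps by metis
  qed
  have tr: "smooth_on (map_prod \<phi> \<psi> ` (U \<times> U' \<inter> T \<times> T')) (map_prod \<phi>' \<psi>' \<circ> inv_into (U \<times> U') (map_prod \<phi> \<psi>))"
    if U: "(U, \<phi>) \<in> atlas M" "(U', \<psi>) \<in> atlas N" "(T, \<phi>') \<in> atlas M" "(T', \<psi>') \<in> atlas N" for U \<phi> U' \<psi> T \<phi>' T' \<psi>'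
  proof -
    let ?S = "map_prod \<phi> \<psi> ` (U \<times> U' \<inter> T \<times> T')"
    have "smooth_on ?S (\<lambda>z. (\<phi>' \<circ> inv_into U \<phi>) (fst z))" "smooth_on ?S (\<lambda>z. (\<psi>' \<circ> inv_into U' \<psi>) (snd z))"
      by (rule smooth_on_compose[OF smooth_on_linear[OF bounded_linear_fst] smooth_atlasD(5)[OF M U(1,3)]],
          force, rule smooth_on_compose[OF smooth_on_linear[OF bounded_linear_snd] smooth_atlasD(5)[OF N U(2,4)]], force)
    from smooth_on_Pair[OF this] show ?thesis
      by (rule smooth_on_cong[OF _ order_refl])
        (auto simp: inv_into_map_prod[OF chart_inj[OF M U(1)] chart_inj[OF N U(2)]] M N U)
  qed
  have cover: "(\<Union>(U, \<phi>)\<in>atlas (prod_mfd M N). U) = points (prod_mfd M N)"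
  proof (intro equalityI subsetI)
    fix z assume "z \<in> points (prod_mfd M N)"
    then have "fst z \<in> points M" "snd z \<in> points N" by auto
    then obtain U \<phi> U' \<psi> where "(U, \<phi>) \<in> atlas M" "fst z \<in> U" "(U', \<psi>) \<in> atlas N" "snd z \<in> U'"
      using smooth_atlasD(6)[OF M] smooth_atlasD(6)[OF N] by metis
    then have "(U \<times> U', map_prod \<phi> \<psi>) \<in> atlas (prod_mfd M N)" "z \<in> U \<times> U'" by (auto simp: mem_Times_iff)
    then show "z \<in> (\<Union>(U, \<phi>)\<in>atlas (prod_mfd M N). U)" by blast
  next
    fix z assume "z \<in> (\<Union>(U, \<phi>)\<in>atlas (prod_mfd M N). U)"
    then obtain U \<phi> U' \<psi> where "(U, \<phi>) \<in> atlas M" "(U', \<psi>) \<in> atlas N" "z \<in> U \<times> U'" by auto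
    then show "z \<in> points (prod_mfd M N)" using chart_subset[OF M] chart_subset[OF N] by fastforce
  qed
  show ?thesis unfolding smooth_atlas_def
  proof (intro conjI)
    show "subspace (model (prod_mfd M N))" using smooth_atlasD(1)[OF M] smooth_atlasD(1)[OF N] by (simp add: subspace_Times)
    show "\<forall>(U, \<phi>)\<in>atlas (prod_mfd M N). openin (mtop (prod_mfd M N)) U \<and>
       openin (top_of_set (model (prod_mfd M N))) (\<phi> ` U) \<and>
       homeomorphic_map (subtopology (mtop (prod_mfd M N)) U) (top_of_set (\<phi> ` U)) \<phi>"
      unfolding prod_mfd_simps using op op' hom by blast
    show "\<forall>(U, \<phi>)\<in>atlas (prod_mfd M N). \<forall>(U', \<psi>)\<in>atlas (prod_mfd M N).
       smooth_on (\<phi> ` (U \<inter> U')) (\<psi> \<circ> inv_into U \<phi>)"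
      unfolding prod_mfd_simps using tr by blast
  qed (rule cover)
qed

lemma smooth_at_Pair:
  assumes A: "smooth_atlas A" and M: "smooth_atlas M" and N: "smooth_atlas N"
    and f: "smooth_at A M f p" and g: "smooth_at A N g p"
  shows "smooth_at A (prod_mfd M N) (\<lambda>x. (f x, g x)) p"
proof -
  obtain U \<phi> U' \<psi> W where 1: "p \<in> W" "smooth_in A M f (U, \<phi>) (U', \<psi>) W"
    by (rule smooth_atD[OF f])
  note F = smooth_inD[OF 1(2)]
  obtain T \<tau> where T: "(T, \<tau>) \<in> atlas N" "g p \<in> T"
    using smooth_atlasD(6)[OF N smooth_at_points(2)[OF A N g]] by blast
  obtain W' where 2: "p \<in> W'" "smooth_in A N g (U, \<phi>) (T, \<tau>) W'"
    by (rule smooth_atE[OF A N g F(1) F(6)[OF 1(1)] T])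
  note G = smooth_inD[OF 2(2)]
  have "smooth_on (\<phi> ` (W \<inter> W')) (\<lambda>y. ((\<psi> \<circ> f \<circ> inv_into U \<phi>) y, (\<tau> \<circ> g \<circ> inv_into U \<phi>) y))"
    by (rule smooth_on_Pair[OF smooth_on_subset[OF F(5)] smooth_on_subset[OF G(5)]]) auto
  then have "smooth_on (\<phi> ` (W \<inter> W')) (map_prod \<psi> \<tau> \<circ> (\<lambda>x. (f x, g x)) \<circ> inv_into U \<phi>)"
    by (rule smooth_on_cong[OF _ order_refl]) auto
  then have "smooth_in A (prod_mfd M N) (\<lambda>x. (f x, g x)) (U, \<phi>) (U' \<times> T, map_prod \<psi> \<tau>) (W \<inter> W')"
    using F G by (intro smooth_inI) auto
  then show ?thesis by (rule smooth_atI[rotated]) (use 1 2 in simp)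
qed

lemma smooth_at_fst:
  assumes M: "smooth_atlas M" and N: "smooth_atlas N" and p: "p \<in> points M" "q \<in> points N"
  shows "smooth_at (prod_mfd M N) M fst (p, q)"
proof -
  obtain U \<phi> where U: "(U, \<phi>) \<in> atlas M" "p \<in> U" using smooth_atlasD(6)[OF M p(1)] by blast
  obtain W \<psi> where W: "(W, \<psi>) \<in> atlas N" "q \<in> W" using smooth_atlasD(6)[OF N p(2)] by blast
  have i: "inj_on \<phi> U" "inj_on \<psi> W" by (rule chart_inj[OF M U(1)], rule chart_inj[OF N W(1)])
  have "smooth_on (map_prod \<phi> \<psi> ` (U \<times> W)) fst" by (rule smooth_on_linear[OF bounded_linear_fst])
  then have "smooth_on (map_prod \<phi> \<psi> ` (U \<times> W)) (\<phi> \<circ> fst \<circ> inv_into (U \<times> W) (map_prod \<phi> \<psi>))"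
    by (rule smooth_on_cong[OF _ order_refl]) (use i in \<open>auto simp: inv_into_map_prod\<close>)
  moreover have "openin (mtop (prod_mfd M N)) (U \<times> W)"
    using smooth_atlasD(2)[OF M U(1)] smooth_atlasD(2)[OF N W(1)] by (simp add: openin_prod_Times_iff)
  ultimately have "smooth_in (prod_mfd M N) M fst (U \<times> W, map_prod \<phi> \<psi>) (U, \<phi>) (U \<times> W)"
    using U(1) W(1) by (intro smooth_inI) auto
  then show ?thesis by (rule smooth_atI[rotated]) (use U W in simp)
qed

lemma smooth_at_snd:
  assumes M: "smooth_atlas M" and N: "smooth_atlas N" and p: "p \<in> points M" "q \<in> points N"
  shows "smooth_at (prod_mfd M N) N snd (p, q)"
proof -
  obtain U \<phi> where U: "(U, \<phi>) \<in> atlas M" "p \<in> U" using smooth_atlasD(6)[OF M p(1)] by blast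
  obtain W \<psi> where W: "(W, \<psi>) \<in> atlas N" "q \<in> W" using smooth_atlasD(6)[OF N p(2)] by blast
  have i: "inj_on \<phi> U" "inj_on \<psi> W" by (rule chart_inj[OF M U(1)], rule chart_inj[OF N W(1)])
  have "smooth_on (map_prod \<phi> \<psi> ` (U \<times> W)) snd" by (rule smooth_on_linear[OF bounded_linear_snd])
  then have "smooth_on (map_prod \<phi> \<psi> ` (U \<times> W)) (\<psi> \<circ> snd \<circ> inv_into (U \<times> W) (map_prod \<phi> \<psi>))"
    by (rule smooth_on_cong[OF _ order_refl]) (use i in \<open>auto simp: inv_into_map_prod\<close>)
  moreover have "openin (mtop (prod_mfd M N)) (U \<times> W)"
    using smooth_atlasD(2)[OF M U(1)] smooth_atlasD(2)[OF N W(1)] by (simp add: openin_prod_Times_iff)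
  ultimately have "smooth_in (prod_mfd M N) N snd (U \<times> W, map_prod \<phi> \<psi>) (W, \<psi>) (U \<times> W)"
    using U(1) W(1) by (intro smooth_inI) auto
  then show ?thesis by (rule smooth_atI[rotated]) (use U W in simp)
qed

text \<open>The chart chosen at a point of a product need not be built from the charts chosen at its
  components, so the tangent map of a pair is not the pair of tangent maps. Freezing one component
  at a time gives a statement that holds in every product chart.\<close>

lemma tangent_map_Pair_split:
  assumes A: "smooth_atlas A" and M: "smooth_atlas M" and N: "smooth_atlas N"
    and f: "smooth_at A M f p" and g: "smooth_at A N g p" and u: "u \<in> model A"
  shows "tangent_map A (prod_mfd M N) (\<lambda>x. (f x, g x)) p u =
    tangent_map A (prod_mfd M N) (\<lambda>x. (f x, g p)) p u + tangent_map A (prod_mfd M N) (\<lambda>x. (f p, g x)) p u"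
proof -
  note MN = smooth_atlas_prod[OF M N]
  note fg = smooth_at_Pair[OF A M N f g]
  obtain U \<phi> P \<theta> W where c: "chart_at A p = (U, \<phi>)" "chart_at (prod_mfd M N) (f p, g p) = (P, \<theta>)" "p \<in> W"
    "smooth_in A (prod_mfd M N) (\<lambda>x. (f x, g x)) (U, \<phi>) (P, \<theta>) W"
    by (rule smooth_at_chart_at[OF A MN fg])
  note F = smooth_inD[OF c(4)]
  obtain U1 \<phi>1 U2 \<phi>2 where P: "P = U1 \<times> U2" "\<theta> = map_prod \<phi>1 \<phi>2" "(U1, \<phi>1) \<in> atlas M" "(U2, \<phi>2) \<in> atlas N"
    using F(2) by auto
  let ?f = "\<lambda>y. \<phi>1 (f (inv_into U \<phi> y))" and ?g = "\<lambda>y. \<phi>2 (g (inv_into U \<phi> y))"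
  have sm: "smooth_on (\<phi> ` W) ?f" "smooth_on (\<phi> ` W) ?g"
    using smooth_on_fst[OF F(5)] smooth_on_snd[OF F(5)] by (simp_all add: P o_def)
  have o: "openin (top_of_set (model A)) (\<phi> ` W)" by (rule smooth_in_local_rep(1)[OF A MN c(4)])
  note V = smooth_atlasD(1)[OF A]
  have p: "\<phi> p \<in> \<phi> ` W" using c by blast
  have z: "der (model A) (\<lambda>y. c) (\<phi> p) u = 0" for c :: 'd
    using der_const[OF V _ u] openin_subspace_subset[OF o] p by blast
  have z': "der (model A) (\<lambda>y. c) (\<phi> p) u = 0" for c :: 'f
    using der_const[OF V _ u] openin_subspace_subset[OF o] p by blast
  have e1: "der (model A) (\<lambda>y. (?f y, ?g y)) (\<phi> p) u = (der (model A) ?f (\<phi> p) u, der (model A) ?g (\<phi> p) u)"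
    by (rule der_Pair[OF V o sm p u])
  have e2: "der (model A) (\<lambda>y. (?f y, \<phi>2 (g p))) (\<phi> p) u = (der (model A) ?f (\<phi> p) u, 0)"
    using der_Pair[OF V o sm(1) smooth_on_const p u] z' by metis
  have e3: "der (model A) (\<lambda>y. (\<phi>1 (f p), ?g y)) (\<phi> p) u = (0, der (model A) ?g (\<phi> p) u)"
    using der_Pair[OF V o smooth_on_const sm(2) p u] z by metis
  show ?thesis
    unfolding tangent_map_eq[of A p U \<phi> "prod_mfd M N" "\<lambda>x. (f x, g x)" P \<theta>, OF c(1,2)]
      tangent_map_eq[of A p U \<phi> "prod_mfd M N" "\<lambda>x. (f x, g p)" P \<theta>, OF c(1,2)]
      tangent_map_eq[of A p U \<phi> "prod_mfd M N" "\<lambda>x. (f p, g x)" P \<theta>, OF c(1,2)]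
    using e1 e2 e3 by (simp add: P o_def)
qed

text \<open>Splits the derivative of the group action into the effect of the group element and the
  effect of the point.\<close>

lemma tangent_map_Leibniz:
  assumes A: "smooth_atlas A" and M: "smooth_atlas M" and N: "smooth_atlas N" and P: "smooth_atlas P"
    and f: "smooth_at A M f p" and g: "smooth_at A N g p" and u: "u \<in> model A"
    and m: "smooth_at (prod_mfd M N) P (\<lambda>(x, y). m x y) (f p, g p)"
  shows "tangent_map A P (\<lambda>x. m (f x) (g x)) p u =
    tangent_map A P (\<lambda>x. m (f x) (g p)) p u + tangent_map A P (\<lambda>x. m (f p) (g x)) p u"
proof -
  note MN = smooth_atlas_prod[OF M N]
  have pA: "p \<in> points A" by (rule smooth_at_points(1)[OF A M f])
  note cf = smooth_at_const[OF A M pA smooth_at_points(2)[OF A M f]]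
    and cg = smooth_at_const[OF A N pA smooth_at_points(2)[OF A N g]]
  note s = tangent_map_compose[OF A MN P _ _ u, of _ p "\<lambda>(x, y). m x y"]
  have 1: "tangent_map A P (\<lambda>x. m (f x) (g x)) p u =
      tangent_map (prod_mfd M N) P (\<lambda>(x, y). m x y) (f p, g p) (tangent_map A (prod_mfd M N) (\<lambda>x. (f x, g x)) p u)"
    using s[OF smooth_at_Pair[OF A M N f g]] m by simp
  have 2: "tangent_map A P (\<lambda>x. m (f x) (g p)) p u =
      tangent_map (prod_mfd M N) P (\<lambda>(x, y). m x y) (f p, g p) (tangent_map A (prod_mfd M N) (\<lambda>x. (f x, g p)) p u)"
    using s[OF smooth_at_Pair[OF A M N f cg]] m by simp
  have 3: "tangent_map A P (\<lambda>x. m (f p) (g x)) p u =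
      tangent_map (prod_mfd M N) P (\<lambda>(x, y). m x y) (f p, g p) (tangent_map A (prod_mfd M N) (\<lambda>x. (f p, g x)) p u)"
    using s[OF smooth_at_Pair[OF A M N cf g]] m by simp
  show ?thesis unfolding 1 2 3 tangent_map_Pair_split[OF A M N f g u]
    using linear_add[OF tangent_map_linear[OF MN P m]] by simp
qed

section \<open>Regular level sets\<close>

text \<open>A linear map that is injective on the kernel of the derivative completes
  \<open>f\<close> to a local diffeomorphism, because the dimensions of \<open>L\<close> and
  \<open>W\<close> add up to that of \<open>V\<close>.\<close>

lemma submersion_straighten:
  fixes f :: "'a::euclidean_space \<Rightarrow> 'b::euclidean_space" and \<beta> :: "'a \<Rightarrow> 'c::euclidean_space"
  assumes V: "subspace V" "openin (top_of_set V) S" "smooth_on S f" and L: "subspace L" "f ` S \<subseteq> L"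
    and y0: "y0 \<in> S" "der V f y0 ` V = L"
    and W: "subspace W" "linear \<beta>" "\<beta> ` V \<subseteq> W" "inj_on \<beta> {v \<in> V. der V f y0 v = 0}" "dim W + dim L = dim V"
  obtains S' g where "openin (top_of_set V) S'" "S' \<subseteq> S" "y0 \<in> S'"
    "openin (top_of_set (L \<times> W)) ((\<lambda>y. (f y, \<beta> (y - y0))) ` S')"
    "\<And>y. y \<in> S' \<Longrightarrow> g (f y, \<beta> (y - y0)) = y"
    "smooth_on ((\<lambda>y. (f y, \<beta> (y - y0))) ` S') g"
proof -
  let ?F = "\<lambda>y. (f y, \<beta> (y - y0))"
  have b\<beta>: "bounded_linear \<beta>" using W(2) by (simp add: linear_conv_bounded_linear)
  have y0V: "y0 \<in> V" using y0(1) openin_subspace_subset[OF V(2)] by blast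
  have sd: "smooth_on S (\<lambda>y. y - y0)" by (rule smooth_on_diff[OF smooth_on_id smooth_on_const])
  have s\<beta>: "smooth_on S (\<lambda>y. \<beta> (y - y0))" by (rule smooth_on_linear_compose[OF b\<beta> sd])
  have sF: "smooth_on S ?F" by (rule smooth_on_Pair[OF V(3) s\<beta>])
  have d\<beta>: "der V (\<lambda>y. \<beta> (y - y0)) y0 u = \<beta> u" if "u \<in> V" for u
  proof (rule der_eqI[OF V(1) y0V that])
    have "((\<lambda>y. y - y0) has_derivative (\<lambda>u. u)) (at y0 within V)" by (auto intro!: derivative_eq_intros)
    then show "((\<lambda>y. \<beta> (y - y0)) has_derivative \<beta>) (at y0 within V)"
      using bounded_linear.has_derivative[OF b\<beta>] by fastforce
  qed
  have dF: "der V ?F y0 u = (der V f y0 u, \<beta> u)" if "u \<in> V" for u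
    using der_Pair[OF V(1,2,3) s\<beta> y0(1) that] d\<beta>[OF that] by simp
  have LW: "subspace (L \<times> W)" using L(1) W(1) by (rule subspace_Times)
  have FS: "?F ` S \<subseteq> L \<times> W"
    using L(2) W(3) openin_subspace_subset[OF V(2)] subspace_diff[OF V(1) _ y0V] by fastforce
  have "inj_on (der V ?F y0) V"
  proof (rule inj_onI)
    fix u v assume uv: "u \<in> V" "v \<in> V" "der V ?F y0 u = der V ?F y0 v"
    then have *: "der V f y0 u = der V f y0 v" "\<beta> u = \<beta> v" using dF by auto
    have "u - v \<in> V" "0 \<in> V" using uv V(1) by (auto intro: subspace_diff subspace_0)
    moreover have "der V f y0 (u - v) = 0" "der V f y0 0 = 0" "\<beta> (u - v) = \<beta> 0"
      using * linear_diff[OF der_linear[OF V y0(1)]] linear_0[OF der_linear[OF V y0(1)]] linear_diff[OF W(2)] linear_0[OF W(2)] by auto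
    ultimately have "u - v = 0" using inj_onD[OF W(4), of "u - v" 0] by blast
    then show "u = v" by simp
  qed
  moreover have "dim V = dim (L \<times> W)" using W(5) dim_Times[OF L(1) W(1)] by simp
  ultimately show ?thesis
    by (rule inverse_function_on_subspace[OF V(1,2) sF LW FS y0(1)]) (rule that)
qed

text \<open>\<open>\<theta>\<close> is smooth on an open set of \<open>M\<close> and restricts to a
  chart of \<open>S\<close> whose inverse \<open>\<tau>\<close> is smooth into \<open>M\<close>.
  With both maps on the ambient side, transition maps are compositions of smooth maps through
  \<open>M\<close>.\<close>

definition slice :: "('a, 'e::euclidean_space) mfd \<Rightarrow> 'a set \<Rightarrow> 'e set \<Rightarrow> 'a set \<Rightarrow> ('a \<Rightarrow> 'e) \<Rightarrow> ('e \<Rightarrow> 'a) \<Rightarrow> bool" where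
  "slice M S V U \<theta> \<tau> \<longleftrightarrow> openin (mtop M) U \<and> (\<forall>p\<in>U. smooth_at M (euclid_mfd V V) \<theta> p) \<and>
     openin (top_of_set V) (\<theta> ` (U \<inter> S)) \<and>
     (\<forall>y\<in>\<theta> ` (U \<inter> S). smooth_at (euclid_mfd V V) M \<tau> y) \<and> (\<forall>p\<in>U \<inter> S. \<tau> (\<theta> p) = p)"

text \<open>All slices are taken into the atlas at once, so no choice of charts enters.\<close>

definition slice_mfd :: "('a, 'e::euclidean_space) mfd \<Rightarrow> 'a set \<Rightarrow> 'e set \<Rightarrow> ('a, 'e) mfd" where
  "slice_mfd M S V = \<lparr>mtop = subtopology (mtop M) S, model = V,
     atlas = {(U \<inter> S, \<theta>) | U \<theta>. \<exists>\<tau>. slice M S V U \<theta> \<tau>}\<rparr>"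

lemma slice_mfd_simps [simp]:
  "mtop (slice_mfd M S V) = subtopology (mtop M) S" "model (slice_mfd M S V) = V"
  "atlas (slice_mfd M S V) = {(U \<inter> S, \<theta>) | U \<theta>. \<exists>\<tau>. slice M S V U \<theta> \<tau>}"
  by (simp_all add: slice_mfd_def)

lemma sliceD:
  assumes "slice M S V U \<theta> \<tau>"
  shows "openin (mtop M) U" "\<And>p. p \<in> U \<Longrightarrow> smooth_at M (euclid_mfd V V) \<theta> p"
    "openin (top_of_set V) (\<theta> ` (U \<inter> S))" "\<And>y. y \<in> \<theta> ` (U \<inter> S) \<Longrightarrow> smooth_at (euclid_mfd V V) M \<tau> y"
    "\<And>p. p \<in> U \<Longrightarrow> p \<in> S \<Longrightarrow> \<tau> (\<theta> p) = p"
  using assms unfolding slice_def by auto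

lemma smooth_at_imp_continuous_map:
  assumes "smooth_atlas M" "smooth_atlas N" "openin (mtop M) W" "\<And>p. p \<in> W \<Longrightarrow> smooth_at M N F p"
  shows "continuous_map (subtopology (mtop M) W) (mtop N) F"
  using smooth_map_onI[OF assms] by (simp add: smooth_map_on_def)

lemma slice_inv:
  assumes "slice M S V U \<theta> \<tau>" "y \<in> \<theta> ` (U \<inter> S)"
  shows "inv_into (U \<inter> S) \<theta> y = \<tau> y" "inj_on \<theta> (U \<inter> S)"
proof -
  show inj: "inj_on \<theta> (U \<inter> S)" by (rule inj_on_inverseI[of _ \<tau>]) (use sliceD(5)[OF assms(1)] in auto)
  obtain p where "p \<in> U \<inter> S" "y = \<theta> p" using assms(2) by blast
  then show "inv_into (U \<inter> S) \<theta> y = \<tau> y" using inv_into_f_f[OF inj] sliceD(5)[OF assms(1)] by simp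
qed

lemma smooth_manifold_slice_mfd:
  assumes M: "smooth_manifold M" and V: "subspace V" and S: "S \<subseteq> points M"
    and sl: "\<And>p. p \<in> S \<Longrightarrow> \<exists>U \<theta> \<tau>. p \<in> U \<and> slice M S V U \<theta> \<tau>"
  shows "smooth_manifold (slice_mfd M S V)"
proof -
  note Ma = smooth_manifold_imp_atlas[OF M]
  have VV: "openin (top_of_set V) V" by simp
  note E = smooth_atlas_euclid[OF V VV]
  have chart: "homeomorphic_map (subtopology (subtopology (mtop M) S) (U \<inter> S)) (top_of_set (\<theta> ` (U \<inter> S))) \<theta>"
    if s: "slice M S V U \<theta> \<tau>" for U \<theta> \<tau>
  proof -
    have t: "subtopology (subtopology (mtop M) S) (U \<inter> S) = subtopology (mtop M) (U \<inter> S)"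
      by (simp add: subtopology_subtopology Int_commute Int_left_commute)
    have "continuous_map (subtopology (mtop M) U) (top_of_set V) \<theta>"
      using smooth_at_imp_continuous_map[OF Ma E sliceD(1,2)[OF s]] by simp
    then have "continuous_map (subtopology (mtop M) (U \<inter> S)) (top_of_set V) \<theta>"
      by (rule continuous_map_from_subtopology_mono) blast
    then have "continuous_map (subtopology (mtop M) (U \<inter> S)) euclidean \<theta>"
      by (rule continuous_map_into_fulltopology)
    then have 1: "continuous_map (subtopology (mtop M) (U \<inter> S)) (top_of_set (\<theta> ` (U \<inter> S))) \<theta>"
      by (rule continuous_map_into_subtopology) auto
    have W: "openin (mtop (euclid_mfd V V)) (\<theta> ` (U \<inter> S))" using sliceD(3)[OF s] by simp
    have "continuous_map (subtopology (top_of_set V) (\<theta> ` (U \<inter> S))) (mtop M) \<tau>"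
      using smooth_at_imp_continuous_map[OF E Ma W sliceD(4)[OF s]] by simp
    moreover have "subtopology (top_of_set V) (\<theta> ` (U \<inter> S)) = top_of_set (\<theta> ` (U \<inter> S))"
      using openin_subspace_subset[OF sliceD(3)[OF s]] by (simp add: subtopology_subtopology inf.absorb2)
    ultimately have "continuous_map (top_of_set (\<theta> ` (U \<inter> S))) (mtop M) \<tau>" by simp
    then have 2: "continuous_map (top_of_set (\<theta> ` (U \<inter> S))) (subtopology (mtop M) (U \<inter> S)) \<tau>"
      by (rule continuous_map_into_subtopology) (use sliceD(5)[OF s] in auto)
    have "homeomorphic_maps (subtopology (mtop M) (U \<inter> S)) (top_of_set (\<theta> ` (U \<inter> S))) \<theta> \<tau>"
      using 1 2 sliceD(5)[OF s] by (auto simp: homeomorphic_maps_def)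
    then show ?thesis unfolding t homeomorphic_map_maps by blast
  qed
  have trans: "smooth_on (\<theta> ` ((U \<inter> S) \<inter> (U' \<inter> S))) (\<theta>' \<circ> inv_into (U \<inter> S) \<theta>)"
    if s: "slice M S V U \<theta> \<tau>" "slice M S V U' \<theta>' \<tau>'" for U \<theta> \<tau> U' \<theta>' \<tau>'
  proof (rule smooth_on_local)
    let ?S = "\<theta> ` ((U \<inter> S) \<inter> (U' \<inter> S))"
    fix y assume "y \<in> ?S"
    then obtain p where p: "p \<in> U" "p \<in> U'" "p \<in> S" "y = \<theta> p" by blast
    have y: "y \<in> \<theta> ` (U \<inter> S)" "\<tau> y = p" using p sliceD(5)[OF s(1)] by auto
    have "smooth_at (euclid_mfd V V) (euclid_mfd V V) (\<lambda>z. \<theta>' (\<tau> z)) y"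
      using smooth_at_compose[OF E Ma E sliceD(4)[OF s(1) y(1)]] sliceD(2)[OF s(2)] p(2) y(2) by blast
    then obtain W where W: "openin (top_of_set V) W" "y \<in> W" "smooth_on W (\<lambda>z. \<theta>' (\<tau> z))"
      by (rule smooth_at_euclidE[OF VV])
    obtain T where T: "open T" "W = V \<inter> T" using W(1) openin_open by metis
    have "?S \<subseteq> V" using openin_subspace_subset[OF sliceD(3)[OF s(1)]] by blast
    then have "?S \<inter> W = ?S \<inter> T" using T(2) by blast
    then have "openin (top_of_set ?S) (?S \<inter> W)" using T(1) by (simp add: openin_open_Int)
    moreover have "smooth_on (?S \<inter> W) (\<theta>' \<circ> inv_into (U \<inter> S) \<theta>)"
      by (rule smooth_on_cong[OF W(3)]) (auto simp: slice_inv[OF s(1)])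
    ultimately show "\<exists>T. openin (top_of_set ?S) T \<and> y \<in> T \<and> smooth_on T (\<theta>' \<circ> inv_into (U \<inter> S) \<theta>)"
      using \<open>y \<in> ?S\<close> W(2) by blast
  qed
  have cover: "(\<Union>(U, \<phi>)\<in>atlas (slice_mfd M S V). U) = points (slice_mfd M S V)"
  proof (intro equalityI subsetI)
    fix p assume "p \<in> (\<Union>(U, \<phi>)\<in>atlas (slice_mfd M S V). U)"
    then show "p \<in> points (slice_mfd M S V)" using S by auto
  next
    fix p assume "p \<in> points (slice_mfd M S V)"
    then have p: "p \<in> S" by simp
    then obtain U \<theta> \<tau> where "p \<in> U" "slice M S V U \<theta> \<tau>" using sl by blast
    then have "(U \<inter> S, \<theta>) \<in> atlas (slice_mfd M S V)" "p \<in> U \<inter> S" using p by auto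
    then show "p \<in> (\<Union>(U, \<phi>)\<in>atlas (slice_mfd M S V). U)" by blast
  qed
  show ?thesis unfolding smooth_manifold_def
  proof (intro conjI)
    show "Hausdorff_space (mtop (slice_mfd M S V))" "second_countable (mtop (slice_mfd M S V))"
      using M by (simp_all add: smooth_manifold_def Hausdorff_space_subtopology second_countable_subtopology)
    show "subspace (model (slice_mfd M S V))" using V by simp
    show "\<forall>(U, \<phi>)\<in>atlas (slice_mfd M S V). openin (mtop (slice_mfd M S V)) U \<and>
       openin (top_of_set (model (slice_mfd M S V))) (\<phi> ` U) \<and>
       homeomorphic_map (subtopology (mtop (slice_mfd M S V)) U) (top_of_set (\<phi> ` U)) \<phi>"
    proof (intro ballI)
      fix c assume "c \<in> atlas (slice_mfd M S V)"
      then obtain U \<theta> \<tau> where c: "c = (U \<inter> S, \<theta>)" "slice M S V U \<theta> \<tau>" by auto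
      have "openin (subtopology (mtop M) S) (U \<inter> S)" using sliceD(1)[OF c(2)] openin_subtopology by blast
      then show "case c of (U, \<phi>) \<Rightarrow> openin (mtop (slice_mfd M S V)) U \<and>
       openin (top_of_set (model (slice_mfd M S V))) (\<phi> ` U) \<and>
       homeomorphic_map (subtopology (mtop (slice_mfd M S V)) U) (top_of_set (\<phi> ` U)) \<phi>"
        using sliceD(3)[OF c(2)] chart[OF c(2)] by (simp add: c(1))
    qed
    show "\<forall>(U, \<phi>)\<in>atlas (slice_mfd M S V). \<forall>(U', \<psi>)\<in>atlas (slice_mfd M S V). smooth_on (\<phi> ` (U \<inter> U')) (\<psi> \<circ> inv_into U \<phi>)"
    proof (intro ballI)
      fix c d assume "c \<in> atlas (slice_mfd M S V)"
      then obtain U \<theta> \<tau> where c: "c = (U \<inter> S, \<theta>)" "slice M S V U \<theta> \<tau>" by auto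
      have "smooth_on (\<theta> ` ((U \<inter> S) \<inter> U')) (\<psi> \<circ> inv_into (U \<inter> S) \<theta>)"
        if "(U', \<psi>) \<in> atlas (slice_mfd M S V)" for U' \<psi>
        using trans[OF c(2)] that by auto
      then show "case c of (U, \<phi>) \<Rightarrow> \<forall>(U', \<psi>)\<in>atlas (slice_mfd M S V). smooth_on (\<phi> ` (U \<inter> U')) (\<psi> \<circ> inv_into U \<phi>)"
        unfolding c(1) by blast
    qed
  qed (rule cover)
qed

lemma tangent_map_left_inverse:
  assumes M: "smooth_atlas M" and N: "smooth_atlas N" and F: "smooth_at M N F p" and G: "smooth_at N M G (F p)"
    and W: "openin (mtop M) W" "p \<in> W" "\<And>x. x \<in> W \<Longrightarrow> G (F x) = x" and u: "u \<in> model M"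
  shows "tangent_map N M G (F p) (tangent_map M N F p u) = u"
proof -
  have "tangent_map N M G (F p) (tangent_map M N F p u) = tangent_map M M (\<lambda>x. G (F x)) p u"
    by (rule tangent_map_compose[OF M N M F G u, symmetric])
  also have "\<dots> = tangent_map M M (\<lambda>x. x) p u"
    by (rule fun_cong[OF tangent_map_cong[OF M W]])
  finally show ?thesis using tangent_map_id[OF M smooth_at_points(1)[OF M N F] u] by simp
qed

text \<open>Near \<open>p\<close> the inclusion is \<open>\<tau>\<close> after
  \<open>\<theta>\<close>. Its tangent map is injective because the tangent map of the chart
  \<open>\<theta>\<close> factors through it.\<close>

lemma slice_mfd_incl:
  assumes M: "smooth_manifold M" and V: "subspace V" and S: "S \<subseteq> points M"
    and sl: "\<And>p. p \<in> S \<Longrightarrow> \<exists>U \<theta> \<tau>. p \<in> U \<and> slice M S V U \<theta> \<tau>" and p: "p \<in> S"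
  shows "smooth_at (slice_mfd M S V) M (\<lambda>x. x) p"
    "inj_on (tangent_map (slice_mfd M S V) M (\<lambda>x. x) p) V"
proof -
  let ?N = "slice_mfd M S V"
  note Ma = smooth_manifold_imp_atlas[OF M]
  note N = smooth_manifold_imp_atlas[OF smooth_manifold_slice_mfd[OF M V S sl]]
  have VV: "openin (top_of_set V) V" by simp
  note E = smooth_atlas_euclid[OF V VV]
  obtain U \<theta> \<tau> where U: "p \<in> U" "slice M S V U \<theta> \<tau>" using sl[OF p] by blast
  have US: "openin (mtop ?N) (U \<inter> S)" using sliceD(1)[OF U(2)] openin_subtopology by auto
  have c: "(U \<inter> S, \<theta>) \<in> atlas ?N" using U(2) by auto
  have pU: "p \<in> U \<inter> S" "\<theta> p \<in> \<theta> ` (U \<inter> S)" using U(1) p by auto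
  have \<theta>V: "\<theta> p \<in> V" using pU(2) openin_subspace_subset[OF sliceD(3)[OF U(2)]] by blast
  have s\<theta>: "smooth_at ?N (euclid_mfd V V) \<theta> p"
    using smooth_at_chart[OF N c pU(1), of V] \<theta>V by simp
  have s\<tau>: "smooth_at (euclid_mfd V V) M \<tau> (\<theta> p)" by (rule sliceD(4)[OF U(2) pU(2)])
  show i: "smooth_at ?N M (\<lambda>x. x) p"
    by (rule smooth_at_cong[OF smooth_at_compose[OF N E Ma s\<theta> s\<tau>] US pU(1) _ N]) (use sliceD(5)[OF U(2)] in auto)
  have s\<theta>': "smooth_at M (euclid_mfd V V) \<theta> p" by (rule sliceD(2)[OF U(2,1)])
  have s\<iota>: "smooth_at (euclid_mfd V V) ?N (inv_into (U \<inter> S) \<theta>) (\<theta> p)"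
    using smooth_at_chart_inv[OF N c, of V "\<theta> p"] \<theta>V pU(2) by simp
  show "inj_on (tangent_map ?N M (\<lambda>x. x) p) V"
  proof (rule inj_onI)
    fix u v assume uv: "u \<in> V" "v \<in> V" "tangent_map ?N M (\<lambda>x. x) p u = tangent_map ?N M (\<lambda>x. x) p v"
    have "tangent_map ?N (euclid_mfd V V) \<theta> p w = tangent_map M (euclid_mfd V V) \<theta> p (tangent_map ?N M (\<lambda>x. x) p w)" if "w \<in> V" for w
      using tangent_map_compose[OF N Ma E i s\<theta>'] that by simp
    then have "tangent_map ?N (euclid_mfd V V) \<theta> p u = tangent_map ?N (euclid_mfd V V) \<theta> p v" using uv by simp
    moreover have "tangent_map (euclid_mfd V V) ?N (inv_into (U \<inter> S) \<theta>) (\<theta> p) (tangent_map ?N (euclid_mfd V V) \<theta> p w) = w" if "w \<in> V" for w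
      by (rule tangent_map_left_inverse[OF N E s\<theta> s\<iota> US pU(1)]) (use that chart_inv[OF N c] in auto)
    ultimately show "u = v" using uv by metis
  qed
qed

lemma embedded_submanifold_slice_mfd:
  assumes M: "smooth_manifold M" and V: "subspace V" and S: "S \<subseteq> points M"
    and sl: "\<And>p. p \<in> S \<Longrightarrow> \<exists>U \<theta> \<tau>. p \<in> U \<and> slice M S V U \<theta> \<tau>"
  shows "embedded_submanifold (slice_mfd M S V) S M"
proof -
  note N = smooth_manifold_slice_mfd[OF M V S sl]
  have "smooth_map (slice_mfd M S V) M (\<lambda>x. x)"
    by (rule smooth_map_onI[OF smooth_manifold_imp_atlas[OF N] smooth_manifold_imp_atlas[OF M]])
      (use slice_mfd_incl(1)[OF M V S sl] openin_topspace[of "subtopology (mtop M) S"] in \<open>simp_all\<close>)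
  then show ?thesis using N S slice_mfd_incl(2)[OF M V S sl] by (simp add: embedded_submanifold_def)
qed

text \<open>In a slice the map is the inverse chart after \<open>\<theta>\<close> after
  \<open>F\<close>; it matters here that \<open>\<theta>\<close> is smooth on an open set of
  \<open>M\<close> and not only along \<open>S\<close>.\<close>

lemma smooth_at_into_slice_mfd:
  assumes M: "smooth_manifold M" and V: "subspace V" and S: "S \<subseteq> points M"
    and sl: "\<And>p. p \<in> S \<Longrightarrow> \<exists>U \<theta> \<tau>. p \<in> U \<and> slice M S V U \<theta> \<tau>"
    and P: "smooth_atlas P" and F: "smooth_at P M F p" and W: "openin (mtop P) W" "p \<in> W" "\<And>x. x \<in> W \<Longrightarrow> F x \<in> S"
  shows "smooth_at P (slice_mfd M S V) F p"
proof -
  let ?N = "slice_mfd M S V"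
  note Ma = smooth_manifold_imp_atlas[OF M]
  note N = smooth_manifold_imp_atlas[OF smooth_manifold_slice_mfd[OF M V S sl]]
  have VV: "openin (top_of_set V) V" by simp
  note E = smooth_atlas_euclid[OF V VV]
  obtain U \<theta> \<tau> where U: "F p \<in> U" "slice M S V U \<theta> \<tau>" using sl[OF W(3)[OF W(2)]] by blast
  have c: "(U \<inter> S, \<theta>) \<in> atlas ?N" using U(2) by auto
  have Fp: "F p \<in> U \<inter> S" "\<theta> (F p) \<in> \<theta> ` (U \<inter> S)" using U(1) W by auto
  have \<theta>V: "\<theta> (F p) \<in> V" using Fp(2) openin_subspace_subset[OF sliceD(3)[OF U(2)]] by blast
  have "smooth_at (euclid_mfd V V) ?N (inv_into (U \<inter> S) \<theta>) (\<theta> (F p))"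
    using smooth_at_chart_inv[OF N c, of V "\<theta> (F p)"] \<theta>V Fp(2) by simp
  from smooth_at_compose[OF P E N smooth_at_compose[OF P Ma E F sliceD(2)[OF U(2,1)]] this]
  have s: "smooth_at P ?N (\<lambda>x. inv_into (U \<inter> S) \<theta> (\<theta> (F x))) p" .
  obtain A \<phi> B \<psi> W' where W': "p \<in> W'" "smooth_in P M F (A, \<phi>) (B, \<psi>) W'" by (rule smooth_atD[OF F])
  have "openin (mtop P) {x \<in> W'. F x \<in> U}"
    by (rule openin_preimage_restrict[OF smooth_inD(3)[OF W'(2)] smooth_in_continuous[OF P Ma W'(2)] sliceD(1)[OF U(2)]])
  then have o: "openin (mtop P) (W \<inter> {x \<in> W'. F x \<in> U})" using W(1) by blast
  show ?thesis
    by (rule smooth_at_cong[OF s o _ _ P]) (use W W' U chart_inv[OF N c] in auto)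
qed

lemma regular_level_slice:
  fixes F :: "'a \<Rightarrow> 'b::euclidean_space" and M :: "('a, 'e::euclidean_space) mfd"
  assumes M: "smooth_atlas M" and O': "openin (mtop M) O'" and L: "subspace L"
    and F: "\<And>p. p \<in> O' \<Longrightarrow> smooth_at M (euclid_mfd L L) F p"
    and S: "S = {p \<in> O'. F p = 0}" and V: "subspace V" "dim V + dim L = dim (model M)"
    and p: "p \<in> S" and surj: "tangent_map M (euclid_mfd L L) F p ` model M = L"
  shows "\<exists>U \<theta> \<tau>. p \<in> U \<and> slice M S V U \<theta> \<tau>"
proof -
  let ?E = "model M"
  have LL: "openin (top_of_set L) L" "openin (top_of_set V) V" "openin (top_of_set ?E) ?E" by simp_all
  note EL = smooth_atlas_euclid[OF L LL(1)] and EV = smooth_atlas_euclid[OF V(1) LL(2)]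
  have pO: "p \<in> O'" using p S by blast
  obtain U \<phi> U' \<psi> W where c: "chart_at M p = (U, \<phi>)" "chart_at (euclid_mfd L L) (F p) = (U', \<psi>)" "p \<in> W"
    "smooth_in M (euclid_mfd L L) F (U, \<phi>) (U', \<psi>) W" by (rule smooth_at_chart_at[OF M EL F[OF pO]])
  have [simp]: "U' = L" "\<psi> = (\<lambda>x. x)" using smooth_inD(2)[OF c(4)] by auto
  have s: "smooth_in M (euclid_mfd L L) F (U, \<phi>) (L, \<lambda>x. x) (W \<inter> O')"
    by (rule smooth_in_mono) (use c(4) O' smooth_inD(3)[OF c(4)] in auto)
  note F' = smooth_inD[OF s]
  let ?f = "\<lambda>y. F (inv_into U \<phi> y)" and ?S = "\<phi> ` (W \<inter> O')"
  note E = smooth_atlasD(1)[OF M]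
  have oS: "openin (top_of_set ?E) ?S" by (rule smooth_in_local_rep(1)[OF M EL s])
  have sf: "smooth_on ?S ?f" using F'(5) by (simp add: o_def)
  have fS: "?f ` ?S \<subseteq> L" using smooth_in_local_rep(2)[OF M EL s] by (simp add: o_def)
  have rep: "?f (\<phi> x) = F x" if "x \<in> W \<inter> O'" for x using smooth_in_local_rep(3)[OF M EL s that] by simp
  have p0: "\<phi> p \<in> ?S" using c(3) pO by blast
  have tf: "tangent_map M (euclid_mfd L L) F p = der ?E ?f (\<phi> p)"
    using tangent_map_eq[where F=F, OF c(1,2)] by (simp add: o_def)
  have df: "der ?E ?f (\<phi> p) ` ?E = L" using surj tf by simp
  define Z where "Z = {v \<in> ?E. der ?E ?f (\<phi> p) v = 0}"
  have lin: "linear (der ?E ?f (\<phi> p))" by (rule der_linear[OF E oS sf p0])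
  have Z: "subspace Z" unfolding Z_def using E lin by (auto simp: subspace_def linear_add linear_scale linear_0)
  have "dim L + dim Z = dim ?E" using dim_image_plus_kernel[OF E lin] df by (simp add: Z_def)
  then have "dim Z = dim V" using V(2) by simp
  \<comment> \<open>The kernel \<open>Z\<close> varies with \<open>p\<close>, but the submanifold
    needs one model: \<open>Z\<close> is identified with the fixed \<open>V\<close> of the same
    dimension.\<close>
  then obtain h where h: "linear h" "h ` Z = V" "inj_on h Z" using subspace_isomorphism[OF Z V(1)] by blast
  define \<beta> where "\<beta> = (\<lambda>x. h (proj Z x))"
  have \<beta>: "linear \<beta>" unfolding \<beta>_def using linear_compose[OF linear_proj h(1)] by (simp add: o_def)
  have \<beta>V: "\<beta> x \<in> V" for x unfolding \<beta>_def using proj_in[OF Z] h(2) by blast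
  have \<beta>inj: "inj_on \<beta> {v \<in> ?E. der ?E ?f (\<phi> p) v = 0}"
    unfolding Z_def[symmetric] using h(3) proj_id[OF Z] by (auto simp: inj_on_def \<beta>_def)
  let ?\<Theta> = "\<lambda>y. (?f y, \<beta> (y - \<phi> p))"
  obtain S' g where S': "openin (top_of_set ?E) S'" "S' \<subseteq> ?S" "\<phi> p \<in> S'"
    "openin (top_of_set (L \<times> V)) (?\<Theta> ` S')" "\<And>y. y \<in> S' \<Longrightarrow> g (?\<Theta> y) = y" "smooth_on (?\<Theta> ` S') g"
    by (rule submersion_straighten[OF E oS sf L fS p0 df V(1) \<beta> _ \<beta>inj V(2)]) (use \<beta>V in auto)
  define U1 where "U1 = {q \<in> W \<inter> O'. \<phi> q \<in> S'}"
  define \<theta> where "\<theta> = (\<lambda>q. \<beta> (\<phi> q - \<phi> p))"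
  define \<tau> where "\<tau> = (\<lambda>y. inv_into U \<phi> (g (0, y)))"
  have pU1: "p \<in> U1" unfolding U1_def using c(3) pO S'(3) by blast
  have "U1 = {q \<in> U. \<phi> q \<in> S'} \<inter> (W \<inter> O')" unfolding U1_def using F'(6) by blast
  then have oU1: "openin (mtop M) U1" using openin_Int[OF chart_preimage_open[OF M F'(1) S'(1)] F'(3)] by simp
  have inv: "inv_into U \<phi> (\<phi> q) = q" if "q \<in> W \<inter> O'" for q using chart_inv[OF M F'(1) F'(6)[OF that]] .
  have im: "\<theta> ` (U1 \<inter> S) = {y \<in> V. (0, y) \<in> ?\<Theta> ` S'}"
  proof (intro equalityI subsetI)
    fix y assume "y \<in> \<theta> ` (U1 \<inter> S)"
    then obtain q where q: "q \<in> W \<inter> O'" "\<phi> q \<in> S'" "F q = 0" "y = \<theta> q" unfolding U1_def S by blast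
    then have "(0, y) = ?\<Theta> (\<phi> q)" using rep[OF q(1)] by (simp add: \<theta>_def)
    then show "y \<in> {y \<in> V. (0, y) \<in> ?\<Theta> ` S'}" using q(2,4) \<beta>V by (auto simp: \<theta>_def)
  next
    fix y assume "y \<in> {y \<in> V. (0, y) \<in> ?\<Theta> ` S'}"
    then obtain z where "z \<in> S'" "(0, y) = ?\<Theta> z" by blast
    then have z: "z \<in> S'" "?f z = 0" "y = \<beta> (z - \<phi> p)" by simp_all
    then obtain q where q: "q \<in> W \<inter> O'" "z = \<phi> q" using S'(2) by blast
    then have "q \<in> U1 \<inter> S" using z rep[OF q(1)] unfolding U1_def S by auto
    then show "y \<in> \<theta> ` (U1 \<inter> S)" using z q by (auto simp: \<theta>_def)
  qed
  have oim: "openin (top_of_set V) (\<theta> ` (U1 \<inter> S))"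
  proof -
    have "continuous_map (top_of_set V) (top_of_set (L \<times> V)) (\<lambda>y. (0, y))"
      using subspace_0[OF L] by (auto simp: continuous_map_in_subtopology intro!: continuous_intros)
    from openin_continuous_map_preimage[OF this S'(4)] show ?thesis unfolding im by simp
  qed
  have sl: "slice M S V U1 \<theta> \<tau>" unfolding slice_def
  proof (intro conjI ballI oU1 oim)
    fix q assume "q \<in> U1"
    then have q: "q \<in> U" unfolding U1_def using F'(6) by blast
    have \<phi>q: "\<phi> q \<in> ?E" using q openin_subspace_subset[OF smooth_atlasD(3)[OF M F'(1)]] by blast
    have "smooth_on ?E (\<lambda>y. \<beta> (y - \<phi> p))"
      by (rule smooth_on_linear_compose[OF \<beta>[unfolded linear_conv_bounded_linear] smooth_on_diff[OF smooth_on_id smooth_on_const]])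
    then have "smooth_at (euclid_mfd ?E ?E) (euclid_mfd V V) (\<lambda>y. \<beta> (y - \<phi> p)) (\<phi> q)"
      by (intro smooth_at_euclidI[of _ _ ?E]) (use \<beta>V \<phi>q in auto)
    from smooth_at_compose[OF M smooth_atlas_euclid[OF E LL(3)] EV smooth_at_chart[OF M F'(1) q LL(3) \<phi>q] this]
    show "smooth_at M (euclid_mfd V V) \<theta> q" unfolding \<theta>_def .
  next
    fix y assume y: "y \<in> \<theta> ` (U1 \<inter> S)"
    have s0: "smooth_on (\<theta> ` (U1 \<inter> S)) (\<lambda>y. g (0, y))"
      by (rule smooth_on_compose[OF smooth_on_Pair[OF smooth_on_const smooth_on_id] S'(6)]) (use im in blast)
    have gS: "g (0, z) \<in> S'" if "z \<in> \<theta> ` (U1 \<inter> S)" for z using that S'(5) unfolding im by force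
    have SE: "S' \<subseteq> ?E" by (rule openin_subspace_subset[OF S'(1)])
    have "smooth_at (euclid_mfd V V) (euclid_mfd ?E ?E) (\<lambda>y. g (0, y)) y"
      by (rule smooth_at_euclidI[OF LL(2) oim y openin_subspace_subset[OF oim] _ s0]) (use gS SE in blast)
    moreover have "smooth_at (euclid_mfd ?E ?E) M (inv_into U \<phi>) (g (0, y))"
      by (rule smooth_at_chart_inv[OF M F'(1) LL(3)]) (use gS[OF y] SE S'(2) F'(4) in blast)+
    ultimately show "smooth_at (euclid_mfd V V) M \<tau> y"
      unfolding \<tau>_def by (rule smooth_at_compose[OF EV smooth_atlas_euclid[OF E LL(3)] M])
  next
    fix q assume "q \<in> U1 \<inter> S"
    then have q: "q \<in> W \<inter> O'" "\<phi> q \<in> S'" "F q = 0" unfolding U1_def S by auto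
    then have "g (0, \<theta> q) = \<phi> q" using S'(5)[OF q(2)] rep[OF q(1)] by (simp add: \<theta>_def)
    then show "\<tau> (\<theta> q) = q" using inv[OF q(1)] by (simp add: \<tau>_def)
  qed
  show ?thesis using pU1 sl by blast
qed

text \<open>\<open>F\<close> vanishes on \<open>S\<close>, so tangent vectors of \<open>S\<close>
  lie in the kernel of its derivative; equality follows by counting dimensions.\<close>

lemma regular_level_tangent:
  fixes F :: "'a \<Rightarrow> 'b::euclidean_space" and M :: "('a, 'e::euclidean_space) mfd"
  assumes M: "smooth_manifold M" and O': "openin (mtop M) O'" and L: "subspace L"
    and F: "\<And>p. p \<in> O' \<Longrightarrow> smooth_at M (euclid_mfd L L) F p"
    and S: "S = {p \<in> O'. F p = 0}" and V: "subspace V" "dim V + dim L = dim (model M)"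
    and surj: "\<And>p. p \<in> S \<Longrightarrow> tangent_map M (euclid_mfd L L) F p ` model M = L"
    and p: "p \<in> S"
  shows "tangent_map (slice_mfd M S V) M (\<lambda>x. x) p ` V = {v \<in> model M. tangent_map M (euclid_mfd L L) F p v = 0}"
proof -
  let ?N = "slice_mfd M S V" and ?i = "tangent_map (slice_mfd M S V) M (\<lambda>x. x) p"
  let ?K = "{v \<in> model M. tangent_map M (euclid_mfd L L) F p v = 0}"
  note Ma = smooth_manifold_imp_atlas[OF M]
  have SM: "S \<subseteq> points M" using S openin_subset[OF O'] by blast
  have sl: "\<exists>U \<theta> \<tau>. p \<in> U \<and> slice M S V U \<theta> \<tau>" if "p \<in> S" for p
    by (rule regular_level_slice[OF Ma O' L F S V that surj[OF that]])
  note N = smooth_manifold_imp_atlas[OF smooth_manifold_slice_mfd[OF M V(1) SM sl]]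
  note i = slice_mfd_incl[OF M V(1) SM sl p]
  note EL = smooth_atlas_euclid[OF L, of L, simplified]
  have pO: "p \<in> O'" using p S by blast
  note sF = F[OF pO]
  have lin: "linear ?i" by (rule tangent_map_linear[OF N Ma i(1)])
  have linF: "linear (tangent_map M (euclid_mfd L L) F p)" by (rule tangent_map_linear[OF Ma EL sF])
  have K: "subspace ?K" using smooth_atlasD(1)[OF Ma] linF by (auto simp: subspace_def linear_add linear_scale linear_0)
  have sub: "?i ` V \<subseteq> ?K"
  proof safe
    fix u assume u: "u \<in> V"
    show "?i u \<in> model M" using tangent_map_in[OF N Ma i(1)] u by simp
    have "tangent_map M (euclid_mfd L L) F p (?i u) = tangent_map ?N (euclid_mfd L L) (\<lambda>x. F x) p u"
      using tangent_map_compose[OF N Ma EL i(1) sF] u by simp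
    also have "\<dots> = tangent_map ?N (euclid_mfd L L) (\<lambda>x. 0) p u"
    proof (rule fun_cong[OF tangent_map_cong[OF N]])
      show "openin (mtop ?N) S" using SM by (metis inf.absorb2 openin_topspace slice_mfd_simps(1) topspace_subtopology)
    qed (use p S in auto)
    also have "\<dots> = 0" by (rule tangent_map_const[OF N]) (use p SM u in auto)
    finally show "tangent_map M (euclid_mfd L L) F p (?i u) = 0" .
  qed
  have "dim L + dim ?K = dim (model M)"
    using dim_image_plus_kernel[OF smooth_atlasD(1)[OF Ma] linF] surj[OF p] by simp
  moreover have "dim (?i ` V) = dim V"
    by (rule dim_image_eq[OF lin]) (simp only: span_eq_iff[THEN iffD2, OF V(1)] i(2))
  ultimately have "dim (?i ` V) = dim ?K" using V(2) by simp
  then show ?thesis using subspace_dim_equal[OF linear_subspace_image[OF lin V(1)] K sub] by simp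
qed

section \<open>Proper locally free actions\<close>

lemma openin_Times_box:
  fixes S :: "('a::euclidean_space \<times> 'b::euclidean_space) set"
  assumes "openin (top_of_set (A \<times> B)) S" "(a, b) \<in> S"
  obtains A' B' where "openin (top_of_set A) A'" "openin (top_of_set B) B'" "a \<in> A'" "b \<in> B'" "A' \<times> B' \<subseteq> S"
proof -
  have "openin (prod_topology (top_of_set A) (top_of_set B)) S" using assms(1) by simp
  then show ?thesis using assms(2) that unfolding openin_prod_topology_alt by blast
qed

lemma smooth_at_neighbourhood:
  assumes "smooth_atlas P" "smooth_atlas Q" "smooth_at P Q F p" "openin (mtop Q) O'" "F p \<in> O'"
  obtains W where "openin (mtop P) W" "p \<in> W" "\<And>x. x \<in> W \<Longrightarrow> F x \<in> O'"
proof -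
  obtain A \<phi> B \<psi> W where W: "p \<in> W" "smooth_in P Q F (A, \<phi>) (B, \<psi>) W" by (rule smooth_atD[OF assms(3)])
  have "openin (mtop P) {x \<in> W. F x \<in> O'}"
    by (rule openin_preimage_restrict[OF smooth_inD(3)[OF W(2)] smooth_in_continuous[OF assms(1,2) W(2)] assms(4)])
  then show ?thesis by (rule that) (use W(1) assms(5) in auto)
qed

text \<open>Instantiated twice: for \<open>G\<close> acting on \<open>M\<close> and for the kernel
  group acting on the ray preimage.\<close>

locale smooth_action =
  fixes KG :: "'g monoid" (structure) and K :: "('g, 'k::euclidean_space) mfd"
    and N :: "('m, 'f::euclidean_space) mfd" and \<Phi> :: "'g \<Rightarrow> 'm \<Rightarrow> 'm"
  assumes lie: "lie_group KG K" and N_manifold: "smooth_manifold N"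
    and act_closed: "g \<in> carrier KG \<Longrightarrow> x \<in> points N \<Longrightarrow> \<Phi> g x \<in> points N"
    and act_one: "x \<in> points N \<Longrightarrow> \<Phi> \<one> x = x"
    and act_mult: "g \<in> carrier KG \<Longrightarrow> h \<in> carrier KG \<Longrightarrow> x \<in> points N \<Longrightarrow> \<Phi> (g \<otimes> h) x = \<Phi> g (\<Phi> h x)"
    and act_smooth: "smooth_map (prod_mfd K N) N (\<lambda>(g, x). \<Phi> g x)"

sublocale smooth_action \<subseteq> group KG
  using lie by (simp add: lie_group_def)

context smooth_action
begin

text \<open>The infinitesimal generators at \<open>x\<close>, that is, the directions of the orbit
  through \<open>x\<close>.\<close>

abbreviation vert :: "'m \<Rightarrow> 'k \<Rightarrow> 'f" where
  "vert x \<equiv> tangent_map K N (\<lambda>k. \<Phi> k x) \<one>"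

lemma K_points [simp]: "points K = carrier KG"
  using lie by (simp add: lie_group_def)

lemma Ka: "smooth_atlas K" and Na: "smooth_atlas N" and KNa: "smooth_atlas (prod_mfd K N)"
  and KKa: "smooth_atlas (prod_mfd K K)"
  using lie N_manifold by (auto simp: lie_group_def intro: smooth_manifold_imp_atlas smooth_atlas_prod)

lemma smooth_at_act_pair:
  "g \<in> carrier KG \<Longrightarrow> x \<in> points N \<Longrightarrow> smooth_at (prod_mfd K N) N (\<lambda>(g, x). \<Phi> g x) (g, x)"
  by (rule smooth_map_on_imp_smooth_at[OF KNa Na act_smooth openin_topspace]) auto

lemma smooth_at_act:
  assumes P: "smooth_atlas P" and c: "smooth_at P K c p" and f: "smooth_at P N f p"
  shows "smooth_at P N (\<lambda>x. \<Phi> (c x) (f x)) p"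
proof -
  have "smooth_at (prod_mfd K N) N (\<lambda>(g, x). \<Phi> g x) (c p, f p)"
    using smooth_at_points(2)[OF P Ka c] smooth_at_points(2)[OF P Na f] by (simp add: smooth_at_act_pair)
  from smooth_at_compose[OF P KNa Na smooth_at_Pair[OF P Ka Na c f], of "\<lambda>(g, x). \<Phi> g x"] this show ?thesis by simp
qed

lemma smooth_at_act_left:
  "g \<in> carrier KG \<Longrightarrow> x \<in> points N \<Longrightarrow> smooth_at N N (\<Phi> g) x"
  using smooth_at_act[OF Na smooth_at_const[OF Na Ka] smooth_at_id[OF Na], of x g] by simp

lemma smooth_at_act_right:
  "g \<in> carrier KG \<Longrightarrow> x \<in> points N \<Longrightarrow> smooth_at K N (\<lambda>k. \<Phi> k x) g"
  using smooth_at_act[OF Ka smooth_at_id[OF Ka] smooth_at_const[OF Ka Na], of g x] by simp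

lemma smooth_at_mult:
  assumes P: "smooth_atlas P" and c: "smooth_at P K c p" and f: "smooth_at P K f p"
  shows "smooth_at P K (\<lambda>x. c x \<otimes> f x) p"
proof -
  have "smooth_map (prod_mfd K K) K (\<lambda>(g, h). g \<otimes> h)" using lie by (simp add: lie_group_def)
  then have "smooth_at (prod_mfd K K) K (\<lambda>(g, x). g \<otimes> x) (c p, f p)"
    by (rule smooth_map_on_imp_smooth_at[OF KKa Ka _ openin_topspace])
      (use smooth_at_points(2)[OF P Ka c] smooth_at_points(2)[OF P Ka f] in auto)
  from smooth_at_compose[OF P KKa Ka smooth_at_Pair[OF P Ka Ka c f], of "\<lambda>(g, x). g \<otimes> x"] this show ?thesis by simp
qed

lemma smooth_at_inv:
  assumes P: "smooth_atlas P" and c: "smooth_at P K c p"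
  shows "smooth_at P K (\<lambda>x. inv (c x)) p"
proof -
  have "smooth_map K K (\<lambda>g. inv g)" using lie by (simp add: lie_group_def)
  then have "smooth_at K K (\<lambda>g. inv g) (c p)"
    by (rule smooth_map_on_imp_smooth_at[OF Ka Ka _ openin_topspace]) (use smooth_at_points(2)[OF P Ka c] in auto)
  from smooth_at_compose[OF P Ka Ka c this] show ?thesis .
qed

lemma act_inv: "g \<in> carrier KG \<Longrightarrow> x \<in> points N \<Longrightarrow> \<Phi> (inv g) (\<Phi> g x) = x"
  using act_mult[of "inv g" g x] act_one by simp

lemma act_inv': "g \<in> carrier KG \<Longrightarrow> x \<in> points N \<Longrightarrow> \<Phi> g (\<Phi> (inv g) x) = x"
  using act_mult[of g "inv g" x] act_one by simp

text \<open>For a point moved by a varying group element, the variation of the group element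
  contributes only an orbit direction. Forms that annihilate orbit directions will therefore not see
  it.\<close>

lemma tangent_act:
  assumes P: "smooth_atlas P" and c: "smooth_at P K c p" and f: "smooth_at P N f p" and u: "u \<in> model P"
  obtains \<xi> where "\<xi> \<in> model K" "tangent_map P N (\<lambda>x. \<Phi> (c x) (f x)) p u =
    tangent_map N N (\<Phi> (c p)) (f p) (tangent_map P N f p u) + vert (\<Phi> (c p) (f p)) \<xi>"
proof -
  note pts = smooth_at_points[OF P Ka c] smooth_at_points(2)[OF P Na f]
  have cp: "c p \<in> carrier KG" using pts by simp
  let ?y = "\<Phi> (c p) (f p)"
  have y: "?y \<in> points N" using act_closed cp pts by simp
  have 1: "tangent_map P N (\<lambda>x. \<Phi> (c x) (f x)) p u =
      tangent_map P N (\<lambda>x. \<Phi> (c x) (f p)) p u + tangent_map P N (\<lambda>x. \<Phi> (c p) (f x)) p u"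
    by (rule tangent_map_Leibniz[OF P Ka Na Na c f u smooth_at_act_pair[OF cp pts(3)]])
  have 2: "tangent_map P N (\<lambda>x. \<Phi> (c p) (f x)) p u = tangent_map N N (\<Phi> (c p)) (f p) (tangent_map P N f p u)"
    by (rule tangent_map_compose[OF P Na Na f smooth_at_act_left[OF cp pts(3)] u])
  \<comment> \<open>Division by \<open>c p\<close> brings the family of group elements to the
    identity, where its derivative takes values in the Lie algebra.\<close>
  let ?d = "\<lambda>x. c x \<otimes> inv (c p)"
  have sd: "smooth_at P K ?d p"
    by (rule smooth_at_mult[OF P c smooth_at_const[OF P Ka pts(1)]]) (use cp in simp)
  have dp: "?d p = \<one>" using cp by simp
  obtain W where W: "openin (mtop P) W" "p \<in> W" "\<And>x. x \<in> W \<Longrightarrow> c x \<in> points K"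
    by (rule smooth_at_neighbourhood[OF P Ka c openin_topspace pts(2)]) (rule that)
  have "\<Phi> (c x) (f p) = \<Phi> (?d x) ?y" if "x \<in> W" for x
    using act_mult[of "?d x" "c p" "f p"] W(3)[OF that] cp pts(3) by (simp add: m_assoc)
  then have "tangent_map P N (\<lambda>x. \<Phi> (c x) (f p)) p u = tangent_map P N (\<lambda>x. \<Phi> (?d x) ?y) p u"
    by (intro fun_cong[OF tangent_map_cong[OF P W(1,2)]])
  also have "\<dots> = vert ?y (tangent_map P K ?d p u)"
    using tangent_map_compose[OF P Ka Na sd _ u, of "\<lambda>k. \<Phi> k ?y"] smooth_at_act_right[OF one_closed y] dp by simp
  finally show ?thesis using that[OF tangent_map_in[OF P Ka sd u]] 1 2 by simp
qed

end

text \<open>\<open>free\<close> is freeness at the infinitesimal level: it makes stabilizers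
  discrete, and properness will make them finite. \<open>V\<close> is the model of the orbit space,
  fixed once for all points.\<close>

locale proper_free_action = smooth_action KG K N \<Phi>
  for KG :: "'g monoid" (structure) and K :: "('g, 'k::euclidean_space) mfd"
    and N :: "('m, 'f::euclidean_space) mfd" and \<Phi> :: "'g \<Rightarrow> 'm \<Rightarrow> 'm" +
  fixes V :: "'f set"
  assumes proper: "acts_properly K (mtop N) \<Phi>"
    and free: "x \<in> points N \<Longrightarrow> inj_on (tangent_map K N (\<lambda>k. \<Phi> k x) \<one>) (model K)"
    and V: "subspace V" "dim V + dim (model K) = dim (model N)"
begin

text \<open>A flow box along the orbits: \<open>t\<close> parametrizes a transversal through
  \<open>x0\<close>, and sending \<open>(k, d)\<close> to \<open>\<Phi> k (t d)\<close> is a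
  diffeomorphism of \<open>A \<times> B\<close> onto \<open>W\<close> with inverse
  \<open>(q, p)\<close>.\<close>

definition flowbox :: "'m \<Rightarrow> 'g set \<Rightarrow> 'f set \<Rightarrow> 'm set \<Rightarrow> ('m \<Rightarrow> 'f) \<Rightarrow> ('m \<Rightarrow> 'g) \<Rightarrow> ('f \<Rightarrow> 'm) \<Rightarrow> bool" where
  "flowbox x0 A B W p q t \<longleftrightarrow> openin (mtop K) A \<and> \<one> \<in> A \<and> openin (top_of_set V) B \<and> 0 \<in> B \<and>
     openin (mtop N) W \<and> t 0 = x0 \<and> (\<forall>d\<in>B. smooth_at (euclid_mfd V B) N t d) \<and>
     (\<forall>z\<in>W. smooth_at N (euclid_mfd V B) p z) \<and> (\<forall>z\<in>W. smooth_at N K q z) \<and>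
     (\<forall>k\<in>A. \<forall>d\<in>B. \<Phi> k (t d) \<in> W \<and> p (\<Phi> k (t d)) = d \<and> q (\<Phi> k (t d)) = k) \<and>
     (\<forall>z\<in>W. p z \<in> B \<and> q z \<in> A \<and> \<Phi> (q z) (t (p z)) = z)"

lemma flowboxD:
  assumes "flowbox x0 A B W p q t"
  shows "openin (mtop K) A" "\<one> \<in> A" "openin (top_of_set V) B" "0 \<in> B" "openin (mtop N) W" "t 0 = x0"
    "\<And>d. d \<in> B \<Longrightarrow> smooth_at (euclid_mfd V B) N t d" "\<And>z. z \<in> W \<Longrightarrow> smooth_at N (euclid_mfd V B) p z"
    "\<And>z. z \<in> W \<Longrightarrow> smooth_at N K q z"
    "\<And>k d. k \<in> A \<Longrightarrow> d \<in> B \<Longrightarrow> \<Phi> k (t d) \<in> W" "\<And>k d. k \<in> A \<Longrightarrow> d \<in> B \<Longrightarrow> p (\<Phi> k (t d)) = d"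
    "\<And>k d. k \<in> A \<Longrightarrow> d \<in> B \<Longrightarrow> q (\<Phi> k (t d)) = k"
    "\<And>z. z \<in> W \<Longrightarrow> p z \<in> B" "\<And>z. z \<in> W \<Longrightarrow> q z \<in> A" "\<And>z. z \<in> W \<Longrightarrow> \<Phi> (q z) (t (p z)) = z"
  using assms unfolding flowbox_def by auto

text \<open>In a chart the transversal is an affine piece along a complement of the orbit direction
  at \<open>x0\<close>. At the centre the derivative of the action sends \<open>(\<xi>, d)\<close>
  to \<open>vert x0 \<xi> + a d\<close>, which is bijective by construction, so the inverse function
  theorem applies.\<close>

lemma flowbox_exists:
  assumes x0: "x0 \<in> points N"
  obtains A B W p q t where "flowbox x0 A B W p q t"
proof -
  let ?E = "model N" and ?k = "model K"
  obtain U \<phi> where c: "chart_at N x0 = (U, \<phi>)" by (metis surj_pair)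
  note U = chart_at[OF Na x0 c]
  have eK: "\<one> \<in> points K" by simp
  obtain Uk \<kappa> where ck: "chart_at K \<one> = (Uk, \<kappa>)" by (metis surj_pair)
  note Uk = chart_at[OF Ka eK ck]
  note E = smooth_atlasD(1)[OF Na] and k = smooth_atlasD(1)[OF Ka]
  have o\<phi>: "openin (top_of_set ?E) (\<phi> ` U)" and o\<kappa>: "openin (top_of_set ?k) (\<kappa> ` Uk)"
    by (rule smooth_atlasD(3)[OF Na U(1)], rule smooth_atlasD(3)[OF Ka Uk(1)])
  have \<phi>E: "\<phi> x0 \<in> ?E" and \<kappa>k: "\<kappa> \<one> \<in> ?k"
    using U Uk openin_subspace_subset[OF o\<phi>] openin_subspace_subset[OF o\<kappa>] by auto
  have linv: "linear (vert x0)" by (rule tangent_map_linear[OF Ka Na smooth_at_act_right[OF one_closed x0]])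
  have vE: "vert x0 u \<in> ?E" if "u \<in> ?k" for u
    by (rule tangent_map_in[OF Ka Na smooth_at_act_right[OF one_closed x0] that])
  define O' where "O' = vert x0 ` ?k"
  have O': "subspace O'" unfolding O'_def by (rule linear_subspace_image[OF linv k])
  have dO: "dim O' = dim ?k" unfolding O'_def
    by (rule dim_image_eq[OF linv]) (simp only: span_eq_iff[THEN iffD2, OF k] free[OF x0])
  \<comment> \<open>The orthogonal complement of the orbit direction; a vector common to both is
    orthogonal to itself, which gives injectivity below.\<close>
  define C where "C = {y \<in> ?E. \<forall>x\<in>O'. orthogonal x y}"
  have C: "subspace C" unfolding C_def using E by (auto simp: subspace_def orthogonal_clauses)
  have "dim C + dim O' = dim ?E" unfolding C_def
    by (rule dim_subspace_orthogonal_to_vectors[OF O' E]) (use vE in \<open>auto simp: O'_def\<close>)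
  then have "dim V = dim C" using V(2) dO by simp
  \<comment> \<open>\<open>C\<close> depends on \<open>x0\<close>, \<open>V\<close> does not;
    \<open>a\<close> identifies them, as their dimensions agree.\<close>
  then obtain a where a: "linear a" "a ` V = C" "inj_on a V" using subspace_isomorphism[OF V(1) C] by blast
  have ba: "bounded_linear a" using a(1) by (simp add: linear_conv_bounded_linear)
  have aE: "a d \<in> ?E" if "d \<in> V" for d using a(2) that unfolding C_def by blast
  define D0 where "D0 = {d \<in> V. \<phi> x0 + a d \<in> \<phi> ` U}"
  have "continuous_map (top_of_set V) (top_of_set ?E) (\<lambda>d. \<phi> x0 + a d)"
    using aE \<phi>E subspace_add[OF E] linear_continuous_on[OF ba]
    by (auto simp: continuous_map_in_subtopology intro!: continuous_on_add)
  from openin_continuous_map_preimage[OF this o\<phi>] have oD0: "openin (top_of_set V) D0" by (simp add: D0_def)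
  have D0: "0 \<in> D0" using linear_0[OF a(1)] subspace_0[OF V(1)] U(2) by (simp add: D0_def)
  let ?Z = "(\<kappa> ` Uk) \<times> D0" and ?kV = "?k \<times> V"
  have kV: "subspace ?kV" by (rule subspace_Times[OF k V(1)])
  have kVa: "smooth_atlas (euclid_mfd ?kV ?kV)" using smooth_atlas_euclid[OF kV] by simp
  have oZ: "openin (top_of_set ?kV) ?Z" by (rule openin_Times[OF o\<kappa> oD0])
  let ?P = "euclid_mfd ?kV ?Z"
  note Pa = smooth_atlas_euclid[OF kV oZ]
  let ?z0 = "(\<kappa> \<one>, 0::'f)"
  have z0: "?z0 \<in> ?Z" using Uk(2) D0 by simp
  define t where "t = (\<lambda>d. inv_into U \<phi> (\<phi> x0 + a d))"
  define c' where "c' = (\<lambda>z::'k \<times> 'f. inv_into Uk \<kappa> (fst z))"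
  define \<Psi> where "\<Psi> = (\<lambda>z::'k \<times> 'f. \<Phi> (c' z) (t (snd z)))"
  have EE: "openin (top_of_set ?E) ?E" "openin (top_of_set ?k) ?k" by simp_all
  note Ea = smooth_atlas_euclid[OF E EE(1)] and ka = smooth_atlas_euclid[OF k EE(2)]
  have st0: "smooth_at (euclid_mfd V B) N t d" if "openin (top_of_set V) B" "B \<subseteq> D0" "d \<in> B" for B d
  proof -
    have "smooth_on B (\<lambda>d. \<phi> x0 + a d)" by (rule smooth_on_add[OF smooth_on_const smooth_on_linear[OF ba]])
    then have "smooth_at (euclid_mfd V B) (euclid_mfd ?E ?E) (\<lambda>d. \<phi> x0 + a d) d"
      by (intro smooth_at_euclidI[OF that(1) that(1) that(3)]) (use that(2) openin_subspace_subset[OF o\<phi>] in \<open>auto simp: D0_def\<close>)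
    moreover have "smooth_at (euclid_mfd ?E ?E) N (inv_into U \<phi>) (\<phi> x0 + a d)"
      by (rule smooth_at_chart_inv[OF Na U(1) EE(1)]) (use that openin_subspace_subset[OF o\<phi>] in \<open>auto simp: D0_def\<close>)
    ultimately show ?thesis unfolding t_def by (rule smooth_at_compose[OF smooth_atlas_euclid[OF V(1) that(1)] Ea Na])
  qed
  have sc: "smooth_at ?P K c' z" if "z \<in> ?Z" for z
  proof -
    have "smooth_at ?P (euclid_mfd ?k ?k) fst z"
      by (rule smooth_at_euclidI[OF oZ oZ that order_refl _ smooth_on_linear[OF bounded_linear_fst]])
        (use openin_subspace_subset[OF o\<kappa>] in auto)
    moreover have "smooth_at (euclid_mfd ?k ?k) K (inv_into Uk \<kappa>) (fst z)"
      by (rule smooth_at_chart_inv[OF Ka Uk(1) EE(2)]) (use that openin_subspace_subset[OF o\<kappa>] in auto)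
    ultimately show ?thesis unfolding c'_def by (rule smooth_at_compose[OF Pa ka Ka])
  qed
  have st: "smooth_at ?P N (\<lambda>z. t (snd z)) z" if "z \<in> ?Z" for z
  proof -
    have "smooth_at ?P (euclid_mfd V D0) snd z"
      by (rule smooth_at_euclidI[OF oZ oZ that order_refl _ smooth_on_linear[OF bounded_linear_snd]]) auto
    moreover have "smooth_at (euclid_mfd V D0) N t (snd z)" by (rule st0[OF oD0 order_refl]) (use that in auto)
    ultimately show ?thesis by (rule smooth_at_compose[OF Pa smooth_atlas_euclid[OF V(1) oD0] Na])
  qed
  have s\<Psi>: "smooth_at ?P N \<Psi> z" if "z \<in> ?Z" for z
    unfolding \<Psi>_def by (rule smooth_at_act[OF Pa sc[OF that] st[OF that]])
  have c'0: "c' ?z0 = \<one>" using chart_inv[OF Ka Uk] by (simp add: c'_def)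
  have t0: "t 0 = x0" using chart_inv[OF Na U] linear_0[OF a(1)] by (simp add: t_def)
  have \<Psi>0: "\<Psi> ?z0 = x0" using c'0 t0 act_one[OF x0] by (simp add: \<Psi>_def)
  have PU: "(?Z, \<lambda>x. x) \<in> atlas ?P" by simp
  have "\<Psi> ?z0 \<in> U" using \<Psi>0 U(2) by simp
  then obtain W0 where W0: "?z0 \<in> W0" "smooth_in ?P N \<Psi> (?Z, \<lambda>x. x) (U, \<phi>) W0"
    by (rule smooth_atE[OF Pa Na s\<Psi>[OF z0] PU z0 U(1)])
  note W0' = smooth_inD[OF W0(2)]
  let ?R = "\<lambda>z. \<phi> (\<Psi> z)"
  have oW0: "openin (top_of_set ?kV) W0" using W0'(3) openin_top_of_open[OF oZ] by simp
  have sR: "smooth_on W0 ?R"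
    by (rule smooth_on_cong[OF W0'(5)]) (use W0'(4) in \<open>auto simp: subset_iff\<close>)
  have RE: "?R ` W0 \<subseteq> ?E" using W0'(7) openin_subspace_subset[OF o\<phi>] by blast
  \<comment> \<open>The two partial derivatives: moving only the group element gives a generator,
    moving only along the transversal gives \<open>a\<close>.\<close>
  have dR: "der ?kV ?R ?z0 uw = vert x0 (fst uw) + a (snd uw)" if uw: "uw \<in> ?kV" for uw
  proof -
    have ch: "chart_at ?P ?z0 = (?Z, \<lambda>x. x)" by (rule chart_at_euclid[OF z0])
    have dc: "der ?kV (\<lambda>z. f (inv_into ?Z (\<lambda>x. x) z)) ?z0 = der ?kV f ?z0" for f :: "_ \<Rightarrow> 'b::real_normed_vector"
      by (rule der_cong[OF oZ z0]) simp
    have "tangent_map ?P N \<Psi> ?z0 = der ?kV ?R ?z0"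
      using tangent_map_eq[where F=\<Psi>, OF ch, of N U \<phi>] c \<Psi>0 dc by (simp add: o_def)
    moreover have "tangent_map ?P N \<Psi> ?z0 uw = tangent_map ?P N (\<lambda>z. \<Phi> (c' z) (t (snd ?z0))) ?z0 uw +
        tangent_map ?P N (\<lambda>z. \<Phi> (c' ?z0) (t (snd z))) ?z0 uw"
      unfolding \<Psi>_def
      by (rule tangent_map_Leibniz[OF Pa Ka Na Na sc[OF z0] st[OF z0]])
        (use uw smooth_at_act_pair[OF one_closed x0] c'0 t0 in auto)
    moreover have "tangent_map ?P N (\<lambda>z. \<Phi> (c' z) (t (snd ?z0))) ?z0 uw = vert x0 (tangent_map ?P K c' ?z0 uw)"
      using tangent_map_compose[OF Pa Ka Na sc[OF z0], of "\<lambda>k. \<Phi> k x0" uw] uw c'0 t0 smooth_at_act_right[OF one_closed x0] by simp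
    moreover have "tangent_map ?P K c' ?z0 uw = fst uw"
    proof -
      have "tangent_map ?P K c' ?z0 = der ?kV (\<lambda>z. \<kappa> (c' z)) ?z0"
        using tangent_map_eq[where F=c', OF ch, of K Uk \<kappa>] ck c'0 dc by (simp add: o_def)
      also have "\<dots> = der ?kV fst ?z0"
        by (rule der_cong[OF oZ z0]) (auto simp: c'_def f_inv_into_f)
      finally show ?thesis
        using der_bounded_linear[OF kV _ uw bounded_linear_fst] \<kappa>k subspace_0[OF V(1)] by simp
    qed
    moreover have "tangent_map ?P N (\<lambda>z. \<Phi> (c' ?z0) (t (snd z))) ?z0 uw = a (snd uw)"
    proof -
      have tN: "t d \<in> points N" if "d \<in> D0" for d
        using that chart_subset[OF Na U(1)] inv_into_into[of _ \<phi> U] unfolding D0_def t_def by blast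
      have "tangent_map ?P N (\<lambda>z. \<Phi> (c' ?z0) (t (snd z))) ?z0 uw = tangent_map ?P N (\<lambda>z. t (snd z)) ?z0 uw"
        by (rule fun_cong[OF tangent_map_cong[OF Pa, of ?Z]]) (use z0 c'0 tN act_one in auto)
      also have "tangent_map ?P N (\<lambda>z. t (snd z)) ?z0 = der ?kV (\<lambda>z. \<phi> (t (snd z))) ?z0"
        using tangent_map_eq[where F="\<lambda>z. t (snd z)", OF ch, of N U \<phi>] c t0 dc by (simp add: o_def)
      also have "\<dots> = der ?kV (\<lambda>z. \<phi> x0 + a (snd z)) ?z0"
        by (rule der_cong[OF oZ z0]) (auto simp: t_def D0_def f_inv_into_f)
      also have "\<dots> uw = a (snd uw)"
      proof (rule der_eqI[OF kV _ uw])
        have "((\<lambda>z. a (snd z)) has_derivative (\<lambda>z. a (snd z))) (at ?z0 within ?kV)"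
          by (rule bounded_linear_imp_has_derivative[OF bounded_linear_compose[OF ba bounded_linear_snd]])
        from has_derivative_add[OF has_derivative_const[of "\<phi> x0"] this]
        show "((\<lambda>z. \<phi> x0 + a (snd z)) has_derivative (\<lambda>z. a (snd z))) (at ?z0 within ?kV)" by simp
      qed (use \<kappa>k subspace_0[OF V(1)] in simp)
      finally show ?thesis .
    qed
    ultimately show ?thesis by simp
  qed
  have inj: "inj_on (der ?kV ?R ?z0) ?kV"
  proof (rule inj_onI)
    fix x y assume xy: "x \<in> ?kV" "y \<in> ?kV" "der ?kV ?R ?z0 x = der ?kV ?R ?z0 y"
    have m: "fst x \<in> ?k" "fst y \<in> ?k" "snd x \<in> V" "snd y \<in> V" using xy by auto
    let ?v = "vert x0 (fst x - fst y)" and ?w = "a (snd y - snd x)"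
    have eq: "?v = ?w" using xy(3) dR[OF xy(1)] dR[OF xy(2)]
      by (simp add: linear_diff[OF linv] linear_diff[OF a(1)] algebra_simps)
    have "fst x - fst y \<in> ?k" "snd y - snd x \<in> V" using m k V(1) by (auto intro: subspace_diff)
    then have "?v \<in> O'" "?w \<in> C" using a(2) by (auto simp: O'_def)
    then have "orthogonal ?v ?w" by (simp add: C_def)
    then have z: "?v = 0" "?w = 0" using eq by (auto simp: orthogonal_self)
    have "vert x0 (fst x) = vert x0 (fst y)" using z(1) by (simp add: linear_diff[OF linv])
    then have "fst x = fst y" using inj_onD[OF free[OF x0]] m by blast
    moreover have "a (snd y) = a (snd x)" using z(2) by (simp add: linear_diff[OF a(1)])
    then have "snd x = snd y" using inj_onD[OF a(3)] m by metis
    ultimately show "x = y" by (rule prod_eqI)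
  qed
  have dims: "dim ?kV = dim ?E" using dim_Times[OF k V(1)] V(2) by simp
  obtain S' g where S': "openin (top_of_set ?kV) S'" "S' \<subseteq> W0" "?z0 \<in> S'" "openin (top_of_set ?E) (?R ` S')"
    "\<And>x. x \<in> S' \<Longrightarrow> g (?R x) = x" "smooth_on (?R ` S') g"
    by (rule inverse_function_on_subspace[OF kV oW0 sR E RE W0(1) inj dims]) (rule that)
  \<comment> \<open>The neighbourhood is cut down to a product so that group element and transversal
    point vary independently.\<close>
  obtain A0 B where AB: "openin (top_of_set ?k) A0" "openin (top_of_set V) B" "\<kappa> \<one> \<in> A0" "0 \<in> B" "A0 \<times> B \<subseteq> S'"
    by (rule openin_Times_box[OF S'(1,3)])
  have ABZ: "A0 \<times> B \<subseteq> ?Z" using AB(5) S'(2) W0'(4) by blast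
  have A0U: "A0 \<subseteq> \<kappa> ` Uk" using ABZ AB(4) by blast
  have BD: "B \<subseteq> D0" using ABZ AB(3) by blast
  define A where "A = {k \<in> Uk. \<kappa> k \<in> A0}"
  define Y where "Y = ?R ` (A0 \<times> B)"
  have oAB: "openin (top_of_set ?kV) (A0 \<times> B)" by (rule openin_Times[OF AB(1,2)])
  \<comment> \<open>Written as a preimage under the continuous \<open>g\<close>, the image of the
    box is seen to be open.\<close>
  have YS: "Y = {y \<in> ?R ` S'. g y \<in> A0 \<times> B}"
  proof (intro equalityI subsetI)
    fix y assume "y \<in> Y"
    then obtain z where "z \<in> A0 \<times> B" "y = ?R z" unfolding Y_def by blast
    then show "y \<in> {y \<in> ?R ` S'. g y \<in> A0 \<times> B}" using AB(5) S'(5)[of z] by auto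
  next
    fix y assume "y \<in> {y \<in> ?R ` S'. g y \<in> A0 \<times> B}"
    then have gy: "g y \<in> A0 \<times> B" and "y \<in> ?R ` S'" by simp_all
    then obtain z where "z \<in> S'" "y = ?R z" by (elim imageE)
    note z = this gy
    then have "g y = z" using S'(5) by simp
    then show "y \<in> Y" unfolding Y_def using z by (metis imageI)
  qed
  have oY: "openin (top_of_set ?E) Y"
  proof -
    have "continuous_on (?R ` S') g" by (rule smooth_on_imp_continuous_on[OF S'(6)])
    moreover have "g ` ?R ` S' \<subseteq> ?kV" using S'(5) openin_subspace_subset[OF S'(1)] by auto
    ultimately have "continuous_map (top_of_set (?R ` S')) (top_of_set ?kV) g"
      by (auto simp: continuous_map_in_subtopology)
    from openin_continuous_map_preimage[OF this oAB] have "openin (top_of_set (?R ` S')) Y"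
      unfolding YS by simp
    then show ?thesis using S'(4) openin_trans by blast
  qed
  define W where "W = {z \<in> U. \<phi> z \<in> Y}"
  have oW: "openin (mtop N) W" unfolding W_def by (rule chart_preimage_open[OF Na U(1) oY])
  define p where "p = (\<lambda>z. snd (g (\<phi> z)))"
  define q where "q = (\<lambda>z. inv_into Uk \<kappa> (fst (g (\<phi> z))))"
  have \<Psi>U: "\<Psi> z \<in> U" if "z \<in> A0 \<times> B" for z using W0'(7) AB(5) S'(2) that by blast
  have g\<Psi>: "g (\<phi> (\<Psi> z)) = z" if "z \<in> A0 \<times> B" for z using S'(5) AB(5) that by blast
  have WE: "\<exists>z. z \<in> A0 \<times> B \<and> x = \<Psi> z" if "x \<in> W" for x
  proof -
    obtain z where z: "z \<in> A0 \<times> B" "\<phi> x = \<phi> (\<Psi> z)" using \<open>x \<in> W\<close> unfolding W_def Y_def by blast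
    then have "x = \<Psi> z" using inj_onD[OF chart_inj[OF Na U(1)]] \<Psi>U[OF z(1)] \<open>x \<in> W\<close> unfolding W_def by blast
    then show ?thesis using z by blast
  qed
  have "flowbox x0 A B W p q t"
    unfolding flowbox_def
  proof (intro conjI ballI)
    show "openin (mtop K) A" unfolding A_def by (rule chart_preimage_open[OF Ka Uk(1) AB(1)])
    show "\<one> \<in> A" using Uk AB(3) by (simp add: A_def)
    show "smooth_at (euclid_mfd V B) N t d" if "d \<in> B" for d by (rule st0[OF AB(2) BD that])
    have sg: "smooth_at N (euclid_mfd ?kV ?kV) (\<lambda>z. g (\<phi> z)) z" if z: "z \<in> W" for z
    proof -
      have zU: "z \<in> U" "\<phi> z \<in> Y" "\<phi> z \<in> ?R ` S'" using z YS unfolding W_def by auto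
      have "smooth_at N (euclid_mfd ?E (?R ` S')) \<phi> z" by (rule smooth_at_chart[OF Na U(1) zU(1) S'(4) zU(3)])
      moreover have "smooth_at (euclid_mfd ?E (?R ` S')) (euclid_mfd ?kV ?kV) g (\<phi> z)"
        by (rule smooth_at_euclidI[OF S'(4) S'(4) zU(3) order_refl _ S'(6)])
          (use S'(5) openin_subspace_subset[OF S'(1)] in auto)
      ultimately show ?thesis
        by (rule smooth_at_compose[OF Na smooth_atlas_euclid[OF E S'(4)] kVa])
    qed
    have gAB: "g (\<phi> z) \<in> A0 \<times> B" if z: "z \<in> W" for z using z YS unfolding W_def by blast
    show "smooth_at N (euclid_mfd V B) p z" if z: "z \<in> W" for z
    proof -
      have "smooth_at (euclid_mfd ?kV ?kV) (euclid_mfd V B) snd (g (\<phi> z))"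
        by (rule smooth_at_euclidI[OF _ oAB gAB[OF z] _ _ smooth_on_linear[OF bounded_linear_snd]])
          (use openin_subspace_subset[OF oAB] in auto)
      then show ?thesis unfolding p_def
        by (rule smooth_at_compose[OF Na kVa smooth_atlas_euclid[OF V(1) AB(2)] sg[OF z]])
    qed
    show "smooth_at N K q z" if z: "z \<in> W" for z
    proof -
      have "smooth_at (euclid_mfd ?kV ?kV) (euclid_mfd ?k ?k) fst (g (\<phi> z))"
        by (rule smooth_at_euclidI[OF _ oAB gAB[OF z] _ _ smooth_on_linear[OF bounded_linear_fst]])
          (use openin_subspace_subset[OF oAB] in auto)
      then have 1: "smooth_at N (euclid_mfd ?k ?k) (\<lambda>z. fst (g (\<phi> z))) z"
        by (rule smooth_at_compose[OF Na kVa ka sg[OF z]])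
      have "smooth_at (euclid_mfd ?k ?k) K (inv_into Uk \<kappa>) (fst (g (\<phi> z)))"
        by (rule smooth_at_chart_inv[OF Ka Uk(1) EE(2)]) (use gAB[OF z] A0U openin_subspace_subset[OF AB(1)] in auto)
      from smooth_at_compose[OF Na ka Ka 1 this] show ?thesis unfolding q_def .
    qed
    have AB\<Psi>: "(\<kappa> k, d) \<in> A0 \<times> B" "\<Phi> k (t d) = \<Psi> (\<kappa> k, d)" "inv_into Uk \<kappa> (\<kappa> k) = k" if "k \<in> A" "d \<in> B" for k d
      using that chart_inv[OF Ka Uk(1)] by (auto simp: A_def \<Psi>_def c'_def)
    show "\<Phi> k (t d) \<in> W" if "k \<in> A" "d \<in> B" for k d
      using AB\<Psi>[OF that] \<Psi>U by (auto simp: W_def Y_def)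
    show "p (\<Phi> k (t d)) = d" if "k \<in> A" "d \<in> B" for k d
      using AB\<Psi>[OF that] g\<Psi> by (simp add: p_def)
    show "q (\<Phi> k (t d)) = k" if "k \<in> A" "d \<in> B" for k d
      using AB\<Psi>[OF that] g\<Psi> by (simp add: q_def)
    show "p z \<in> B" if "z \<in> W" for z using gAB[OF that] by (auto simp: p_def)
    show "q z \<in> A" if "z \<in> W" for z
    proof -
      have "fst (g (\<phi> z)) \<in> A0" using gAB[OF that] by auto
      then show ?thesis using A0U by (auto simp: q_def A_def f_inv_into_f inv_into_into)
    qed
    show "\<Phi> (q z) (t (p z)) = z" if z: "z \<in> W" for z
    proof -
      obtain w where w: "w \<in> A0 \<times> B" "z = \<Psi> w" using WE[OF z] by blast
      then have "g (\<phi> z) = w" using g\<Psi> by simp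
      then have "\<Phi> (q z) (t (p z)) = \<Psi> w" by (simp add: p_def q_def \<Psi>_def c'_def)
      then show ?thesis using w by simp
    qed
  qed (rule AB(2) AB(4) oW t0)+
  then show ?thesis by (rule that)
qed

end

section \<open>Slices\<close>

lemma smooth_at_euclid_dom:
  assumes V: "subspace V" and P: "smooth_atlas P" and f: "smooth_at (euclid_mfd V B) P f x"
    and B: "openin (top_of_set V) B" and U: "openin (top_of_set V) U" "U \<subseteq> B" "x \<in> U"
  shows "smooth_at (euclid_mfd V U) P f x"
proof -
  have "smooth_at (euclid_mfd V U) (euclid_mfd V B) (\<lambda>x. x) x"
    by (rule smooth_at_euclidI[OF U(1) U(1) U(3) order_refl _ smooth_on_id]) (use U in blast)
  from smooth_at_compose[OF smooth_atlas_euclid[OF V U(1)] smooth_atlas_euclid[OF V B] P this f] show ?thesis .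
qed

lemma smooth_at_euclid_cod:
  assumes V: "subspace V" and P: "smooth_atlas P" and f: "smooth_at P (euclid_mfd V B) f x"
    and B: "openin (top_of_set V) B" and U: "openin (top_of_set V) U" "f x \<in> U"
  shows "smooth_at P (euclid_mfd V U) f x"
proof -
  have fB: "f x \<in> B" using smooth_at_points(2)[OF P smooth_atlas_euclid[OF V B] f] by simp
  have "smooth_at (euclid_mfd V B) (euclid_mfd V U) (\<lambda>x. x) (f x)"
    by (rule smooth_at_euclidI[OF B openin_Int[OF B U(1)] _ _ _ smooth_on_id]) (use U fB in auto)
  from smooth_at_compose[OF P smooth_atlas_euclid[OF V B] smooth_atlas_euclid[OF V U(1)] f this] show ?thesis .
qed

lemma openin_prod_topologyE:
  assumes "openin (prod_topology X Y) S" "(x, y) \<in> S"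
  obtains A B where "openin X A" "openin Y B" "x \<in> A" "y \<in> B" "A \<times> B \<subseteq> S"
  using assms(1)[unfolded openin_prod_topology_alt, rule_format, OF assms(2)] that by blast

lemma smooth_at_preimage_open:
  assumes "smooth_atlas P" "smooth_atlas Q" "openin (mtop P) W" "\<And>p. p \<in> W \<Longrightarrow> smooth_at P Q F p" "openin (mtop Q) O'"
  shows "openin (mtop P) {x \<in> W. F x \<in> O'}"
  by (rule openin_preimage_restrict[OF assms(3) smooth_at_imp_continuous_map[OF assms(1-4)] assms(5)])

context proper_free_action
begin

section \<open>Topology of the orbit space\<close>

abbreviation orb :: "'m \<Rightarrow> 'm set" where "orb \<equiv> orbit KG \<Phi>"
abbreviation Q :: "'m set topology" where "Q \<equiv> quotient_topology (mtop N) orb"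

lemma orb_act: assumes "k \<in> carrier KG" "x \<in> points N" shows "orb (\<Phi> k x) = orb x"
proof -
  have "\<Phi> g (\<Phi> k x) = \<Phi> (g \<otimes> k) x" if "g \<in> carrier KG" for g using act_mult assms that by simp
  moreover have "\<Phi> g x = \<Phi> (g \<otimes> inv k) (\<Phi> k x)" if "g \<in> carrier KG" for g
    using act_mult[of "g \<otimes> inv k" k x] assms that by (simp add: m_assoc)
  ultimately have "y \<in> orb (\<Phi> k x) \<longleftrightarrow> y \<in> orb x" for y
    using assms m_closed inv_closed unfolding orbit_def mem_Collect_eq by metis
  then show ?thesis by blast
qed

lemma orb_eqD:
  assumes "orb x = orb y" "x \<in> points N" "y \<in> points N"
  obtains k where "k \<in> carrier KG" "y = \<Phi> k x"
proof -
  have "y \<in> orb y" using act_one[OF assms(3)] unfolding orbit_def by force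
  then have "y \<in> orb x" using assms(1) by simp
  then show ?thesis using that unfolding orbit_def by blast
qed

lemma topspace_Q: "topspace Q = orb ` points N"
  by (rule topspace_quotient_topology)

lemma orb_continuous: "continuous_map (mtop N) Q orb"
  using quotient_map_quotient_topology quotient_imp_continuous_map by blast

text \<open>The saturation of an open set is the union of its preimages under the group elements,
  each of which is open.\<close>

lemma orb_open_map: "open_map (mtop N) Q orb"
  unfolding open_map_def
proof (intro allI impI)
  fix U assume U: "openin (mtop N) U"
  then have UN: "U \<subseteq> points N" by (rule openin_subset)
  have "{x \<in> points N. orb x \<in> orb ` U} = (\<Union>k\<in>carrier KG. {x \<in> points N. \<Phi> k x \<in> U})"
  proof (intro equalityI subsetI)
    fix x assume "x \<in> {x \<in> points N. orb x \<in> orb ` U}"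
    then obtain y where y: "x \<in> points N" "y \<in> U" "orb x = orb y" by blast
    obtain k where "k \<in> carrier KG" "y = \<Phi> k x" by (rule orb_eqD[OF y(3,1)]) (use y UN in auto)
    then show "x \<in> (\<Union>k\<in>carrier KG. {x \<in> points N. \<Phi> k x \<in> U})" using y by blast
  next
    fix x assume "x \<in> (\<Union>k\<in>carrier KG. {x \<in> points N. \<Phi> k x \<in> U})"
    then obtain k where "k \<in> carrier KG" "x \<in> points N" "\<Phi> k x \<in> U" by blast
    then show "x \<in> {x \<in> points N. orb x \<in> orb ` U}" using orb_act[of k x] by (metis (mono_tags) imageI mem_Collect_eq)
  qed
  moreover have "openin (mtop N) {x \<in> points N. \<Phi> k x \<in> U}" if "k \<in> carrier KG" for k
    by (rule smooth_at_preimage_open[OF Na Na openin_topspace smooth_at_act_left[OF that] U])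
  ultimately show "openin Q (orb ` U)" using UN by (auto simp: openin_quotient_topology)
qed

lemma second_countable_Q: "second_countable Q"
  using second_countable_open_map_image[OF orb_continuous orb_open_map] topspace_Q N_manifold
  by (simp add: smooth_manifold_def)

lemma proper_closed: "closed_map (prod_topology (mtop K) (mtop N)) (prod_topology (mtop N) (mtop N)) (\<lambda>(k, x). (\<Phi> k x, x))"
  using proper unfolding acts_properly_def proper_map_def by blast

text \<open>A quotient by an open map is Hausdorff when the relation is closed, and the orbit
  relation is the image of a closed map.\<close>

lemma Hausdorff_Q: "Hausdorff_space Q"
  unfolding Hausdorff_space_def
proof (intro allI impI)
  fix a b assume "a \<in> topspace Q \<and> b \<in> topspace Q \<and> a \<noteq> b"
  then obtain x y where xy: "x \<in> points N" "y \<in> points N" "a = orb x" "b = orb y" "orb x \<noteq> orb y"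
    unfolding topspace_Q by blast
  let ?R = "(\<lambda>(k, x). (\<Phi> k x, x)) ` (carrier KG \<times> points N)"
  have "closedin (prod_topology (mtop N) (mtop N)) ?R"
    using proper_closed closedin_topspace[of "prod_topology (mtop K) (mtop N)"] by (simp add: closed_map_def)
  then have "openin (prod_topology (mtop N) (mtop N)) (points N \<times> points N - ?R)" by (simp add: closedin_def)
  moreover have "(y, x) \<in> points N \<times> points N - ?R" using xy orb_act by auto
  ultimately obtain A B where AB: "openin (mtop N) A" "openin (mtop N) B" "y \<in> A" "x \<in> B" "A \<times> B \<subseteq> points N \<times> points N - ?R"
    by (rule openin_prod_topologyE)
  have "disjnt (orb ` B) (orb ` A)"
  proof (rule ccontr)
    assume "\<not> disjnt (orb ` B) (orb ` A)"
    then obtain u v where uv: "u \<in> B" "v \<in> A" "orb u = orb v" unfolding disjnt_iff by blast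
    have p: "u \<in> points N" "v \<in> points N" using uv openin_subset[OF AB(1)] openin_subset[OF AB(2)] by auto
    obtain k where "k \<in> carrier KG" "v = \<Phi> k u" by (rule orb_eqD[OF uv(3) p])
    then have "(v, u) \<in> ?R" using p by force
    then show False using AB(5) uv by blast
  qed
  moreover have "openin Q (orb ` A)" "openin Q (orb ` B)" using orb_open_map AB unfolding open_map_def by blast+
  ultimately show "\<exists>U V. openin Q U \<and> openin Q V \<and> a \<in> U \<and> b \<in> V \<and> disjnt U V"
    using xy AB by blast
qed

section \<open>Stabilizers and tubes\<close>

definition stab :: "'m \<Rightarrow> 'g set" where "stab x = {k \<in> carrier KG. \<Phi> k x = x}"

lemma stab_one: "x \<in> points N \<Longrightarrow> \<one> \<in> stab x"
  using act_one by (simp add: stab_def)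

lemma stab_mult: "x \<in> points N \<Longrightarrow> g \<in> stab x \<Longrightarrow> h \<in> stab x \<Longrightarrow> g \<otimes> h \<in> stab x"
  using act_mult by (simp add: stab_def)

lemma stab_inv: "x \<in> points N \<Longrightarrow> g \<in> stab x \<Longrightarrow> inv g \<in> stab x"
  using act_inv[of g x] by (simp add: stab_def)

lemma openin_K_preimage:
  assumes "\<And>p. p \<in> carrier KG \<Longrightarrow> smooth_at K K F p" "openin (mtop K) A"
  shows "openin (mtop K) {h \<in> carrier KG. F h \<in> A}"
  using smooth_at_preimage_open[OF Ka Ka openin_topspace _ assms(2), of F] assms(1) by simp

lemma smooth_at_K_const: "p \<in> carrier KG \<Longrightarrow> a \<in> carrier KG \<Longrightarrow> smooth_at K K (\<lambda>x. a) p"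
  by (rule smooth_at_const[OF Ka Ka]) auto

lemma smooth_at_K_id: "p \<in> carrier KG \<Longrightarrow> smooth_at K K (\<lambda>x. x) p"
  by (rule smooth_at_id[OF Ka]) auto

text \<open>The stabilizer is compact, being a fibre of the proper map over \<open>(x, x)\<close>,
  and discrete, because in a flow box around \<open>x\<close> the coordinate \<open>q\<close>
  separates group elements near the identity.\<close>

lemma finite_stab:
  assumes x: "x \<in> points N"
  shows "finite (stab x)"
proof -
  obtain A B W p q t where fb: "flowbox x A B W p q t" by (rule flowbox_exists[OF x])
  note F = flowboxD[OF fb]
  let ?X = "prod_topology (mtop K) (mtop N)"
  have "compactin ?X {z \<in> topspace ?X. (\<lambda>(k, x). (\<Phi> k x, x)) z = (x, x)}"
    using proper x unfolding acts_properly_def proper_map_def by simp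
  moreover have "{z \<in> topspace ?X. (\<lambda>(k, x). (\<Phi> k x, x)) z = (x, x)} = stab x \<times> {x}"
    using x by (auto simp: stab_def)
  ultimately have "compactin ?X (stab x \<times> {x})" by simp
  from image_compactin[OF this continuous_map_fst] have c: "compactin (mtop K) (stab x)" by (simp add: fst_image_times)
  \<comment> \<open>The translate of \<open>A\<close> by \<open>k\<close>; it meets the stabilizer
    in \<open>k\<close> alone.\<close>
  define T where "T = (\<lambda>k. {h \<in> carrier KG. inv k \<otimes> h \<in> A})"
  have "openin (mtop K) (T k)" if "k \<in> stab x" for k
    unfolding T_def by (rule openin_K_preimage[OF smooth_at_mult[OF Ka smooth_at_K_const smooth_at_K_id] F(1)])
      (use that in \<open>auto simp: stab_def\<close>)
  moreover have "stab x \<subseteq> \<Union>(T ` stab x)" using F(2) by (auto simp: T_def stab_def)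
  ultimately obtain \<F> where \<F>: "finite \<F>" "\<F> \<subseteq> T ` stab x" "stab x \<subseteq> \<Union>\<F>"
    using c[unfolded compactin_def, THEN conjunct2, rule_format, of "T ` stab x"] by blast
  have "finite (stab x \<inter> Y)" if Y: "Y \<in> \<F>" for Y
  proof -
    obtain k where k: "k \<in> stab x" "Y = T k" using Y \<F>(2) by blast
    have "h = k" if h: "h \<in> stab x \<inter> T k" for h
    proof -
      have hk: "h \<in> carrier KG" "k \<in> carrier KG" using h k by (auto simp: stab_def)
      have "inv k \<otimes> h \<in> A" using h by (simp add: T_def)
      moreover have "inv k \<otimes> h \<in> stab x" using stab_mult[OF x stab_inv[OF x k(1)]] h by blast
      then have "\<Phi> (inv k \<otimes> h) (t 0) = \<Phi> \<one> (t 0)" using F(6) act_one[OF x] by (simp add: stab_def)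
      ultimately have "inv k \<otimes> h = \<one>" using F(12)[OF _ F(4)] F(2) by metis
      then show "h = k" using hk by (metis inv_equality inv_inv inv_closed l_inv r_inv_ex inv_unique')
    qed
    then have "stab x \<inter> Y \<subseteq> {k}" using k(2) by blast
    then show ?thesis by (rule finite_subset) simp
  qed
  moreover have "stab x = (\<Union>Y\<in>\<F>. stab x \<inter> Y)" using \<F>(3) by blast
  ultimately show ?thesis using \<F>(1) by (metis finite_UN_I)
qed

text \<open>The elements outside \<open>D\<close>, the product of \<open>A\<close> with the
  stabilizer, form a closed set. The image of that set under the closed action map misses
  \<open>(x, x)\<close>, so near \<open>x\<close> no such element takes a point to another
  one.\<close>

lemma tube:
  assumes x: "x \<in> points N" and A: "openin (mtop K) A" "\<one> \<in> A"
  obtains W where "openin (mtop N) W" "x \<in> W"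
    "\<And>z k. z \<in> W \<Longrightarrow> k \<in> carrier KG \<Longrightarrow> \<Phi> k z \<in> W \<Longrightarrow> \<exists>a\<in>A. \<exists>g\<in>stab x. k = a \<otimes> g"
proof -
  have AK: "A \<subseteq> carrier KG" using openin_subset[OF A(1)] by simp
  define D where "D = (\<Union>g\<in>stab x. {h \<in> carrier KG. h \<otimes> inv g \<in> A})"
  have "openin (mtop K) {h \<in> carrier KG. h \<otimes> inv g \<in> A}" if "g \<in> stab x" for g
    by (rule openin_K_preimage[OF smooth_at_mult[OF Ka smooth_at_K_id smooth_at_K_const] A(1)])
      (use that in \<open>auto simp: stab_def\<close>)
  then have "openin (mtop K) D" unfolding D_def by blast
  then have "closedin (mtop K) (carrier KG - D)" by (metis K_points openin_closedin_eq)
  then have "closedin (prod_topology (mtop K) (mtop N)) ((carrier KG - D) \<times> points N)"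
    by (simp add: closedin_prod_Times_iff)
  then have "closedin (prod_topology (mtop N) (mtop N)) ((\<lambda>(k, x). (\<Phi> k x, x)) ` ((carrier KG - D) \<times> points N))" (is "closedin _ ?R")
    using proper_closed by (simp add: closed_map_def)
  then have "openin (prod_topology (mtop N) (mtop N)) (points N \<times> points N - ?R)" by (simp add: closedin_def)
  moreover have "k \<in> D" if "k \<in> stab x" for k
    unfolding D_def using that A(2) AK by (intro UN_I[of k]) (auto simp: stab_def)
  then have "(x, x) \<in> points N \<times> points N - ?R" using x by (auto simp: stab_def)
  ultimately obtain W1 W2 where W: "openin (mtop N) W1" "openin (mtop N) W2" "x \<in> W1" "x \<in> W2" "W1 \<times> W2 \<subseteq> points N \<times> points N - ?R"
    by (rule openin_prod_topologyE)
  show ?thesis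
  proof (rule that[of "W1 \<inter> W2"])
    fix z k assume z: "z \<in> W1 \<inter> W2" "k \<in> carrier KG" "\<Phi> k z \<in> W1 \<inter> W2"
    then have zN: "z \<in> points N" using openin_subset[OF W(1)] by blast
    have "(\<Phi> k z, z) \<notin> ?R" using z W(5) by blast
    then have "k \<in> D" using z(2) zN by force
    then obtain g where g: "g \<in> stab x" "k \<otimes> inv g \<in> A" unfolding D_def by blast
    have "k = (k \<otimes> inv g) \<otimes> g" using g z(2) by (simp add: stab_def m_assoc)
    then show "\<exists>a\<in>A. \<exists>g\<in>stab x. k = a \<otimes> g" using g by blast
  qed (use W in auto)
qed

section \<open>Lifts and slice charts\<close>

lemma small_square:
  assumes A: "openin (mtop K) A" "\<one> \<in> A"
  obtains A' where "openin (mtop K) A'" "\<one> \<in> A'" "\<And>a b. a \<in> A' \<Longrightarrow> b \<in> A' \<Longrightarrow> a \<otimes> b \<in> A"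
proof -
  have "smooth_at (prod_mfd K K) K (\<lambda>z. fst z \<otimes> snd z) z" if "z \<in> points (prod_mfd K K)" for z
  proof -
    have "smooth_map (prod_mfd K K) K (\<lambda>(g, h). g \<otimes> h)" using lie by (simp add: lie_group_def)
    from smooth_map_on_imp_smooth_at[OF KKa Ka this openin_topspace that] show ?thesis by (simp add: case_prod_unfold)
  qed
  from smooth_at_preimage_open[OF KKa Ka openin_topspace this A(1)]
  have "openin (prod_topology (mtop K) (mtop K)) {z \<in> carrier KG \<times> carrier KG. fst z \<otimes> snd z \<in> A}" by simp
  moreover have "(\<one>, \<one>) \<in> {z \<in> carrier KG \<times> carrier KG. fst z \<otimes> snd z \<in> A}" using A(2) by simp
  ultimately obtain A1 A2 where "openin (mtop K) A1" "openin (mtop K) A2" "\<one> \<in> A1" "\<one> \<in> A2"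
     "A1 \<times> A2 \<subseteq> {z \<in> carrier KG \<times> carrier KG. fst z \<otimes> snd z \<in> A}"
    by (rule openin_prod_topologyE)
  then show ?thesis by (intro that[of "A1 \<inter> A2"]) auto
qed

text \<open>\<open>s\<close> projects \<open>W\<close> along the orbits to transversal coordinates,
  and \<open>e\<close> records smoothly the group element that leads back; by the last clause
  \<open>s\<close> is locally constant along orbits. This is what remains of the pair
  \<open>(p, q)\<close> of a flow box after restriction and translation by the group.\<close>

definition good_lift :: "'f set \<Rightarrow> ('f \<Rightarrow> 'm) \<Rightarrow> 'm set \<Rightarrow> ('m \<Rightarrow> 'f) \<Rightarrow> ('m \<Rightarrow> 'g) \<Rightarrow> bool" where
  "good_lift U t W s e \<longleftrightarrow> openin (mtop N) W \<and>
     (\<forall>z\<in>W. smooth_at N (euclid_mfd V U) s z \<and> smooth_at N K e z \<and> s z \<in> U \<and> \<Phi> (e z) (t (s z)) = z \<and>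
       (\<exists>A. openin (mtop K) A \<and> \<one> \<in> A \<and> (\<forall>k\<in>A. s (\<Phi> k z) = s z)))"

lemma good_liftD:
  assumes "good_lift U t W s e"
  shows "openin (mtop N) W" "\<And>z. z \<in> W \<Longrightarrow> smooth_at N (euclid_mfd V U) s z"
    "\<And>z. z \<in> W \<Longrightarrow> smooth_at N K e z" "\<And>z. z \<in> W \<Longrightarrow> s z \<in> U" "\<And>z. z \<in> W \<Longrightarrow> \<Phi> (e z) (t (s z)) = z"
    "\<And>z. z \<in> W \<Longrightarrow> \<exists>A. openin (mtop K) A \<and> \<one> \<in> A \<and> (\<forall>k\<in>A. s (\<Phi> k z) = s z)"
  using assms unfolding good_lift_def by blast+

text \<open>An orbifold chart together with its transversal. The last clause realizes each element
  of \<open>\<Gamma>\<close> on the transversal by a smoothly varying group element; this will make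
  the reduced form invariant.\<close>

definition slice_chart :: "('m set, 'f) orbichart \<Rightarrow> ('f \<Rightarrow> 'm) \<Rightarrow> 'm set \<Rightarrow> ('m \<Rightarrow> 'f) \<Rightarrow> ('m \<Rightarrow> 'g) \<Rightarrow> bool" where
  "slice_chart = (\<lambda>(U, \<Gamma>, \<phi>) t W p q. orbichart Q V (U, \<Gamma>, \<phi>) \<and>
     (\<forall>d\<in>U. smooth_at (euclid_mfd V U) N t d \<and> \<phi> d = orb (t d) \<and> t d \<in> W \<and> p (t d) = d \<and> q (t d) = \<one>) \<and>
     good_lift U t W p q \<and>
     (\<forall>\<gamma>\<in>\<Gamma>. \<exists>c. \<forall>d\<in>U. smooth_at (euclid_mfd V U) K c d \<and> t (\<gamma> d) = \<Phi> (c d) (t d)))"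

lemma slice_chartD:
  assumes "slice_chart (U, \<Gamma>, \<phi>) t W p q"
  shows "orbichart Q V (U, \<Gamma>, \<phi>)" "\<And>d. d \<in> U \<Longrightarrow> smooth_at (euclid_mfd V U) N t d"
    "\<And>d. d \<in> U \<Longrightarrow> \<phi> d = orb (t d)" "\<And>d. d \<in> U \<Longrightarrow> t d \<in> W" "\<And>d. d \<in> U \<Longrightarrow> p (t d) = d" "\<And>d. d \<in> U \<Longrightarrow> q (t d) = \<one>"
    "good_lift U t W p q"
    "\<And>\<gamma>. \<gamma> \<in> \<Gamma> \<Longrightarrow> \<exists>c. \<forall>d\<in>U. smooth_at (euclid_mfd V U) K c d \<and> t (\<gamma> d) = \<Phi> (c d) (t d)"
  using assms unfolding slice_chart_def by auto

text \<open>An element of the stabilizer acts on the transversal by moving a point and projecting it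
  back along the orbits. The neighbourhoods are shrunk until these maps compose like the group,
  preserve a connected domain, and relate any two points of it that lie on one orbit.\<close>

lemma slice_exists:
  assumes fb: "flowbox x0 A B W p q t" and x0: "x0 \<in> points N" and B1: "openin (top_of_set V) B1" "0 \<in> B1"
  obtains U \<Gamma> W' where "slice_chart (U, \<Gamma>, \<lambda>d. orb (t d)) t W' p q" "0 \<in> U" "U \<subseteq> B1" "U \<subseteq> B"
proof -
  note F = flowboxD[OF fb]
  let ?\<Gamma> = "stab x0"
  have AK: "A \<subseteq> carrier KG" using openin_subset[OF F(1)] by simp
  have Ba: "smooth_atlas (euclid_mfd V B)" by (rule smooth_atlas_euclid[OF V(1) F(3)])
  have tN: "t d \<in> points N" if "d \<in> B" for d using smooth_at_points(2)[OF Ba Na F(7)[OF that]] .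
  have G: "g \<in> carrier KG" "\<Phi> g x0 = x0" if "g \<in> ?\<Gamma>" for g using that by (auto simp: stab_def)
  \<comment> \<open>If \<open>q z\<close> and \<open>b\<close> are both in \<open>A2\<close>, their
    product is still in \<open>A\<close>, so moving \<open>z\<close> by \<open>b\<close> stays in
    the box and leaves \<open>p\<close> unchanged; this is \<open>pinv\<close>.\<close>
  obtain A2 where A2: "openin (mtop K) A2" "\<one> \<in> A2" "\<And>a b. a \<in> A2 \<Longrightarrow> b \<in> A2 \<Longrightarrow> a \<otimes> b \<in> A"
    by (rule small_square[OF F(1,2)]) (rule that)
  have A2K: "A2 \<subseteq> carrier KG" using openin_subset[OF A2(1)] by simp
  \<comment> \<open>Projecting back introduces a factor \<open>inv a\<close>. When a further
    \<open>g\<close> is moved past it, its conjugate appears, which has to be small as well;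
    finiteness of the stabilizer keeps \<open>A3\<close> open.\<close>
  define A3 where "A3 = A2 \<inter> (\<Inter>g\<in>?\<Gamma>. {a \<in> carrier KG. g \<otimes> inv a \<otimes> inv g \<in> A2})"
  have "openin (mtop K) {a \<in> carrier KG. g \<otimes> inv a \<otimes> inv g \<in> A2}" if "g \<in> ?\<Gamma>" for g
    by (rule openin_K_preimage[OF smooth_at_mult[OF Ka smooth_at_mult[OF Ka smooth_at_K_const
         smooth_at_inv[OF Ka smooth_at_K_id]] smooth_at_K_const] A2(1)]) (use G[OF that] in auto)
  then have oA3: "openin (mtop K) A3" unfolding A3_def
    using finite_stab[OF x0] stab_one[OF x0] A2(1) by (intro openin_Int openin_INT2) auto
  have A3: "\<one> \<in> A3" "A3 \<subseteq> A2" "\<And>a g. a \<in> A3 \<Longrightarrow> g \<in> ?\<Gamma> \<Longrightarrow> g \<otimes> inv a \<otimes> inv g \<in> A2"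
    unfolding A3_def using A2(2) G by auto
  have pinv: "p (\<Phi> b z) = p z" "\<Phi> b z \<in> W" if "z \<in> W" "b \<in> A2" "q z \<in> A2" for z b
  proof -
    have bq: "b \<otimes> q z \<in> A" "b \<in> carrier KG" "q z \<in> carrier KG" using A2(3) that A2K by auto
    have "\<Phi> b z = \<Phi> (b \<otimes> q z) (t (p z))"
      using act_mult[OF bq(2,3) tN[OF F(13)[OF that(1)]]] F(15)[OF that(1)] by simp
    then show "p (\<Phi> b z) = p z" "\<Phi> b z \<in> W" using F(10,11)[OF bq(1) F(13)[OF that(1)]] by auto
  qed
  \<comment> \<open>Two points of \<open>W1\<close> on one orbit differ by an element of the
    stabilizer followed by one of \<open>A2\<close>, and \<open>p\<close> will not see the
    latter.\<close>
  obtain W1 where W1: "openin (mtop N) W1" "x0 \<in> W1"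
    "\<And>z k. z \<in> W1 \<Longrightarrow> k \<in> carrier KG \<Longrightarrow> \<Phi> k z \<in> W1 \<Longrightarrow> \<exists>a\<in>A2. \<exists>g\<in>?\<Gamma>. k = a \<otimes> g"
    by (rule tube[OF x0 A2(1,2)]) (rule that)
  define Wq where "Wq = {z \<in> W. q z \<in> A3}"
  have oWq: "openin (mtop N) Wq" unfolding Wq_def by (rule smooth_at_preimage_open[OF Na Ka F(5) F(9) oA3])
  have x0W: "x0 \<in> W" "q x0 = \<one>" "p x0 = 0"
    using F(10-12)[OF F(2) F(4)] F(6) act_one[OF x0] by auto
  have x0Wq: "x0 \<in> Wq" using x0W A3(1) by (simp add: Wq_def)
  define h where "h = (\<lambda>g d. p (\<Phi> g (t d)))"
  have sgt: "smooth_at (euclid_mfd V B) N (\<lambda>d. \<Phi> g (t d)) d" if "d \<in> B" "g \<in> carrier KG" for d g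
    by (rule smooth_at_act[OF Ba smooth_at_const[OF Ba Ka] F(7)[OF that(1)]]) (use that in auto)
  have pre: "openin (top_of_set V) {d \<in> B. F d \<in> O'}" if "\<And>d. d \<in> B \<Longrightarrow> smooth_at (euclid_mfd V B) N F d" "openin (mtop N) O'" for F O'
  proof -
    have "openin (mtop (euclid_mfd V B)) {d \<in> B. F d \<in> O'}"
      by (rule smooth_at_preimage_open[OF Ba Na _ that]) auto
    then show ?thesis using openin_top_of_open[OF F(3)] by simp
  qed
  \<comment> \<open>On \<open>B0\<close> each element of the stabilizer keeps the transversal in the
    part of the box where \<open>q\<close> takes values in \<open>A3\<close>.\<close>
  define B0 where "B0 = B \<inter> B1 \<inter> {d \<in> B. t d \<in> W1} \<inter> (\<Inter>g\<in>?\<Gamma>. {d \<in> B. \<Phi> g (t d) \<in> Wq})"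
  have oB0: "openin (top_of_set V) B0" unfolding B0_def
    using finite_stab[OF x0] stab_one[OF x0] pre[OF F(7) W1(1)] pre[OF sgt oWq] G(1) F(3) B1(1)
    by (intro openin_Int openin_INT2) auto
  have B0: "0 \<in> B0" unfolding B0_def using F(4,6) B1(2) W1(2) x0Wq G(2) by auto
  have B0D: "d \<in> B" "d \<in> B1" "t d \<in> W1" "\<And>g. g \<in> ?\<Gamma> \<Longrightarrow> \<Phi> g (t d) \<in> W" "\<And>g. g \<in> ?\<Gamma> \<Longrightarrow> q (\<Phi> g (t d)) \<in> A3" if "d \<in> B0" for d
    using that unfolding B0_def Wq_def by auto
  have hB: "h g d \<in> B" if "d \<in> B0" "g \<in> ?\<Gamma>" for g d unfolding h_def by (rule F(13)[OF B0D(4)[OF that]])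
  have th: "t (h g d) = \<Phi> (inv (q (\<Phi> g (t d))) \<otimes> g) (t d)" if d: "d \<in> B0" "g \<in> ?\<Gamma>" for g d
  proof -
    let ?z = "\<Phi> g (t d)"
    have zW: "?z \<in> W" by (rule B0D(4)[OF d])
    have qK: "q ?z \<in> carrier KG" using F(14)[OF zW] AK by blast
    have "t (p ?z) = \<Phi> (inv (q ?z)) ?z" using act_inv[OF qK tN[OF F(13)[OF zW]]] F(15)[OF zW] by simp
    then show ?thesis using act_mult[of "inv (q ?z)" g "t d"] qK G(1)[OF d(2)] tN[OF B0D(1)[OF d(1)]] by (simp add: h_def)
  qed
  \<comment> \<open>The correction made after \<open>g\<close> is moved past \<open>g'\<close>,
    where it becomes the conjugate \<open>?b\<close>; this lies in \<open>A2\<close>, so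
    \<open>p\<close> ignores it.\<close>
  have hcomp: "h g' (h g d) = h (g' \<otimes> g) d" if d: "d \<in> B0" "g \<in> ?\<Gamma>" "g' \<in> ?\<Gamma>" for g g' d
  proof -
    let ?a = "q (\<Phi> g (t d))"
    let ?b = "g' \<otimes> inv ?a \<otimes> inv g'"
    have aA: "?a \<in> A3" by (rule B0D(5)[OF d(1,2)])
    have aK: "?a \<in> carrier KG" using aA A3(2) A2K by blast
    have gK: "g \<in> carrier KG" "g' \<in> carrier KG" using G(1) d by auto
    have td: "t d \<in> points N" by (rule tN[OF B0D(1)[OF d(1)]])
    have gg: "g' \<otimes> g \<in> ?\<Gamma>" by (rule stab_mult[OF x0 d(3,2)])
    have alg: "g' \<otimes> (inv ?a \<otimes> g) = ?b \<otimes> (g' \<otimes> g)"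
    proof -
      have "inv g' \<otimes> (g' \<otimes> g) = g" using gK by (simp flip: m_assoc)
      then show ?thesis using aK gK by (simp add: m_assoc)
    qed
    have "\<Phi> g' (t (h g d)) = \<Phi> (g' \<otimes> (inv ?a \<otimes> g)) (t d)"
      using th[OF d(1,2)] act_mult[of g' "inv ?a \<otimes> g" "t d"] aK gK td by simp
    also have "\<dots> = \<Phi> ?b (\<Phi> (g' \<otimes> g) (t d))" unfolding alg using act_mult[of ?b "g' \<otimes> g" "t d"] aK gK td by simp
    finally have "h g' (h g d) = p (\<Phi> ?b (\<Phi> (g' \<otimes> g) (t d)))" by (simp add: h_def)
    also have "\<dots> = p (\<Phi> (g' \<otimes> g) (t d))"
      by (rule pinv(1)[OF B0D(4)[OF d(1) gg] A3(3)[OF aA d(3)]]) (use B0D(5)[OF d(1) gg] A3(2) in blast)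
    finally show ?thesis by (simp add: h_def)
  qed
  \<comment> \<open>Stable under all \<open>h g\<close> by the composition law: applying
    \<open>h g'\<close> after \<open>h g\<close> gives another map of the family.\<close>
  define U1 where "U1 = {d \<in> B0. \<forall>g\<in>?\<Gamma>. h g d \<in> B0}"
  have sh: "smooth_at (euclid_mfd V B) (euclid_mfd V B) (h g) d" if d: "d \<in> B0" "g \<in> ?\<Gamma>" for g d
    unfolding h_def by (rule smooth_at_compose[OF Ba Na Ba sgt[OF B0D(1)[OF d(1)] G(1)[OF d(2)]] F(8)[OF B0D(4)[OF d]]])
  have B0B: "B0 \<subseteq> B" unfolding B0_def by blast
  have hpre: "openin (top_of_set V) {d \<in> B0. h g d \<in> O'}" if g: "g \<in> ?\<Gamma>" and O': "openin (top_of_set V) O'" for g O'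
  proof -
    have 1: "openin (mtop (euclid_mfd V B)) B0" using oB0 B0B openin_top_of_open[OF F(3)] by simp
    have 2: "openin (mtop (euclid_mfd V B)) (B \<inter> O')" using O' F(3) openin_top_of_open[OF F(3)] by auto
    have "openin (mtop (euclid_mfd V B)) {d \<in> B0. h g d \<in> B \<inter> O'}"
      by (rule smooth_at_preimage_open[OF Ba Ba 1 sh[OF _ g] 2])
    moreover have "{d \<in> B0. h g d \<in> B \<inter> O'} = {d \<in> B0. h g d \<in> O'}" using hB g by blast
    ultimately show ?thesis using openin_top_of_open[OF F(3)] by simp
  qed
  have "U1 = (\<Inter>g\<in>?\<Gamma>. {d \<in> B0. h g d \<in> B0})" unfolding U1_def using stab_one[OF x0] by blast
  then have oU1: "openin (top_of_set V) U1"
    using finite_stab[OF x0] stab_one[OF x0] hpre[OF _ oB0] by (auto intro!: openin_INT2)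
  have h0: "h g 0 = 0" if "g \<in> ?\<Gamma>" for g using G(2)[OF that] F(6) x0W(3) by (simp add: h_def)
  have U10: "0 \<in> U1" unfolding U1_def using B0 h0 by simp
  have hone: "h \<one> d = d" if "d \<in> B" for d using F(11)[OF F(2) that] by (simp add: h_def)
  have hU1: "h g d \<in> U1" if d: "d \<in> U1" "g \<in> ?\<Gamma>" for g d
    using d hcomp[of d g] stab_mult[OF x0 _ d(2)] unfolding U1_def by auto
  obtain T where T: "open T" "U1 = V \<inter> T" using oU1 openin_open by metis
  then obtain \<epsilon> where \<epsilon>: "\<epsilon> > 0" "ball 0 \<epsilon> \<subseteq> T" using U10 open_contains_ball by blast
  \<comment> \<open>\<open>U1\<close> may be disconnected. The images of a ball are connected and
    share the fixed point 0, so their union is a connected invariant domain.\<close>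
  define D where "D = V \<inter> ball 0 \<epsilon>"
  have DU1: "D \<subseteq> U1" "0 \<in> D" using \<epsilon> T U10 unfolding D_def by auto
  have oD: "openin (top_of_set V) D" unfolding D_def by (simp add: openin_open_Int)
  define U where "U = (\<Union>g\<in>?\<Gamma>. h g ` D)"
  have U1B: "U1 \<subseteq> B0" unfolding U1_def by blast
  have UU1: "U \<subseteq> U1" unfolding U_def using hU1 DU1 by blast
  have hinv: "h (inv g) (h g d) = d" "h g (h (inv g) d) = d" if "d \<in> U1" "g \<in> ?\<Gamma>" for g d
    using hcomp[of d g "inv g"] hcomp[of d "inv g" g] stab_inv[OF x0 that(2)] that hone[of d] B0D(1)[of d] U1B G(1)[OF that(2)] by auto
  have hU: "h g d \<in> U" if d: "d \<in> U" "g \<in> ?\<Gamma>" for g d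
  proof -
    obtain g' e where e: "g' \<in> ?\<Gamma>" "e \<in> D" "d = h g' e" using d(1) unfolding U_def by blast
    have "h g d = h (g \<otimes> g') e" unfolding e(3) by (rule hcomp[OF _ e(1) d(2)]) (use e(2) DU1 U1B in blast)
    then show ?thesis unfolding U_def using stab_mult[OF x0 d(2) e(1)] e(2) by blast
  qed
  \<comment> \<open>Openness of \<open>U\<close>: each image under \<open>h g\<close> is a preimage
    under the inverse map.\<close>
  have Ueq: "U = (\<Union>g\<in>?\<Gamma>. U1 \<inter> {d \<in> B0. h g d \<in> D})"
  proof (intro equalityI subsetI)
    fix d assume d: "d \<in> U"
    then obtain g e where e: "g \<in> ?\<Gamma>" "e \<in> D" "d = h g e" unfolding U_def by blast
    then have "h (inv g) d = e" using hinv(1)[of e g] DU1 by auto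
    then show "d \<in> (\<Union>g\<in>?\<Gamma>. U1 \<inter> {d \<in> B0. h g d \<in> D})"
      using stab_inv[OF x0 e(1)] e(2) d UU1 U1B by blast
  next
    fix d assume "d \<in> (\<Union>g\<in>?\<Gamma>. U1 \<inter> {d \<in> B0. h g d \<in> D})"
    then obtain g where g: "g \<in> ?\<Gamma>" "d \<in> U1" "h g d \<in> D" by blast
    then have "d = h (inv g) (h g d)" using hinv(1) by simp
    then show "d \<in> U" unfolding U_def using stab_inv[OF x0 g(1)] g(3) by blast
  qed
  have oU: "openin (top_of_set V) U" unfolding Ueq using oU1 hpre[OF _ oD] by (intro openin_Union) auto
  have U0: "0 \<in> U" unfolding U_def using h0 stab_one[OF x0] DU1(2) by force
  have connU: "connected U"
    unfolding U_def
  proof (rule connected_Union)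
    show "connected s" if s: "s \<in> (\<lambda>g. h g ` D) ` ?\<Gamma>" for s
    proof -
      obtain g where g: "g \<in> ?\<Gamma>" "s = h g ` D" using s by blast
      have Dd: "openin (mtop (euclid_mfd V B)) D" using oD DU1 U1B B0B openin_top_of_open[OF F(3)] by auto
      have "continuous_map (subtopology (mtop (euclid_mfd V B)) D) (mtop (euclid_mfd V B)) (h g)"
        by (rule smooth_at_imp_continuous_map[OF Ba Ba Dd sh[OF _ g(1)]]) (use DU1 U1B in blast)
      moreover have "subtopology (top_of_set B) D = top_of_set D"
        using DU1 U1B B0B by (metis (no_types) inf.absorb2 order_trans subtopology_subtopology)
      ultimately have "continuous_on D (h g)" by (simp add: continuous_map_in_subtopology)
      moreover have "connected D" unfolding D_def
        using V(1) by (intro convex_connected convex_Int subspace_imp_convex convex_ball)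
      ultimately show ?thesis unfolding g(2) by (rule connected_continuous_image)
    qed
    show "\<Inter>((\<lambda>g. h g ` D) ` ?\<Gamma>) \<noteq> {}" using h0 DU1(2) by (metis INT_I empty_iff imageI)
  qed
  have UB: "U \<subseteq> B" "U \<subseteq> B1" using UU1 U1B B0D by blast+
  have UB0: "U \<subseteq> B0" using UU1 U1B by blast
  have Ua: "smooth_atlas (euclid_mfd V U)" by (rule smooth_atlas_euclid[OF V(1) oU])
  \<comment> \<open>Stabilizer elements that act alike on \<open>U\<close> are identified here, so
    \<open>\<Gamma>'\<close> may be a proper quotient of the stabilizer.\<close>
  define \<Gamma>' where "\<Gamma>' = (\<lambda>g. restrict (h g) U) ` ?\<Gamma>"
  have hbij: "bij_betw (h g) U U" if g: "g \<in> ?\<Gamma>" for g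
    by (rule bij_betw_byWitness[where f'="h (inv g)"])
      (use hinv[OF _ g] UU1 hU[OF _ g] hU[OF _ stab_inv[OF x0 g]] in auto)
  have hBij: "restrict (h g) U \<in> Bij U" if g: "g \<in> ?\<Gamma>" for g
    using hbij[OF g] by (simp add: Bij_def bij_betw_restrict_eq)
  have hmult: "restrict (h g') U \<otimes>\<^bsub>BijGroup U\<^esub> restrict (h g) U = restrict (h (g' \<otimes> g)) U" if g: "g \<in> ?\<Gamma>" "g' \<in> ?\<Gamma>" for g g'
  proof -
    have "compose U (restrict (h g') U) (restrict (h g) U) = restrict (h (g' \<otimes> g)) U"
      using hU[OF _ g(1)] hcomp[OF _ g] UB0 by (auto simp: compose_def restrict_def fun_eq_iff)
    then show ?thesis using hBij g by (simp add: BijGroup_def)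
  qed
  have one': "\<one>\<^bsub>BijGroup U\<^esub> = restrict (h \<one>) U"
    using hone UB by (auto simp: BijGroup_def restrict_def fun_eq_iff)
  have subg: "subgroup \<Gamma>' (BijGroup U)"
  proof (rule subgroup.intro)
    show "\<Gamma>' \<subseteq> carrier (BijGroup U)" using hBij by (auto simp: \<Gamma>'_def BijGroup_def)
    show "x \<otimes>\<^bsub>BijGroup U\<^esub> y \<in> \<Gamma>'" if "x \<in> \<Gamma>'" "y \<in> \<Gamma>'" for x y
      using that hmult stab_mult[OF x0] unfolding \<Gamma>'_def by auto
    show "\<one>\<^bsub>BijGroup U\<^esub> \<in> \<Gamma>'" unfolding one' \<Gamma>'_def using stab_one[OF x0] by blast
    show "inv\<^bsub>BijGroup U\<^esub> x \<in> \<Gamma>'" if x: "x \<in> \<Gamma>'" for x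
    proof -
      obtain g where g: "g \<in> ?\<Gamma>" "x = restrict (h g) U" using x unfolding \<Gamma>'_def by blast
      have "inv\<^bsub>BijGroup U\<^esub> x = restrict (h (inv g)) U"
      proof (rule group.inv_equality[OF group_BijGroup])
        show "restrict (h (inv g)) U \<otimes>\<^bsub>BijGroup U\<^esub> x = \<one>\<^bsub>BijGroup U\<^esub>"
          unfolding g(2) one' using hmult[OF g(1) stab_inv[OF x0 g(1)]] G(1)[OF g(1)] by simp
        show "x \<in> carrier (BijGroup U)" "restrict (h (inv g)) U \<in> carrier (BijGroup U)"
          using hBij g stab_inv[OF x0 g(1)] by (auto simp: BijGroup_def)
      qed
      then show ?thesis unfolding \<Gamma>'_def using stab_inv[OF x0 g(1)] by blast
    qed
  qed
  have stU: "smooth_at (euclid_mfd V U) N t d" if "d \<in> U" for d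
    by (rule smooth_at_euclid_dom[OF V(1) Na F(7) F(3) oU UB(1) that]) (use that UB in blast)
  have shU: "smooth_at (euclid_mfd V U) (euclid_mfd V U) (h g) d" if d: "d \<in> U" and g: "g \<in> ?\<Gamma>" for d g
    by (rule smooth_at_euclid_cod[OF V(1) Ua smooth_at_euclid_dom[OF V(1) Ba sh F(3) oU UB(1) d] F(3) oU])
      (use d g UB0 hU in auto)
  define W' where "W' = {z \<in> W. p z \<in> U}"
  have oW': "openin (mtop N) W'"
  proof -
    have o: "openin (mtop (euclid_mfd V B)) U" using oU UB openin_top_of_open[OF F(3)] by simp
    show ?thesis unfolding W'_def by (rule smooth_at_preimage_open[OF Na Ba F(5) F(8) o])
  qed
  have tW: "t d \<in> W" "p (t d) = d" "q (t d) = \<one>" if "d \<in> B" for d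
    using F(10-12)[OF F(2) that] act_one[OF tN[OF that]] by auto
  have gl: "good_lift U t W' p q"
    unfolding good_lift_def
  proof (intro conjI ballI oW')
    fix z assume z: "z \<in> W'"
    then have zW: "z \<in> W" "p z \<in> U" by (auto simp: W'_def)
    show "smooth_at N (euclid_mfd V U) p z" by (rule smooth_at_euclid_cod[OF V(1) Na F(8)[OF zW(1)] F(3) oU zW(2)])
    show "smooth_at N K q z" "p z \<in> U" "\<Phi> (q z) (t (p z)) = z" using F(9,15) zW by auto
    have qz: "q z \<in> carrier KG" using F(14)[OF zW(1)] AK by blast
    let ?A = "{k \<in> carrier KG. k \<otimes> q z \<in> A}"
    have "openin (mtop K) ?A"
      by (rule openin_K_preimage[OF smooth_at_mult[OF Ka smooth_at_K_id smooth_at_K_const] F(1)]) (use qz in auto)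
    moreover have "\<one> \<in> ?A" using F(14)[OF zW(1)] qz by simp
    moreover have "p (\<Phi> k z) = p z" if k: "k \<in> ?A" for k
    proof -
      have "\<Phi> k z = \<Phi> (k \<otimes> q z) (t (p z))"
        using act_mult[of k "q z" "t (p z)"] k qz tN[OF F(13)[OF zW(1)]] F(15)[OF zW(1)] by simp
      then show ?thesis using F(11)[of "k \<otimes> q z" "p z"] k F(13)[OF zW(1)] by simp
    qed
    ultimately show "\<exists>A. openin (mtop K) A \<and> \<one> \<in> A \<and> (\<forall>k\<in>A. p (\<Phi> k z) = p z)" by blast
  qed
  have orbW: "orb (t (p z)) = orb z" if "z \<in> W" for z
    using orb_act[of "q z" "t (p z)"] F(14)[OF that] F(15)[OF that] tN[OF F(13)[OF that]] AK by auto
  have chart: "orbichart Q V (U, \<Gamma>', \<lambda>d. orb (t d))"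
    unfolding orbichart_def prod.case
  proof (intro conjI ballI oU connU subg)
    show "finite \<Gamma>'" unfolding \<Gamma>'_def using finite_stab[OF x0] by simp
    show "smooth_on U \<gamma>" if \<gamma>: "\<gamma> \<in> \<Gamma>'" for \<gamma>
    proof -
      obtain g where g: "g \<in> ?\<Gamma>" "\<gamma> = restrict (h g) U" using \<gamma> unfolding \<Gamma>'_def by blast
      have "smooth_map (euclid_mfd V U) (euclid_mfd V U) (h g)"
        by (rule smooth_map_onI[OF Ua Ua]) (use shU[OF _ g(1)] in auto)
      then have "smooth_on U (h g)" using smooth_map_euclid_iff[OF V(1) oU V(1) oU] by blast
      then show ?thesis unfolding g(2) by (rule smooth_on_cong[OF _ order_refl]) simp
    qed
    have "continuous_map (subtopology (mtop (euclid_mfd V U)) U) (mtop N) t"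
      by (rule smooth_at_imp_continuous_map[OF Ua Na _ stU]) auto
    then have "continuous_map (top_of_set U) (mtop N) t" by (simp add: subtopology_subtopology)
    from continuous_map_compose[OF this orb_continuous]
    show "continuous_map (top_of_set U) Q (\<lambda>d. orb (t d))" by (simp add: o_def)
    show "open_map (top_of_set U) Q (\<lambda>d. orb (t d))"
      unfolding open_map_def
    proof (intro allI impI)
      fix O' assume O': "openin (top_of_set U) O'"
      then have OU: "O' \<subseteq> U" "openin (top_of_set V) O'" using openin_top_of_open[OF oU] by auto
      then have o': "openin (mtop (euclid_mfd V B)) O'" using UB openin_top_of_open[OF F(3)] by auto
      have o: "openin (mtop N) {z \<in> W. p z \<in> O'}" by (rule smooth_at_preimage_open[OF Na Ba F(5) F(8) o'])
      have "(\<lambda>d. orb (t d)) ` O' = orb ` {z \<in> W. p z \<in> O'}"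
      proof (intro equalityI subsetI)
        fix y assume "y \<in> (\<lambda>d. orb (t d)) ` O'"
        then obtain d where "d \<in> O'" "y = orb (t d)" by blast
        then show "y \<in> orb ` {z \<in> W. p z \<in> O'}" using tW[of d] OU UB by (intro image_eqI[of _ _ "t d"]) auto
      next
        fix y assume "y \<in> orb ` {z \<in> W. p z \<in> O'}"
        then obtain z where "z \<in> W" "p z \<in> O'" "y = orb z" by blast
        then show "y \<in> (\<lambda>d. orb (t d)) ` O'" using orbW[of z] by (intro image_eqI[of _ _ "p z"]) auto
      qed
      then show "openin Q ((\<lambda>d. orb (t d)) ` O')" using orb_open_map o unfolding open_map_def by simp
    qed
    fix d d' assume d: "d \<in> U" "d' \<in> U"
    then have dB: "d \<in> B" "d' \<in> B" "d \<in> B0" "d' \<in> B0" using UB UB0 by auto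
    show "orb (t d) = orb (t d') \<longleftrightarrow> (\<exists>\<gamma>\<in>\<Gamma>'. d' = \<gamma> d)"
    proof
      assume "orb (t d) = orb (t d')"
      then obtain k where k: "k \<in> carrier KG" "t d' = \<Phi> k (t d)" by (rule orb_eqD) (use tN dB in auto)
      have "\<exists>a\<in>A2. \<exists>g\<in>?\<Gamma>. k = a \<otimes> g"
        by (rule W1(3)[OF B0D(3)[OF dB(3)] k(1)]) (use k(2) B0D(3)[OF dB(4)] in simp)
      then obtain a g where ag: "a \<in> A2" "g \<in> ?\<Gamma>" "k = a \<otimes> g" by blast
      let ?z = "\<Phi> g (t d)"
      have "t d' = \<Phi> a ?z" using k(2) ag act_mult[of a g "t d"] A2K G(1)[OF ag(2)] tN[OF dB(1)] by auto
      then have "d' = p (\<Phi> a ?z)" using tW(2)[OF dB(2)] by simp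
      also have "\<dots> = h g d" unfolding h_def
        by (rule pinv(1)[OF B0D(4)[OF dB(3) ag(2)] ag(1)]) (use B0D(5)[OF dB(3) ag(2)] A3(2) in blast)
      finally show "\<exists>\<gamma>\<in>\<Gamma>'. d' = \<gamma> d" unfolding \<Gamma>'_def using ag(2) d(1) by auto
    next
      assume "\<exists>\<gamma>\<in>\<Gamma>'. d' = \<gamma> d"
      then obtain g where g: "g \<in> ?\<Gamma>" "d' = h g d" unfolding \<Gamma>'_def using d(1) by auto
      have "q (\<Phi> g (t d)) \<in> carrier KG" using B0D(5)[OF dB(3) g(1)] A3(2) A2K by blast
      then show "orb (t d) = orb (t d')"
        using th[OF dB(3) g(1)] g(2) orb_act[of "inv (q (\<Phi> g (t d))) \<otimes> g" "t d"] G(1)[OF g(1)] tN[OF dB(1)] by simp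
    qed
  qed
  have "slice_chart (U, \<Gamma>', \<lambda>d. orb (t d)) t W' p q"
    unfolding slice_chart_def prod.case
  proof (intro conjI ballI chart gl refl)
    show "smooth_at (euclid_mfd V U) N t d" "t d \<in> W'" "p (t d) = d" "q (t d) = \<one>" if "d \<in> U" for d
      using stU[OF that] tW[of d] UB that by (auto simp: W'_def)
    fix \<gamma> assume "\<gamma> \<in> \<Gamma>'"
    then obtain g where g: "g \<in> ?\<Gamma>" "\<gamma> = restrict (h g) U" unfolding \<Gamma>'_def by blast
    \<comment> \<open>The group element found in \<open>th\<close>: \<open>g\<close> followed by the
      correction that leads back to the transversal.\<close>
    let ?c = "\<lambda>d. inv (q (\<Phi> g (t d))) \<otimes> g"
    show "\<exists>c. \<forall>d\<in>U. smooth_at (euclid_mfd V U) K c d \<and> t (\<gamma> d) = \<Phi> (c d) (t d)"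
    proof (intro exI[of _ ?c] ballI conjI)
      fix d assume d: "d \<in> U"
      have dB: "d \<in> B" "d \<in> B0" using d UB UB0 by auto
      have "smooth_at (euclid_mfd V B) K (\<lambda>d. q (\<Phi> g (t d))) d"
        by (rule smooth_at_compose[OF Ba Na Ka sgt[OF dB(1) G(1)[OF g(1)]] F(9)[OF B0D(4)[OF dB(2) g(1)]]])
      then have "smooth_at (euclid_mfd V B) K ?c d"
        by (intro smooth_at_mult[OF Ba] smooth_at_inv[OF Ba] smooth_at_const[OF Ba Ka]) (use dB G(1)[OF g(1)] in auto)
      then show "smooth_at (euclid_mfd V U) K ?c d" by (rule smooth_at_euclid_dom[OF V(1) Ka _ F(3) oU UB(1) d])
      show "t (\<gamma> d) = \<Phi> (?c d) (t d)" using th[OF dB(2) g(1)] g(2) d by simp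
    qed
  qed
  then show ?thesis by (rule that) (use U0 UB in auto)
qed

end

section \<open>The orbifold structure of the orbit space\<close>

context proper_free_action
begin

lemma vert_in: "z \<in> points N \<Longrightarrow> \<xi> \<in> model K \<Longrightarrow> vert z \<xi> \<in> model N"
  by (rule tangent_map_in[OF Ka Na smooth_at_act_right[OF one_closed]])

lemma linear_vert: "z \<in> points N \<Longrightarrow> linear (vert z)"
  by (rule tangent_map_linear[OF Ka Na smooth_at_act_right[OF one_closed]])

lemma tangent_vert_zero:
  assumes P: "smooth_atlas P" and s: "smooth_at N P s z"
    and A: "openin (mtop K) A" "\<one> \<in> A" "\<And>k. k \<in> A \<Longrightarrow> s (\<Phi> k z) = s z" and \<xi>: "\<xi> \<in> model K"
  shows "tangent_map N P s z (vert z \<xi>) = 0"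
proof -
  have z: "z \<in> points N" by (rule smooth_at_points(1)[OF Na P s])
  have "tangent_map N P s z (vert z \<xi>) = tangent_map K P (\<lambda>k. s (\<Phi> k z)) \<one> \<xi>"
    using tangent_map_compose[OF Ka Na P smooth_at_act_right[OF one_closed z], of s \<xi>] s \<xi> act_one[OF z] by simp
  also have "\<dots> = tangent_map K P (\<lambda>k. s z) \<one> \<xi>"
    by (rule fun_cong[OF tangent_map_cong[OF Ka A]])
  also have "\<dots> = 0" by (rule tangent_map_const[OF Ka _ \<xi>]) simp
  finally show ?thesis .
qed

text \<open>Obtained by differentiating \<open>z = \<Phi> (e z) (t (s z))\<close>: up to an orbit
  direction a tangent vector is recovered from its image under \<open>s\<close>.\<close>

lemma good_lift_decomp:
  assumes gl: "good_lift U t W s e" and U: "openin (top_of_set V) U" and t: "\<And>d. d \<in> U \<Longrightarrow> smooth_at (euclid_mfd V U) N t d"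
    and z: "z \<in> W" and u: "u \<in> model N"
  obtains \<xi> where "\<xi> \<in> model K"
    "u = tangent_map N N (\<Phi> (e z)) (t (s z)) (tangent_map (euclid_mfd V U) N t (s z) (tangent_map N (euclid_mfd V U) s z u)) + vert z \<xi>"
proof -
  note G = good_liftD[OF gl]
  note Ua = smooth_atlas_euclid[OF V(1) U]
  have ts: "smooth_at N N (\<lambda>w. t (s w)) z" by (rule smooth_at_compose[OF Na Ua Na G(2)[OF z] t[OF G(4)[OF z]]])
  obtain \<xi> where \<xi>: "\<xi> \<in> model K" "tangent_map N N (\<lambda>x. \<Phi> (e x) (t (s x))) z u =
    tangent_map N N (\<Phi> (e z)) (t (s z)) (tangent_map N N (\<lambda>w. t (s w)) z u) + vert (\<Phi> (e z) (t (s z))) \<xi>"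
    by (rule tangent_act[OF Na G(3)[OF z] ts u])
  have "tangent_map N N (\<lambda>x. \<Phi> (e x) (t (s x))) z u = tangent_map N N (\<lambda>x. x) z u"
    by (rule fun_cong[OF tangent_map_cong[OF Na G(1) z G(5)]])
  also have "\<dots> = u" by (rule tangent_map_id[OF Na smooth_at_points(1)[OF Na Na ts] u])
  finally show ?thesis
    using \<xi> G(5)[OF z] tangent_map_compose[OF Na Ua Na G(2)[OF z] t[OF G(4)[OF z]] u] by (intro that[of \<xi>]) simp_all
qed

text \<open>By the decomposition a vector killed by \<open>s\<close> is an orbit direction;
  conversely \<open>s\<close> is constant along short pieces of orbits.\<close>

lemma good_lift_kernel:
  assumes gl: "good_lift U t W s e" and U: "openin (top_of_set V) U" and t: "\<And>d. d \<in> U \<Longrightarrow> smooth_at (euclid_mfd V U) N t d"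
    and z: "z \<in> W"
  shows "{u \<in> model N. tangent_map N (euclid_mfd V U) s z u = 0} = vert z ` model K"
proof -
  note G = good_liftD[OF gl]
  note Ua = smooth_atlas_euclid[OF V(1) U]
  have zN: "z \<in> points N" using openin_subset[OF G(1)] z by blast
  obtain A where A: "openin (mtop K) A" "\<one> \<in> A" "\<And>k. k \<in> A \<Longrightarrow> s (\<Phi> k z) = s z" using G(6)[OF z] by blast
  show ?thesis
  proof (intro equalityI subsetI)
    fix u assume "u \<in> {u \<in> model N. tangent_map N (euclid_mfd V U) s z u = 0}"
    then have u: "u \<in> model N" "tangent_map N (euclid_mfd V U) s z u = 0" by auto
    obtain \<xi> where \<xi>: "\<xi> \<in> model K"
      "u = tangent_map N N (\<Phi> (e z)) (t (s z)) (tangent_map (euclid_mfd V U) N t (s z) (tangent_map N (euclid_mfd V U) s z u)) + vert z \<xi>"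
      by (rule good_lift_decomp[OF gl U t z u(1)])
    have eK: "e z \<in> carrier KG" using smooth_at_points(2)[OF Na Ka G(3)[OF z]] by simp
    note tz = t[OF G(4)[OF z]]
    note tN = smooth_at_points(2)[OF Ua Na tz]
    have "tangent_map (euclid_mfd V U) N t (s z) 0 = 0" "tangent_map N N (\<Phi> (e z)) (t (s z)) 0 = 0"
      using linear_0[OF tangent_map_linear[OF Ua Na tz]]
        linear_0[OF tangent_map_linear[OF Na Na smooth_at_act_left[OF eK tN]]] by auto
    then have "u = vert z \<xi>" using \<xi>(2) u(2) by simp
    then show "u \<in> vert z ` model K" using \<xi>(1) by blast
  next
    fix u assume "u \<in> vert z ` model K"
    then show "u \<in> {u \<in> model N. tangent_map N (euclid_mfd V U) s z u = 0}"
      using vert_in[OF zN] tangent_vert_zero[OF Ua G(2)[OF z] A] by auto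
  qed
qed

text \<open>A kernel of dimension \<open>dim (model K)\<close> leaves an image of dimension
  \<open>dim V\<close>.\<close>

lemma good_lift_submersion:
  assumes gl: "good_lift U t W s e" and U: "openin (top_of_set V) U" and t: "\<And>d. d \<in> U \<Longrightarrow> smooth_at (euclid_mfd V U) N t d"
    and z: "z \<in> W"
  shows "tangent_map N (euclid_mfd V U) s z ` model N = V"
proof -
  note G = good_liftD[OF gl]
  note Ua = smooth_atlas_euclid[OF V(1) U]
  have zN: "z \<in> points N" using openin_subset[OF G(1)] z by blast
  note lin = tangent_map_linear[OF Na Ua G(2)[OF z]]
  note E = smooth_atlasD(1)[OF Na] and k = smooth_atlasD(1)[OF Ka]
  have "dim (vert z ` model K) = dim (model K)"
    by (rule dim_image_eq[OF linear_vert[OF zN]]) (simp only: span_eq_iff[THEN iffD2, OF k] free[OF zN])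
  then have "dim (tangent_map N (euclid_mfd V U) s z ` model N) = dim V"
    using dim_image_plus_kernel[OF E lin] good_lift_kernel[OF gl U t z] V(2) by simp
  moreover have "tangent_map N (euclid_mfd V U) s z ` model N \<subseteq> V"
    using tangent_map_in[OF Na Ua G(2)[OF z]] by auto
  ultimately show ?thesis
    by (intro subspace_dim_equal linear_subspace_image[OF lin E] V(1)) simp_all
qed

lemma orbichart_open: "orbichart Q V (U, \<Gamma>, \<phi>) \<Longrightarrow> openin (top_of_set V) U"
  by (simp add: orbichart_def)

lemma good_lift_orb:
  assumes gl: "good_lift U t W s e" and U: "openin (top_of_set V) U" and t: "\<And>d. d \<in> U \<Longrightarrow> smooth_at (euclid_mfd V U) N t d" and z: "z \<in> W"
  shows "orb (t (s z)) = orb z"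
proof -
  note G = good_liftD[OF gl]
  note Ua = smooth_atlas_euclid[OF V(1) U]
  have "e z \<in> carrier KG" using smooth_at_points(2)[OF Na Ka G(3)[OF z]] by simp
  then show ?thesis using orb_act[of "e z" "t (s z)"] G(5)[OF z] smooth_at_points(2)[OF Ua Na t[OF G(4)[OF z]]] by simp
qed

lemma good_lift_local_lift:
  assumes sc: "slice_chart (U, \<Gamma>, \<phi>) t W0 p q" and gl: "good_lift U t W s e"
  shows "local_lift N V (U, \<Gamma>, \<phi>) orb W s"
proof -
  note C = slice_chartD[OF sc] and G = good_liftD[OF gl]
  note U = orbichart_open[OF C(1)]
  have "smooth_map_on N W (euclid_mfd V U) s"
    by (rule smooth_map_onI[OF Na smooth_atlas_euclid[OF V(1) U] G(1,2)])
  moreover have "\<phi> (s z) = orb z" if "z \<in> W" for z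
    using C(3)[OF G(4)[OF that]] good_lift_orb[OF gl U C(2) that] by simp
  ultimately show ?thesis using G(1) by (simp add: local_lift_def)
qed

text \<open>The lift belonging to the chart is transported by an element \<open>k\<close> with
  \<open>z = \<Phi> k (t y)\<close>. The freedom in \<open>y\<close> matches the definition of an
  orbifold submersion, which asks for a lift through every point above the image.\<close>

lemma good_lift_exists:
  assumes sc: "slice_chart (U, \<Gamma>, \<phi>) t W p q" and z: "z \<in> points N" and y: "y \<in> U" "\<phi> y = orb z"
  obtains W' s e where "good_lift U t W' s e" "z \<in> W'" "s z = y"
proof -
  note C = slice_chartD[OF sc]
  note G = good_liftD[OF C(7)]
  note U = orbichart_open[OF C(1)]
  note Ua = smooth_atlas_euclid[OF V(1) U]
  have ty: "t y \<in> points N" by (rule smooth_at_points(2)[OF Ua Na C(2)[OF y(1)]])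
  have "orb (t y) = orb z" using C(3)[OF y(1)] y(2) by simp
  then obtain k where k: "k \<in> carrier KG" "z = \<Phi> k (t y)" by (rule orb_eqD[OF _ ty z])
  have ik: "inv k \<in> carrier KG" using k by simp
  let ?s = "\<lambda>w. p (\<Phi> (inv k) w)" and ?e = "\<lambda>w. k \<otimes> q (\<Phi> (inv k) w)"
  define W' where "W' = {w \<in> points N. \<Phi> (inv k) w \<in> W}"
  have gl: "good_lift U t W' ?s ?e"
    unfolding good_lift_def
  proof (intro conjI ballI)
    show "openin (mtop N) W'" unfolding W'_def
      by (rule smooth_at_preimage_open[OF Na Na openin_topspace smooth_at_act_left[OF ik] G(1)])
    fix w assume "w \<in> W'"
    then have w: "w \<in> points N" "\<Phi> (inv k) w \<in> W" by (auto simp: W'_def)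
    let ?w = "\<Phi> (inv k) w"
    show "smooth_at N (euclid_mfd V U) ?s w" by (rule smooth_at_compose[OF Na Na Ua smooth_at_act_left[OF ik w(1)] G(2)[OF w(2)]])
    have sq: "smooth_at N K (\<lambda>w. q (\<Phi> (inv k) w)) w" by (rule smooth_at_compose[OF Na Na Ka smooth_at_act_left[OF ik w(1)] G(3)[OF w(2)]])
    show "smooth_at N K ?e w" by (rule smooth_at_mult[OF Na smooth_at_const[OF Na Ka w(1)] sq]) (use k in simp)
    show "?s w \<in> U" by (rule G(4)[OF w(2)])
    have qK: "q ?w \<in> carrier KG" using smooth_at_points(2)[OF Na Ka G(3)[OF w(2)]] by simp
    have tp: "t (p ?w) \<in> points N" by (rule smooth_at_points(2)[OF Ua Na C(2)[OF G(4)[OF w(2)]]])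
    show "\<Phi> (?e w) (t (?s w)) = w"
      using act_mult[OF k(1) qK tp] G(5)[OF w(2)] act_inv'[OF k(1) w(1)] by simp
    obtain A where A: "openin (mtop K) A" "\<one> \<in> A" "\<forall>k\<in>A. p (\<Phi> k ?w) = p ?w" using G(6)[OF w(2)] by blast
    \<comment> \<open>The neighbourhood of the identity along which \<open>p\<close> is constant,
      conjugated by \<open>k\<close>.\<close>
    let ?A = "{h \<in> carrier KG. inv k \<otimes> h \<otimes> k \<in> A}"
    have "openin (mtop K) ?A"
      by (rule openin_K_preimage[OF smooth_at_mult[OF Ka smooth_at_mult[OF Ka smooth_at_K_const smooth_at_K_id] smooth_at_K_const] A(1)])
        (use k in auto)
    moreover have "\<one> \<in> ?A" using A(2) k by simp
    moreover have "?s (\<Phi> h w) = ?s w" if h: "h \<in> ?A" for h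
    proof -
      have hK: "h \<in> carrier KG" using h by blast
      have "\<Phi> (inv k \<otimes> h \<otimes> k) ?w = \<Phi> ((inv k \<otimes> h \<otimes> k) \<otimes> inv k) w"
        using act_mult[of "inv k \<otimes> h \<otimes> k" "inv k" w] k hK w(1) by simp
      also have "(inv k \<otimes> h \<otimes> k) \<otimes> inv k = inv k \<otimes> h" using k hK by (simp add: m_assoc)
      also have "\<Phi> (inv k \<otimes> h) w = \<Phi> (inv k) (\<Phi> h w)" using act_mult[OF ik hK w(1)] .
      finally show ?thesis using A(3) h by (metis (mono_tags, lifting) mem_Collect_eq)
    qed
    ultimately show "\<exists>A. openin (mtop K) A \<and> \<one> \<in> A \<and> (\<forall>k\<in>A. ?s (\<Phi> k w) = ?s w)" by blast
  qed
  have "\<Phi> (inv k) z = t y" using act_inv[OF k(1) ty] k(2) by simp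
  then show ?thesis using that[OF gl] C(4,5)[OF y(1)] z by (simp add: W'_def)
qed

text \<open>A transversal at \<open>z\<close> followed by a lift into a chart is a local
  diffeomorphism, since the lift kills exactly the orbit directions. The conclusion is uniform in
  \<open>D\<close> and \<open>H\<close> because domain and group of a common chart are found only
  after two such lifts are known.\<close>

lemma lift_embedding:
  assumes sc: "slice_chart (U, \<Gamma>, \<phi>) t W0 p0 q0" and gl: "good_lift U t W s e" and z: "z \<in> W"
    and fb: "flowbox z A B Wz pz qz tz"
  obtains B1 where "openin (top_of_set V) B1" "0 \<in> B1"
    "\<And>D H. openin (top_of_set V) D \<Longrightarrow> D \<subseteq> B1 \<Longrightarrow> orbichart_embedding V (D, H, \<lambda>d. orb (tz d)) (U, \<Gamma>, \<phi>) (\<lambda>d. s (tz d))"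
proof -
  note C = slice_chartD[OF sc] and G = good_liftD[OF gl] and F = flowboxD[OF fb]
  note U = orbichart_open[OF C(1)]
  note Ua = smooth_atlas_euclid[OF V(1) U]
  note Ba = smooth_atlas_euclid[OF V(1) F(3)]
  define Bj where "Bj = {d \<in> B. tz d \<in> W}"
  have "openin (mtop (euclid_mfd V B)) Bj" unfolding Bj_def
    by (rule smooth_at_preimage_open[OF Ba Na _ F(7) G(1)]) auto
  then have oBj: "openin (top_of_set V) Bj" using openin_top_of_open[OF F(3)] by simp
  note Bja = smooth_atlas_euclid[OF V(1) oBj]
  have B0: "0 \<in> Bj" using F(4,6) z by (simp add: Bj_def)
  let ?j = "\<lambda>d. s (tz d)"
  have stz: "smooth_at (euclid_mfd V Bj) N tz d" if "d \<in> Bj" for d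
    by (rule smooth_at_euclid_dom[OF V(1) Na F(7) F(3) oBj _ that]) (use that in \<open>auto simp: Bj_def\<close>)
  have sj: "smooth_at (euclid_mfd V Bj) (euclid_mfd V U) ?j d" if "d \<in> Bj" for d
    by (rule smooth_at_compose[OF Bja Na Ua stz[OF that] G(2)]) (use that in \<open>simp add: Bj_def\<close>)
  have "smooth_map (euclid_mfd V Bj) (euclid_mfd V U) ?j"
    by (rule smooth_map_onI[OF Bja Ua]) (use sj in auto)
  then have j: "smooth_on Bj ?j" "?j ` Bj \<subseteq> U" using smooth_map_euclid_iff[OF V(1) oBj V(1) U] by auto
  have jV: "?j ` Bj \<subseteq> V" using j(2) openin_subspace_subset[OF U] by blast
  have zN: "z \<in> points N" using openin_subset[OF G(1)] z by blast
  have tz0: "tz 0 = z" by (rule F(6))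
  have zWz: "z \<in> Wz" using F(10)[OF F(2,4)] tz0 act_one[OF zN] by simp
  have dj: "der V ?j 0 w = tangent_map N (euclid_mfd V U) s z (tangent_map (euclid_mfd V Bj) N tz 0 w)" if "w \<in> V" for w
  proof -
    have "tangent_map (euclid_mfd V Bj) (euclid_mfd V U) ?j 0 = der V ?j 0"
      by (rule tangent_map_euclid[OF oBj B0]) (use G(4)[OF z] tz0 in simp)
    then show ?thesis using tangent_map_compose[OF Bja Na Ua stz[OF B0], of s w] G(2)[OF z] tz0 that by simp
  qed
  have inj: "inj_on (der V ?j 0) V"
  proof (rule inj_onI)
    fix v w assume vw: "v \<in> V" "w \<in> V" "der V ?j 0 v = der V ?j 0 w"
    let ?T = "tangent_map (euclid_mfd V Bj) N tz 0"
    have lT: "linear ?T" by (rule tangent_map_linear[OF Bja Na stz[OF B0]])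
    have ls: "linear (tangent_map N (euclid_mfd V U) s z)" by (rule tangent_map_linear[OF Na Ua G(2)[OF z]])
    have "v - w \<in> V" using vw V(1) by (intro subspace_diff)
    moreover have "?T (v - w) \<in> model N" using tangent_map_in[OF Bja Na stz[OF B0]] calculation by simp
    moreover have "tangent_map N (euclid_mfd V U) s z (?T (v - w)) = 0"
      using dj[OF vw(1)] dj[OF vw(2)] vw(3) by (simp add: linear_diff[OF lT] linear_diff[OF ls])
    ultimately obtain \<xi> where \<xi>: "\<xi> \<in> model K" "?T (v - w) = vert z \<xi>"
      using good_lift_kernel[OF gl U C(2) z] by blast
    \<comment> \<open>\<open>pz\<close> kills orbit directions and is a left inverse of
      \<open>tz\<close>, so a tangent vector of the transversal that is an orbit direction must
      vanish.\<close>
    have "tangent_map N (euclid_mfd V B) pz z (vert z \<xi>) = 0"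
    proof (rule tangent_vert_zero[OF Ba F(8)[OF zWz] F(1,2) _ \<xi>(1)])
      show "pz (\<Phi> k z) = pz z" if "k \<in> A" for k
        using F(11)[OF that F(4)] F(11)[OF F(2,4)] tz0 act_one[OF zN] by simp
    qed
    moreover have "tangent_map N (euclid_mfd V B) pz z (?T (v - w)) = v - w"
    proof -
      have "tangent_map (euclid_mfd V Bj) (euclid_mfd V B) (\<lambda>d. pz (tz d)) 0 (v - w) = tangent_map N (euclid_mfd V B) pz (tz 0) (?T (v - w))"
        by (rule tangent_map_compose[OF Bja Na Ba stz[OF B0]]) (use F(8)[OF zWz] tz0 \<open>v - w \<in> V\<close> in auto)
      moreover have "tangent_map (euclid_mfd V Bj) (euclid_mfd V B) (\<lambda>d. pz (tz d)) 0 = der V (\<lambda>d. pz (tz d)) 0"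
        by (rule tangent_map_euclid[OF oBj B0]) (use F(13)[OF zWz] tz0 in simp)
      moreover have "der V (\<lambda>d. pz (tz d)) 0 = der V (\<lambda>d. d) 0"
      proof (rule der_cong[OF oBj B0])
        fix d assume "d \<in> Bj"
        then have "d \<in> B" by (simp add: Bj_def)
        then show "pz (tz d) = d" using F(11)[OF F(2), of d] act_one[OF smooth_at_points(2)[OF Ba Na F(7)]] by simp
      qed
      ultimately show ?thesis using der_id[OF V(1) subspace_0[OF V(1)] \<open>v - w \<in> V\<close>] tz0 by simp
    qed
    ultimately show "v = w" using \<xi>(2) by simp
  qed
  obtain S' g where S': "openin (top_of_set V) S'" "S' \<subseteq> Bj" "0 \<in> S'" "openin (top_of_set V) (?j ` S')"
    "\<And>x. x \<in> S' \<Longrightarrow> g (?j x) = x" "smooth_on (?j ` S') g"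
    by (rule inverse_function_on_subspace[OF V(1) oBj j(1) V(1) jV B0 inj refl]) (rule that)
  show ?thesis
  proof (rule that[OF S'(1,3)])
    fix D H assume D: "openin (top_of_set V) D" "D \<subseteq> S'"
    have injD: "inj_on ?j D" by (rule inj_on_inverseI[of _ g]) (use S'(5) D in blast)
    have jD: "?j ` D = {y \<in> ?j ` S'. g y \<in> D}"
    proof (intro equalityI subsetI)
      fix y assume "y \<in> {y \<in> ?j ` S'. g y \<in> D}"
      then obtain x where "x \<in> S'" "y = ?j x" "g y \<in> D" by auto
      then show "y \<in> ?j ` D" using S'(5) by auto
    qed (use S'(5) D in auto)
    have "g ` ?j ` S' \<subseteq> V" using S'(5) openin_subspace_subset[OF S'(1)] by auto
    then have "continuous_map (top_of_set (?j ` S')) (top_of_set V) g"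
      using smooth_on_imp_continuous_on[OF S'(6)] by (auto simp: continuous_map_in_subtopology)
    from openin_continuous_map_preimage[OF this D(1)] have "openin (top_of_set (?j ` S')) (?j ` D)" unfolding jD by simp
    then have o: "openin (top_of_set V) (?j ` D)" using S'(4) openin_trans by blast
    have sD: "smooth_on D ?j" by (rule smooth_on_subset[OF j(1)]) (use D S' in blast)
    have sI: "smooth_on (?j ` D) (inv_into D ?j)"
    proof (rule smooth_on_cong[OF S'(6)])
      show "?j ` D \<subseteq> ?j ` S'" using D by blast
      fix y assume "y \<in> ?j ` D"
      then obtain x where "x \<in> D" "y = ?j x" by blast
      then show "g y = inv_into D ?j y" using S'(5) D inv_into_f_f[OF injD] by auto
    qed
    have "\<phi> (?j x) = orb (tz x)" if "x \<in> D" for x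
    proof -
      have "tz x \<in> W" "?j x \<in> U" using that D S'(2) j(2) by (auto simp: Bj_def)
      then show ?thesis using C(3) good_lift_orb[OF gl U C(2)] by simp
    qed
    moreover have "?j ` D \<subseteq> U" using j(2) D(2) S'(2) by blast
    ultimately show "orbichart_embedding V (D, H, \<lambda>d. orb (tz d)) (U, \<Gamma>, \<phi>) ?j"
      using o injD sD sI by (simp add: orbichart_embedding_def)
  qed
qed

definition slice_atlas :: "('m set, 'f) orbichart set" where
  "slice_atlas = {c. \<exists>t W p q. slice_chart c t W p q}"

text \<open>Two charts are compatible because a slice through a point \<open>z\<close> of the common
  orbit embeds into both, by lifts taking \<open>z\<close> to the two given points.\<close>

lemma orbifold_slice_atlas: "orbifold Q V slice_atlas"
  unfolding orbifold_def
proof (intro conjI ballI Hausdorff_Q second_countable_Q V(1))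
  show "orbichart Q V c" if c: "c \<in> slice_atlas" for c
  proof -
    obtain t W p q where "slice_chart c t W p q" using c unfolding slice_atlas_def by blast
    then show ?thesis by (cases c) (auto dest: slice_chartD(1))
  qed
  show "(\<Union>(U, \<Gamma>, \<phi>)\<in>slice_atlas. \<phi> ` U) = topspace Q"
  proof (intro equalityI subsetI)
    fix a assume "a \<in> (\<Union>(U, \<Gamma>, \<phi>)\<in>slice_atlas. \<phi> ` U)"
    then obtain U \<Gamma> \<phi> t W p q where "slice_chart (U, \<Gamma>, \<phi>) t W p q" "a \<in> \<phi> ` U"
      unfolding slice_atlas_def by auto
    then obtain d where d: "slice_chart (U, \<Gamma>, \<phi>) t W p q" "d \<in> U" "a = \<phi> d" by blast
    note C = slice_chartD[OF d(1)]
    show "a \<in> topspace Q" unfolding topspace_Q d(3) C(3)[OF d(2)]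
      using smooth_at_points(2)[OF smooth_atlas_euclid[OF V(1) orbichart_open[OF C(1)]] Na C(2)[OF d(2)]] by blast
  next
    fix a assume "a \<in> topspace Q"
    then obtain x where x: "x \<in> points N" "a = orb x" unfolding topspace_Q by blast
    obtain A B W p q t where fb: "flowbox x A B W p q t" by (rule flowbox_exists[OF x(1)])
    obtain U \<Gamma> W' where U: "slice_chart (U, \<Gamma>, \<lambda>d. orb (t d)) t W' p q" "0 \<in> U"
      by (rule slice_exists[OF fb x(1) flowboxD(3,4)[OF fb]])
    have "(U, \<Gamma>, \<lambda>d. orb (t d)) \<in> slice_atlas" unfolding slice_atlas_def using U(1) by blast
    moreover have "a = orb (t 0)" using x(2) flowboxD(6)[OF fb] by simp
    ultimately show "a \<in> (\<Union>(U, \<Gamma>, \<phi>)\<in>slice_atlas. \<phi> ` U)" using U(2) by force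
  qed
  show "orbicharts_compatible Q V c d" if cd: "c \<in> slice_atlas" "d \<in> slice_atlas" for c d
  proof -
    obtain U1 \<Gamma>1 \<phi>1 U2 \<Gamma>2 \<phi>2 where e: "c = (U1, \<Gamma>1, \<phi>1)" "d = (U2, \<Gamma>2, \<phi>2)" by (metis surj_pair)
    obtain t1 W1 p1 q1 t2 W2 p2 q2 where sc: "slice_chart (U1, \<Gamma>1, \<phi>1) t1 W1 p1 q1" "slice_chart (U2, \<Gamma>2, \<phi>2) t2 W2 p2 q2"
      using cd unfolding slice_atlas_def e by blast
    note C1 = slice_chartD[OF sc(1)] and C2 = slice_chartD[OF sc(2)]
    have "\<exists>W H \<psi> j1 j2. orbichart Q V (W, H, \<psi>) \<and> a \<in> \<psi> ` W \<and>
       orbichart_embedding V (W, H, \<psi>) (U1, \<Gamma>1, \<phi>1) j1 \<and> orbichart_embedding V (W, H, \<psi>) (U2, \<Gamma>2, \<phi>2) j2"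
      if a: "a \<in> \<phi>1 ` U1 \<inter> \<phi>2 ` U2" for a
    proof -
      obtain y1 y2 where y: "y1 \<in> U1" "y2 \<in> U2" "a = \<phi>1 y1" "a = \<phi>2 y2" using a by blast
      define z where "z = t1 y1"
      have z: "z \<in> points N" unfolding z_def
        by (rule smooth_at_points(2)[OF smooth_atlas_euclid[OF V(1) orbichart_open[OF C1(1)]] Na C1(2)[OF y(1)]])
      have oz: "\<phi>1 y1 = orb z" "\<phi>2 y2 = orb z" using C1(3)[OF y(1)] y(3,4) by (auto simp: z_def)
      obtain W1' s1 e1 where l1: "good_lift U1 t1 W1' s1 e1" "z \<in> W1'" "s1 z = y1"
        by (rule good_lift_exists[OF sc(1) z y(1) oz(1)])
      obtain W2' s2 e2 where l2: "good_lift U2 t2 W2' s2 e2" "z \<in> W2'" "s2 z = y2"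
        by (rule good_lift_exists[OF sc(2) z y(2) oz(2)])
      obtain A B Wz pz qz tz where fb: "flowbox z A B Wz pz qz tz" by (rule flowbox_exists[OF z])
      obtain B1 where B1: "openin (top_of_set V) B1" "0 \<in> B1"
        "\<And>D H. openin (top_of_set V) D \<Longrightarrow> D \<subseteq> B1 \<Longrightarrow> orbichart_embedding V (D, H, \<lambda>d. orb (tz d)) (U1, \<Gamma>1, \<phi>1) (\<lambda>d. s1 (tz d))"
        by (rule lift_embedding[OF sc(1) l1(1,2) fb]) (rule that)
      obtain B2 where B2: "openin (top_of_set V) B2" "0 \<in> B2"
        "\<And>D H. openin (top_of_set V) D \<Longrightarrow> D \<subseteq> B2 \<Longrightarrow> orbichart_embedding V (D, H, \<lambda>d. orb (tz d)) (U2, \<Gamma>2, \<phi>2) (\<lambda>d. s2 (tz d))"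
        by (rule lift_embedding[OF sc(2) l2(1,2) fb]) (rule that)
      \<comment> \<open>A slice inside both neighbourhoods, so that the two lifts are embeddings of
        one and the same chart.\<close>
      obtain D H W' where D: "slice_chart (D, H, \<lambda>d. orb (tz d)) tz W' pz qz" "0 \<in> D" "D \<subseteq> B1 \<inter> B2"
        by (rule slice_exists[OF fb z, of "B1 \<inter> B2"]) (use B1 B2 in auto)
      note oc = slice_chartD(1)[OF D(1)]
      have "a \<in> (\<lambda>d. orb (tz d)) ` D" using D(2) flowboxD(6)[OF fb] oz(1) y(3) by (intro image_eqI[of _ _ 0]) auto
      then show ?thesis using oc B1(3)[OF orbichart_open[OF oc]] B2(3)[OF orbichart_open[OF oc]] D(3) by blast
    qed
    then show ?thesis unfolding orbicharts_compatible_def e by simp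
  qed
qed

lemma submersion_slice_atlas: "orbifold_submersion N V slice_atlas orb"
proof -
  have "\<exists>W s. local_lift N V (U, \<Gamma>, \<phi>) orb W s \<and> x \<in> W \<and> s x = y \<and>
           (\<forall>z\<in>W. tangent_map N (euclid_mfd V U) s z ` model N = V)"
    if c: "(U, \<Gamma>, \<phi>) \<in> slice_atlas" and x: "x \<in> points N" and y: "y \<in> U" "\<phi> y = orb x" for U \<Gamma> \<phi> x y
  proof -
    obtain t W p q where sc: "slice_chart (U, \<Gamma>, \<phi>) t W p q" using c unfolding slice_atlas_def by blast
    note C = slice_chartD[OF sc]
    obtain W' s e where gl: "good_lift U t W' s e" "x \<in> W'" "s x = y" by (rule good_lift_exists[OF sc x y])
    show ?thesis
      using good_lift_local_lift[OF sc gl(1)] gl(2,3) good_lift_submersion[OF gl(1) orbichart_open[OF C(1)] C(2)] by blast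
  qed
  then show ?thesis unfolding orbifold_submersion_def by auto
qed

end

section \<open>Differential forms\<close>

text \<open>The pointwise part of \<open>two_form\<close>, kept apart so that forms can be handled
  as families of bilinear maps on a subspace.\<close>

definition alt_form :: "'e::euclidean_space set \<Rightarrow> ('e \<Rightarrow> 'e \<Rightarrow> real) \<Rightarrow> bool" where
  "alt_form V \<eta> \<longleftrightarrow> (\<forall>u\<in>V. \<forall>v\<in>V. \<eta> u v = - \<eta> v u) \<and>
     (\<forall>u\<in>V. \<forall>v\<in>V. \<forall>w\<in>V. \<forall>a b. \<eta> (a *\<^sub>R u + b *\<^sub>R v) w = a * \<eta> u w + b * \<eta> v w)"

lemma alt_formD:
  assumes "alt_form V \<eta>" "subspace V"
  shows alt_form_anti: "u \<in> V \<Longrightarrow> v \<in> V \<Longrightarrow> \<eta> u v = - \<eta> v u"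
    and alt_form_comb: "u \<in> V \<Longrightarrow> v \<in> V \<Longrightarrow> w \<in> V \<Longrightarrow> \<eta> (a *\<^sub>R u + b *\<^sub>R v) w = a * \<eta> u w + b * \<eta> v w"
    and alt_form_add: "u \<in> V \<Longrightarrow> v \<in> V \<Longrightarrow> w \<in> V \<Longrightarrow> \<eta> (u + v) w = \<eta> u w + \<eta> v w"
    and alt_form_scale: "u \<in> V \<Longrightarrow> w \<in> V \<Longrightarrow> \<eta> (a *\<^sub>R u) w = a * \<eta> u w"
    and alt_form_zero: "w \<in> V \<Longrightarrow> \<eta> 0 w = 0"
proof -
  show anti: "u \<in> V \<Longrightarrow> v \<in> V \<Longrightarrow> \<eta> u v = - \<eta> v u" for u v using assms(1) unfolding alt_form_def by blast
  have comb: "u \<in> V \<Longrightarrow> v \<in> V \<Longrightarrow> w \<in> V \<Longrightarrow> \<eta> (a *\<^sub>R u + b *\<^sub>R v) w = a * \<eta> u w + b * \<eta> v w" for u v w a b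
    using assms(1) unfolding alt_form_def by blast
  then show "u \<in> V \<Longrightarrow> v \<in> V \<Longrightarrow> w \<in> V \<Longrightarrow> \<eta> (a *\<^sub>R u + b *\<^sub>R v) w = a * \<eta> u w + b * \<eta> v w" .
  show "u \<in> V \<Longrightarrow> v \<in> V \<Longrightarrow> w \<in> V \<Longrightarrow> \<eta> (u + v) w = \<eta> u w + \<eta> v w"
    using comb[of u v w 1 1] by simp
  show sc: "u \<in> V \<Longrightarrow> w \<in> V \<Longrightarrow> \<eta> (a *\<^sub>R u) w = a * \<eta> u w" for u w a
    using comb[of u u w a 0] by simp
  show "w \<in> V \<Longrightarrow> \<eta> 0 w = 0" using sc[of 0 w 0] subspace_0[OF assms(2)] by simp
qed

lemma alt_form_add_right:
  "alt_form V \<eta> \<Longrightarrow> subspace V \<Longrightarrow> u \<in> V \<Longrightarrow> v \<in> V \<Longrightarrow> w \<in> V \<Longrightarrow> \<eta> w (u + v) = \<eta> w u + \<eta> w v"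
  using alt_form_add[of V \<eta> u v w] alt_form_anti[of V \<eta> w] subspace_add[of V u v] by simp

lemma alt_form_sum:
  assumes "alt_form V \<eta>" "subspace V" "finite I" "\<And>i. i \<in> I \<Longrightarrow> f i \<in> V" "w \<in> V"
  shows "\<eta> (\<Sum>i\<in>I. c i *\<^sub>R f i) w = (\<Sum>i\<in>I. c i * \<eta> (f i) w)"
  using assms(3,4)
proof (induction I rule: finite_induct)
  case empty then show ?case using alt_form_zero[OF assms(1,2,5)] by simp
next
  case (insert i I)
  have "(\<Sum>i\<in>I. c i *\<^sub>R f i) \<in> V" using insert.prems assms(2) by (intro subspace_sum subspace_scale) auto
  then show ?case using insert alt_form_add[OF assms(1,2) subspace_scale[OF assms(2)] _ assms(5)] alt_form_scale[OF assms(1,2) _ assms(5)]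
    by simp
qed

lemma alt_form_expand:
  assumes \<eta>: "alt_form V \<eta>" and V: "subspace V" and ab: "a \<in> V" "b \<in> V"
  shows "\<eta> a b = (\<Sum>i\<in>onb V. \<Sum>j\<in>onb V. (a \<bullet> i) * ((b \<bullet> j) * \<eta> i j))"
proof -
  note B = onb[OF V]
  have e: "x = (\<Sum>i\<in>onb V. (x \<bullet> i) *\<^sub>R i)" if "x \<in> V" for x using proj_id[OF V that] by (simp add: proj_def)
  have 1: "\<eta> x w = (\<Sum>i\<in>onb V. (x \<bullet> i) * \<eta> i w)" if "x \<in> V" "w \<in> V" for x w
    by (subst e[OF that(1)]) (rule alt_form_sum[OF \<eta> V B(7) _ that(2)], use B(1) in blast)
  have 2: "\<eta> i b = (\<Sum>j\<in>onb V. (b \<bullet> j) * \<eta> i j)" if "i \<in> V" for i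
  proof -
    have "\<eta> i b = - (\<Sum>j\<in>onb V. (b \<bullet> j) * \<eta> j i)" using alt_form_anti[OF \<eta> V that ab(2)] 1[OF ab(2) that] by simp
    also have "\<dots> = (\<Sum>j\<in>onb V. (b \<bullet> j) * \<eta> i j)"
      unfolding sum_negf[symmetric] by (rule sum.cong[OF refl]) (use alt_form_anti[OF \<eta> V that] B(1) in auto)
    finally show ?thesis .
  qed
  show ?thesis unfolding 1[OF ab] sum_distrib_left[symmetric]
    by (rule sum.cong[OF refl]) (use 2 B(1) in auto)
qed

lemma alt_form_pullback:
  assumes "alt_form W \<eta>" "linear T" "T ` V \<subseteq> W"
  shows "alt_form V (\<lambda>u v. \<eta> (T u) (T v))"
proof -
  have T: "T u \<in> W" if "u \<in> V" for u using assms(3) that by blast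
  have e: "T (a *\<^sub>R u + b *\<^sub>R v) = a *\<^sub>R T u + b *\<^sub>R T v" for a b u v
    using assms(2) by (simp add: linear_add linear_scale)
  show ?thesis unfolding alt_form_def e using assms(1)[unfolded alt_form_def] T by blast
qed

text \<open>Smoothness of a form is known on constant vectors; moving arguments are expanded in
  \<open>onb V\<close>.\<close>

lemma smooth_on_form:
  fixes f :: "'a::euclidean_space \<Rightarrow> 'b::euclidean_space"
  assumes V: "subspace V" and \<eta>: "\<And>y. y \<in> U \<Longrightarrow> alt_form V (\<eta> y)"
    and sm: "\<And>u v. u \<in> V \<Longrightarrow> v \<in> V \<Longrightarrow> smooth_on U (\<lambda>y. \<eta> y u v)"
    and f: "smooth_on Y f" "f ` Y \<subseteq> U" and a: "smooth_on Y a" "a ` Y \<subseteq> V" and b: "smooth_on Y b" "b ` Y \<subseteq> V"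
  shows "smooth_on Y (\<lambda>y. \<eta> (f y) (a y) (b y))"
proof (rule smooth_on_cong[OF _ order_refl])
  note B = onb[OF V]
  have "smooth_on Y (\<lambda>y. \<eta> (f y) i j)" if "i \<in> onb V" "j \<in> onb V" for i j
    by (rule smooth_on_compose[OF f(1) sm]) (use that B(1) f(2) in auto)
  moreover have "smooth_on Y (\<lambda>y. a y \<bullet> i)" "smooth_on Y (\<lambda>y. b y \<bullet> i)" for i
    by (rule smooth_on_linear_compose[OF bounded_linear_inner_left a(1)], rule smooth_on_linear_compose[OF bounded_linear_inner_left b(1)])
  ultimately show "smooth_on Y (\<lambda>y. \<Sum>i\<in>onb V. \<Sum>j\<in>onb V. (a y \<bullet> i) * ((b y \<bullet> j) * \<eta> (f y) i j))"
    by (intro smooth_on_sum smooth_on_mult B(7)) auto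
  fix y assume y: "y \<in> Y"
  show "(\<Sum>i\<in>onb V. \<Sum>j\<in>onb V. (a y \<bullet> i) * ((b y \<bullet> j) * \<eta> (f y) i j)) = \<eta> (f y) (a y) (b y)"
    by (rule alt_form_expand[OF \<eta> V, symmetric]) (use y f(2) a(2) b(2) in auto)
qed

text \<open>Product rule for base point and both arguments. It too goes through the basis expansion,
  where only products of scalar functions are differentiated.\<close>

lemma der_form:
  fixes f :: "'a::euclidean_space \<Rightarrow> 'b::euclidean_space"
  assumes V: "subspace V" "openin (top_of_set V) U" and \<eta>: "\<And>y. y \<in> U \<Longrightarrow> alt_form V (\<eta> y)"
    and sm: "\<And>u v. u \<in> V \<Longrightarrow> v \<in> V \<Longrightarrow> smooth_on U (\<lambda>y. \<eta> y u v)"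
    and E: "subspace E" "openin (top_of_set E) Y"
    and f: "smooth_on Y f" "f ` Y \<subseteq> U" and a: "smooth_on Y a" "a ` Y \<subseteq> V" and b: "smooth_on Y b" "b ` Y \<subseteq> V"
    and y: "y \<in> Y" and u: "u \<in> E"
  shows "der E (\<lambda>y. \<eta> (f y) (a y) (b y)) y u =
    der V (\<lambda>x. \<eta> x (a y) (b y)) (f y) (der E f y u) + \<eta> (f y) (der E a y u) (b y) + \<eta> (f y) (a y) (der E b y u)"
proof -
  note B = onb[OF V(1)]
  let ?I = "onb V"
  have fy: "f y \<in> U" "a y \<in> V" "b y \<in> V" using y f a b by auto
  have UV: "U \<subseteq> V" by (rule openin_subspace_subset[OF V(2)])
  have fV: "f ` Y \<subseteq> V" using f(2) UV by blast
  have dfV: "der E f y u \<in> V" by (rule der_in[OF E f(1) y u V(1) fV])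
  have daV: "der E a y u \<in> V" by (rule der_in[OF E a(1) y u V(1) a(2)])
  have dbV: "der E b y u \<in> V" by (rule der_in[OF E b(1) y u V(1) b(2)])
  have IV: "i \<in> V" if "i \<in> ?I" for i using that B(1) by blast
  have s: "smooth_on Y (\<lambda>y. \<eta> (f y) i j)" if "i \<in> ?I" "j \<in> ?I" for i j
    by (rule smooth_on_compose[OF f(1) sm[OF IV[OF that(1)] IV[OF that(2)]]]) (use f(2) in auto)
  have sa: "smooth_on Y (\<lambda>y. a y \<bullet> i)" and sb: "smooth_on Y (\<lambda>y. b y \<bullet> i)" for i
    by (rule smooth_on_linear_compose[OF bounded_linear_inner_left a(1)], rule smooth_on_linear_compose[OF bounded_linear_inner_left b(1)])
  have da: "der E (\<lambda>y. a y \<bullet> i) y u = der E a y u \<bullet> i" and db: "der E (\<lambda>y. b y \<bullet> i) y u = der E b y u \<bullet> i" for i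
    by (rule der_linear_compose[OF E a(1) y u bounded_linear_inner_left], rule der_linear_compose[OF E b(1) y u bounded_linear_inner_left])
  have ds: "der E (\<lambda>y. \<eta> (f y) i j) y u = der V (\<lambda>x. \<eta> x i j) (f y) (der E f y u)" if "i \<in> ?I" "j \<in> ?I" for i j
    by (rule der_compose[OF E f(1) V sm[OF IV[OF that(1)] IV[OF that(2)]] y u f(2)])
  have dprod: "der E (\<lambda>y. (a y \<bullet> i) * ((b y \<bullet> j) * \<eta> (f y) i j)) y u =
      (a y \<bullet> i) * ((b y \<bullet> j) * der V (\<lambda>x. \<eta> x i j) (f y) (der E f y u)) +
      (der E a y u \<bullet> i) * ((b y \<bullet> j) * \<eta> (f y) i j) + (a y \<bullet> i) * ((der E b y u \<bullet> j) * \<eta> (f y) i j)"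
    if ij: "i \<in> ?I" "j \<in> ?I" for i j
    using der_bilinear[OF bounded_bilinear_mult E sa smooth_on_mult[OF sb s[OF ij]] y u, of i j]
      der_bilinear[OF bounded_bilinear_mult E sb s[OF ij] y u, of j]
    by (simp add: da db ds[OF ij] algebra_simps)
  have "der E (\<lambda>y. \<eta> (f y) (a y) (b y)) y u = der E (\<lambda>y. \<Sum>i\<in>?I. \<Sum>j\<in>?I. (a y \<bullet> i) * ((b y \<bullet> j) * \<eta> (f y) i j)) y u"
    by (rule fun_cong[OF der_cong[OF E(2) y]], rule alt_form_expand[OF \<eta> V(1)]) (use f a b in auto)
  also have "\<dots> = (\<Sum>i\<in>?I. \<Sum>j\<in>?I. der E (\<lambda>y. (a y \<bullet> i) * ((b y \<bullet> j) * \<eta> (f y) i j)) y u)"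
  proof (subst der_sum[OF E _ y u])
    show "smooth_on Y (\<lambda>x. \<Sum>j\<in>?I. (a x \<bullet> i) * ((b x \<bullet> j) * \<eta> (f x) i j))" if "i \<in> ?I" for i
      using that s sa sb B(7) by (intro smooth_on_sum smooth_on_mult) auto
    show "(\<Sum>i\<in>?I. der E (\<lambda>x. \<Sum>j\<in>?I. (a x \<bullet> i) * ((b x \<bullet> j) * \<eta> (f x) i j)) y u) =
      (\<Sum>i\<in>?I. \<Sum>j\<in>?I. der E (\<lambda>y. (a y \<bullet> i) * ((b y \<bullet> j) * \<eta> (f y) i j)) y u)"
      by (rule sum.cong[OF refl], rule der_sum[OF E _ y u]) (use s sa sb in \<open>auto intro!: smooth_on_mult\<close>)
  qed
  also have "\<dots> = (\<Sum>i\<in>?I. \<Sum>j\<in>?I. (a y \<bullet> i) * ((b y \<bullet> j) * der V (\<lambda>x. \<eta> x i j) (f y) (der E f y u)))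
     + (\<Sum>i\<in>?I. \<Sum>j\<in>?I. (der E a y u \<bullet> i) * ((b y \<bullet> j) * \<eta> (f y) i j))
     + (\<Sum>i\<in>?I. \<Sum>j\<in>?I. (a y \<bullet> i) * ((der E b y u \<bullet> j) * \<eta> (f y) i j))"
    by (simp add: dprod sum.distrib)
  also have "(\<Sum>i\<in>?I. \<Sum>j\<in>?I. (der E a y u \<bullet> i) * ((b y \<bullet> j) * \<eta> (f y) i j)) = \<eta> (f y) (der E a y u) (b y)"
    by (rule alt_form_expand[OF \<eta>[OF fy(1)] V(1) daV fy(3), symmetric])
  also have "(\<Sum>i\<in>?I. \<Sum>j\<in>?I. (a y \<bullet> i) * ((der E b y u \<bullet> j) * \<eta> (f y) i j)) = \<eta> (f y) (a y) (der E b y u)"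
    by (rule alt_form_expand[OF \<eta>[OF fy(1)] V(1) fy(2) dbV, symmetric])
  also have "(\<Sum>i\<in>?I. \<Sum>j\<in>?I. (a y \<bullet> i) * ((b y \<bullet> j) * der V (\<lambda>x. \<eta> x i j) (f y) (der E f y u))) =
      der V (\<lambda>x. \<eta> x (a y) (b y)) (f y) (der E f y u)"
  proof -
    have dc: "der V (\<lambda>x. (a y \<bullet> i) * ((b y \<bullet> j) * \<eta> x i j)) (f y) w = (a y \<bullet> i) * ((b y \<bullet> j) * der V (\<lambda>x. \<eta> x i j) (f y) w)"
      if "i \<in> ?I" "j \<in> ?I" "w \<in> V" for i j w
      using der_linear_compose[OF V sm[OF IV[OF that(1)] IV[OF that(2)]] fy(1) that(3) bounded_linear_mult_right, of "(a y \<bullet> i) * (b y \<bullet> j)"]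
      by (simp add: mult.assoc)
    have "der V (\<lambda>x. \<eta> x (a y) (b y)) (f y) (der E f y u) =
       der V (\<lambda>x. \<Sum>i\<in>?I. \<Sum>j\<in>?I. (a y \<bullet> i) * ((b y \<bullet> j) * \<eta> x i j)) (f y) (der E f y u)"
      by (rule fun_cong[OF der_cong[OF V(2) fy(1)]], rule alt_form_expand[OF \<eta> V(1)]) (use fy in auto)
    also have "\<dots> = (\<Sum>i\<in>?I. der V (\<lambda>x. \<Sum>j\<in>?I. (a y \<bullet> i) * ((b y \<bullet> j) * \<eta> x i j)) (f y) (der E f y u))"
      by (rule der_sum[OF V _ fy(1) dfV]) (use B(7) IV sm in \<open>auto intro!: smooth_on_sum smooth_on_mult[OF smooth_on_const]\<close>)
    also have "\<dots> = (\<Sum>i\<in>?I. \<Sum>j\<in>?I. der V (\<lambda>x. (a y \<bullet> i) * ((b y \<bullet> j) * \<eta> x i j)) (f y) (der E f y u))"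
      by (rule sum.cong[OF refl], rule der_sum[OF V _ fy(1) dfV]) (use IV sm in \<open>auto intro!: smooth_on_mult[OF smooth_on_const]\<close>)
    finally show ?thesis using dc dfV by simp
  qed
  finally show ?thesis .
qed

text \<open>Pullback commutes with the exterior derivative. The product rule adds six terms with
  second derivatives of \<open>f\<close>, which cancel in pairs by symmetry of second derivatives
  and antisymmetry of the form.\<close>

lemma closed_pullback_local:
  fixes f :: "'a::euclidean_space \<Rightarrow> 'b::euclidean_space"
  assumes V: "subspace V" "openin (top_of_set V) U" and \<eta>: "\<And>y. y \<in> U \<Longrightarrow> alt_form V (\<eta> y)"
    and sm: "\<And>u v. u \<in> V \<Longrightarrow> v \<in> V \<Longrightarrow> smooth_on U (\<lambda>y. \<eta> y u v)"
    and cl: "\<And>x u v w. x \<in> U \<Longrightarrow> u \<in> V \<Longrightarrow> v \<in> V \<Longrightarrow> w \<in> V \<Longrightarrow>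
      der V (\<lambda>y. \<eta> y v w) x u + der V (\<lambda>y. \<eta> y w u) x v + der V (\<lambda>y. \<eta> y u v) x w = 0"
    and E: "subspace E" "openin (top_of_set E) Y" and f: "smooth_on Y f" "f ` Y \<subseteq> U"
    and y: "y \<in> Y" and u: "u \<in> E" and v: "v \<in> E" and w: "w \<in> E"
  defines "\<alpha> \<equiv> \<lambda>y u v. \<eta> (f y) (der E f y u) (der E f y v)"
  shows "der E (\<lambda>y. \<alpha> y v w) y u + der E (\<lambda>y. \<alpha> y w u) y v + der E (\<lambda>y. \<alpha> y u v) y w = 0"
proof -
  have fV: "f ` Y \<subseteq> V" using f(2) openin_subspace_subset[OF V(2)] by blast
  have sd: "smooth_on Y (\<lambda>y. der E f y u)" "(\<lambda>y. der E f y u) ` Y \<subseteq> V" if "u \<in> E" for u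
    using smooth_on_der[OF E f(1) that] der_in[OF E f(1) _ that V(1) fV] by auto
  have fy: "f y \<in> U" using f y by blast
  let ?d = "der E f y" and ?s = "\<lambda>u v. der E (\<lambda>y. der E f y v) y u" and ?\<eta> = "\<eta> (f y)"
  have D: "der E (\<lambda>y. \<alpha> y v w) y u = der V (\<lambda>x. \<eta> x (?d v) (?d w)) (f y) (?d u) + ?\<eta> (?s u v) (?d w) + ?\<eta> (?d v) (?s u w)"
    if "u \<in> E" "v \<in> E" "w \<in> E" for u v w
    unfolding \<alpha>_def by (rule der_form[OF V \<eta> sm E f sd[OF that(2)] sd[OF that(3)] y that(1)])
  have sym: "?s u v = ?s v u" if "u \<in> E" "v \<in> E" for u v
    by (rule der_symmetric[OF E f(1) y that(2,1)])
  have dV: "?d u \<in> V" if "u \<in> E" for u using sd(2)[OF that] y by blast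
  have sV: "?s u v \<in> V" if "u \<in> E" "v \<in> E" for u v by (rule der_in[OF E sd(1)[OF that(2)] y that(1) V(1) sd(2)[OF that(2)]])
  note anti = alt_form_anti[OF \<eta>[OF fy] V(1)]
  have "?\<eta> (?s v w) (?d u) = - ?\<eta> (?d u) (?s w v)" "?\<eta> (?s w u) (?d v) = - ?\<eta> (?d v) (?s u w)" "?\<eta> (?s u v) (?d w) = - ?\<eta> (?d w) (?s v u)"
    using anti[OF sV dV] sym u v w by metis+
  then show ?thesis
    unfolding D[OF u v w] D[OF v w u] D[OF w u v] using cl[OF fy dV[OF u] dV[OF v] dV[OF w]] by simp
qed

text \<open>The chart is the identity, yet \<open>form_in_chart\<close> passes through the tangent
  map of its inverse; hence the restriction to points of \<open>Y\<close> and vectors of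
  \<open>E\<close>.\<close>

lemma form_in_chart_euclid:
  assumes "subspace E" "openin (top_of_set E) Y" "x \<in> Y" "u \<in> E" "v \<in> E"
  shows "form_in_chart (euclid_mfd E Y) (Y, \<lambda>x. x) \<alpha> x u v = \<alpha> x u v"
proof -
  have "tangent_map (euclid_mfd E Y) (euclid_mfd E Y) (inv_into Y (\<lambda>x. x)) x = der E (inv_into Y (\<lambda>x. x)) x"
    by (rule tangent_map_euclid[OF assms(2,3)]) (use assms in simp)
  also have "\<dots> = der E (\<lambda>x. x) x" by (rule der_cong[OF assms(2,3)]) simp
  finally show ?thesis
    using der_id[OF assms(1)] assms openin_subspace_subset[OF assms(2)] by (simp add: form_in_chart_def pullback_form_def subset_iff)
qed

lemma two_form_euclidI:
  assumes E: "subspace E" "openin (top_of_set E) Y" and "\<And>x. x \<in> Y \<Longrightarrow> alt_form E (\<alpha> x)"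
    and "\<And>u v. u \<in> E \<Longrightarrow> v \<in> E \<Longrightarrow> smooth_on Y (\<lambda>x. \<alpha> x u v)"
  shows "two_form (euclid_mfd E Y) \<alpha>"
proof -
  have "smooth_on Y (\<lambda>x. form_in_chart (euclid_mfd E Y) (Y, \<lambda>x. x) \<alpha> x u v)" if "u \<in> E" "v \<in> E" for u v
    by (rule smooth_on_cong[OF assms(4)[OF that] order_refl]) (use form_in_chart_euclid[OF E] that in simp)
  then show ?thesis using assms(3) unfolding two_form_def alt_form_def euclid_mfd_simps topspace_euclidean_subtopology
    by (intro conjI) (blast, blast, simp)
qed

lemma closed_form_euclidI:
  assumes E: "subspace E" "openin (top_of_set E) Y"
    and cl: "\<And>x u v w. x \<in> Y \<Longrightarrow> u \<in> E \<Longrightarrow> v \<in> E \<Longrightarrow> w \<in> E \<Longrightarrow>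
      der E (\<lambda>y. \<alpha> y v w) x u + der E (\<lambda>y. \<alpha> y w u) x v + der E (\<lambda>y. \<alpha> y u v) x w = 0"
  shows "closed_form (euclid_mfd E Y) \<alpha>"
proof -
  have "der E (\<lambda>y. form_in_chart (euclid_mfd E Y) (Y, \<lambda>x. x) \<alpha> y u v) x = der E (\<lambda>y. \<alpha> y u v) x"
    if "x \<in> Y" "u \<in> E" "v \<in> E" for x u v
    by (rule der_cong[OF E(2) that(1)]) (rule form_in_chart_euclid[OF E _ that(2,3)])
  then show ?thesis using cl by (simp add: closed_form_def Let_def)
qed

lemma two_formD:
  assumes "two_form M \<omega>"
  shows "p \<in> points M \<Longrightarrow> alt_form (model M) (\<omega> p)"
    and "(U, \<phi>) \<in> atlas M \<Longrightarrow> u \<in> model M \<Longrightarrow> v \<in> model M \<Longrightarrow> smooth_on (\<phi> ` U) (\<lambda>x. form_in_chart M (U, \<phi>) \<omega> x u v)"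
proof -
  show "p \<in> points M \<Longrightarrow> alt_form (model M) (\<omega> p)" using assms unfolding two_form_def alt_form_def by blast
  note A = assms[unfolded two_form_def, THEN conjunct2, THEN conjunct2]
  show "(U, \<phi>) \<in> atlas M \<Longrightarrow> u \<in> model M \<Longrightarrow> v \<in> model M \<Longrightarrow> smooth_on (\<phi> ` U) (\<lambda>x. form_in_chart M (U, \<phi>) \<omega> x u v)"
    using bspec[OF A, of "(U, \<phi>)", unfolded prod.case] by blast
qed

lemma closed_formD:
  assumes "closed_form M \<omega>" "(U, \<phi>) \<in> atlas M" "x \<in> \<phi> ` U" "u \<in> model M" "v \<in> model M" "w \<in> model M"
  shows "der (model M) (\<lambda>y. form_in_chart M (U, \<phi>) \<omega> y v w) x u + der (model M) (\<lambda>y. form_in_chart M (U, \<phi>) \<omega> y w u) x v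
    + der (model M) (\<lambda>y. form_in_chart M (U, \<phi>) \<omega> y u v) x w = 0"
  using bspec[OF assms(1)[unfolded closed_form_def] assms(2), unfolded prod.case Let_def] assms(3-6) by blast

lemma two_form_euclid_cong:
  assumes E: "subspace E" "openin (top_of_set E) Y" and \<alpha>: "two_form (euclid_mfd E Y) \<alpha>"
    and eq: "\<And>x u v. x \<in> Y \<Longrightarrow> u \<in> E \<Longrightarrow> v \<in> E \<Longrightarrow> \<beta> x u v = \<alpha> x u v"
  shows "two_form (euclid_mfd E Y) \<beta>"
proof (rule two_form_euclidI[OF E])
  show "alt_form E (\<beta> x)" if x: "x \<in> Y" for x
  proof -
    have a: "alt_form E (\<alpha> x)" using two_formD(1)[OF \<alpha>, of x] x by simp
    show ?thesis
      unfolding alt_form_def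
    proof (intro conjI ballI allI)
      show "\<beta> x u v = - \<beta> x v u" if "u \<in> E" "v \<in> E" for u v
        unfolding eq[OF x that] eq[OF x that(2,1)] by (rule alt_form_anti[OF a E(1) that])
      show "\<beta> x (c *\<^sub>R u + d *\<^sub>R v) w = c * \<beta> x u w + d * \<beta> x v w" if "u \<in> E" "v \<in> E" "w \<in> E" for u v w c d
        unfolding eq[OF x that(1,3)] eq[OF x that(2,3)]
          eq[OF x subspace_add[OF E(1) subspace_scale[OF E(1) that(1)] subspace_scale[OF E(1) that(2)]] that(3)]
        by (rule alt_form_comb[OF a E(1) that])
    qed
  qed
  show "smooth_on Y (\<lambda>x. \<beta> x u v)" if "u \<in> E" "v \<in> E" for u v
  proof (rule smooth_on_cong[OF _ order_refl])
    show "smooth_on Y (\<lambda>x. form_in_chart (euclid_mfd E Y) (Y, \<lambda>x. x) \<alpha> x u v)"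
      using two_formD(2)[OF \<alpha>, of Y "\<lambda>x. x" u v] that by simp
    show "form_in_chart (euclid_mfd E Y) (Y, \<lambda>x. x) \<alpha> x u v = \<beta> x u v" if "x \<in> Y" for x
      using eq[OF that] form_in_chart_euclid[OF E that] \<open>u \<in> E\<close> \<open>v \<in> E\<close> by simp
  qed
qed

lemma closed_form_euclid_cong:
  assumes E: "subspace E" "openin (top_of_set E) Y" and \<alpha>: "closed_form (euclid_mfd E Y) \<alpha>"
    and eq: "\<And>x u v. x \<in> Y \<Longrightarrow> u \<in> E \<Longrightarrow> v \<in> E \<Longrightarrow> \<beta> x u v = \<alpha> x u v"
  shows "closed_form (euclid_mfd E Y) \<beta>"
proof (rule closed_form_euclidI[OF E])
  fix x u v w assume x: "x \<in> Y" and uvw: "u \<in> E" "v \<in> E" "w \<in> E"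
  have d: "der E (\<lambda>y. \<beta> y a b) x c = der E (\<lambda>y. form_in_chart (euclid_mfd E Y) (Y, \<lambda>x. x) \<alpha> y a b) x c"
    if "a \<in> E" "b \<in> E" for a b c
    by (rule fun_cong[OF der_cong[OF E(2) x]]) (use eq form_in_chart_euclid[OF E] that in simp)
  show "der E (\<lambda>y. \<beta> y v w) x u + der E (\<lambda>y. \<beta> y w u) x v + der E (\<lambda>y. \<beta> y u v) x w = 0"
    unfolding d[OF uvw(2,3)] d[OF uvw(3,1)] d[OF uvw(1,2)]
    using closed_formD[OF \<alpha>, of Y "\<lambda>x. x" x u v w] x uvw by simp
qed

lemma pullback_form_compose:
  assumes "smooth_atlas A" "smooth_atlas B" "smooth_atlas C" "smooth_at A B F p" "smooth_at B C G (F p)" "u \<in> model A" "v \<in> model A"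
  shows "pullback_form A C (\<lambda>x. G (F x)) \<omega> p u v = pullback_form A B F (pullback_form B C G \<omega>) p u v"
  using tangent_map_compose[OF assms(1-5)] assms(6,7) by (simp add: pullback_form_def)

lemma pullback_form_cong:
  assumes "smooth_atlas A" "openin (mtop A) W" "p \<in> W" "\<And>x. x \<in> W \<Longrightarrow> F x = G x"
  shows "pullback_form A B F \<omega> p = pullback_form A B G \<omega> p"
proof -
  have "tangent_map A B F p = tangent_map A B G p" by (rule tangent_map_cong[OF assms])
  then show ?thesis using assms(3,4) by (simp add: pullback_form_def fun_eq_iff)
qed

lemma alt_form_pullback_form:
  assumes "smooth_atlas A" "smooth_atlas B" "smooth_at A B F p" "alt_form (model B) (\<omega> (F p))"
  shows "alt_form (model A) (pullback_form A B F \<omega> p)"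
proof -
  have "alt_form (model A) (\<lambda>u v. \<omega> (F p) (tangent_map A B F p u) (tangent_map A B F p v))"
    by (rule alt_form_pullback[OF assms(4) tangent_map_linear[OF assms(1-3)]])
      (use tangent_map_in[OF assms(1-3)] in blast)
  moreover have "pullback_form A B F \<omega> p = (\<lambda>u v. \<omega> (F p) (tangent_map A B F p u) (tangent_map A B F p v))"
    by (simp add: pullback_form_def fun_eq_iff)
  ultimately show ?thesis by simp
qed

text \<open>Smoothness and closedness are local, so near \<open>y0\<close> the map can be read in
  one chart of \<open>M\<close> and the coordinate computation applies.\<close>

theorem pullback_form_euclid_closed:
  assumes M: "smooth_atlas M" and \<omega>: "two_form M \<omega>" "closed_form M \<omega>"
    and E: "subspace E" "openin (top_of_set E) Y" and F: "\<And>y. y \<in> Y \<Longrightarrow> smooth_at (euclid_mfd E Y) M F y"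
  shows "two_form (euclid_mfd E Y) (pullback_form (euclid_mfd E Y) M F \<omega>)"
    "closed_form (euclid_mfd E Y) (pullback_form (euclid_mfd E Y) M F \<omega>)"
proof -
  let ?P = "euclid_mfd E Y" and ?V = "model M"
  let ?\<alpha> = "pullback_form ?P M F \<omega>"
  note Pa = smooth_atlas_euclid[OF E]
  note V = smooth_atlasD(1)[OF M]
  have alt: "alt_form E (?\<alpha> y)" if "y \<in> Y" for y
    using alt_form_pullback_form[of ?P M F y \<omega>, OF Pa M F[OF that] two_formD(1)[OF \<omega>(1) smooth_at_points(2)[OF Pa M F[OF that]]]] by simp
  have loc: "\<exists>Y0. openin (top_of_set E) Y0 \<and> y0 \<in> Y0 \<and> Y0 \<subseteq> Y \<and>
      (\<forall>u\<in>E. \<forall>v\<in>E. smooth_on Y0 (\<lambda>y. ?\<alpha> y u v)) \<and>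
      (\<forall>u\<in>E. \<forall>v\<in>E. \<forall>w\<in>E. der E (\<lambda>y. ?\<alpha> y v w) y0 u + der E (\<lambda>y. ?\<alpha> y w u) y0 v + der E (\<lambda>y. ?\<alpha> y u v) y0 w = 0)"
    if y0: "y0 \<in> Y" for y0
  proof -
    have Fy0: "F y0 \<in> points M" by (rule smooth_at_points(2)[OF Pa M F[OF y0]])
    obtain U \<phi> where U: "(U, \<phi>) \<in> atlas M" "F y0 \<in> U" using smooth_atlasD(6)[OF M Fy0] by blast
    note oU = smooth_atlasD(3)[OF M U(1)]
    note Ua = smooth_atlas_euclid[OF V oU]
    define Y0 where "Y0 = {y \<in> Y. F y \<in> U}"
    have "openin (mtop ?P) Y0" unfolding Y0_def
      by (rule smooth_at_preimage_open[OF Pa M _ F smooth_atlasD(2)[OF M U(1)]]) auto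
    then have oY0: "openin (top_of_set E) Y0" "Y0 \<subseteq> Y" and oY0': "openin (mtop ?P) Y0" using openin_top_of_open[OF E(2)] by auto
    let ?f = "\<lambda>y. \<phi> (F y)" and ?\<eta> = "form_in_chart M (U, \<phi>) \<omega>"
    have sf: "smooth_at ?P (euclid_mfd ?V (\<phi> ` U)) ?f y" if "y \<in> Y0" for y
      by (rule smooth_at_compose[OF Pa M Ua F smooth_at_chart[OF M U(1) _ oU]]) (use that in \<open>auto simp: Y0_def\<close>)
    note Y0a = smooth_atlas_euclid[OF E(1) oY0(1)]
    have "smooth_map (euclid_mfd E Y0) (euclid_mfd ?V (\<phi> ` U)) ?f"
      by (rule smooth_map_onI[OF Y0a Ua]) (use smooth_at_euclid_dom[OF E(1) Ua sf E(2) oY0] in auto)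
    then have f: "smooth_on Y0 ?f" "?f ` Y0 \<subseteq> \<phi> ` U" using smooth_map_euclid_iff[OF E(1) oY0(1) V oU] by auto
    have \<eta>alt: "alt_form ?V (?\<eta> x)" if "x \<in> \<phi> ` U" for x
    proof -
      have "smooth_at (euclid_mfd ?V (\<phi> ` U)) M (inv_into U \<phi>) x" by (rule smooth_at_chart_inv[OF M U(1) oU that that])
      from alt_form_pullback_form[OF Ua M this, of \<omega>] two_formD(1)[OF \<omega>(1) smooth_at_points(2)[OF Ua M this]]
      show ?thesis by (simp add: form_in_chart_def)
    qed
    have eq: "?\<alpha> y u v = ?\<eta> (?f y) (der E ?f y u) (der E ?f y v)" if y: "y \<in> Y0" and uv: "u \<in> E" "v \<in> E" for y u v
    proof -
      have yY: "y \<in> Y" "F y \<in> U" "?f y \<in> \<phi> ` U" using y by (auto simp: Y0_def)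
      have "?\<alpha> y = pullback_form ?P M (\<lambda>y. inv_into U \<phi> (?f y)) \<omega> y"
        by (rule pullback_form_cong[OF Pa oY0' y]) (use chart_inv[OF M U(1)] in \<open>auto simp: Y0_def\<close>)
      then have "?\<alpha> y u v = pullback_form ?P (euclid_mfd ?V (\<phi> ` U)) ?f (pullback_form (euclid_mfd ?V (\<phi> ` U)) M (inv_into U \<phi>) \<omega>) y u v"
        using pullback_form_compose[OF Pa Ua M sf[OF y] smooth_at_chart_inv[OF M U(1) oU yY(3) yY(3)], of u v \<omega>] uv by simp
      then show ?thesis
        using tangent_map_euclid[OF E(2) yY(1), of ?f "\<phi> ` U" ?V] yY(3) by (simp add: pullback_form_def form_in_chart_def)
    qed
    have fV: "?f ` Y0 \<subseteq> ?V" using f(2) openin_subspace_subset[OF oU] by blast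
    have sd: "smooth_on Y0 (\<lambda>y. der E ?f y u)" "(\<lambda>y. der E ?f y u) ` Y0 \<subseteq> ?V" if "u \<in> E" for u
      using smooth_on_der[OF E(1) oY0(1) f(1) that] der_in[OF E(1) oY0(1) f(1) _ that V fV] by auto
    have y00: "y0 \<in> Y0" using y0 U(2) by (simp add: Y0_def)
    have sm: "smooth_on Y0 (\<lambda>y. ?\<alpha> y u v)" if uv: "u \<in> E" "v \<in> E" for u v
      by (rule smooth_on_cong[OF smooth_on_form[OF V \<eta>alt two_formD(2)[OF \<omega>(1) U(1)] f sd[OF uv(1)] sd[OF uv(2)]] order_refl])
        (use eq uv in auto)
    have d: "der E (\<lambda>y. ?\<alpha> y u v) y0 = der E (\<lambda>y. ?\<eta> (?f y) (der E ?f y u) (der E ?f y v)) y0" if "u \<in> E" "v \<in> E" for u v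
      by (rule der_cong[OF oY0(1) y00]) (rule eq[OF _ that])
    have "der E (\<lambda>y. ?\<alpha> y v w) y0 u + der E (\<lambda>y. ?\<alpha> y w u) y0 v + der E (\<lambda>y. ?\<alpha> y u v) y0 w = 0"
      if "u \<in> E" "v \<in> E" "w \<in> E" for u v w
      unfolding d[OF that(2,3)] d[OF that(3,1)] d[OF that(1,2)]
      by (rule closed_pullback_local[OF V oU \<eta>alt two_formD(2)[OF \<omega>(1) U(1)] closed_formD[OF \<omega>(2) U(1)] E(1) oY0(1) f y00 that])
    then show ?thesis using oY0 y00 sm by (intro exI[of _ Y0] conjI ballI)
  qed
  show "two_form ?P ?\<alpha>"
  proof (rule two_form_euclidI[OF E alt])
    fix u v assume uv: "u \<in> E" "v \<in> E"
    show "smooth_on Y (\<lambda>x. ?\<alpha> x u v)"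
    proof (rule smooth_on_local)
      fix x assume "x \<in> Y"
      from loc[OF this] uv openin_top_of_open[OF E(2)]
      show "\<exists>T. openin (top_of_set Y) T \<and> x \<in> T \<and> smooth_on T (\<lambda>x. ?\<alpha> x u v)" by metis
    qed
  qed
  show "closed_form ?P ?\<alpha>" by (rule closed_form_euclidI[OF E]) (use loc in blast)
qed

lemma image_eqE: "f ` A = B \<Longrightarrow> y \<in> B \<Longrightarrow> (\<And>x. x \<in> A \<Longrightarrow> f x = y \<Longrightarrow> P) \<Longrightarrow> P"
  by blast

text \<open>A finite case of Baire's argument: closed sets with empty interior have a finite union
  with empty interior.\<close>

lemma finite_closed_cover_interior:
  assumes "finite I" "\<And>i. i \<in> I \<Longrightarrow> closedin X (C i)" "topspace X \<subseteq> (\<Union>i\<in>I. C i)" "topspace X \<noteq> {}"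
  shows "\<exists>i\<in>I. X interior_of (C i) \<noteq> {}"
proof (rule ccontr)
  assume "\<not> ?thesis"
  then have *: "X interior_of (C i) = {}" if "i \<in> I" for i using that by blast
  have "X interior_of (\<Union>i\<in>I. C i) = {}"
    using assms(1,2) *
  proof (induction I rule: finite_induct)
    case empty then show ?case by (simp add: interior_of_empty)
  next
    case (insert i I)
    then show ?case by (simp add: interior_of_union_eq_empty)
  qed
  moreover have "X interior_of (\<Union>i\<in>I. C i) = topspace X"
    by (rule antisym[OF interior_of_subset_topspace interior_of_maximal[OF assms(3) openin_topspace]])
  ultimately show False using assms(4) by simp
qed

text \<open>Two smooth lifts need not differ by a single element of the group, but the sets where they
  differ by a fixed one are closed and cover, so such agreement holds on a dense open set.\<close>

lemma pullback_eq_up_to_finite_group: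
  fixes f g :: "'a::euclidean_space \<Rightarrow> 'b::euclidean_space"
  assumes V: "subspace V" "openin (top_of_set V) U" and \<eta>: "\<And>y. y \<in> U \<Longrightarrow> alt_form V (\<eta> y)"
    and sm: "\<And>u v. u \<in> V \<Longrightarrow> v \<in> V \<Longrightarrow> smooth_on U (\<lambda>y. \<eta> y u v)"
    and E: "subspace E" "openin (top_of_set E) Y" and f: "smooth_on Y f" "f ` Y \<subseteq> U" and g: "smooth_on Y g" "g ` Y \<subseteq> U"
    and \<Gamma>: "finite \<Gamma>" "\<And>\<gamma>. \<gamma> \<in> \<Gamma> \<Longrightarrow> smooth_on U \<gamma>" "\<And>\<gamma>. \<gamma> \<in> \<Gamma> \<Longrightarrow> \<gamma> ` U \<subseteq> U"
    and inv: "\<And>\<gamma> x u v. \<gamma> \<in> \<Gamma> \<Longrightarrow> x \<in> U \<Longrightarrow> u \<in> V \<Longrightarrow> v \<in> V \<Longrightarrow> \<eta> (\<gamma> x) (der V \<gamma> x u) (der V \<gamma> x v) = \<eta> x u v"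
    and br: "\<And>y. y \<in> Y \<Longrightarrow> \<exists>\<gamma>\<in>\<Gamma>. f y = \<gamma> (g y)"
    and y: "y \<in> Y" and uv: "u \<in> E" "v \<in> E"
  shows "\<eta> (f y) (der E f y u) (der E f y v) = \<eta> (g y) (der E g y u) (der E g y v)"
proof -
  have UV: "U \<subseteq> V" by (rule openin_subspace_subset[OF V(2)])
  have sd: "smooth_on Y (\<lambda>y. der E h y u)" "(\<lambda>y. der E h y u) ` Y \<subseteq> V" if "u \<in> E" "smooth_on Y h" "h ` Y \<subseteq> U" for u and h :: "'a \<Rightarrow> 'b"
    using smooth_on_der[OF E that(2,1)] der_in[OF E that(2) _ that(1) V(1)] that(3) UV by (auto simp: image_subset_iff subset_iff)
  define h where "h = (\<lambda>y. \<eta> (f y) (der E f y u) (der E f y v) - \<eta> (g y) (der E g y u) (der E g y v))"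
  have "smooth_on Y h" unfolding h_def
    by (rule smooth_on_diff; rule smooth_on_form[OF V(1) \<eta> sm]) (use f g sd uv in blast)+
  then have ch: "continuous_on Y h" by (rule smooth_on_imp_continuous_on)
  have "h y = 0"
  proof (rule ccontr)
    assume hy: "h y \<noteq> 0"
    \<comment> \<open>If the pullbacks differ at \<open>y\<close>, they differ on an open set. On
      some open part of it a single \<open>\<gamma>\<close> relates the two maps, and there
      invariance forces equality.\<close>
    define O' where "O' = {y \<in> Y. h y \<noteq> 0}"
    have "openin (top_of_set Y) O'"
    proof -
      have "O' = Y \<inter> h -` (- {0})" by (auto simp: O'_def)
      then show ?thesis using continuous_openin_preimage_gen[OF ch open_Compl[OF closed_singleton]] by simp
    qed
    then have oO: "openin (top_of_set E) O'" "O' \<subseteq> Y" using openin_top_of_open[OF E(2)] by auto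
    have "\<exists>\<gamma>\<in>\<Gamma>. (top_of_set O') interior_of {y \<in> O'. f y = \<gamma> (g y)} \<noteq> {}"
    proof (rule finite_closed_cover_interior[OF \<Gamma>(1)])
      fix \<gamma> assume \<gamma>: "\<gamma> \<in> \<Gamma>"
      have "continuous_on Y (\<lambda>y. f y - \<gamma> (g y))"
        by (rule smooth_on_imp_continuous_on[OF smooth_on_diff[OF f(1) smooth_on_compose[OF g(1) \<Gamma>(2)[OF \<gamma>]]]]) (use g(2) in blast)
      then have "continuous_on O' (\<lambda>y. f y - \<gamma> (g y))" using oO(2) continuous_on_subset by blast
      from continuous_closedin_preimage_constant[OF this, of 0]
      show "closedin (top_of_set O') {y \<in> O'. f y = \<gamma> (g y)}" by simp
    qed (use br oO(2) y hy in \<open>auto simp: O'_def\<close>)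
    then obtain \<gamma> y1 where \<gamma>: "\<gamma> \<in> \<Gamma>" "y1 \<in> (top_of_set O') interior_of {y \<in> O'. f y = \<gamma> (g y)}" by blast
    then obtain T where T: "openin (top_of_set O') T" "y1 \<in> T" "T \<subseteq> {y \<in> O'. f y = \<gamma> (g y)}"
      unfolding interior_of_def by blast
    have oT: "openin (top_of_set E) T" using T(1) oO(1) openin_trans by blast
    have TY: "T \<subseteq> Y" using T(3) oO(2) by blast
    have y1: "y1 \<in> Y" "g y1 \<in> U" "h y1 \<noteq> 0" "f y1 = \<gamma> (g y1)" using T TY g(2) by (auto simp: O'_def)
    have "der E f y1 w = der V \<gamma> (g y1) (der E g y1 w)" if "w \<in> E" for w
    proof -
      have "der E f y1 = der E (\<lambda>y. \<gamma> (g y)) y1" by (rule der_cong[OF oT T(2)]) (use T(3) in blast)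
      then show ?thesis using der_compose[OF E g(1) V \<Gamma>(2)[OF \<gamma>(1)] y1(1) that g(2)] by simp
    qed
    moreover have "der E g y1 w \<in> V" if "w \<in> E" for w using sd(2)[OF that g] y1(1) by blast
    ultimately have "h y1 = 0" unfolding h_def y1(4) using inv[OF \<gamma>(1) y1(2)] uv by simp
    then show False using y1(3) by simp
  qed
  then show ?thesis by (simp add: h_def)
qed

section \<open>The reduced symplectic form\<close>

text \<open>What reduction asks of a form: invariance, kernel equal to the orbit directions,
  closedness. Closedness is stated for pullbacks to open sets of \<open>V\<close>, which is how
  charts use it; for the ray preimage these are pullbacks of \<open>\<omega>\<close> itself.\<close>

locale reducible_form = proper_free_action KG K N \<Phi> V
  for KG :: "'g monoid" (structure) and K :: "('g, 'k::euclidean_space) mfd"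
    and N :: "('m, 'f::euclidean_space) mfd" and \<Phi> :: "'g \<Rightarrow> 'm \<Rightarrow> 'm" and V :: "'f set" +
  fixes \<sigma> :: "('m, 'f) form2"
  assumes \<sigma>_alt: "x \<in> points N \<Longrightarrow> alt_form (model N) (\<sigma> x)"
    and \<sigma>_inv: "g \<in> carrier KG \<Longrightarrow> x \<in> points N \<Longrightarrow> u \<in> model N \<Longrightarrow> v \<in> model N \<Longrightarrow>
      \<sigma> (\<Phi> g x) (tangent_map N N (\<Phi> g) x u) (tangent_map N N (\<Phi> g) x v) = \<sigma> x u v"
    and \<sigma>_ker: "x \<in> points N \<Longrightarrow> u \<in> model N \<Longrightarrow> (\<forall>v\<in>model N. \<sigma> x u v = 0) \<longleftrightarrow> u \<in> vert x ` model K"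
    and \<sigma>_closed: "openin (top_of_set V) U \<Longrightarrow> (\<And>d. d \<in> U \<Longrightarrow> smooth_at (euclid_mfd V U) N t d) \<Longrightarrow>
      two_form (euclid_mfd V U) (pullback_form (euclid_mfd V U) N t \<sigma>) \<and>
      closed_form (euclid_mfd V U) (pullback_form (euclid_mfd V U) N t \<sigma>)"
begin

lemma E: "subspace (model N)" by (rule smooth_atlasD(1)[OF Na])

lemma \<sigma>_vert_left: "x \<in> points N \<Longrightarrow> \<xi> \<in> model K \<Longrightarrow> v \<in> model N \<Longrightarrow> \<sigma> x (vert x \<xi>) v = 0"
  using \<sigma>_ker[OF _ vert_in] by blast

lemma \<sigma>_vert_right: "x \<in> points N \<Longrightarrow> \<xi> \<in> model K \<Longrightarrow> v \<in> model N \<Longrightarrow> \<sigma> x v (vert x \<xi>) = 0"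
  using alt_form_anti[OF \<sigma>_alt E, of x v "vert x \<xi>"] \<sigma>_vert_left[of x \<xi> v] vert_in[of x \<xi>] by simp

lemma \<sigma>_mod_vert:
  assumes x: "x \<in> points N" and uv: "u \<in> model N" "v \<in> model N" and \<xi>: "\<xi> \<in> model K" "\<xi>' \<in> model K"
  shows "\<sigma> x (u + vert x \<xi>) (v + vert x \<xi>') = \<sigma> x u v"
proof -
  note alt = \<sigma>_alt[OF x]
  have m: "vert x \<xi> \<in> model N" "vert x \<xi>' \<in> model N" "v + vert x \<xi>' \<in> model N"
    using vert_in[OF x] \<xi> uv E by (auto intro: subspace_add)
  show ?thesis
    using alt_form_add[OF alt E uv(1) m(1,3)] alt_form_add_right[OF alt E uv(2) m(2) uv(1)]
      \<sigma>_vert_left[OF x \<xi>(1) m(3)] \<sigma>_vert_right[OF x \<xi>(2) uv(1)] by simp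
qed

text \<open>By \<open>tangent_act\<close> the moved map has the pushed-forward derivative plus orbit
  directions; the form is invariant and annihilates the latter. Comparisons of parametrizations
  below reduce to this.\<close>

lemma pullback_act:
  assumes P: "smooth_atlas P" and c: "smooth_at P K c p" and f: "smooth_at P N f p" and uv: "u \<in> model P" "v \<in> model P"
  shows "pullback_form P N (\<lambda>x. \<Phi> (c x) (f x)) \<sigma> p u v = pullback_form P N f \<sigma> p u v"
proof -
  have cp: "c p \<in> carrier KG" using smooth_at_points(2)[OF P Ka c] by simp
  have fp: "f p \<in> points N" by (rule smooth_at_points(2)[OF P Na f])
  let ?T = "tangent_map N N (\<Phi> (c p)) (f p)" and ?t = "tangent_map P N f p"
  obtain \<xi> where \<xi>: "\<xi> \<in> model K" "tangent_map P N (\<lambda>x. \<Phi> (c x) (f x)) p u = ?T (?t u) + vert (\<Phi> (c p) (f p)) \<xi>"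
    by (rule tangent_act[OF P c f uv(1)])
  obtain \<xi>' where \<xi>': "\<xi>' \<in> model K" "tangent_map P N (\<lambda>x. \<Phi> (c x) (f x)) p v = ?T (?t v) + vert (\<Phi> (c p) (f p)) \<xi>'"
    by (rule tangent_act[OF P c f uv(2)])
  have t: "?t u \<in> model N" "?t v \<in> model N" using tangent_map_in[OF P Na f] uv by auto
  have "?T (?t u) \<in> model N" "?T (?t v) \<in> model N" using tangent_map_in[OF Na Na smooth_at_act_left[OF cp fp]] t by auto
  from \<sigma>_mod_vert[OF act_closed[OF cp fp] this \<xi>(1) \<xi>'(1)] \<sigma>_inv[OF cp fp t]
  show ?thesis by (simp add: pullback_form_def \<xi>(2) \<xi>'(2))
qed

text \<open>A chart records only the orbits \<open>orb (t d)\<close>, so a parametrization of a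
  transversal has to be chosen for it.\<close>

definition chart_param :: "('m set, 'f) orbichart \<Rightarrow> 'f \<Rightarrow> 'm" where
  "chart_param c = (SOME t. \<exists>W p q. slice_chart c t W p q)"

definition \<Omega> :: "('m set, 'f) orbichart \<Rightarrow> ('f, 'f) form2" where
  "\<Omega> c = pullback_form (euclid_mfd V (fst c)) N (chart_param c) \<sigma>"

lemma slice_atlasE:
  assumes "c \<in> slice_atlas"
  obtains U \<Gamma> \<phi> t W p q where "c = (U, \<Gamma>, \<phi>)" "slice_chart (U, \<Gamma>, \<phi>) t W p q" "\<Omega> c = pullback_form (euclid_mfd V U) N t \<sigma>"
proof -
  have "\<exists>t W p q. slice_chart c t W p q" using assms by (simp add: slice_atlas_def)
  from someI_ex[OF this, folded chart_param_def] obtain W p q where "slice_chart c (chart_param c) W p q" by blast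
  then show ?thesis using that[of "fst c" "fst (snd c)" "snd (snd c)" "chart_param c"] by (auto simp: \<Omega>_def)
qed

text \<open>The action of \<open>e w\<close> turns \<open>t (s w)\<close> back into
  \<open>w\<close>, and by \<open>pullback_act\<close> this action does not change the
  pullback.\<close>

lemma good_lift_pullback:
  assumes gl: "good_lift U t W s e" and U: "openin (top_of_set V) U" and t: "\<And>d. d \<in> U \<Longrightarrow> smooth_at (euclid_mfd V U) N t d"
    and z: "z \<in> W" and uv: "u \<in> model N" "v \<in> model N"
  shows "pullback_form N (euclid_mfd V U) s (pullback_form (euclid_mfd V U) N t \<sigma>) z u v = \<sigma> z u v"
proof -
  note G = good_liftD[OF gl]
  note Ua = smooth_atlas_euclid[OF V(1) U]
  have zN: "z \<in> points N" using openin_subset[OF G(1)] z by blast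
  have ts: "smooth_at N N (\<lambda>w. t (s w)) z" by (rule smooth_at_compose[OF Na Ua Na G(2)[OF z] t[OF G(4)[OF z]]])
  have "pullback_form N (euclid_mfd V U) s (pullback_form (euclid_mfd V U) N t \<sigma>) z u v = pullback_form N N (\<lambda>w. t (s w)) \<sigma> z u v"
    by (rule pullback_form_compose[OF Na Ua Na G(2)[OF z] t[OF G(4)[OF z]] uv, symmetric])
  also have "\<dots> = pullback_form N N (\<lambda>w. \<Phi> (e w) (t (s w))) \<sigma> z u v"
    by (rule pullback_act[OF Na G(3)[OF z] ts uv, symmetric])
  also have "\<dots> = pullback_form N N (\<lambda>w. w) \<sigma> z u v"
    by (rule fun_cong[OF fun_cong[OF pullback_form_cong[OF Na G(1) z G(5)]]])
  also have "\<dots> = \<sigma> z u v" using tangent_map_id[OF Na zN] uv by (simp add: pullback_form_def)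
  finally show ?thesis .
qed

text \<open>On the transversal \<open>\<gamma>\<close> is the action of a varying group element, so
  \<open>pullback_act\<close> applies again.\<close>

lemma \<Omega>_invariant:
  assumes sc: "slice_chart (U, \<Gamma>, \<phi>) t W p q" and \<gamma>: "\<gamma> \<in> \<Gamma>" and x: "x \<in> U" and uv: "u \<in> V" "v \<in> V"
    and \<gamma>U: "\<gamma> ` U \<subseteq> U"
  shows "pullback_form (euclid_mfd V U) N t \<sigma> (\<gamma> x) (der V \<gamma> x u) (der V \<gamma> x v) = pullback_form (euclid_mfd V U) N t \<sigma> x u v"
proof -
  let ?P = "euclid_mfd V U"
  note C = slice_chartD[OF sc]
  note U = orbichart_open[OF C(1)]
  note Ua = smooth_atlas_euclid[OF V(1) U]
  have "smooth_on U \<gamma>" using C(1) \<gamma> by (simp add: orbichart_def)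
  then have s\<gamma>: "smooth_at ?P ?P \<gamma> x" by (intro smooth_at_euclidI[OF U U x]) (use \<gamma>U in auto)
  have gx: "\<gamma> x \<in> U" using \<gamma>U x by blast
  obtain c where c: "\<And>d. d \<in> U \<Longrightarrow> smooth_at ?P K c d" "\<And>d. d \<in> U \<Longrightarrow> t (\<gamma> d) = \<Phi> (c d) (t d)" using C(8)[OF \<gamma>] by blast
  have "pullback_form ?P N t \<sigma> (\<gamma> x) (der V \<gamma> x u) (der V \<gamma> x v) = pullback_form ?P ?P \<gamma> (pullback_form ?P N t \<sigma>) x u v"
    using tangent_map_euclid[OF U x, of \<gamma> U V] gx by (simp add: pullback_form_def)
  also have "\<dots> = pullback_form ?P N (\<lambda>d. t (\<gamma> d)) \<sigma> x u v"
    by (rule pullback_form_compose[OF Ua Ua Na s\<gamma> C(2)[OF gx], symmetric]) (use uv in auto)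
  also have "\<dots> = pullback_form ?P N (\<lambda>d. \<Phi> (c d) (t d)) \<sigma> x u v"
    by (rule fun_cong[OF fun_cong[OF pullback_form_cong[OF Ua _ x c(2)]]]) auto
  also have "\<dots> = pullback_form ?P N t \<sigma> x u v" by (rule pullback_act[OF Ua c(1)[OF x] C(2)[OF x]]) (use uv in auto)
  finally show ?thesis .
qed

lemma local_lift_smooth_at:
  assumes "local_lift N V (U, \<Gamma>, \<phi>) orb W s" "openin (top_of_set V) U" "x \<in> W"
  shows "smooth_at N (euclid_mfd V U) s x" "s x \<in> U" "\<phi> (s x) = orb x" "openin (mtop N) W"
proof -
  have *: "openin (mtop N) W" "smooth_map_on N W (euclid_mfd V U) s" "\<forall>x\<in>W. \<phi> (s x) = orb x"
    using assms(1) by (simp_all add: local_lift_def)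
  show s: "smooth_at N (euclid_mfd V U) s x"
    by (rule smooth_map_on_imp_smooth_at[OF Na smooth_atlas_euclid[OF V(1) assms(2)] *(2,1) assms(3)])
  show "s x \<in> U" using smooth_at_points(2)[OF Na smooth_atlas_euclid[OF V(1) assms(2)] s] by simp
  show "\<phi> (s x) = orb x" "openin (mtop N) W" using * assms(3) by auto
qed

lemma tangent_map_in_chart_at:
  assumes c: "chart_at N x = (U0, \<theta>)" and s: "s x \<in> U"
  shows "tangent_map N (euclid_mfd V U) s x = der (model N) (\<lambda>y. s (inv_into U0 \<theta> y)) (\<theta> x)"
  using tangent_map_eq[where F=s, OF c chart_at_euclid[OF s]] by (simp add: o_def)

text \<open>For lifts built from slices this is \<open>good_lift_pullback\<close>. An arbitrary lift
  \<open>s'\<close> is compared near \<open>x\<close> with such a lift \<open>s\<close> of the same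
  value at \<open>x\<close>: both project to the same orbits, so pointwise they differ by elements
  of the finite group.\<close>

lemma pullback_eq_slice_atlas: "orbifold_pullback_eq N V slice_atlas orb \<Omega> \<sigma>"
  unfolding orbifold_pullback_eq_def
proof (intro ballI allI impI)
  fix c W' s' x u v
  assume c: "c \<in> slice_atlas" and l: "local_lift N V c orb W' s'" and x: "x \<in> W'" and uv: "u \<in> model N" "v \<in> model N"
  obtain U \<Gamma> \<phi> t W p q where C0: "c = (U, \<Gamma>, \<phi>)" "slice_chart (U, \<Gamma>, \<phi>) t W p q" "\<Omega> c = pullback_form (euclid_mfd V U) N t \<sigma>"
    by (rule slice_atlasE[OF c])
  note C = slice_chartD[OF C0(2)]
  note U = orbichart_open[OF C(1)]
  let ?P = "euclid_mfd V U"
  let ?\<eta> = "pullback_form ?P N t \<sigma>"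
  note Ua = smooth_atlas_euclid[OF V(1) U]
  note L = local_lift_smooth_at[OF l[unfolded C0(1)] U]
  have xN: "x \<in> points N" using openin_subset[OF L(4)[OF x]] x by blast
  obtain W2 s e where gl: "good_lift U t W2 s e" "x \<in> W2" "s x = s' x"
    by (rule good_lift_exists[OF C0(2) xN L(2,3)[OF x]])
  note G = good_liftD[OF gl(1)]
  obtain U0 \<theta> where ch: "chart_at N x = (U0, \<theta>)" by (metis surj_pair)
  note U0 = chart_at[OF Na xN ch]
  define O' where "O' = U0 \<inter> W' \<inter> W2"
  have O': "openin (mtop N) O'" "x \<in> O'" "O' \<subseteq> U0" unfolding O'_def
    using smooth_atlasD(2)[OF Na U0(1)] L(4)[OF x] G(1) U0(2) x gl(2) by auto
  define Y where "Y = \<theta> ` O'"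
  have oY: "openin (top_of_set (model N)) Y" unfolding Y_def by (rule chart_image_open[OF Na U0(1) O'(1,3)])
  let ?i = "inv_into U0 \<theta>"
  have iY: "?i y \<in> O'" "y \<in> \<theta> ` U0" if "y \<in> Y" for y using that chart_inv[OF Na U0(1)] O'(3) unfolding Y_def by auto
  have rep: "smooth_on Y (\<lambda>y. h (?i y)) \<and> (\<lambda>y. h (?i y)) ` Y \<subseteq> U" if h: "\<And>z. z \<in> O' \<Longrightarrow> smooth_at N ?P h z" for h
  proof -
    have "smooth_at (euclid_mfd (model N) Y) ?P (\<lambda>y. h (?i y)) y" if "y \<in> Y" for y
      by (rule smooth_at_compose[OF smooth_atlas_euclid[OF E oY] Na Ua smooth_at_chart_inv[OF Na U0(1) oY that iY(2)[OF that]] h[OF iY(1)[OF that]]])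
    then have "smooth_map (euclid_mfd (model N) Y) ?P (\<lambda>y. h (?i y))"
      by (intro smooth_map_onI[OF smooth_atlas_euclid[OF E oY] Ua]) auto
    then show ?thesis by (simp only: smooth_map_euclid_iff[OF E oY V(1) U])
  qed
  have f: "smooth_on Y (\<lambda>y. s' (?i y))" "(\<lambda>y. s' (?i y)) ` Y \<subseteq> U" using rep[of s'] L(1) by (auto simp: O'_def)
  have g: "smooth_on Y (\<lambda>y. s (?i y))" "(\<lambda>y. s (?i y)) ` Y \<subseteq> U" using rep[of s] G(2) by (auto simp: O'_def)
  have \<Gamma>: "finite \<Gamma>" "\<And>\<gamma>. \<gamma> \<in> \<Gamma> \<Longrightarrow> smooth_on U \<gamma>" "subgroup \<Gamma> (BijGroup U)"
    "\<And>x y. x \<in> U \<Longrightarrow> y \<in> U \<Longrightarrow> \<phi> x = \<phi> y \<longleftrightarrow> (\<exists>\<gamma>\<in>\<Gamma>. y = \<gamma> x)"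
    using C(1) by (simp_all add: orbichart_def)
  have \<Gamma>U: "\<gamma> ` U \<subseteq> U" if "\<gamma> \<in> \<Gamma>" for \<gamma>
  proof -
    have "\<gamma> \<in> Bij U" using subgroup.subset[OF \<Gamma>(3)] that by (auto simp: BijGroup_def)
    then show ?thesis using Bij_imp_funcset by blast
  qed
  have cl: "two_form ?P ?\<eta>" using \<sigma>_closed[OF U C(2)] by blast
  have alt: "alt_form V (?\<eta> y)" if "y \<in> U" for y using two_formD(1)[OF cl] that by simp
  have sm: "smooth_on U (\<lambda>y. ?\<eta> y a b)" if "a \<in> V" "b \<in> V" for a b
  proof -
    have "smooth_on U (\<lambda>x. form_in_chart ?P (U, \<lambda>x. x) ?\<eta> x a b)" using two_formD(2)[OF cl, of U "\<lambda>x. x"] that by simp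
    then show ?thesis by (rule smooth_on_cong[OF _ order_refl]) (use form_in_chart_euclid[OF V(1) U] that in simp)
  qed
  have br: "\<exists>\<gamma>\<in>\<Gamma>. s' (?i y) = \<gamma> (s (?i y))" if "y \<in> Y" for y
  proof -
    have i: "?i y \<in> W'" "?i y \<in> W2" using iY(1)[OF that] by (auto simp: O'_def)
    have "\<phi> (s (?i y)) = \<phi> (s' (?i y))"
      using C(3)[OF G(4)[OF i(2)]] good_lift_orb[OF gl(1) U C(2) i(2)] L(3)[OF i(1)] by simp
    then show ?thesis using \<Gamma>(4)[OF G(4)[OF i(2)] L(2)[OF i(1)]] by simp
  qed
  have xY: "\<theta> x \<in> Y" using O'(2) by (simp add: Y_def)
  have ix: "?i (\<theta> x) = x" by (rule chart_inv[OF Na U0])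
  have "?\<eta> (s' (?i (\<theta> x))) (der (model N) (\<lambda>y. s' (?i y)) (\<theta> x) u) (der (model N) (\<lambda>y. s' (?i y)) (\<theta> x) v) =
    ?\<eta> (s (?i (\<theta> x))) (der (model N) (\<lambda>y. s (?i y)) (\<theta> x) u) (der (model N) (\<lambda>y. s (?i y)) (\<theta> x) v)"
    by (rule pullback_eq_up_to_finite_group[OF V(1) U alt sm E oY f g \<Gamma>(1,2) \<Gamma>U \<Omega>_invariant[OF C0(2) _ _ _ _ \<Gamma>U] br xY uv])
  then have "pullback_form N ?P s' ?\<eta> x u v = pullback_form N ?P s ?\<eta> x u v"
    using tangent_map_in_chart_at[where s=s', OF ch L(2)[OF x]] tangent_map_in_chart_at[where s=s, OF ch G(4)[OF gl(2)]] ix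
    by (simp add: pullback_form_def)
  also have "\<dots> = \<sigma> x u v" by (rule good_lift_pullback[OF gl(1) U C(2) gl(2) uv])
  finally show "pullback_form N (euclid_mfd V (fst c)) s' (\<Omega> c) x u v = \<sigma> x u v" using C0 by simp
qed

text \<open>The lift \<open>p\<close> of a chart is a submersion and inverts \<open>t\<close>, so
  each pair of vectors at a point of the chart comes from \<open>N\<close>, where the value is
  prescribed.\<close>

lemma pullback_eq_unique:
  assumes eq: "orbifold_pullback_eq N V slice_atlas orb \<Omega>1 \<sigma>" "orbifold_pullback_eq N V slice_atlas orb \<Omega>2 \<sigma>"
    and c: "(U, \<Gamma>, \<phi>) \<in> slice_atlas" and x: "x \<in> U" and uv: "u \<in> V" "v \<in> V"
  shows "\<Omega>1 (U, \<Gamma>, \<phi>) x u v = \<Omega>2 (U, \<Gamma>, \<phi>) x u v"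
proof -
  obtain t W p q where sc: "slice_chart (U, \<Gamma>, \<phi>) t W p q" using c by (auto simp: slice_atlas_def)
  note C = slice_chartD[OF sc]
  note U = orbichart_open[OF C(1)]
  let ?T = "tangent_map N (euclid_mfd V U) p (t x)"
  have T: "?T ` model N = V" by (rule good_lift_submersion[OF C(7) U C(2) C(4)[OF x]])
  obtain a where a: "a \<in> model N" "?T a = u" by (rule image_eqE[OF T uv(1)])
  obtain b where b: "b \<in> model N" "?T b = v" by (rule image_eqE[OF T uv(2)])
  note ab = a(1) b(1) a(2) b(2)
  have val: "\<Omega>' (U, \<Gamma>, \<phi>) x u v = \<sigma> (t x) a b" if "orbifold_pullback_eq N V slice_atlas orb \<Omega>' \<sigma>" for \<Omega>'
  proof -
    have "pullback_form N (euclid_mfd V (fst (U, \<Gamma>, \<phi>))) p (\<Omega>' (U, \<Gamma>, \<phi>)) (t x) a b = \<sigma> (t x) a b"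
      using that c good_lift_local_lift[OF sc C(7)] C(4)[OF x] ab(1,2) unfolding orbifold_pullback_eq_def by blast
    then show ?thesis using ab(3,4) C(5)[OF x] by (simp add: pullback_form_def)
  qed
  show ?thesis using val[OF eq(1)] val[OF eq(2)] by simp
qed

text \<open>Tangent vectors of the transversal and orbit directions span the tangent space of
  \<open>N\<close>. So a degenerate vector of the chart goes to a vector in the kernel of
  \<open>\<sigma>\<close>, an orbit direction; \<open>p\<close> kills it, yet \<open>p\<close>
  inverts \<open>t\<close>.\<close>

lemma \<Omega>_nondegenerate:
  assumes sc: "slice_chart (U, \<Gamma>, \<phi>) t W p q" and x: "x \<in> U" and u: "u \<in> V"
    and z: "\<And>v. v \<in> V \<Longrightarrow> pullback_form (euclid_mfd V U) N t \<sigma> x u v = 0"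
  shows "u = 0"
proof -
  note C = slice_chartD[OF sc]
  note U = orbichart_open[OF C(1)]
  note G = good_liftD[OF C(7)]
  note Ua = smooth_atlas_euclid[OF V(1) U]
  let ?t = "tangent_map (euclid_mfd V U) N t x" and ?p = "tangent_map N (euclid_mfd V U) p (t x)"
  have tN: "t x \<in> points N" by (rule smooth_at_points(2)[OF Ua Na C(2)[OF x]])
  have tu: "?t w \<in> model N" if "w \<in> V" for w using tangent_map_in[OF Ua Na C(2)[OF x]] that by simp
  have pw: "?p w \<in> V" if "w \<in> model N" for w using tangent_map_in[OF Na Ua G(2)[OF C(4)[OF x]]] that by simp
  have id1: "tangent_map N N (\<Phi> \<one>) (t x) w = w" if "w \<in> model N" for w
  proof -
    have "tangent_map N N (\<Phi> \<one>) (t x) w = tangent_map N N (\<lambda>x. x) (t x) w"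
      by (rule fun_cong[OF tangent_map_cong[OF Na openin_topspace tN act_one]])
    then show ?thesis using tangent_map_id[OF Na tN that] by simp
  qed
  have "\<sigma> (t x) (?t u) w = 0" if w: "w \<in> model N" for w
  proof -
    obtain \<xi> where \<xi>: "\<xi> \<in> model K" "w = tangent_map N N (\<Phi> (q (t x))) (t (p (t x)))
        (tangent_map (euclid_mfd V U) N t (p (t x)) (tangent_map N (euclid_mfd V U) p (t x) w)) + vert (t x) \<xi>"
      by (rule good_lift_decomp[OF C(7) U C(2) C(4)[OF x] w])
    have w': "w = ?t (?p w) + vert (t x) \<xi>" using \<xi>(2) C(5,6)[OF x] id1[OF tu[OF pw[OF w]]] by simp
    have "\<sigma> (t x) (?t u) (?t (?p w) + vert (t x) \<xi>) = \<sigma> (t x) (?t u) (?t (?p w))"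
      using alt_form_add_right[OF \<sigma>_alt[OF tN] E tu[OF pw[OF w]] vert_in[OF tN \<xi>(1)] tu[OF u]]
        \<sigma>_vert_right[OF tN \<xi>(1) tu[OF u]] by simp
    also have "\<dots> = 0" using z[OF pw[OF w]] by (simp add: pullback_form_def)
    finally show ?thesis using w' by simp
  qed
  then have "?t u \<in> vert (t x) ` model K" using \<sigma>_ker[OF tN tu[OF u]] by blast
  then have "?p (?t u) = 0" using good_lift_kernel[OF C(7) U C(2) C(4)[OF x]] by blast
  moreover have "?p (?t u) = u"
    by (rule tangent_map_left_inverse[OF Ua Na C(2)[OF x] G(2)[OF C(4)[OF x]], of U]) (use x u C(5) in auto)
  ultimately show ?thesis by simp
qed

lemma symplectic_\<Omega>: "orbifold_symplectic_form Q V slice_atlas \<Omega>"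
  unfolding orbifold_symplectic_form_def
proof (intro conjI ballI allI impI)
  fix c assume c: "c \<in> slice_atlas"
  obtain U \<Gamma> \<phi> t W p q where C0: "c = (U, \<Gamma>, \<phi>)" "slice_chart (U, \<Gamma>, \<phi>) t W p q" "\<Omega> c = pullback_form (euclid_mfd V U) N t \<sigma>"
    by (rule slice_atlasE[OF c])
  note C = slice_chartD[OF C0(2)]
  have "symplectic_form (euclid_mfd V U) (pullback_form (euclid_mfd V U) N t \<sigma>)"
    unfolding symplectic_form_def using \<sigma>_closed[OF orbichart_open[OF C(1)] C(2)] \<Omega>_nondegenerate[OF C0(2)] by auto
  then show "case c of (U, \<Gamma>, \<phi>) \<Rightarrow> symplectic_form (euclid_mfd V U) (\<Omega> (U, \<Gamma>, \<phi>))" using C0 by simp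
next
  fix c d w j1 j2 x u v
  assume c: "c \<in> slice_atlas" and d: "d \<in> slice_atlas"
    and w: "orbichart Q V w \<and> orbichart_embedding V w c j1 \<and> orbichart_embedding V w d j2"
    and x: "x \<in> fst w" and uv: "u \<in> V" "v \<in> V"
  obtain U1 \<Gamma>1 \<phi>1 t1 W1 p1 q1 where C0: "c = (U1, \<Gamma>1, \<phi>1)" "slice_chart (U1, \<Gamma>1, \<phi>1) t1 W1 p1 q1"
    by (rule slice_atlasE[OF c])
  obtain U2 \<Gamma>2 \<phi>2 t2 W2 p2 q2 where D0: "d = (U2, \<Gamma>2, \<phi>2)" "slice_chart (U2, \<Gamma>2, \<phi>2) t2 W2 p2 q2"
    by (rule slice_atlasE[OF d])
  obtain W H \<psi> where w': "w = (W, H, \<psi>)" by (metis surj_pair)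
  note C = slice_chartD[OF C0(2)] and D = slice_chartD[OF D0(2)]
  note U1 = orbichart_open[OF C(1)] and U2 = orbichart_open[OF D(1)]
  have oW: "openin (top_of_set V) W" using w orbichart_open unfolding w' by blast
  have xW: "x \<in> W" using x w' by simp
  note U1a = smooth_atlas_euclid[OF V(1) U1] and U2a = smooth_atlas_euclid[OF V(1) U2] and Wa = smooth_atlas_euclid[OF V(1) oW]
  let ?P1 = "euclid_mfd V U1" and ?P2 = "euclid_mfd V U2" and ?PW = "euclid_mfd V W"
  have e1: "j1 ` W \<subseteq> U1" "openin (top_of_set V) (j1 ` W)" "inj_on j1 W" "smooth_on W j1" "smooth_on (j1 ` W) (inv_into W j1)" "\<forall>x\<in>W. \<phi>1 (j1 x) = \<psi> x"
    and e2: "j2 ` W \<subseteq> U2" "smooth_on W j2" "\<forall>x\<in>W. \<phi>2 (j2 x) = \<psi> x"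
    using w unfolding w' C0(1) D0(1) orbichart_embedding_def by auto
  have y1: "j1 x \<in> U1" using e1(1) xW by blast
  define z where "z = t1 (j1 x)"
  have zN: "z \<in> points N" unfolding z_def by (rule smooth_at_points(2)[OF U1a Na C(2)[OF y1]])
  have "\<phi>1 (j1 x) = orb z" using C(3)[OF y1] by (simp add: z_def)
  then obtain W' s e where gl: "good_lift U1 t1 W' s e" "z \<in> W'" "s z = j1 x" by (rule good_lift_exists[OF C0(2) zN y1])
  note G = good_liftD[OF gl(1)]
  define i where "i = inv_into W j1"
  have ij: "i (j1 y) = y" if "y \<in> W" for y unfolding i_def using inv_into_f_f[OF e1(3) that] .
  define W3 where "W3 = {w \<in> W'. s w \<in> j1 ` W}"
  have "openin (mtop ?P1) (j1 ` W)" using e1(1,2) openin_top_of_open[OF U1] by simp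
  from smooth_at_preimage_open[OF Na U1a G(1) G(2) this] have oW3: "openin (mtop N) W3" by (simp add: W3_def)
  have zW3: "z \<in> W3" using gl xW by (simp add: W3_def)
  \<comment> \<open>A lift into the first chart followed by the transition between the embeddings is
    a lift into the second. Both forms pull back to \<open>\<sigma>\<close> along their lifts, which
    forces them to agree.\<close>
  let ?s2 = "\<lambda>w. j2 (i (s w))"
  have sj2: "smooth_at ?PW ?P2 j2 y" if "y \<in> W" for y
    by (rule smooth_at_euclidI[OF oW oW that order_refl _ e2(2)]) (use e2(1) in blast)
  have sj1: "smooth_at ?PW ?P1 j1 y" if "y \<in> W" for y
    by (rule smooth_at_euclidI[OF oW oW that order_refl _ e1(4)]) (use e1(1) in blast)
  have si: "smooth_at ?P1 ?PW i y" if "y \<in> j1 ` W" for y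
    by (rule smooth_at_euclidI[OF U1 e1(2) that e1(1)]) (use e1(5) inv_into_into[of _ j1 W] in \<open>auto simp: i_def\<close>)
  have iW: "i y \<in> W" if "y \<in> j1 ` W" for y using that ij by auto
  have sj2i: "smooth_at ?P1 ?P2 (\<lambda>y. j2 (i y)) y" if "y \<in> j1 ` W" for y
    by (rule smooth_at_compose[OF U1a Wa U2a si[OF that] sj2[OF iW[OF that]]])
  have ss2: "smooth_at N ?P2 ?s2 w" if "w \<in> W3" for w
    by (rule smooth_at_compose[OF Na U1a U2a G(2) sj2i]) (use that in \<open>auto simp: W3_def\<close>)
  have "\<phi>2 (?s2 w) = orb w" if w: "w \<in> W3" for w
  proof -
    obtain y where y: "y \<in> W" "s w = j1 y" "w \<in> W'" using w by (auto simp: W3_def)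
    have "\<phi>2 (?s2 w) = \<phi>1 (s w)" using e1(6) e2(3) y ij by simp
    then show ?thesis using C(3)[OF G(4)[OF y(3)]] good_lift_orb[OF gl(1) U1 C(2) y(3)] by simp
  qed
  moreover have "smooth_map_on N W3 ?P2 ?s2" by (rule smooth_map_onI[OF Na U2a oW3 ss2])
  ultimately have l2: "local_lift N V d orb W3 ?s2" using oW3 by (simp add: local_lift_def D0(1))
  have l1: "local_lift N V c orb W' s" using good_lift_local_lift[OF C0(2) gl(1)] by (simp add: C0(1))
  have Tj1: "tangent_map ?PW ?P1 j1 x u \<in> V" if "u \<in> V" for u using tangent_map_in[OF Wa U1a sj1[OF xW]] that by simp
  have T: "tangent_map N ?P1 s z ` model N = V" by (rule good_lift_submersion[OF gl(1) U1 C(2) gl(2)])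
  obtain a where a: "a \<in> model N" "tangent_map N ?P1 s z a = tangent_map ?PW ?P1 j1 x u"
    by (rule image_eqE[OF T Tj1[OF uv(1)]])
  obtain b where b: "b \<in> model N" "tangent_map N ?P1 s z b = tangent_map ?PW ?P1 j1 x v"
    by (rule image_eqE[OF T Tj1[OF uv(2)]])
  note ab = a(1) b(1) a(2) b(2)
  have Ts2: "tangent_map N ?P2 ?s2 z a = tangent_map ?PW ?P2 j2 x u"
    if "a \<in> model N" "u \<in> V" "tangent_map N ?P1 s z a = tangent_map ?PW ?P1 j1 x u" for a u
  proof -
    have jx: "j1 x \<in> j1 ` W" using xW by blast
    have "tangent_map N ?P2 ?s2 z a = tangent_map ?P1 ?P2 (\<lambda>y. j2 (i y)) (j1 x) (tangent_map N ?P1 s z a)"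
      using tangent_map_compose[OF Na U1a U2a G(2)[OF gl(2)], of "\<lambda>y. j2 (i y)" a] sj2i[OF jx] gl(3) that(1) by simp
    also have "\<dots> = tangent_map ?PW ?P2 (\<lambda>y. j2 (i (j1 y))) x u"
      using tangent_map_compose[OF Wa U1a U2a sj1[OF xW] sj2i[OF jx], of u] that by simp
    also have "\<dots> = tangent_map ?PW ?P2 j2 x u"
      by (rule fun_cong[OF tangent_map_cong[OF Wa, of W]]) (use xW ij in auto)
    finally show ?thesis .
  qed
  have s2z: "?s2 z = j2 x" using gl(3) ij[OF xW] by simp
  note PE = pullback_eq_slice_atlas[unfolded orbifold_pullback_eq_def, rule_format]
  have "pullback_form N ?P1 s (\<Omega> c) z a b = \<sigma> z a b" using PE[OF c l1 gl(2) ab(1,2)] by (simp add: C0(1))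
  moreover have "pullback_form N ?P2 ?s2 (\<Omega> d) z a b = \<sigma> z a b" using PE[OF d l2 zW3 ab(1,2)] by (simp add: D0(1))
  ultimately have "\<Omega> c (j1 x) (tangent_map ?PW ?P1 j1 x u) (tangent_map ?PW ?P1 j1 x v) = \<Omega> d (j2 x) (tangent_map ?PW ?P2 j2 x u) (tangent_map ?PW ?P2 j2 x v)"
    using Ts2[OF ab(1) uv(1) ab(3)] Ts2[OF ab(2) uv(2) ab(4)] ab(3,4) gl(3) s2z by (simp add: pullback_form_def)
  then show "pullback_form (euclid_mfd V (fst w)) (euclid_mfd V (fst c)) j1 (\<Omega> c) x u v =
     pullback_form (euclid_mfd V (fst w)) (euclid_mfd V (fst d)) j2 (\<Omega> d) x u v"
    by (simp add: pullback_form_def w' C0(1) D0(1))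
qed

end

section \<open>Hamiltonian actions\<close>

lemma smooth_atlas_real_line: "smooth_atlas real_line"
  by (rule smooth_atlas_euclid) simp_all

lemma subspace_expand_inner:
  assumes "subspace W" "x \<in> W"
  shows "x = (\<Sum>b\<in>onb W. (x \<bullet> b) *\<^sub>R b)"
  using proj_id[OF assms] by (simp add: proj_def)

lemma subspace_inner_eqI:
  assumes W: "subspace W" "x \<in> W" "y \<in> W" and "\<And>b. b \<in> W \<Longrightarrow> x \<bullet> b = y \<bullet> b"
  shows "x = y"
proof -
  have "x - y \<in> W" using W by (intro subspace_diff)
  then have "(x - y) \<bullet> (x - y) = 0" using assms(4)[of "x - y"] by (simp add: inner_diff_left)
  then show ?thesis by simp
qed

lemma dual_linear:
  assumes \<nu>: "\<nu> \<in> dual V" and V: "subspace V"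
  shows dual_add: "u \<in> V \<Longrightarrow> v \<in> V \<Longrightarrow> \<nu> (u + v) = \<nu> u + \<nu> v"
    and dual_scale: "u \<in> V \<Longrightarrow> \<nu> (a *\<^sub>R u) = a * \<nu> u"
    and dual_zero: "\<nu> 0 = 0"
proof -
  have l: "\<nu> (a *\<^sub>R u + b *\<^sub>R v) = a * \<nu> u + b * \<nu> v" if "u \<in> V" "v \<in> V" for u v a b
    using \<nu> that unfolding dual_def by blast
  show "u \<in> V \<Longrightarrow> v \<in> V \<Longrightarrow> \<nu> (u + v) = \<nu> u + \<nu> v" using l[of u v 1 1] by simp
  show s: "u \<in> V \<Longrightarrow> \<nu> (a *\<^sub>R u) = a * \<nu> u" for u a using l[of u u a 0] by simp
  show "\<nu> 0 = 0" using s[of 0 0] subspace_0[OF V] by simp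
qed

lemma dual_sum:
  assumes \<nu>: "\<nu> \<in> dual V" and V: "subspace V" and "finite I" "\<And>i. i \<in> I \<Longrightarrow> f i \<in> V"
  shows "\<nu> (\<Sum>i\<in>I. c i *\<^sub>R f i) = (\<Sum>i\<in>I. c i * \<nu> (f i))"
  using assms(3,4)
proof (induction I rule: finite_induct)
  case empty show ?case using dual_zero[OF \<nu> V] by simp
next
  case (insert i I)
  have "(\<Sum>i\<in>I. c i *\<^sub>R f i) \<in> V" using insert.prems V by (intro subspace_sum subspace_scale) auto
  then show ?case using insert dual_add[OF \<nu> V subspace_scale[OF V]] dual_scale[OF \<nu> V] by simp
qed

text \<open>Each component is smooth on its own neighbourhood; as there are finitely many, these can
  be intersected.\<close>

lemma smooth_at_onb_sum:
  fixes f :: "'e::euclidean_space \<Rightarrow> 'a \<Rightarrow> real"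
  assumes A: "smooth_atlas A" and W: "subspace W" and f: "\<And>b. b \<in> onb W \<Longrightarrow> smooth_at A real_line (f b) p" and p: "p \<in> points A"
  shows "smooth_at A (euclid_mfd W W) (\<lambda>x. \<Sum>b\<in>onb W. f b x *\<^sub>R b) p"
proof -
  note B = onb[OF W]
  obtain U \<phi> where U: "(U, \<phi>) \<in> atlas A" "p \<in> U" using smooth_atlasD(6)[OF A p] by blast
  have "\<exists>T. p \<in> T \<and> smooth_in A real_line (f b) (U, \<phi>) (UNIV, \<lambda>x. x) T" if "b \<in> onb W" for b
    by (rule smooth_atE[OF A smooth_atlas_real_line f[OF that] U, of UNIV "\<lambda>x. x"]) (auto simp: euclid_mfd_def)
  then obtain T where T: "\<And>b. b \<in> onb W \<Longrightarrow> p \<in> T b" "\<And>b. b \<in> onb W \<Longrightarrow> smooth_in A real_line (f b) (U, \<phi>) (UNIV, \<lambda>x. x) (T b)"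
    by metis
  define O' where "O' = U \<inter> (\<Inter>b\<in>onb W. T b)"
  have oO: "openin (mtop A) O'"
  \<comment> \<open>An intersection over no indices is the whole type, which need not be open in
    \<open>mtop A\<close>, hence the separate case.\<close>
  proof (cases "onb W = {}")
    case True then show ?thesis unfolding O'_def using smooth_atlasD(2)[OF A U(1)] by simp
  next
    case False
    then show ?thesis unfolding O'_def
      using smooth_atlasD(2)[OF A U(1)] smooth_inD(3)[OF T(2)] B(7) by (intro openin_Int openin_INT2) auto
  qed
  have "smooth_on (\<phi> ` O') (\<lambda>y. \<Sum>b\<in>onb W. f b (inv_into U \<phi> y) *\<^sub>R b)"
  proof (intro smooth_on_sum smooth_on_scaleR smooth_on_const B(7))
    fix b assume b: "b \<in> onb W"
    show "smooth_on (\<phi> ` O') (\<lambda>y. f b (inv_into U \<phi> y))"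
      by (rule smooth_on_cong[OF smooth_inD(5)[OF T(2)[OF b]]]) (use b in \<open>auto simp: O'_def\<close>)
  qed
  then have "smooth_in A (euclid_mfd W W) (\<lambda>x. \<Sum>b\<in>onb W. f b x *\<^sub>R b) (U, \<phi>) (W, \<lambda>x. x) O'"
    using oO U B(1) by (intro smooth_inI) (auto simp: O'_def o_def intro!: subspace_sum[OF W] subspace_scale[OF W])
  then show ?thesis by (rule smooth_atI[rotated]) (use U(2) T(1) in \<open>simp add: O'_def\<close>)
qed

lemma tangent_map_inner:
  fixes F :: "'a \<Rightarrow> 'e::euclidean_space"
  assumes A: "smooth_atlas A" and W: "subspace W" and F: "smooth_at A (euclid_mfd W W) F p" and v: "v \<in> model A"
  shows "tangent_map A real_line (\<lambda>x. F x \<bullet> \<xi>) p v = tangent_map A (euclid_mfd W W) F p v \<bullet> \<xi>"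
proof -
  note Wa = smooth_atlas_euclid[OF W, of W, simplified]
  have FW: "F p \<in> W" using smooth_at_points(2)[OF A Wa F] by simp
  have s: "smooth_at (euclid_mfd W W) real_line (\<lambda>x. x \<bullet> \<xi>) (F p)"
    by (rule smooth_at_euclidI[of _ _ W]) (use FW smooth_on_linear[OF bounded_linear_inner_left] in auto)
  have t: "tangent_map A (euclid_mfd W W) F p v \<in> W" using tangent_map_in[OF A Wa F v] by simp
  have "tangent_map A real_line (\<lambda>x. F x \<bullet> \<xi>) p v =
      tangent_map (euclid_mfd W W) real_line (\<lambda>x. x \<bullet> \<xi>) (F p) (tangent_map A (euclid_mfd W W) F p v)"
    by (rule tangent_map_compose[OF A Wa smooth_atlas_real_line F s v])
  also have "\<dots> = der W (\<lambda>x. x \<bullet> \<xi>) (F p) (tangent_map A (euclid_mfd W W) F p v)"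
    using tangent_map_euclid[of W W "F p" "\<lambda>x. x \<bullet> \<xi>" UNIV UNIV] FW by simp
  also have "\<dots> = tangent_map A (euclid_mfd W W) F p v \<bullet> \<xi>"
    by (rule der_bounded_linear[OF W FW t bounded_linear_inner_left])
  finally show ?thesis .
qed

locale hamiltonian =
  fixes G :: "'g monoid" (structure) and GM :: "('g, 'e::euclidean_space) mfd" and M :: "('m, 'f::euclidean_space) mfd"
    and \<omega> :: "('m, 'f) form2" and \<Phi> :: "'g \<Rightarrow> 'm \<Rightarrow> 'm" and J :: "'m \<Rightarrow> 'e \<Rightarrow> real" and \<mu> :: "'e \<Rightarrow> real"
  assumes M: "smooth_manifold M" and \<omega>: "symplectic_form M \<omega>" and lie_G: "lie_group G GM"
    and ham: "hamiltonian_action G GM M \<omega> \<Phi> J" and \<mu>: "\<mu> \<in> dual (model GM)"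
    and transverse: "transverse_to_ray GM M J \<mu>"

sublocale hamiltonian \<subseteq> smooth_action G GM M \<Phi>
proof unfold_locales
  interpret group_action G "points M" \<Phi> using ham by (simp add: hamiltonian_action_def)
  interpret group G using lie_G by (simp add: lie_group_def)
  show "lie_group G GM" by (rule lie_G)
  show "smooth_manifold M" by (rule M)
  show "\<Phi> g x \<in> points M" if "g \<in> carrier G" "x \<in> points M" for g x using element_image that by blast
  show "\<Phi> \<one> x = x" if "x \<in> points M" for x using id_eq_one that by (metis restrict_apply')
  show "\<Phi> (g \<otimes> h) x = \<Phi> g (\<Phi> h x)" if "g \<in> carrier G" "h \<in> carrier G" "x \<in> points M" for g h x
    using composition_rule that by blast
  show "smooth_map (prod_mfd GM M) M (\<lambda>(g, x). \<Phi> g x)" using ham by (simp add: hamiltonian_action_def)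
qed

context hamiltonian
begin

abbreviation \<gg> :: "'e set" where "\<gg> \<equiv> model GM"
abbreviation S :: "'m set" where "S \<equiv> ray_preimage GM M J \<mu>"

lemma subspace_\<gg>: "subspace \<gg>" by (rule smooth_atlasD(1)[OF Ka])

lemma subspace_TM: "subspace (model M)" by (rule smooth_atlasD(1)[OF Na])

lemma J_dual: "x \<in> points M \<Longrightarrow> J x \<in> dual \<gg>"
  using ham by (simp add: hamiltonian_action_def)

lemma J_smooth: "\<xi> \<in> \<gg> \<Longrightarrow> x \<in> points M \<Longrightarrow> smooth_at M real_line (\<lambda>x. J x \<xi>) x"
  using ham smooth_map_on_imp_smooth_at[OF Na smooth_atlas_real_line _ openin_topspace] unfolding hamiltonian_action_def by blast

lemma J_moment: "\<xi> \<in> \<gg> \<Longrightarrow> x \<in> points M \<Longrightarrow> v \<in> model M \<Longrightarrow> tangent_map M real_line (\<lambda>y. J y \<xi>) x v = \<omega> x (vert x \<xi>) v"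
  using ham unfolding hamiltonian_action_def infinitesimal_generator_def by blast

lemma J_equivariant: "g \<in> carrier G \<Longrightarrow> x \<in> points M \<Longrightarrow> J (\<Phi> g x) = coad G GM g (J x)"
  using ham unfolding hamiltonian_action_def by blast

lemma \<omega>_invariant: "g \<in> carrier G \<Longrightarrow> x \<in> points M \<Longrightarrow> u \<in> model M \<Longrightarrow> v \<in> model M \<Longrightarrow>
    \<omega> (\<Phi> g x) (tangent_map M M (\<Phi> g) x u) (tangent_map M M (\<Phi> g) x v) = \<omega> x u v"
  using ham unfolding hamiltonian_action_def pullback_form_def by blast

lemma \<omega>_alt: "x \<in> points M \<Longrightarrow> alt_form (model M) (\<omega> x)"
  by (rule two_formD(1)[OF \<omega>[unfolded symplectic_form_def, THEN conjunct1]])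

lemma \<omega>_nondegenerate: "x \<in> points M \<Longrightarrow> u \<in> model M \<Longrightarrow> (\<And>v. v \<in> model M \<Longrightarrow> \<omega> x u v = 0) \<Longrightarrow> u = 0"
  using \<omega> unfolding symplectic_form_def by blast

lemma vert_in_TM: "x \<in> points M \<Longrightarrow> \<xi> \<in> \<gg> \<Longrightarrow> vert x \<xi> \<in> model M"
  by (rule tangent_map_in[OF Ka Na smooth_at_act_right[OF one_closed]])

lemma vert_linear: "x \<in> points M \<Longrightarrow> linear (vert x)"
  by (rule tangent_map_linear[OF Ka Na smooth_at_act_right[OF one_closed]])

lemma S_points: "x \<in> S \<Longrightarrow> x \<in> points M"
  by (simp add: ray_preimage_def)

lemma S_J:
  assumes "x \<in> S"
  obtains r where "r > 0" "J x = (\<lambda>\<xi>\<in>\<gg>. r * \<mu> \<xi>)"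
  using assms by (auto simp: ray_preimage_def ray_def)

lemma S_I: "x \<in> points M \<Longrightarrow> r > 0 \<Longrightarrow> J x = (\<lambda>\<xi>\<in>\<gg>. r * \<mu> \<xi>) \<Longrightarrow> x \<in> S"
  by (auto simp: ray_preimage_def ray_def)

section \<open>Isotropy and the momentum map\<close>

lemma Ad_in: assumes g: "g \<in> carrier G" and \<xi>: "\<xi> \<in> \<gg>" shows "Ad G GM g \<xi> \<in> \<gg>"
proof -
  have "smooth_at GM GM (\<lambda>h. g \<otimes> h \<otimes> inv g) \<one>"
    by (intro smooth_at_mult[OF Ka] smooth_at_const[OF Ka Ka] smooth_at_id[OF Ka]) (use g in auto)
  then show ?thesis unfolding Ad_def by (rule tangent_map_in[OF Ka Ka _ \<xi>])
qed

lemma coad_scale: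
  assumes "g \<in> carrier G"
  shows "coad G GM g (\<lambda>\<xi>\<in>\<gg>. r * \<nu> \<xi>) = (\<lambda>\<xi>\<in>\<gg>. r * coad G GM g \<nu> \<xi>)"
  unfolding coad_def using Ad_in assms by (intro restrict_ext) simp

text \<open>The coadjoint action is linear, so an element fixing \<open>\<mu>\<close> fixes every
  multiple of it.\<close>

lemma isotropy_J:
  assumes g: "g \<in> isotropy_group G GM \<mu>" and x: "x \<in> S"
  shows "J (\<Phi> g x) = J x" "\<Phi> g x \<in> S"
proof -
  have gG: "g \<in> carrier G" "coad G GM g \<mu> = \<mu>" using g by (auto simp: isotropy_group_def)
  obtain r where r: "r > 0" "J x = (\<lambda>\<xi>\<in>\<gg>. r * \<mu> \<xi>)" by (rule S_J[OF x])
  show J: "J (\<Phi> g x) = J x"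
    unfolding J_equivariant[OF gG(1) S_points[OF x]] r(2) coad_scale[OF gG(1)] gG(2) ..
  show "\<Phi> g x \<in> S" by (rule S_I[OF act_closed[OF gG(1) S_points[OF x]] r(1)]) (simp add: J r(2))
qed

text \<open>The value of \<open>J\<close> at \<open>x\<close> is a positive multiple of
  \<open>\<mu>\<close>, and the factor can be divided out; so \<open>J\<close> along the orbit of a
  single point detects the isotropy group of \<open>\<mu>\<close>.\<close>

lemma isotropy_groupI:
  assumes g: "g \<in> carrier G" and x: "x \<in> S" and J: "\<And>\<xi>. \<xi> \<in> \<gg> \<Longrightarrow> J (\<Phi> g x) \<xi> = J x \<xi>"
  shows "g \<in> isotropy_group G GM \<mu>"
proof -
  obtain r where r: "r > 0" "J x = (\<lambda>\<xi>\<in>\<gg>. r * \<mu> \<xi>)" by (rule S_J[OF x])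
  have "coad G GM g \<mu> \<xi> = \<mu> \<xi>" if "\<xi> \<in> \<gg>" for \<xi>
    using J[OF that] r(1) that unfolding J_equivariant[OF g S_points[OF x]] r(2) coad_scale[OF g] by simp
  moreover have "coad G GM g \<mu> \<in> extensional \<gg>" "\<mu> \<in> extensional \<gg>" using \<mu> by (auto simp: coad_def dual_def)
  ultimately have "coad G GM g \<mu> = \<mu>" by (intro extensionalityI[of _ \<gg>])
  then show ?thesis using g by (simp add: isotropy_group_def)
qed

lemma isotropy_algebra_in: "\<zeta> \<in> isotropy_algebra G GM \<mu> \<Longrightarrow> \<zeta> \<in> \<gg>"
proof -
  assume "\<zeta> \<in> isotropy_algebra G GM \<mu>"
  then obtain \<gamma> where \<gamma>: "\<zeta> = tangent_map real_line GM \<gamma> 0 1" "smooth_map real_line GM \<gamma>"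
    unfolding isotropy_algebra_def by blast
  have "smooth_at real_line GM \<gamma> 0"
    by (rule smooth_map_on_imp_smooth_at[OF smooth_atlas_real_line Ka \<gamma>(2) openin_topspace]) simp
  then show ?thesis unfolding \<gamma>(1) by (intro tangent_map_in[OF smooth_atlas_real_line Ka]) auto
qed

text \<open>\<open>J\<close> is constant along \<open>\<Phi> (\<gamma> t) x\<close> for a curve
  \<open>\<gamma>\<close> in the isotropy group, and by the momentum equation the left side is its
  derivative there.\<close>

lemma isotropy_algebra_moment:
  assumes \<zeta>: "\<zeta> \<in> isotropy_algebra G GM \<mu>" and x: "x \<in> S" and \<xi>: "\<xi> \<in> \<gg>"
  shows "\<omega> x (vert x \<xi>) (vert x \<zeta>) = 0"
proof -
  obtain \<gamma> where \<gamma>: "\<zeta> = tangent_map real_line GM \<gamma> 0 1" "smooth_map real_line GM \<gamma>" "\<gamma> 0 = \<one>"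
      "range \<gamma> \<subseteq> isotropy_group G GM \<mu>"
    using \<zeta> unfolding isotropy_algebra_def by blast
  note R = smooth_atlas_real_line
  note xM = S_points[OF x]
  have s\<gamma>: "smooth_at real_line GM \<gamma> 0"
    by (rule smooth_map_on_imp_smooth_at[OF R Ka \<gamma>(2) openin_topspace]) simp
  have sx: "smooth_at GM M (\<lambda>k. \<Phi> k x) (\<gamma> 0)" unfolding \<gamma>(3) by (rule smooth_at_act_right[OF one_closed xM])
  have one: "(1::real) \<in> model real_line" by simp
  have \<gamma>x: "vert x \<zeta> = tangent_map real_line M (\<lambda>t. \<Phi> (\<gamma> t) x) 0 1"
    using tangent_map_compose[OF R Ka Na s\<gamma> sx one] \<gamma>(1,3) by simp
  have s\<gamma>x: "smooth_at real_line M (\<lambda>t. \<Phi> (\<gamma> t) x) 0" by (rule smooth_at_compose[OF R Ka Na s\<gamma> sx])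
  have x0: "\<Phi> (\<gamma> 0) x = x" using \<gamma>(3) act_one[OF xM] by simp
  have "\<omega> x (vert x \<xi>) (vert x \<zeta>) = tangent_map M real_line (\<lambda>y. J y \<xi>) x (vert x \<zeta>)"
    by (rule J_moment[OF \<xi> xM vert_in_TM[OF xM isotropy_algebra_in[OF \<zeta>]], symmetric])
  also have "\<dots> = tangent_map real_line real_line (\<lambda>t. J (\<Phi> (\<gamma> t) x) \<xi>) 0 1"
    unfolding \<gamma>x using tangent_map_compose[OF R Na R s\<gamma>x _ one, of "\<lambda>y. J y \<xi>"] J_smooth[OF \<xi> xM] x0 by simp
  also have "\<dots> = tangent_map real_line real_line (\<lambda>t. J x \<xi>) 0 1"
  proof (rule fun_cong[OF tangent_map_cong[OF R openin_topspace]])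
    show "J (\<Phi> (\<gamma> t) x) \<xi> = J x \<xi>" for t using isotropy_J(1)[OF subsetD[OF \<gamma>(4) rangeI] x] by (rule fun_cong)
  qed simp
  also have "\<dots> = 0" by (rule tangent_map_const[OF R]) simp_all
  finally show ?thesis .
qed

text \<open>The stabilizer of the momentum value along an orbit is a fibre of a map of constant rank:
  by equivariance its derivative at \<open>g\<close> factors through its derivative at the identity.  Hence
  each vector of the kernel is the velocity of a curve in the stabilizer.\<close>

lemma isotropy_algebraI:
  assumes x: "x \<in> S" and \<xi>: "\<xi> \<in> \<gg>" and van: "\<And>\<eta>. \<eta> \<in> \<gg> \<Longrightarrow> \<omega> x (vert x \<eta>) (vert x \<xi>) = 0"
  shows "\<xi> \<in> isotropy_algebra G GM \<mu>"
proof -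
  note xM = S_points[OF x]
  note R = smooth_atlas_real_line
  note g = subspace_\<gg>
  note ga = smooth_atlas_euclid[OF g, of \<gg>, simplified]
  note B = onb[OF g]
  have e: "\<one> \<in> points GM" by simp
  obtain U \<kappa> where c: "chart_at GM \<one> = (U, \<kappa>)" by (metis surj_pair)
  note U = chart_at[OF Ka e c]
  let ?i = "inv_into U \<kappa>"
  define Y where "Y = \<kappa> ` U"
  have oY: "openin (top_of_set \<gg>) Y" unfolding Y_def by (rule smooth_atlasD(3)[OF Ka U(1)])
  note Ya = smooth_atlas_euclid[OF g oY]
  have Yg: "Y \<subseteq> \<gg>" by (rule openin_subspace_subset[OF oY])
  define y0 where "y0 = \<kappa> \<one>"
  have y0: "y0 \<in> Y" "?i y0 = \<one>" using U chart_inv[OF Ka U] by (auto simp: Y_def y0_def)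
  have iU: "?i y \<in> U" "\<kappa> (?i y) = y" "?i y \<in> carrier G" if "y \<in> Y" for y
    using that inv_into_into[of y \<kappa> U] f_inv_into_f[of y \<kappa> U] chart_subset[OF Ka U(1)] by (auto simp: Y_def)
  have si: "smooth_at (euclid_mfd \<gg> Y) GM ?i y" if "y \<in> Y" for y
    by (rule smooth_at_chart_inv[OF Ka U(1) oY that]) (use that in \<open>simp add: Y_def\<close>)
  \<comment> \<open>The functional \<open>J (\<Phi> h x)\<close> turned into a vector of
    \<open>\<gg>\<close> by the inner product, so that calculus on subspaces applies.\<close>
  define f where "f = (\<lambda>h. \<Sum>b\<in>onb \<gg>. J (\<Phi> h x) b *\<^sub>R b)"
  have sJ: "smooth_at GM real_line (\<lambda>h. J (\<Phi> h x) \<eta>) h" if "h \<in> carrier G" "\<eta> \<in> \<gg>" for h \<eta>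
    by (rule smooth_at_compose[OF Ka Na R smooth_at_act_right[OF that(1) xM] J_smooth[OF that(2) act_closed[OF that(1) xM]]])
  have sf: "smooth_at GM (euclid_mfd \<gg> \<gg>) f h" if "h \<in> carrier G" for h
    unfolding f_def by (rule smooth_at_onb_sum[OF Ka g sJ[OF that]]) (use B(1) that in auto)
  have fg: "f h \<in> \<gg>" for h unfolding f_def using B(1) by (intro subspace_sum[OF g] subspace_scale[OF g]) auto
  have f_inner: "f h \<bullet> \<eta> = J (\<Phi> h x) \<eta>" if h: "h \<in> carrier G" and \<eta>: "\<eta> \<in> \<gg>" for h \<eta>
  proof -
    have "J (\<Phi> h x) \<eta> = (\<Sum>b\<in>onb \<gg>. (\<eta> \<bullet> b) * J (\<Phi> h x) b)"
      by (subst subspace_expand_inner[OF g \<eta>]) (rule dual_sum[OF J_dual[OF act_closed[OF h xM]] g B(7)], use B(1) in blast)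
    then show ?thesis unfolding f_def inner_sum_left by (simp add: inner_commute mult.commute)
  qed
  \<comment> \<open>The coadjoint action of \<open>h\<close> under the same identification.\<close>
  define Cg where "Cg = (\<lambda>h z. \<Sum>b\<in>onb \<gg>. (z \<bullet> Ad G GM (inv h) b) *\<^sub>R b)"
  have lC: "linear (Cg h)" for h
    unfolding Cg_def by (rule linearI) (simp_all add: inner_add_left scaleR_add_left sum.distrib scaleR_sum_right)
  then have bC: "bounded_linear (Cg h)" for h by (simp add: linear_conv_bounded_linear)
  have f_mult: "f (h \<otimes> k) = Cg h (f k)" if h: "h \<in> carrier G" "k \<in> carrier G" for h k
    unfolding fun_cong[OF f_def, of "h \<otimes> k"] Cg_def
  proof (rule sum.cong[OF refl])
    fix b assume b: "b \<in> onb \<gg>"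
    then have bg: "b \<in> \<gg>" using B(1) by blast
    have "J (\<Phi> (h \<otimes> k) x) b = coad G GM h (J (\<Phi> k x)) b"
      using act_mult[OF h xM] J_equivariant[OF h(1) act_closed[OF h(2) xM]] by simp
    also have "\<dots> = f k \<bullet> Ad G GM (inv h) b"
      using f_inner[OF h(2) Ad_in[OF inv_closed[OF h(1)] bg]] bg by (simp add: coad_def)
    finally show "J (\<Phi> (h \<otimes> k) x) b *\<^sub>R b = (f k \<bullet> Ad G GM (inv h) b) *\<^sub>R b" by simp
  qed
  define ft where "ft = (\<lambda>y. f (?i y))"
  have sft: "smooth_on Y ft"
  proof -
    have "smooth_at (euclid_mfd \<gg> Y) (euclid_mfd \<gg> \<gg>) ft y" if "y \<in> Y" for y
      unfolding ft_def by (rule smooth_at_compose[OF Ya Ka ga si[OF that] sf[OF iU(3)[OF that]]])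
    then have "smooth_map (euclid_mfd \<gg> Y) (euclid_mfd \<gg> \<gg>) ft" by (intro smooth_map_onI[OF Ya ga]) auto
    then show ?thesis using smooth_map_euclid_iff[OF g oY g, of \<gg> ft] by simp
  qed
  have ftg: "ft ` Y \<subseteq> \<gg>" using fg by (auto simp: ft_def)
  define A where "A = der \<gg> ft y0"
  have lA: "linear A" unfolding A_def by (rule der_linear[OF g oY sft y0(1)])
  have Ag: "A u \<in> \<gg>" if "u \<in> \<gg>" for u unfolding A_def by (rule der_in[OF g oY sft y0(1) that g ftg])
  have A_tangent: "tangent_map GM (euclid_mfd \<gg> \<gg>) f \<one> = A"
    using tangent_map_eq[where F=f, OF c chart_at_euclid[OF fg]] by (simp add: A_def ft_def y0_def o_def)
  have A\<xi>: "A \<xi> = 0"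
  proof (rule subspace_inner_eqI[OF g Ag[OF \<xi>] subspace_0[OF g]])
    fix \<eta> assume \<eta>: "\<eta> \<in> \<gg>"
    have "A \<xi> \<bullet> \<eta> = tangent_map GM real_line (\<lambda>h. f h \<bullet> \<eta>) \<one> \<xi>"
      using tangent_map_inner[OF Ka g sf[OF one_closed] \<xi>] A_tangent by simp
    also have "\<dots> = tangent_map GM real_line (\<lambda>h. J (\<Phi> h x) \<eta>) \<one> \<xi>"
      by (rule fun_cong[OF tangent_map_cong[OF Ka openin_topspace e]]) (use f_inner \<eta> in simp)
    also have "\<dots> = tangent_map M real_line (\<lambda>y. J y \<eta>) x (vert x \<xi>)"
      using tangent_map_compose[OF Ka Na R smooth_at_act_right[OF one_closed xM] _ \<xi>, of "\<lambda>y. J y \<eta>"]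
        J_smooth[OF \<eta> xM] act_one[OF xM] by simp
    also have "\<dots> = \<omega> x (vert x \<eta>) (vert x \<xi>)" by (rule J_moment[OF \<eta> xM vert_in_TM[OF xM \<xi>]])
    finally show "A \<xi> \<bullet> \<eta> = 0 \<bullet> \<eta>" using van[OF \<eta>] by simp
  qed
  \<comment> \<open>Equivariance made infinitesimal: around \<open>y\<close> the map
    \<open>ft\<close> is \<open>Cg\<close> applied to a translate that passes through the identity,
    so its derivatives have the form \<open>Cg h (A u)\<close>.\<close>
  have factor: "\<exists>u\<in>\<gg>. der \<gg> ft y w = Cg (?i y) (A u)" if y: "y \<in> Y" and w: "w \<in> \<gg>" for y w
  proof -
    let ?h = "?i y"
    have hG: "?h \<in> carrier G" by (rule iU(3)[OF y])
    let ?m = "\<lambda>z. inv ?h \<otimes> ?i z"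
    have sm: "smooth_at (euclid_mfd \<gg> Y) GM ?m y"
      by (rule smooth_at_mult[OF Ya smooth_at_const[OF Ya Ka] si[OF y]]) (use y hG in auto)
    have m1: "?m y = \<one>" using hG by simp
    let ?u = "tangent_map (euclid_mfd \<gg> Y) GM ?m y w"
    have u: "?u \<in> \<gg>" by (rule tangent_map_in[OF Ya Ka sm]) (use w in simp)
    have sfm: "smooth_at (euclid_mfd \<gg> Y) (euclid_mfd \<gg> \<gg>) (\<lambda>z. f (?m z)) y"
      by (rule smooth_at_compose[OF Ya Ka ga sm]) (use sf m1 in simp)
    have fm: "tangent_map (euclid_mfd \<gg> Y) (euclid_mfd \<gg> \<gg>) (\<lambda>z. f (?m z)) y w = A ?u"
      using tangent_map_compose[OF Ya Ka ga sm, of f w] sf[OF one_closed] m1 w A_tangent by simp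
    obtain W where W: "openin (top_of_set \<gg>) W" "y \<in> W" "W \<subseteq> Y" "(\<lambda>z. f (?m z)) ` W \<subseteq> \<gg>" "smooth_on W (\<lambda>z. f (?m z))"
      by (rule smooth_at_euclidE[OF oY sfm])
    have "der \<gg> ft y w = der \<gg> (\<lambda>z. Cg ?h (f (?m z))) y w"
    proof (rule fun_cong[OF der_cong[OF oY y]])
      fix z assume "z \<in> Y"
      then have "?i z \<in> carrier G" by (rule iU(3))
      then show "ft z = Cg ?h (f (?m z))" using f_mult[OF hG, of "?m z"] hG by (simp add: ft_def flip: m_assoc)
    qed
    also have "\<dots> = Cg ?h (der \<gg> (\<lambda>z. f (?m z)) y w)"
      by (rule der_linear_compose[OF g W(1,5,2) w bC])
    also have "der \<gg> (\<lambda>z. f (?m z)) y w = A ?u"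
      using tangent_map_euclid[OF oY y, of "\<lambda>z. f (?m z)" \<gg> \<gg>] fg fm by simp
    finally show ?thesis using u by blast
  qed
  define Rg where "Rg = A ` \<gg>"
  have Rg: "subspace Rg" "Rg \<subseteq> \<gg>" unfolding Rg_def using linear_subspace_image[OF lA g] Ag by auto
  \<comment> \<open>Continuity of \<open>Cg\<close> in \<open>h\<close> is read off from smoothness
    of \<open>f (h \<otimes> k)\<close> in both variables: its derivative in \<open>k\<close> at the
    identity is \<open>Cg h (A u)\<close>.\<close>
  have CA: "continuous_on Y (\<lambda>y. Cg (?i y) (A u)) \<and> Cg (?i y0) (A u) = A u" if u: "u \<in> \<gg>" for u
  proof -
    let ?YY = "Y \<times> Y" and ?gg = "\<gg> \<times> \<gg>"
    have gg: "subspace ?gg" by (rule subspace_Times[OF g g])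
    have oYY: "openin (top_of_set ?gg) ?YY" by (rule openin_Times[OF oY oY])
    note YYa = smooth_atlas_euclid[OF gg oYY]
    let ?H = "\<lambda>z. f (?i (fst z) \<otimes> ?i (snd z))"
    have sH: "smooth_at (euclid_mfd ?gg ?YY) (euclid_mfd \<gg> \<gg>) ?H z" if z: "z \<in> ?YY" for z
    proof -
      have "smooth_at (euclid_mfd ?gg ?YY) (euclid_mfd \<gg> Y) fst z" "smooth_at (euclid_mfd ?gg ?YY) (euclid_mfd \<gg> Y) snd z"
        using z by (auto intro!: smooth_at_euclidI[OF oYY oYY] smooth_on_linear bounded_linear_fst bounded_linear_snd)
      then have "smooth_at (euclid_mfd ?gg ?YY) GM (\<lambda>z. ?i (fst z) \<otimes> ?i (snd z)) z"
        using z by (intro smooth_at_mult[OF YYa] smooth_at_compose[OF YYa Ya Ka _ si]) auto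
      then show ?thesis by (rule smooth_at_compose[OF YYa Ka ga _ sf]) (use z iU(3) in auto)
    qed
    have "smooth_map (euclid_mfd ?gg ?YY) (euclid_mfd \<gg> \<gg>) ?H" by (rule smooth_map_onI[OF YYa ga]) (use sH in auto)
    then have H: "smooth_on ?YY ?H" using smooth_map_euclid_iff[OF gg oYY g, of \<gg> ?H] by simp
    have 0: "(0, u) \<in> ?gg" using u subspace_0[OF g] by simp
    have eq: "der ?gg ?H (y, y0) (0, u) = Cg (?i y) (A u)" if y: "y \<in> Y" for y
    proof -
      have sp: "smooth_on Y (\<lambda>z. (y, z))" by (rule smooth_on_Pair[OF smooth_on_const smooth_on_id])
      have "der \<gg> (\<lambda>z. ?H (y, z)) y0 u = der ?gg ?H (y, y0) (der \<gg> (\<lambda>z. (y, z)) y0 u)"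
        by (rule der_compose[OF g oY sp gg oYY H y0(1) u]) (use y in auto)
      moreover have "der \<gg> (\<lambda>z. (y, z)) y0 u = (0, u)"
        using der_Pair[OF g oY smooth_on_const[of _ y] smooth_on_id y0(1) u]
          der_const[OF g subsetD[OF Yg y0(1)] u, of y] der_id[OF g subsetD[OF Yg y0(1)] u] by simp
      moreover have "der \<gg> (\<lambda>z. ?H (y, z)) y0 u = der \<gg> (\<lambda>z. Cg (?i y) (ft z)) y0 u"
        by (rule fun_cong[OF der_cong[OF oY y0(1)]]) (use f_mult iU(3) y in \<open>simp add: ft_def\<close>)
      moreover have "der \<gg> (\<lambda>z. Cg (?i y) (ft z)) y0 u = Cg (?i y) (A u)"
        unfolding A_def by (rule der_linear_compose[OF g oY sft y0(1) u bC])
      ultimately show ?thesis by simp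
    qed
    have "smooth_on Y (\<lambda>y. der ?gg ?H (y, y0) (0, u))"
      by (rule smooth_on_compose[OF smooth_on_Pair[OF smooth_on_id smooth_on_const] smooth_on_der[OF gg oYY H 0]]) (use y0(1) in auto)
    then have "smooth_on Y (\<lambda>y. Cg (?i y) (A u))" by (rule smooth_on_cong[OF _ order_refl]) (use eq in simp)
    then have "continuous_on Y (\<lambda>y. Cg (?i y) (A u))" by (rule smooth_on_imp_continuous_on)
    moreover have "Cg (?i y0) (A u) = A u"
    proof -
      have "der \<gg> (\<lambda>z. Cg (?i y0) (ft z)) y0 u = Cg (?i y0) (A u)"
        unfolding A_def by (rule der_linear_compose[OF g oY sft y0(1) u bC])
      moreover have "der \<gg> (\<lambda>z. Cg (?i y0) (ft z)) y0 u = der \<gg> ft y0 u"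
      proof (rule fun_cong[OF der_cong[OF oY y0(1)]])
        fix z assume "z \<in> Y"
        then show "Cg (?i y0) (ft z) = ft z" using f_mult[OF one_closed iU(3)] iU(3) y0(2) by (simp add: ft_def)
      qed
      ultimately show ?thesis by (simp add: A_def)
    qed
    ultimately show ?thesis ..
  qed
  let ?P = "proj Rg"
  have PR: "?P r = r" if "r \<in> Rg" for r by (rule proj_id[OF Rg(1) that])
  \<comment> \<open>\<open>D y\<close> bounds the distance between the identity and
    \<open>Cg (?i y)\<close> followed by projection, on the image \<open>Rg\<close> of
    \<open>A\<close>. It is 0 at \<open>y0\<close>, and below 1 the composition is injective on
    \<open>Rg\<close>.\<close>
  define D where "D = (\<lambda>y. \<Sum>r\<in>onb Rg. norm (?P (Cg (?i y) r) - r))"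
  have onbR: "\<exists>u\<in>\<gg>. r = A u" if "r \<in> onb Rg" for r using onb(1)[OF Rg(1)] that unfolding Rg_def by blast
  have cD: "continuous_on Y D"
  proof -
    have "continuous_on Y (\<lambda>y. Cg (?i y) r)" if "r \<in> onb Rg" for r using CA onbR[OF that] by auto
    then show ?thesis unfolding D_def
      by (intro continuous_on_sum continuous_on_norm continuous_on_diff continuous_on_const
          bounded_linear.continuous_on[OF bounded_linear_proj])
  qed
  have D0: "D y0 = 0"
  proof -
    have "?P (Cg (?i y0) r) - r = 0" if r: "r \<in> onb Rg" for r
    proof -
      have "Cg (?i y0) r = r" using CA onbR[OF r] by auto
      then show ?thesis using PR onb(1)[OF Rg(1)] r by auto
    qed
    then show ?thesis unfolding D_def by (simp add: sum.neutral)
  qed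
  \<comment> \<open>A nonzero vector displaced by less than its own length cannot arrive at
    0.\<close>
  have injP: "r = 0" if D1: "D y < 1" and r: "r \<in> Rg" "?P (Cg (?i y) r) = 0" for y r
  proof (rule ccontr)
    assume "r \<noteq> 0"
    have lin: "linear (\<lambda>r. ?P (Cg (?i y) r) - r)"
      by (intro linear_compose_sub linear_id[unfolded id_def]) (use linear_compose[OF lC linear_proj] in \<open>simp add: o_def\<close>)
    have "- r = ?P (Cg (?i y) r) - r" using r(2) by simp
    also have "\<dots> = (\<Sum>b\<in>onb Rg. (r \<bullet> b) *\<^sub>R (?P (Cg (?i y) b) - b))" by (rule expand_onb[OF Rg(1) r(1) lin])
    finally have "norm r = norm (\<Sum>b\<in>onb Rg. (r \<bullet> b) *\<^sub>R (?P (Cg (?i y) b) - b))" by (metis norm_minus_cancel)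
    also have "\<dots> \<le> (\<Sum>b\<in>onb Rg. norm r * norm (?P (Cg (?i y) b) - b))"
    proof (rule sum_norm_le)
      fix b assume "b \<in> onb Rg"
      then have "\<bar>r \<bullet> b\<bar> \<le> norm r" using Cauchy_Schwarz_ineq2[of r b] onb(3)[OF Rg(1)] by simp
      then show "norm ((r \<bullet> b) *\<^sub>R (?P (Cg (?i y) b) - b)) \<le> norm r * norm (?P (Cg (?i y) b) - b)"
        by (simp add: mult_right_mono)
    qed
    also have "\<dots> = norm r * D y" by (simp add: D_def sum_distrib_left)
    finally show False using D1 \<open>r \<noteq> 0\<close> by simp
  qed
  define Z where "Z = {u \<in> \<gg>. A u = 0}"
  have Z: "subspace Z" unfolding Z_def using g lA by (auto simp: subspace_def linear_add linear_scale linear_0)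
  have \<xi>Z: "\<xi> \<in> Z" using \<xi> A\<xi> by (simp add: Z_def)
  \<comment> \<open>Projected to \<open>Rg\<close>, the map becomes a submersion at
    \<open>y0\<close> with the same kernel \<open>Z\<close>, so its level set near \<open>y0\<close>
    is a manifold with tangent space \<open>Z\<close> there.\<close>
  let ?F = "\<lambda>y. ?P (ft y)"
  have sF: "smooth_on Y ?F" by (rule smooth_on_linear_compose[OF bounded_linear_proj sft])
  have FR: "?F ` Y \<subseteq> Rg" using proj_in[OF Rg(1)] by auto
  have dF: "der \<gg> ?F y0 u = A u" if "u \<in> \<gg>" for u
    using der_linear_compose[OF g oY sft y0(1) that bounded_linear_proj] PR that by (simp add: A_def Rg_def)
  have dFR: "der \<gg> ?F y0 ` \<gg> = Rg" by (rule trans[OF image_cong[OF refl dF] Rg_def[symmetric]])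
  have kerF: "{u \<in> \<gg>. der \<gg> ?F y0 u = 0} = Z" unfolding Z_def using dF by auto
  have injZ: "inj_on (proj Z) {u \<in> \<gg>. der \<gg> ?F y0 u = 0}"
    unfolding kerF by (rule inj_on_inverseI[of _ "\<lambda>x. x"]) (rule proj_id[OF Z])
  have dimZ: "dim Z + dim Rg = dim \<gg>" using dim_image_plus_kernel[OF g lA] by (simp add: Rg_def Z_def)
  let ?\<Theta> = "\<lambda>y. (?F y, proj Z (y - y0))"
  obtain S' k where S': "openin (top_of_set \<gg>) S'" "S' \<subseteq> Y" "y0 \<in> S'" "openin (top_of_set (Rg \<times> Z)) (?\<Theta> ` S')"
    "\<And>y. y \<in> S' \<Longrightarrow> k (?\<Theta> y) = y" "smooth_on (?\<Theta> ` S') k"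
    by (rule submersion_straighten[OF g oY sF Rg(1) FR y0(1) dFR Z linear_proj _ injZ dimZ]) (use proj_in[OF Z] in auto)
  define a0 where "a0 = ?F y0"
  have a0: "a0 \<in> Rg" unfolding a0_def by (rule proj_in[OF Rg(1)])
  define I where "I = {s::real. (a0, s *\<^sub>R \<xi>) \<in> ?\<Theta> ` S'}"
  have sL: "smooth_on X (\<lambda>s::real. (a0, s *\<^sub>R \<xi>))" for X
    by (rule smooth_on_Pair[OF smooth_on_const smooth_on_scaleR[OF smooth_on_id smooth_on_const]])
  have oI: "open I"
  proof -
    have "continuous_map (top_of_set (UNIV::real set)) (top_of_set (Rg \<times> Z)) (\<lambda>s. (a0, s *\<^sub>R \<xi>))"
      using smooth_on_imp_continuous_on[OF sL] a0 subspace_scale[OF Z \<xi>Z] by (auto simp: continuous_map_in_subtopology)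
    from openin_continuous_map_preimage[OF this S'(4)] show ?thesis by (simp add: I_def)
  qed
  have \<Theta>0: "?\<Theta> y0 = (a0, 0)" using linear_0[OF linear_proj[of Z]] by (simp add: a0_def)
  have I0: "0 \<in> I" unfolding I_def using S'(3) \<Theta>0 by (metis (mono_tags, lifting) imageI mem_Collect_eq scaleR_zero_left)
  \<comment> \<open>The curve in the level set of \<open>?F\<close> whose second coordinate under
    \<open>?\<Theta>\<close> is \<open>s *\<^sub>R \<xi>\<close>.\<close>
  define cv where "cv = (\<lambda>s. k (a0, s *\<^sub>R \<xi>))"
  have cvS: "cv s \<in> S'" "?\<Theta> (cv s) = (a0, s *\<^sub>R \<xi>)" if s: "s \<in> I" for s
  proof -
    have "(a0, s *\<^sub>R \<xi>) \<in> ?\<Theta> ` S'" using s unfolding I_def by (rule CollectD)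
    then obtain y where "(a0, s *\<^sub>R \<xi>) = ?\<Theta> y" "y \<in> S'" by (rule imageE)
    then show "cv s \<in> S'" "?\<Theta> (cv s) = (a0, s *\<^sub>R \<xi>)" using S'(5) by (simp_all add: cv_def)
  qed
  have cv0: "cv 0 = y0" using S'(5)[OF S'(3)] \<Theta>0 by (simp add: cv_def)
  have scv: "smooth_on I cv" unfolding cv_def by (rule smooth_on_compose[OF sL S'(6)]) (simp add: I_def)
  have RI: "subspace (UNIV::real set)" "openin (top_of_set UNIV) I" using oI by auto
  have cvY: "cv ` I \<subseteq> Y" using cvS(1) S'(2) by blast
  have cvg: "cv ` I \<subseteq> \<gg>" using cvY Yg by blast
  have dcv: "der UNIV cv s 1 \<in> \<gg>" if "s \<in> I" for s by (rule der_in[OF RI scv that _ g cvg]) simp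
  have d1: "der UNIV (\<lambda>s. ft (cv s)) s 1 = der \<gg> ft (cv s) (der UNIV cv s 1)" if "s \<in> I" for s
    by (rule der_compose[OF RI scv g oY sft that _ cvY]) simp
  have sfc: "smooth_on I (\<lambda>s. ft (cv s))" by (rule smooth_on_compose[OF scv sft]) (use cvY in blast)
  have d2: "?P (der \<gg> ft (cv s) (der UNIV cv s 1)) = 0" if s: "s \<in> I" for s
  proof -
    have "?P (der UNIV (\<lambda>s. ft (cv s)) s 1) = der UNIV (\<lambda>s. ?P (ft (cv s))) s 1"
      by (rule der_linear_compose[OF RI sfc s _ bounded_linear_proj, symmetric]) simp
    also have "\<dots> = der UNIV (\<lambda>s. a0) s 1"
      by (rule fun_cong[OF der_cong[OF RI(2) s]]) (use cvS(2) in blast)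
    also have "\<dots> = 0" by (rule der_const[OF RI(1)]) simp_all
    finally show ?thesis using d1[OF s] by simp
  qed
  \<comment> \<open>The velocity lies in \<open>Z\<close>, because its image under \<open>A\<close>
    is in \<open>Rg\<close> and has projection 0; on \<open>Z\<close> it is determined by the second
    coordinate.\<close>
  have d3: "der UNIV cv 0 1 = \<xi>"
  proof -
    let ?w = "der UNIV cv 0 1"
    have w: "?w \<in> \<gg>" by (rule dcv[OF I0])
    have "A ?w = ?P (A ?w)" using PR w by (simp add: Rg_def)
    also have "\<dots> = 0" using d2[OF I0] cv0 by (simp add: A_def)
    finally have wZ: "?w \<in> Z" using w by (simp add: Z_def)
    have "proj Z ?w = proj Z (der UNIV (\<lambda>s. cv s - y0) 0 1)"
    proof -
      have "((\<lambda>s. cv s - y0) has_derivative der UNIV cv 0) (at 0 within UNIV)"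
        using has_derivative_diff[OF smooth_on_has_derivative[OF RI scv I0] has_derivative_const[of y0]] by simp
      then have "der UNIV (\<lambda>s. cv s - y0) 0 1 = der UNIV cv 0 1" by (intro der_eqI[OF RI(1)]) auto
      then show ?thesis by simp
    qed
    also have "\<dots> = der UNIV (\<lambda>s. proj Z (cv s - y0)) 0 1"
      by (rule der_linear_compose[OF RI smooth_on_diff[OF scv smooth_on_const] I0 _ bounded_linear_proj, symmetric]) simp
    also have "\<dots> = der UNIV (\<lambda>s. s *\<^sub>R \<xi>) 0 1"
      by (rule fun_cong[OF der_cong[OF RI(2) I0]]) (use cvS(2) in blast)
    also have "\<dots> = \<xi>" using der_bounded_linear[OF RI(1), of 0 1 "\<lambda>s. s *\<^sub>R \<xi>"] bounded_linear_scaleR_left[of \<xi>] by simp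
    finally show ?thesis using proj_id[OF Z wZ] by simp
  qed
  have "continuous_on I (\<lambda>s. D (cv s))"
    by (rule continuous_on_compose2[OF cD smooth_on_imp_continuous_on[OF scv] cvY])
  then have "open (I \<inter> (\<lambda>s. D (cv s)) -` {..<1})" using oI by (intro continuous_open_preimage) auto
  moreover have "0 \<in> I \<inter> (\<lambda>s. D (cv s)) -` {..<1}" using I0 cv0 D0 by simp
  ultimately obtain \<delta> where \<delta>: "\<delta> > 0" "ball 0 \<delta> \<subseteq> I \<inter> (\<lambda>s. D (cv s)) -` {..<1}"
    using open_contains_ball by blast
  \<comment> \<open>So far only the projection of \<open>ft\<close> is constant along the curve. Its
    derivative has the form \<open>Cg h (A u)\<close> with projection 0, so \<open>A u = 0\<close>
    by \<open>injP\<close> and the whole derivative vanishes.\<close>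
  have zero: "((\<lambda>s. ft (cv s)) has_derivative (\<lambda>h. 0)) (at s within ball 0 \<delta>)" if s: "s \<in> ball 0 \<delta>" for s
  proof -
    have sI: "s \<in> I" "D (cv s) < 1" using s \<delta>(2) by auto
    have cY: "cv s \<in> Y" using cvY sI by blast
    obtain u where u: "u \<in> \<gg>" "der \<gg> ft (cv s) (der UNIV cv s 1) = Cg (?i (cv s)) (A u)"
      using factor[OF cY dcv[OF sI(1)]] by blast
    have "A u = 0" by (rule injP[OF sI(2)]) (use u d2[OF sI(1)] in \<open>auto simp: Rg_def\<close>)
    then have z1: "der UNIV (\<lambda>s. ft (cv s)) s 1 = 0" using d1[OF sI(1)] u(2) linear_0[OF lC] by simp
    have "der UNIV (\<lambda>s. ft (cv s)) s h = 0" for h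
      using linear_scale[OF der_linear[OF RI sfc sI(1)], of h 1] z1 by simp
    then have "der UNIV (\<lambda>s. ft (cv s)) s = (\<lambda>h. 0)" by (rule ext)
    then show ?thesis using smooth_on_has_derivative[OF RI sfc sI(1)] by (auto intro: has_derivative_at_withinI)
  qed
  obtain cc where "\<forall>s\<in>ball 0 \<delta>. ft (cv s) = cc"
    using has_derivative_zero_constant[OF convex_ball zero] by blast
  then have const: "ft (cv s) = ft y0" if "s \<in> ball 0 \<delta>" for s using that \<delta>(1) cv0 by (metis centre_in_ball)
  define \<epsilon> where "\<epsilon> = \<delta> / 2"
  have \<epsilon>: "\<epsilon> > 0" "\<epsilon> < \<delta>" using \<delta>(1) by (auto simp: \<epsilon>_def)
  \<comment> \<open>\<open>isotropy_algebra\<close> requires curves on the whole line: this function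
    stays between \<open>-\<epsilon>\<close> and \<open>\<epsilon>\<close>, inside the ball, and has
    velocity 1 at 0.\<close>
  define \<tau> where "\<tau> = (\<lambda>t::real. \<epsilon> * sin ((1 / \<epsilon>) * t))"
  have \<tau>b: "\<tau> t \<in> ball 0 \<delta>" for t
  proof -
    have "\<bar>\<tau> t\<bar> \<le> \<epsilon> * 1" unfolding \<tau>_def abs_mult using \<epsilon>(1) by (intro mult_mono) auto
    then show ?thesis using \<epsilon>(2) by (simp add: dist_norm)
  qed
  have s\<tau>: "smooth_on UNIV \<tau>" unfolding \<tau>_def
    by (rule smooth_on_mult[OF smooth_on_const smooth_on_compose[OF smooth_on_mult[OF smooth_on_const smooth_on_id] smooth_on_sin[of UNIV]]]) simp
  have d\<tau>: "der UNIV \<tau> 0 1 = 1"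
  proof -
    have "(\<tau> has_derivative (\<lambda>h. h)) (at 0)" unfolding \<tau>_def using \<epsilon>(1)
      by (auto intro!: derivative_eq_intros)
    then show ?thesis using frechet_derivative_at by metis
  qed
  have ballI: "ball 0 \<delta> \<subseteq> I" using \<delta>(2) by blast
  have \<tau>I: "\<tau> ` UNIV \<subseteq> I" using \<tau>b ballI by blast
  define \<gamma> where "\<gamma> = (\<lambda>t. ?i (cv (\<tau> t)))"
  have sct: "smooth_on UNIV (\<lambda>t. cv (\<tau> t))" by (rule smooth_on_compose[OF s\<tau> scv]) (use \<tau>I in blast)
  have ctY: "cv (\<tau> t) \<in> Y" for t using cvY \<tau>I by blast
  have "smooth_at real_line GM \<gamma> t" for t
  proof -
    have "smooth_at real_line (euclid_mfd \<gg> Y) (\<lambda>t. cv (\<tau> t)) t"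
      by (rule smooth_at_euclidI[of _ _ UNIV]) (use ctY sct in auto)
    then show ?thesis unfolding \<gamma>_def by (rule smooth_at_compose[OF R Ya Ka, where G="?i"]) (rule si[OF ctY])
  qed
  then have s\<gamma>: "smooth_map real_line GM \<gamma>" by (intro smooth_map_onI[OF R Ka]) auto
  have \<tau>0: "\<tau> 0 = 0" by (simp add: \<tau>_def)
  have \<gamma>0: "\<gamma> 0 = \<one>" using \<tau>0 cv0 y0(2) by (simp add: \<gamma>_def)
  have "\<gamma> t \<in> isotropy_group G GM \<mu>" for t
  proof (rule isotropy_groupI[OF _ x])
    show \<gamma>G: "\<gamma> t \<in> carrier G" unfolding \<gamma>_def by (rule iU(3)[OF ctY])
    have "f (\<gamma> t) = f \<one>" using const[OF \<tau>b] y0(2) by (simp add: \<gamma>_def ft_def)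
    then show "J (\<Phi> (\<gamma> t) x) \<eta> = J x \<eta>" if "\<eta> \<in> \<gg>" for \<eta>
      using f_inner[OF \<gamma>G that] f_inner[OF one_closed that] act_one[OF xM] by simp
  qed
  then have r\<gamma>: "range \<gamma> \<subseteq> isotropy_group G GM \<mu>" by blast
  have "tangent_map real_line GM \<gamma> 0 1 = der UNIV (\<lambda>t. \<kappa> (\<gamma> t)) 0 1"
    using tangent_map_eq[where F=\<gamma>, OF chart_at_euclid[of 0 UNIV UNIV], of GM U \<kappa>] c \<gamma>0
    by (simp add: o_def inv_into_ident)
  also have "\<dots> = der UNIV (\<lambda>t. cv (\<tau> t)) 0 1" using iU(2)[OF ctY] by (simp add: \<gamma>_def)
  also have "\<dots> = der UNIV cv (\<tau> 0) (der UNIV \<tau> 0 1)"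
    by (rule der_compose[OF RI(1) _ s\<tau> RI scv _ _ \<tau>I]) simp_all
  also have "\<dots> = \<xi>" using d\<tau> \<tau>0 d3 by simp
  finally show ?thesis unfolding isotropy_algebra_def using s\<gamma> \<gamma>0 r\<gamma> by blast
qed

end

section \<open>The ray preimage and its quotient\<close>

text \<open>\<open>splitting\<close> is hypothesis (3). \<open>nonempty\<close> provides a point at
  which the dimensions of the model spaces can be compared; an empty preimage is handled in the
  final theorem.\<close>

locale ray_reduction = hamiltonian G GM M \<omega> \<Phi> J \<mu>
  for G :: "'g monoid" (structure) and GM :: "('g, 'e::euclidean_space) mfd" and M :: "('m, 'f::euclidean_space) mfd"
    and \<omega> :: "('m, 'f) form2" and \<Phi> :: "'g \<Rightarrow> 'm \<Rightarrow> 'm" and J :: "'m \<Rightarrow> 'e \<Rightarrow> real" and \<mu> :: "'e \<Rightarrow> real" +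
  fixes K :: "('g, 'k::euclidean_space) mfd"
  assumes kernel: "kernel_group K G GM \<mu>"
    and acts_properly: "acts_properly K (subtopology (mtop M) S) \<Phi>"
    and splitting: "\<gg> = {\<eta> + \<zeta> | \<eta> \<zeta>. \<eta> \<in> \<gg> \<and> \<mu> \<eta> = 0 \<and> \<zeta> \<in> isotropy_algebra G GM \<mu>}"
    and nonempty: "S \<noteq> {}"
begin

section \<open>The ray preimage as a regular level set\<close>

definition L :: "'e set" where "L = {\<xi> \<in> \<gg>. \<mu> \<xi> = 0}"

lemma subspace_L: "subspace L"
  unfolding L_def using dual_zero[OF \<mu> subspace_\<gg>] dual_add[OF \<mu> subspace_\<gg>] dual_scale[OF \<mu> subspace_\<gg>] subspace_\<gg>
  by (auto simp: subspace_def)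

lemma L_in: "\<xi> \<in> L \<Longrightarrow> \<xi> \<in> \<gg>" and L_\<mu>: "\<xi> \<in> L \<Longrightarrow> \<mu> \<xi> = 0" and L_I: "\<xi> \<in> \<gg> \<Longrightarrow> \<mu> \<xi> = 0 \<Longrightarrow> \<xi> \<in> L"
  by (simp_all add: L_def)

lemma onb_L: "b \<in> onb L \<Longrightarrow> b \<in> L"
  using onb(1)[OF subspace_L] by blast

text \<open>The restriction of \<open>J p\<close> to \<open>ker \<mu>\<close>, turned into a vector
  of \<open>L\<close> by the inner product. It vanishes exactly where \<open>J p\<close> is a
  multiple of \<open>\<mu>\<close>.\<close>

definition F :: "'m \<Rightarrow> 'e" where "F p = (\<Sum>b\<in>onb L. J p b *\<^sub>R b)"

abbreviation TF :: "'m \<Rightarrow> 'f \<Rightarrow> 'e" where "TF \<equiv> tangent_map M (euclid_mfd L L) F"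

lemma euclid_L: "smooth_atlas (euclid_mfd L L)"
  by (rule smooth_atlas_euclid[OF subspace_L]) simp

lemma F_smooth: "p \<in> points M \<Longrightarrow> smooth_at M (euclid_mfd L L) F p"
  unfolding F_def by (rule smooth_at_onb_sum[OF Na subspace_L]) (use J_smooth L_in onb_L in auto)

lemma F_inner: "p \<in> points M \<Longrightarrow> \<xi> \<in> L \<Longrightarrow> F p \<bullet> \<xi> = J p \<xi>"
proof -
  assume p: "p \<in> points M" and \<xi>: "\<xi> \<in> L"
  have "J p \<xi> = (\<Sum>b\<in>onb L. (\<xi> \<bullet> b) * J p b)"
    by (subst subspace_expand_inner[OF subspace_L \<xi>])
      (rule dual_sum[OF J_dual[OF p] subspace_\<gg> onb(7)[OF subspace_L]], use onb_L L_in in blast)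
  then show ?thesis unfolding F_def inner_sum_left by (simp add: inner_commute mult.commute)
qed

lemma F_in: "F p \<in> L"
  unfolding F_def by (intro subspace_sum[OF subspace_L] subspace_scale[OF subspace_L] onb_L)

lemma F_eq_0_iff: "p \<in> points M \<Longrightarrow> F p = 0 \<longleftrightarrow> (\<forall>\<xi>\<in>L. J p \<xi> = 0)"
  using F_inner[of p] subspace_inner_eqI[OF subspace_L F_in subspace_0[OF subspace_L], of p] by force

lemma TF_in: "p \<in> points M \<Longrightarrow> v \<in> model M \<Longrightarrow> TF p v \<in> L"
  using tangent_map_in[OF Na euclid_L F_smooth] by simp

lemma TF_linear: "p \<in> points M \<Longrightarrow> linear (TF p)"
  by (rule tangent_map_linear[OF Na euclid_L F_smooth])

text \<open>The linear equations of the tangent space of the preimage: they are the contractions of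
  \<open>\<omega>\<close> with generators from \<open>ker \<mu>\<close>.\<close>

lemma TF_inner:
  assumes p: "p \<in> points M" and v: "v \<in> model M" and \<xi>: "\<xi> \<in> L"
  shows "TF p v \<bullet> \<xi> = \<omega> p (vert p \<xi>) v"
proof -
  have "TF p v \<bullet> \<xi> = tangent_map M real_line (\<lambda>x. F x \<bullet> \<xi>) p v"
    by (rule tangent_map_inner[OF Na subspace_L F_smooth[OF p] v, symmetric])
  also have "\<dots> = tangent_map M real_line (\<lambda>x. J x \<xi>) p v"
    by (rule fun_cong[OF tangent_map_cong[OF Na openin_topspace p]]) (rule F_inner[OF _ \<xi>])
  also have "\<dots> = \<omega> p (vert p \<xi>) v" by (rule J_moment[OF L_in[OF \<xi>] p v])
  finally show ?thesis .
qed

text \<open>If \<open>\<mu> = 0\<close> then the ray is a point; otherwise the condition \<open>J p e0 > 0\<close> selects the ray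
  among the multiples of \<open>\<mu>\<close>.\<close>

definition e0 :: 'e where "e0 = (SOME e. e \<in> \<gg> \<and> \<mu> e = 1)"
definition M0 :: "'m set" where "M0 = {p \<in> points M. L = \<gg> \<or> J p e0 > 0}"

lemma e0: assumes "L \<noteq> \<gg>" shows "e0 \<in> \<gg>" "\<mu> e0 = 1"
proof -
  obtain \<xi> where \<xi>: "\<xi> \<in> \<gg>" "\<mu> \<xi> \<noteq> 0" using assms by (auto simp: L_def)
  then have "(1 / \<mu> \<xi>) *\<^sub>R \<xi> \<in> \<gg> \<and> \<mu> ((1 / \<mu> \<xi>) *\<^sub>R \<xi>) = 1"
    using subspace_scale[OF subspace_\<gg>] dual_scale[OF \<mu> subspace_\<gg>] by simp
  from someI[of "\<lambda>e. e \<in> \<gg> \<and> \<mu> e = 1", OF this] show "e0 \<in> \<gg>" "\<mu> e0 = 1" by (simp_all add: e0_def)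
qed

lemma openin_M0: "openin (mtop M) M0"
proof (cases "L = \<gg>")
  case True then show ?thesis by (simp add: M0_def)
next
  case False
  have "openin (mtop M) {p \<in> points M. J p e0 \<in> {0<..}}"
    by (rule smooth_at_preimage_open[OF Na smooth_atlas_real_line openin_topspace J_smooth[OF e0(1)[OF False]]]) auto
  then show ?thesis using False by (simp add: M0_def)
qed

text \<open>A functional that vanishes on \<open>ker \<mu>\<close> is a multiple of
  \<open>\<mu>\<close>, with its value at \<open>e0\<close> as the factor; positivity of the factor
  is the open condition defining \<open>M0\<close>.\<close>

lemma S_level: "S = {p \<in> M0. F p = 0}"
proof (intro equalityI subsetI)
  fix p assume p: "p \<in> S"
  note pM = S_points[OF p]
  obtain r where r: "r > 0" "J p = (\<lambda>\<xi>\<in>\<gg>. r * \<mu> \<xi>)" by (rule S_J[OF p])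
  have "J p \<xi> = 0" if "\<xi> \<in> L" for \<xi> using that r(2) by (simp add: L_def)
  then have "F p = 0" using F_eq_0_iff[OF pM] by simp
  moreover have "J p e0 > 0" if "L \<noteq> \<gg>" using e0[OF that] r by simp
  ultimately show "p \<in> {p \<in> M0. F p = 0}" using pM by (auto simp: M0_def)
next
  fix p assume "p \<in> {p \<in> M0. F p = 0}"
  then have pM: "p \<in> points M" and M0: "L = \<gg> \<or> J p e0 > 0" and F0: "\<And>\<xi>. \<xi> \<in> L \<Longrightarrow> J p \<xi> = 0"
    using F_eq_0_iff by (auto simp: M0_def)
  have ext: "J p \<in> extensional \<gg>" using J_dual[OF pM] by (simp add: dual_def)
  show "p \<in> S"
  proof (cases "L = \<gg>")
    case True
    have "J p = (\<lambda>\<xi>\<in>\<gg>. 1 * \<mu> \<xi>)"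
      by (rule extensionalityI[OF ext restrict_extensional]) (use F0 L_\<mu> True in auto)
    then show ?thesis by (rule S_I[OF pM, rotated]) simp
  next
    case False
    note e = e0[OF False]
    have "J p \<xi> = J p e0 * \<mu> \<xi>" if \<xi>: "\<xi> \<in> \<gg>" for \<xi>
    proof -
      \<comment> \<open>Subtracting \<open>\<mu> \<xi>\<close> times \<open>e0\<close> projects
        \<open>\<xi>\<close> into \<open>ker \<mu>\<close>.\<close>
      have s: "(- \<mu> \<xi>) *\<^sub>R e0 \<in> \<gg>" by (rule subspace_scale[OF subspace_\<gg> e(1)])
      have "\<xi> + (- \<mu> \<xi>) *\<^sub>R e0 \<in> L"
        by (rule L_I[OF subspace_add[OF subspace_\<gg> \<xi> s]])
          (use dual_add[OF \<mu> subspace_\<gg> \<xi> s] dual_scale[OF \<mu> subspace_\<gg> e(1), of "- \<mu> \<xi>"] e(2) in simp)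
      from F0[OF this] show ?thesis
        using dual_add[OF J_dual[OF pM] subspace_\<gg> \<xi> s] dual_scale[OF J_dual[OF pM] subspace_\<gg> e(1), of "- \<mu> \<xi>"]
        by simp
    qed
    then have "J p = (\<lambda>\<xi>\<in>\<gg>. J p e0 * \<mu> \<xi>)" by (intro extensionalityI[OF ext restrict_extensional]) simp
    then show ?thesis by (rule S_I[OF pM, rotated]) (use M0 False in simp)
  qed
qed

lemma inner_dual: "(\<lambda>\<xi>\<in>\<gg>. \<xi> \<bullet> \<eta>) \<in> dual \<gg>"
  using subspace_\<gg> by (auto simp: dual_def subspace_add subspace_scale inner_add_left)

text \<open>Transversality applied to the functional given by the inner product with
  \<open>\<eta>\<close>. On \<open>L\<close> the term with \<open>\<mu>\<close> drops out, and the
  momentum equation turns the derivative of \<open>J\<close> into \<open>\<omega>\<close>.\<close>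

lemma transverse_inner:
  assumes p: "p \<in> S"
  obtains v where "v \<in> model M" "\<And>\<xi>. \<xi> \<in> L \<Longrightarrow> \<xi> \<bullet> \<eta> = \<omega> p (vert p \<xi>) v"
proof -
  note T = transverse[unfolded transverse_to_ray_def, THEN bspec, OF p, THEN bspec, OF inner_dual[of \<eta>]]
  obtain v c where v: "v \<in> model M" and
    *: "\<forall>\<xi>\<in>\<gg>. (\<lambda>\<xi>\<in>\<gg>. \<xi> \<bullet> \<eta>) \<xi> = tangent_map M real_line (\<lambda>y. J y \<xi>) p v + c * \<mu> \<xi>" using T by blast
  have "\<xi> \<bullet> \<eta> = \<omega> p (vert p \<xi>) v" if \<xi>: "\<xi> \<in> L" for \<xi>
    using bspec[OF *, OF L_in[OF \<xi>]] L_in[OF \<xi>] L_\<mu>[OF \<xi>] J_moment[OF L_in[OF \<xi>] S_points[OF p] v] by simp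
  then show ?thesis by (rule that[OF v])
qed

lemma TF_surj:
  assumes p: "p \<in> S" shows "TF p ` model M = L"
proof (intro equalityI subsetI)
  fix \<eta> assume \<eta>: "\<eta> \<in> L"
  obtain v where v: "v \<in> model M" "\<And>\<xi>. \<xi> \<in> L \<Longrightarrow> \<xi> \<bullet> \<eta> = \<omega> p (vert p \<xi>) v" using transverse_inner[OF p, of \<eta>] by metis
  have "\<eta> = TF p v"
    by (rule subspace_inner_eqI[OF subspace_L \<eta> TF_in[OF S_points[OF p] v(1)]])
      (use v(2) TF_inner[OF S_points[OF p] v(1)] in \<open>simp add: inner_commute\<close>)
  then show "\<eta> \<in> TF p ` model M" using v(1) by blast
qed (use TF_in S_points p in blast)

lemma \<omega>_zero: "p \<in> points M \<Longrightarrow> v \<in> model M \<Longrightarrow> \<omega> p 0 v = 0"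
  by (rule alt_form_zero[OF \<omega>_alt subspace_TM])

text \<open>For the vector \<open>v\<close> that \<open>transverse_inner\<close> assigns to
  \<open>\<xi>\<close>, the number \<open>\<xi> \<bullet> \<xi>\<close> equals
  \<open>\<omega> p (vert p \<xi>) v\<close> and hence vanishes. This yields local freeness of the
  kernel group.\<close>

lemma vert_inj_on_L:
  assumes p: "p \<in> S" and \<xi>: "\<xi> \<in> L" "vert p \<xi> = 0" shows "\<xi> = 0"
proof -
  obtain v where v: "v \<in> model M" "\<And>\<zeta>. \<zeta> \<in> L \<Longrightarrow> \<zeta> \<bullet> \<xi> = \<omega> p (vert p \<zeta>) v" using transverse_inner[OF p, of \<xi>] by metis
  have "\<xi> \<bullet> \<xi> = 0" using v(2)[OF \<xi>(1)] \<xi>(2) \<omega>_zero[OF S_points[OF p] v(1)] by simp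
  then show ?thesis by simp
qed

text \<open>Chosen by dimension alone: \<open>regular_level_slice\<close> carries the tangent space
  at each point over to it.\<close>

definition VN :: "'f set" where "VN = (SOME V. subspace V \<and> dim V + dim L = dim (model M))"

lemma VN: "subspace VN" "dim VN + dim L = dim (model M)"
proof -
  obtain p where p: "p \<in> S" using nonempty by blast
  have "dim L \<le> dim (model M)" using dim_image_le[OF TF_linear[OF S_points[OF p]], of "model M"] TF_surj[OF p] by simp
  obtain V where "subspace V" "V \<subseteq> span (model M)" "dim V = dim (model M) - dim L"
    by (rule choose_subspace_of_subspace[OF diff_le_self])
  then have "subspace V \<and> dim V + dim L = dim (model M)" using \<open>dim L \<le> dim (model M)\<close> by simp
  from someI[of "\<lambda>V. subspace V \<and> dim V + dim L = dim (model M)", OF this] show "subspace VN" "dim VN + dim L = dim (model M)"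
    by (simp_all add: VN_def)
qed

abbreviation N :: "('m, 'f) mfd" where "N \<equiv> slice_mfd M S VN"

lemma F_smooth_M0: "p \<in> M0 \<Longrightarrow> smooth_at M (euclid_mfd L L) F p"
  by (rule F_smooth) (simp add: M0_def)

lemma S_slice: "p \<in> S \<Longrightarrow> \<exists>U \<theta> \<tau>. p \<in> U \<and> slice M S VN U \<theta> \<tau>"
  by (rule regular_level_slice[OF Na openin_M0 subspace_L F_smooth_M0 S_level VN _ TF_surj])

lemma S_subset: "S \<subseteq> points M"
  using S_points by blast

lemmas N_manifold' = smooth_manifold_slice_mfd[OF M VN(1) S_subset S_slice]
lemmas N_embedded = embedded_submanifold_slice_mfd[OF M VN(1) S_subset S_slice]
lemmas N_atlas = smooth_manifold_imp_atlas[OF N_manifold']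

lemma N_points: "points N = S"
  using S_subset by (simp add: inf.absorb2)

abbreviation \<iota> :: "'m \<Rightarrow> 'f \<Rightarrow> 'f" where "\<iota> \<equiv> tangent_map N M (\<lambda>x. x)"

lemma incl_smooth: "p \<in> S \<Longrightarrow> smooth_at N M (\<lambda>x. x) p"
  and \<iota>_inj: "p \<in> S \<Longrightarrow> inj_on (\<iota> p) VN"
  by (rule slice_mfd_incl[OF M VN(1) S_subset S_slice], assumption+)+

lemma \<iota>_image: "p \<in> S \<Longrightarrow> \<iota> p ` VN = {v \<in> model M. TF p v = 0}"
  by (rule regular_level_tangent[OF M openin_M0 subspace_L F_smooth_M0 S_level VN TF_surj])

lemma \<iota>_in: "p \<in> S \<Longrightarrow> u \<in> VN \<Longrightarrow> \<iota> p u \<in> model M" and TF_\<iota>: "p \<in> S \<Longrightarrow> u \<in> VN \<Longrightarrow> TF p (\<iota> p u) = 0"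
  using \<iota>_image[of p] by blast+

section \<open>The kernel group acting on the preimage\<close>

abbreviation KG :: "'g monoid" where "KG \<equiv> G\<lparr>carrier := points K\<rparr>"

lemma K_subgroup: "lie_subgroup K G GM"
  using kernel by (simp add: kernel_group_def)

lemma K_lie: "lie_group KG K"
  using K_subgroup by (simp add: lie_subgroup_def)

lemma K_atlas: "smooth_atlas K"
  using K_lie by (simp add: lie_group_def smooth_manifold_imp_atlas)

lemma K_isotropy: "k \<in> points K \<Longrightarrow> k \<in> isotropy_group G GM \<mu>"
  using kernel normal_imp_subgroup subgroup.subset unfolding kernel_group_def by fastforce

lemma K_in: "k \<in> points K \<Longrightarrow> k \<in> carrier G"
  using K_isotropy by (simp add: isotropy_group_def)

lemma K_one: "\<one> \<in> points K"
  using K_subgroup subgroup.one_closed by (auto simp: lie_subgroup_def)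

lemma K_incl_smooth: "k \<in> points K \<Longrightarrow> smooth_at K GM (\<lambda>x. x) k"
  using K_subgroup smooth_map_on_imp_smooth_at[OF K_atlas Ka _ openin_topspace] unfolding lie_subgroup_def by blast

text \<open>The inclusion of the Lie algebra of \<open>K\<close> into \<open>\<gg>\<close>.\<close>

abbreviation \<kappa> :: "'k \<Rightarrow> 'e" where "\<kappa> \<equiv> tangent_map K GM (\<lambda>x. x) \<one>"

lemma \<kappa>_image: "\<kappa> ` model K = {\<xi> \<in> isotropy_algebra G GM \<mu>. \<mu> \<xi> = 0}"
  using kernel by (simp add: kernel_group_def lie_subalgebra_of_def)

lemma \<kappa>_inj: "inj_on \<kappa> (model K)"
  using K_subgroup K_one by (simp add: lie_subgroup_def)

lemma \<kappa>_L: "\<zeta> \<in> model K \<Longrightarrow> \<kappa> \<zeta> \<in> L"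
  using \<kappa>_image isotropy_algebra_in by (auto simp: L_def)

lemma \<kappa>_linear: "linear \<kappa>"
  by (rule tangent_map_linear[OF K_atlas Ka K_incl_smooth[OF K_one]])

lemma smooth_at_into_N:
  "smooth_atlas P \<Longrightarrow> smooth_at P M f p \<Longrightarrow> openin (mtop P) W \<Longrightarrow> p \<in> W \<Longrightarrow> (\<And>x. x \<in> W \<Longrightarrow> f x \<in> S) \<Longrightarrow> smooth_at P N f p"
  by (rule smooth_at_into_slice_mfd[OF M VN(1) S_subset S_slice])

lemma act_S: "k \<in> points K \<Longrightarrow> x \<in> S \<Longrightarrow> \<Phi> k x \<in> S"
  by (rule isotropy_J(2)[OF K_isotropy])

end

text \<open>The inclusions of \<open>K\<close> in \<open>G\<close> and of the preimage in
  \<open>M\<close> are smooth, and a smooth map into \<open>M\<close> with values in the preimage is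
  smooth into the submanifold. Only smoothness of the inclusion of \<open>K\<close> enters, so its
  finer topology does no harm.\<close>

sublocale ray_reduction \<subseteq> KN: smooth_action "G\<lparr>carrier := points K\<rparr>" K "slice_mfd M S VN" \<Phi>
proof unfold_locales
  show "lie_group KG K" by (rule K_lie)
  show "smooth_manifold N" by (rule N_manifold')
  show "\<Phi> k x \<in> points N" if "k \<in> carrier KG" "x \<in> points N" for k x using that act_S unfolding N_points by simp
  show "\<Phi> \<one>\<^bsub>KG\<^esub> x = x" if "x \<in> points N" for x using act_one S_points that unfolding N_points by simp
  show "\<Phi> (g \<otimes>\<^bsub>KG\<^esub> h) x = \<Phi> g (\<Phi> h x)" if "g \<in> carrier KG" "h \<in> carrier KG" "x \<in> points N" for g h x
    using act_mult K_in S_points that unfolding N_points by simp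
  have KN: "smooth_atlas (prod_mfd K N)" by (rule smooth_atlas_prod[OF K_atlas N_atlas])
  have pts: "points (prod_mfd K N) = points K \<times> S" using N_points by simp
  show "smooth_map (prod_mfd K N) N (\<lambda>(g, x). \<Phi> g x)"
  proof (rule smooth_map_onI[OF KN N_atlas openin_topspace])
    fix z assume "z \<in> points (prod_mfd K N)"
    then obtain k x where z: "z = (k, x)" "k \<in> points K" "x \<in> S" unfolding pts by blast
    have xN: "x \<in> points N" unfolding N_points by (rule z(3))
    have "smooth_at (prod_mfd K N) GM fst z" unfolding z(1)
      using smooth_at_compose[OF KN K_atlas Ka smooth_at_fst[OF K_atlas N_atlas z(2) xN], of "\<lambda>x. x"] K_incl_smooth[OF z(2)] by simp
    moreover have "smooth_at (prod_mfd K N) M snd z" unfolding z(1)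
      using smooth_at_compose[OF KN N_atlas Na smooth_at_snd[OF K_atlas N_atlas z(2) xN], of "\<lambda>x. x"] incl_smooth[OF z(3)] by simp
    ultimately have "smooth_at (prod_mfd K N) M (\<lambda>z. \<Phi> (fst z) (snd z)) z" by (rule smooth_at_act[OF KN])
    then have "smooth_at (prod_mfd K N) N (\<lambda>z. \<Phi> (fst z) (snd z)) z"
      by (rule smooth_at_into_N[OF KN _ openin_topspace]) (use z act_S pts in auto)
    then show "smooth_at (prod_mfd K N) N (\<lambda>(g, x). \<Phi> g x) z" unfolding case_prod_beta .
  qed
qed

context ray_reduction
begin

declare KN.K_points [simp del] \<comment> \<open>it would loop, as \<open>carrier KG\<close> simplifies to \<open>points K\<close>\<close>

text \<open>Generators on the preimage and on \<open>M\<close> correspond under the two inclusions: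
  both sides differentiate the orbit map of \<open>K\<close> at \<open>x\<close>, seen in
  \<open>M\<close>.\<close>

lemma \<iota>_vert:
  assumes x: "x \<in> S" and \<zeta>: "\<zeta> \<in> model K"
  shows "\<iota> x (tangent_map K N (\<lambda>k. \<Phi> k x) \<one> \<zeta>) = vert x (\<kappa> \<zeta>)"
proof -
  have xN: "x \<in> points N" using x N_points by simp
  note s = KN.smooth_at_act_right[OF KN.one_closed xN, simplified]
  have x1: "\<Phi> \<one> x = x" by (rule act_one[OF S_points[OF x]])
  have "\<iota> x (tangent_map K N (\<lambda>k. \<Phi> k x) \<one> \<zeta>) = tangent_map K M (\<lambda>k. \<Phi> k x) \<one> \<zeta>"
    using tangent_map_compose[OF K_atlas N_atlas Na s _ \<zeta>, of "\<lambda>x. x"] incl_smooth[OF x] x1 by simp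
  also have "\<dots> = vert x (\<kappa> \<zeta>)"
    by (rule tangent_map_compose[OF K_atlas Ka Na K_incl_smooth[OF K_one] smooth_at_act_right[OF one_closed S_points[OF x]] \<zeta>])
  finally show ?thesis .
qed

lemma vertN_linear: "x \<in> S \<Longrightarrow> linear (tangent_map K N (\<lambda>k. \<Phi> k x) \<one>)"
  using tangent_map_linear[OF K_atlas N_atlas KN.smooth_at_act_right[OF KN.one_closed, simplified]] S_subset by auto

lemma vertN_in: "x \<in> S \<Longrightarrow> \<zeta> \<in> model K \<Longrightarrow> tangent_map K N (\<lambda>k. \<Phi> k x) \<one> \<zeta> \<in> VN"
  using tangent_map_in[OF K_atlas N_atlas KN.smooth_at_act_right[OF KN.one_closed, simplified]] S_subset by auto

lemma vertN_inj:
  assumes x: "x \<in> S" shows "inj_on (tangent_map K N (\<lambda>k. \<Phi> k x) \<one>) (model K)"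
proof (rule linear_inj_on_iff_eq_0[OF vertN_linear[OF x] smooth_atlasD(1)[OF K_atlas], THEN iffD2, rule_format])
  fix \<zeta> assume \<zeta>: "\<zeta> \<in> model K" "tangent_map K N (\<lambda>k. \<Phi> k x) \<one> \<zeta> = 0"
  have "linear (\<iota> x)" by (rule tangent_map_linear[OF N_atlas Na incl_smooth[OF x]])
  then have "vert x (\<kappa> \<zeta>) = 0" using \<iota>_vert[OF x \<zeta>(1)] \<zeta>(2) linear_0[of "\<iota> x"] by simp
  then have "\<kappa> \<zeta> = 0" by (rule vert_inj_on_L[OF x \<kappa>_L[OF \<zeta>(1)]])
  then show "\<zeta> = 0" using inj_onD[OF \<kappa>_inj, of \<zeta> 0] \<zeta>(1) linear_0[OF \<kappa>_linear] subspace_0[OF smooth_atlasD(1)[OF K_atlas]] by simp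
qed

text \<open>The model of the reduced space. Its existence needs \<open>dim (model K)\<close> not to
  exceed \<open>dim VN\<close>, which the injective generators at one point provide.\<close>

definition V :: "'f set" where "V = (SOME V. subspace V \<and> dim V + dim (model K) = dim VN)"

lemma V_dim: "subspace V" "dim V + dim (model K) = dim VN"
proof -
  obtain x where x: "x \<in> S" using nonempty by blast
  let ?t = "tangent_map K N (\<lambda>k. \<Phi> k x) \<one>"
  have "dim (?t ` model K) = dim (model K)"
    using dim_image_eq[OF vertN_linear[OF x], of "model K", unfolded span_eq_iff[THEN iffD2, OF smooth_atlasD(1)[OF K_atlas]]]
      vertN_inj[OF x] by blast
  then have le: "dim (model K) \<le> dim VN" using dim_subset[of "?t ` model K" VN] vertN_in[OF x] by auto
  obtain W where "subspace W" "W \<subseteq> span VN" "dim W = dim VN - dim (model K)"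
    by (rule choose_subspace_of_subspace[OF diff_le_self])
  then have "subspace W \<and> dim W + dim (model K) = dim VN" using le by simp
  from someI[of "\<lambda>V. subspace V \<and> dim V + dim (model K) = dim VN", OF this]
  show "subspace V" "dim V + dim (model K) = dim VN" by (simp_all add: V_def)
qed

section \<open>The kernel of the restricted form\<close>

definition \<sigma> :: "('m, 'f) form2" where "\<sigma> = pullback_form N M (\<lambda>x. x) \<omega>"

lemma \<sigma>_apply: "\<sigma> x u v = \<omega> x (\<iota> x u) (\<iota> x v)"
  by (simp add: \<sigma>_def pullback_form_def)

lemma kernel_\<sigma>:
  assumes x: "x \<in> S" and u: "u \<in> VN" and z: "\<And>v. v \<in> VN \<Longrightarrow> \<omega> x (\<iota> x u) (\<iota> x v) = 0"
  shows "u \<in> tangent_map K N (\<lambda>k. \<Phi> k x) \<one> ` model K"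
proof -
  note xM = S_points[OF x]
  define w where "w = \<iota> x u"
  have w: "w \<in> model M" "TF x w = 0" using \<iota>_in[OF x u] TF_\<iota>[OF x u] by (auto simp: w_def)
  have alt: "alt_form (model M) (\<omega> x)" by (rule \<omega>_alt[OF xM])
  note anti = alt_form_anti[OF alt subspace_TM]
  have wz: "\<omega> x w v = 0" if "v \<in> model M" "TF x v = 0" for v
  proof -
    have "v \<in> \<iota> x ` VN" unfolding \<iota>_image[OF x] using that by simp
    then obtain v' where "v = \<iota> x v'" "v' \<in> VN" by blast
    then show ?thesis using z by (simp add: w_def)
  qed
  \<comment> \<open>A linear section of \<open>TF x\<close>: every tangent vector of
    \<open>M\<close> is a value of \<open>B\<close> plus a vector in the kernel of
    \<open>TF x\<close>, and the pairing of \<open>w\<close> with the latter is 0.\<close>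
  obtain B where B: "range B \<subseteq> model M" "linear B" "\<And>l. l \<in> TF x ` model M \<Longrightarrow> TF x (B l) = l"
    using linear_exists_right_inverse_on[OF TF_linear[OF xM] subspace_TM] by blast
  have BM: "B l \<in> model M" for l using B(1) by blast
  \<comment> \<open>The Lagrange multiplier: the functional \<open>\<omega> x w\<close> factors
    through \<open>TF x\<close>, and \<open>\<xi>\<close> represents the factor on \<open>L\<close>
    by the inner product.\<close>
  define \<xi> where "\<xi> = (\<Sum>b\<in>onb L. \<omega> x w (B b) *\<^sub>R b)"
  have \<xi>L: "\<xi> \<in> L" unfolding \<xi>_def by (intro subspace_sum[OF subspace_L] subspace_scale[OF subspace_L] onb_L)
  note \<xi> = L_in[OF \<xi>L]
  have v\<xi>: "vert x \<xi> \<in> model M" by (rule vert_in_TM[OF xM \<xi>])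
  have eq: "\<omega> x w v = \<omega> x (vert x \<xi>) v" if v: "v \<in> model M" for v
  proof -
    let ?a = "TF x v"
    have a: "?a \<in> L" by (rule TF_in[OF xM v])
    have k: "v - B ?a \<in> model M" "TF x (v - B ?a) = 0"
      using subspace_diff[OF subspace_TM v BM] linear_diff[OF TF_linear[OF xM]] B(3) v by auto
    have "\<omega> x w v = \<omega> x w (B ?a + (v - B ?a))" by simp
    also have "\<dots> = \<omega> x w (B ?a)" unfolding alt_form_add_right[OF alt subspace_TM BM k(1) w(1)] wz[OF k] by simp
    also have "\<dots> = - \<omega> x (B ?a) w" by (rule anti[OF w(1) BM])
    also have "B ?a = (\<Sum>b\<in>onb L. (?a \<bullet> b) *\<^sub>R B b)" by (rule expand_onb[OF subspace_L a B(2)])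
    also have "\<omega> x \<dots> w = (\<Sum>b\<in>onb L. (?a \<bullet> b) * \<omega> x (B b) w)"
      by (rule alt_form_sum[OF alt subspace_TM onb(7)[OF subspace_L] BM w(1)])
    also have "- \<dots> = (\<Sum>b\<in>onb L. (?a \<bullet> b) * \<omega> x w (B b))"
      unfolding sum_negf[symmetric] by (rule sum.cong[OF refl]) (simp add: anti[OF w(1) BM])
    also have "\<dots> = ?a \<bullet> \<xi>" by (simp add: \<xi>_def inner_sum_right mult.commute)
    also have "\<dots> = \<omega> x (vert x \<xi>) v" by (rule TF_inner[OF xM v \<xi>L])
    finally show ?thesis .
  qed
  have "w + (- 1) *\<^sub>R vert x \<xi> = 0"
  proof (rule \<omega>_nondegenerate[OF xM])
    show "w + (- 1) *\<^sub>R vert x \<xi> \<in> model M" by (rule subspace_add[OF subspace_TM w(1) subspace_scale[OF subspace_TM v\<xi>]])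
    show "\<omega> x (w + (- 1) *\<^sub>R vert x \<xi>) v = 0" if "v \<in> model M" for v
      using alt_form_comb[OF alt subspace_TM w(1) v\<xi> that, of 1 "- 1"] eq[OF that] by simp
  qed
  then have w\<xi>: "w = vert x \<xi>" by simp
  have "\<xi> \<in> isotropy_algebra G GM \<mu>"
  proof (rule isotropy_algebraI[OF x \<xi>])
    fix \<eta> assume "\<eta> \<in> \<gg>"
    then obtain a \<zeta> where a: "\<eta> = a + \<zeta>" "a \<in> L" "\<zeta> \<in> isotropy_algebra G GM \<mu>"
      using splitting unfolding L_def by blast
    have va: "vert x a \<in> model M" "vert x \<zeta> \<in> model M"
      using vert_in_TM[OF xM] L_in[OF a(2)] isotropy_algebra_in[OF a(3)] by blast+
    have "\<omega> x (vert x \<eta>) (vert x \<xi>) = \<omega> x (vert x a) w + \<omega> x (vert x \<zeta>) (vert x \<xi>)"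
      using alt_form_add[OF alt subspace_TM va v\<xi>] linear_add[OF vert_linear[OF xM]] w\<xi> by (simp add: a(1))
    moreover have "\<omega> x (vert x a) w = 0" using TF_inner[OF xM w(1) a(2)] w(2) by simp
    moreover have "\<omega> x (vert x \<zeta>) (vert x \<xi>) = 0"
      unfolding anti[OF va(2) v\<xi>] isotropy_algebra_moment[OF a(3) x \<xi>] by simp
    ultimately show "\<omega> x (vert x \<eta>) (vert x \<xi>) = 0" by simp
  qed
  \<comment> \<open>Both in the isotropy algebra and in \<open>ker \<mu>\<close>, the vector lies in
    the Lie algebra that defines the kernel group.\<close>
  then have "\<xi> \<in> \<kappa> ` model K" unfolding \<kappa>_image using L_\<mu>[OF \<xi>L] by simp
  then obtain \<zeta> where \<zeta>: "\<xi> = \<kappa> \<zeta>" "\<zeta> \<in> model K" by blast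
  have "\<iota> x u = \<iota> x (tangent_map K N (\<lambda>k. \<Phi> k x) \<one> \<zeta>)"
    using \<iota>_vert[OF x \<zeta>(2)] w\<xi> \<zeta>(1) by (simp add: w_def)
  then have "u = tangent_map K N (\<lambda>k. \<Phi> k x) \<one> \<zeta>" by (rule inj_onD[OF \<iota>_inj[OF x] _ u vertN_in[OF x \<zeta>(2)]])
  then show ?thesis using \<zeta>(2) by blast
qed

end

text \<open>For the kernel of \<open>\<sigma>\<close>, one inclusion is
  \<open>kernel_\<sigma>\<close>; the other holds because generators of \<open>K\<close> come from
  \<open>L\<close> and tangent vectors of the preimage are killed by \<open>TF\<close>. Closedness
  is inherited from \<open>\<omega>\<close>, since a pullback of \<open>\<sigma>\<close> is one of
  \<open>\<omega>\<close>.\<close>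

sublocale ray_reduction \<subseteq> RF: reducible_form "G\<lparr>carrier := points K\<rparr>" K "slice_mfd M S VN" \<Phi> V \<sigma>
proof unfold_locales
  show "acts_properly K (mtop N) \<Phi>" using acts_properly by simp
  show "inj_on (tangent_map K N (\<lambda>k. \<Phi> k x) \<one>\<^bsub>KG\<^esub>) (model K)" if "x \<in> points N" for x
    using vertN_inj that unfolding N_points by simp
  show "subspace V" by (rule V_dim)
  show "dim V + dim (model K) = dim (model N)" using V_dim by simp
  show "alt_form (model N) (\<sigma> x)" if "x \<in> points N" for x
    unfolding \<sigma>_def using alt_form_pullback_form[OF N_atlas Na incl_smooth] \<omega>_alt S_points that unfolding N_points by blast
  show "\<sigma> (\<Phi> g x) (tangent_map N N (\<Phi> g) x u) (tangent_map N N (\<Phi> g) x v) = \<sigma> x u v"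
    if g: "g \<in> carrier KG" and x: "x \<in> points N" and uv: "u \<in> model N" "v \<in> model N" for g x u v
  proof -
    have gK: "g \<in> points K" using g by simp
    have xS: "x \<in> S" using x N_points by simp
    note xM = S_points[OF xS]
    have "\<sigma> (\<Phi> g x) (tangent_map N N (\<Phi> g) x u) (tangent_map N N (\<Phi> g) x v) = pullback_form N N (\<Phi> g) \<sigma> x u v"
      by (simp add: pullback_form_def)
    also have "\<dots> = pullback_form N M (\<Phi> g) \<omega> x u v"
      unfolding \<sigma>_def
      by (rule pullback_form_compose[OF N_atlas N_atlas Na KN.smooth_at_act_left[OF g x] incl_smooth[OF act_S[OF gK xS]] uv, symmetric])
    also have "\<dots> = pullback_form N M (\<lambda>x. x) (pullback_form M M (\<Phi> g) \<omega>) x u v"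
      by (rule pullback_form_compose[OF N_atlas Na Na incl_smooth[OF xS] smooth_at_act_left[OF K_in[OF gK] xM] uv])
    also have "\<dots> = \<sigma> x u v"
      using \<omega>_invariant[OF K_in[OF gK] xM \<iota>_in[OF xS] \<iota>_in[OF xS]] uv by (simp add: pullback_form_def \<sigma>_def)
    finally show ?thesis .
  qed
  show "(\<forall>v\<in>model N. \<sigma> x u v = 0) \<longleftrightarrow> u \<in> tangent_map K N (\<lambda>k. \<Phi> k x) \<one>\<^bsub>KG\<^esub> ` model K"
    if x: "x \<in> points N" and u: "u \<in> model N" for x u
  proof
    have xS: "x \<in> S" using x N_points by simp
    show "u \<in> tangent_map K N (\<lambda>k. \<Phi> k x) \<one>\<^bsub>KG\<^esub> ` model K" if "\<forall>v\<in>model N. \<sigma> x u v = 0"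
      using kernel_\<sigma>[OF xS, of u] u that by (simp add: \<sigma>_apply)
    assume "u \<in> tangent_map K N (\<lambda>k. \<Phi> k x) \<one>\<^bsub>KG\<^esub> ` model K"
    then obtain \<zeta> where \<zeta>: "\<zeta> \<in> model K" "u = tangent_map K N (\<lambda>k. \<Phi> k x) \<one> \<zeta>" by auto
    show "\<forall>v\<in>model N. \<sigma> x u v = 0"
    proof
      fix v assume "v \<in> model N"
      then have v: "v \<in> VN" by simp
      show "\<sigma> x u v = 0" unfolding \<sigma>_apply \<zeta>(2) \<iota>_vert[OF xS \<zeta>(1)]
        using TF_inner[OF S_points[OF xS] \<iota>_in[OF xS v] \<kappa>_L[OF \<zeta>(1)]] TF_\<iota>[OF xS v] by simp
    qed
  qed
  show "two_form (euclid_mfd V U) (pullback_form (euclid_mfd V U) N t \<sigma>) \<and>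
      closed_form (euclid_mfd V U) (pullback_form (euclid_mfd V U) N t \<sigma>)"
    if U: "openin (top_of_set V) U" and t: "\<And>d. d \<in> U \<Longrightarrow> smooth_at (euclid_mfd V U) N t d" for U t
  proof -
    note Va = smooth_atlas_euclid[OF V_dim(1) U]
    have tS: "t d \<in> S" if "d \<in> U" for d using smooth_at_points(2)[OF Va N_atlas t[OF that]] N_points by simp
    have tM: "smooth_at (euclid_mfd V U) M t d" if "d \<in> U" for d
      by (rule smooth_at_compose[OF Va N_atlas Na t[OF that] incl_smooth[OF tS[OF that]]])
    have eq: "pullback_form (euclid_mfd V U) N t \<sigma> d u v = pullback_form (euclid_mfd V U) M t \<omega> d u v"
      if "d \<in> U" "u \<in> V" "v \<in> V" for d u v
      unfolding \<sigma>_def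
      by (rule pullback_form_compose[OF Va N_atlas Na t[OF that(1)] incl_smooth[OF tS[OF that(1)]], symmetric]) (use that in simp_all)
    have \<omega>': "two_form M \<omega>" "closed_form M \<omega>" using \<omega> by (simp_all add: symplectic_form_def)
    note c = pullback_form_euclid_closed[OF Na \<omega>' V_dim(1) U tM]
    show ?thesis
      using two_form_euclid_cong[OF V_dim(1) U c(1) eq] closed_form_euclid_cong[OF V_dim(1) U c(2) eq] by blast
  qed
qed

lemma (in ray_reduction) reduction:
  defines "\<pi> \<equiv> orbit (G\<lparr>carrier := points K\<rparr>) \<Phi>"
  defines "Q \<equiv> quotient_topology (subtopology (mtop M) S) \<pi>"
  shows "\<exists>N :: ('m, 'f) mfd. embedded_submanifold N S M \<and>
    (\<exists>(V :: 'f set) A. orbifold Q V A \<and> orbifold_submersion N V A \<pi> \<and>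
      (\<exists>\<Omega>. orbifold_symplectic_form Q V A \<Omega> \<and>
         orbifold_pullback_eq N V A \<pi> \<Omega> (pullback_form N M (\<lambda>x. x) \<omega>) \<and>
         (\<forall>\<Omega>'. orbifold_symplectic_form Q V A \<Omega>' \<and>
            orbifold_pullback_eq N V A \<pi> \<Omega>' (pullback_form N M (\<lambda>x. x) \<omega>) \<longrightarrow>
            (\<forall>(U, \<Gamma>, \<phi>)\<in>A. \<forall>x\<in>U. \<forall>u\<in>V. \<forall>v\<in>V.
               \<Omega>' (U, \<Gamma>, \<phi>) x u v = \<Omega> (U, \<Gamma>, \<phi>) x u v))))"
proof -
  have Q: "Q = RF.Q" by (simp add: Q_def \<pi>_def)
  have u: "\<forall>\<Omega>'. orbifold_symplectic_form Q V RF.slice_atlas \<Omega>' \<and> orbifold_pullback_eq N V RF.slice_atlas \<pi> \<Omega>' \<sigma> \<longrightarrow>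
     (\<forall>(U, \<Gamma>, \<phi>)\<in>RF.slice_atlas. \<forall>x\<in>U. \<forall>u\<in>V. \<forall>v\<in>V. \<Omega>' (U, \<Gamma>, \<phi>) x u v = RF.\<Omega> (U, \<Gamma>, \<phi>) x u v)"
    by (clarify, rule RF.pullback_eq_unique[OF _ RF.pullback_eq_slice_atlas]) (simp_all add: \<pi>_def)
  show ?thesis
    using N_embedded RF.orbifold_slice_atlas[folded Q] RF.submersion_slice_atlas[folded \<pi>_def]
      RF.symplectic_\<Omega>[folded Q] RF.pullback_eq_slice_atlas[folded \<pi>_def] u
    unfolding \<sigma>_def by blast
qed

theorem theorem2p1:
  fixes G :: "'g monoid"
    and GM :: "('g, 'e::euclidean_space) mfd"
    and M :: "('m, 'f::euclidean_space) mfd"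
    and \<omega> :: "('m, 'f) form2"
    and \<Phi> :: "'g \<Rightarrow> 'm \<Rightarrow> 'm"
    and J :: "'m \<Rightarrow> 'e \<Rightarrow> real"
    and \<mu> :: "'e \<Rightarrow> real"
    and K :: "('g, 'k::euclidean_space) mfd"
  defines "S \<equiv> ray_preimage GM M J \<mu>"
  defines "\<pi> \<equiv> orbit (G\<lparr>carrier := points K\<rparr>) \<Phi>"
  defines "Q \<equiv> quotient_topology (subtopology (mtop M) S) \<pi>"
  assumes "smooth_manifold M" and "symplectic_form M \<omega>"
    and "lie_group G GM"
    and "hamiltonian_action G GM M \<omega> \<Phi> J"
    and "\<mu> \<in> dual (model GM)"
    and "kernel_group K G GM \<mu>"
    and "acts_properly K (subtopology (mtop M) S) \<Phi>"
    and "transverse_to_ray GM M J \<mu>"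
    and "model GM = {\<eta> + \<zeta> | \<eta> \<zeta>. \<eta> \<in> model GM \<and> \<mu> \<eta> = 0 \<and> \<zeta> \<in> isotropy_algebra G GM \<mu>}"
  shows "\<exists>N :: ('m, 'f) mfd. embedded_submanifold N S M \<and>
    (\<exists>(V :: 'f set) A. orbifold Q V A \<and> orbifold_submersion N V A \<pi> \<and>
      (\<exists>\<Omega>. orbifold_symplectic_form Q V A \<Omega> \<and>
         orbifold_pullback_eq N V A \<pi> \<Omega> (pullback_form N M (\<lambda>x. x) \<omega>) \<and>
         (\<forall>\<Omega>'. orbifold_symplectic_form Q V A \<Omega>' \<and>
            orbifold_pullback_eq N V A \<pi> \<Omega>' (pullback_form N M (\<lambda>x. x) \<omega>) \<longrightarrow>
            (\<forall>(U, \<Gamma>, \<phi>)\<in>A. \<forall>x\<in>U. \<forall>u\<in>V. \<forall>v\<in>V.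
               \<Omega>' (U, \<Gamma>, \<phi>) x u v = \<Omega> (U, \<Gamma>, \<phi>) x u v))))"
\<comment> \<open>The choice of the model spaces rests on a point of \<open>S\<close>. Without one
  the orbit space is empty, and the empty atlas on the zero space serves.\<close>
proof (cases "S = {}")
  case True
  have 0: "subspace {0::'f}" by (simp add: subspace_def)
  have e: "embedded_submanifold (slice_mfd M {} {0}) S M"
    unfolding True by (rule embedded_submanifold_slice_mfd[OF assms(4) 0]) auto
  have t: "topspace Q = {}" by (simp add: Q_def topspace_quotient_topology True)
  have "orbifold Q {0::'f} {}"
    unfolding orbifold_def using t 0
    by (auto simp: Hausdorff_space_def second_countable_def intro!: exI[of _ "{}"])
  then show ?thesis
    using e by (intro exI[of _ "slice_mfd M {} {0}"] exI[of _ "{0}"] exI[of _ "{}"] conjI)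
      (auto simp: orbifold_submersion_def orbifold_symplectic_form_def orbifold_pullback_eq_def)
next
  case False
  interpret ray_reduction G GM M \<omega> \<Phi> J \<mu> K
    using assms False by (intro ray_reduction.intro hamiltonian.intro ray_reduction_axioms.intro) (simp_all add: S_def)
  show ?thesis unfolding Q_def \<pi>_def S_def by (rule reduction)
qed

end
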